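(* There exists an absolute constant $C_0$ such that for every $n\ge2$, every integer $1\le k<n$, every origin-symmetric convex body $L$ in $\mathbb{R}^n$, and every measure $\mu$ with even continuous non-negative density on $L$, $$\mu(L)\ \le\ C_0^k\Big(\sqrt{\frac nk}\Big(\log\Big(\frac{en}{k}\Big)\Big)^{3/2}\Big)^k\,\frac{n}{n-k}\,c_{n,k}\,\max_{H\in Gr_{n-k}}\mu(L\cap H)\,|L|^{k/n}.$$
   Context: $Gr_{n-k}$ is the Grassmannian of $(n-k)$-dimensional linear subspaces of $\mathbb{R}^n$. If $\mu$ has density $g$, $\mu(L)=\int_Lg$ and $\mu(L\cap H)=\int_{L\cap H}g$ with respect to $(n-k)$-dimensional Lebesgue measure on $H$. $|L|$ is volume, $B_2^m$ the Euclidean unit ball in $\mathbb{R}^m$, and $c_{n,k}=|B_2^n|^{\frac{n-k}{n}}/|B_2^{n-k}|$. *)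

theory Defs
  imports "HOL-Analysis.Analysis"
begin

text \<open>R^n is modelled as the extensional functions on the index set {..<n}
  (the carrier of the product measure), with Lebesgue measure the product of
  n copies of lborel. Linear operations and the Euclidean structure are
  written out explicitly since n varies inside the statement.\<close>

definition Rn :: "nat \<Rightarrow> (nat \<Rightarrow> real) set" where
  "Rn n = PiE {..<n} (\<lambda>_. UNIV)"

definition lebn :: "nat \<Rightarrow> (nat \<Rightarrow> real) measure" where
  "lebn n = PiM {..<n} (\<lambda>_. lborel)"

definition vadd :: "nat \<Rightarrow> (nat \<Rightarrow> real) \<Rightarrow> (nat \<Rightarrow> real) \<Rightarrow> (nat \<Rightarrow> real)" where
  "vadd n x y = (\<lambda>i\<in>{..<n}. x i + y i)"

definition vscale :: "nat \<Rightarrow> real \<Rightarrow> (nat \<Rightarrow> real) \<Rightarrow> (nat \<Rightarrow> real)" where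
  "vscale n c x = (\<lambda>i\<in>{..<n}. c * x i)"

definition vneg :: "nat \<Rightarrow> (nat \<Rightarrow> real) \<Rightarrow> (nat \<Rightarrow> real)" where
  "vneg n x = (\<lambda>i\<in>{..<n}. - x i)"

definition ipn :: "nat \<Rightarrow> (nat \<Rightarrow> real) \<Rightarrow> (nat \<Rightarrow> real) \<Rightarrow> real" where
  "ipn n x y = (\<Sum>i<n. x i * y i)"

definition enorm :: "nat \<Rightarrow> (nat \<Rightarrow> real) \<Rightarrow> real" where
  "enorm n x = sqrt (ipn n x x)"

definition convex_n :: "nat \<Rightarrow> (nat \<Rightarrow> real) set \<Rightarrow> bool" where
  "convex_n n L \<longleftrightarrow> L \<subseteq> Rn n \<and>
     (\<forall>x\<in>L. \<forall>y\<in>L. \<forall>t::real. 0 \<le> t \<and> t \<le> 1 \<longrightarrow> vadd n (vscale n (1 - t) x) (vscale n t y) \<in> L)"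

text \<open>Convex body: compact convex set with non-empty interior (interior taken
  in R^n, i.e. w.r.t. Euclidean balls inside Rn n). Compactness is w.r.t. the
  product topology, which on Rn n is the Euclidean topology.\<close>
definition convex_body :: "nat \<Rightarrow> (nat \<Rightarrow> real) set \<Rightarrow> bool" where
  "convex_body n L \<longleftrightarrow> L \<subseteq> Rn n \<and> convex_n n L \<and> compact L \<and>
     (\<exists>x\<in>L. \<exists>r>0. {y \<in> Rn n. enorm n (vadd n y (vneg n x)) < r} \<subseteq> L)"

definition origin_symmetric :: "nat \<Rightarrow> (nat \<Rightarrow> real) set \<Rightarrow> bool" where
  "origin_symmetric n L \<longleftrightarrow> (\<forall>x\<in>L. vneg n x \<in> L)"

text \<open>An (m-dimensional) subspace H of R^n is given by an orthonormal basis
  u 0, ..., u (m-1); Lebesgue measure on H is the image of Lebesgue measure on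
  R^m under t \<mapsto> \<Sum> t_j u_j.\<close>
definition orthonormal_n :: "nat \<Rightarrow> nat \<Rightarrow> (nat \<Rightarrow> nat \<Rightarrow> real) \<Rightarrow> bool" where
  "orthonormal_n n m u \<longleftrightarrow> (\<forall>j<m. u j \<in> Rn n) \<and>
     (\<forall>i<m. \<forall>j<m. ipn n (u i) (u j) = (if i = j then 1 else 0))"

definition lincomb :: "nat \<Rightarrow> nat \<Rightarrow> (nat \<Rightarrow> nat \<Rightarrow> real) \<Rightarrow> (nat \<Rightarrow> real) \<Rightarrow> (nat \<Rightarrow> real)" where
  "lincomb n m u t = (\<lambda>i\<in>{..<n}. \<Sum>j<m. t j * u j i)"

definition dens_measure :: "nat \<Rightarrow> ((nat \<Rightarrow> real) \<Rightarrow> real) \<Rightarrow> (nat \<Rightarrow> real) set \<Rightarrow> real" where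
  "dens_measure n g L = (\<integral>x. indicator L x * g x \<partial>lebn n)"

definition section_measure :: "nat \<Rightarrow> nat \<Rightarrow> ((nat \<Rightarrow> real) \<Rightarrow> real) \<Rightarrow> (nat \<Rightarrow> real) set
    \<Rightarrow> (nat \<Rightarrow> nat \<Rightarrow> real) \<Rightarrow> real" where
  "section_measure n m g L u =
     (\<integral>t. indicator L (lincomb n m u t) * g (lincomb n m u t) \<partial>lebn m)"

definition max_section :: "nat \<Rightarrow> nat \<Rightarrow> ((nat \<Rightarrow> real) \<Rightarrow> real) \<Rightarrow> (nat \<Rightarrow> real) set \<Rightarrow> real" where
  "max_section n m g L = (SUP u\<in>{u. orthonormal_n n m u}. section_measure n m g L u)"

definition voln :: "nat \<Rightarrow> (nat \<Rightarrow> real) set \<Rightarrow> real" where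
  "voln n L = measure (lebn n) L"

definition unit_ball_vol :: "nat \<Rightarrow> real" where
  "unit_ball_vol n = voln n {x \<in> Rn n. enorm n x \<le> 1}"

definition c_const :: "nat \<Rightarrow> nat \<Rightarrow> real" where
  "c_const n k = unit_ball_vol n powr ((real n - real k) / real n) / unit_ball_vol (n - k)"

end

theory Submission
  imports Defs "HOL-Probability.Probability"
begin

text \<open>
  For an even probability measure on a symmetric body L, a factor 1 + lam / s times the gradient of the
  log-Laplace transform lam maps the polar body of L at level s into 2 L. Comparing volumes, one finds a tilt
  of the measure with a covariance of small determinant, hence an ellipsoid that carries a proportion at
  least exp (- s) / 2 of the measure and whose volume is controlled by the ratio of the volumes of L
  and of its polar.

  For uniform measures this can be iterated and yields an M-ellipsoid; covering the body and its polar
  by translates of their M-ellipsoids gives the reverse Santalo inequality, which bounds the ratio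
  above. For the given density one takes s = k, so that the loss is only exponential in k.

  Finally, a function supported in an ellipsoid of radius R in the metric of A is averaged over the random
  hyperplanes orthogonal to the transpose of A applied to a Gaussian vector. Each averaging lowers the
  dimension by one, and after k steps the integral is bounded by the largest (n - k)-dimensional section.
  The logarithmic factor of the statement is not produced by this argument and is bounded below by 1.
\<close>

section \<open>Lebesgue measure and triangular maps\<close>

text \<open>The map of the tilt argument is the gradient of \<open>lam + lam^2 / (2 * s)\<close>,
  which is convex because \<open>lam >= 0\<close> for a centred measure. The quadratic term
  contributes \<open>b b^T / s\<close> to the Jacobian, \<open>b\<close> being the barycentre of the
  tilted measure. Hence the inverse Jacobian controls second moments about the origin and not only
  about \<open>b\<close>, and the ellipsoid is centred, as sections by linear subspaces demand.

  The factor \<open>sqrt (n / k)\<close> comes from the level: the polar at level \<open>k\<close>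
  has \<open>(k / n) ^ n\<close> times the volume of the polar at level \<open>n\<close>, the
  determinant of \<open>A\<close> is bounded below by the square root of such a volume, and it
  enters with exponent \<open>- k / n\<close>.

  The averaging works because the inner product of \<open>A^T \<gamma>\<close> with \<open>x\<close>
  is that of \<open>\<gamma>\<close> with \<open>A x\<close>, a normal variable of variance
  \<open>|A x|^2\<close> whose density at 0 is bounded below on the ellipsoid. A hyperplane section
  multiplies the determinant by the random factor \<open>|\<gamma>| / |A^T \<gamma>|\<close>;
  negative moments of these two norms must therefore be bounded, which triangular matrices allow
  coordinate by coordinate.\<close>

definition mv :: "nat \<Rightarrow> (nat \<Rightarrow> nat \<Rightarrow> real) \<Rightarrow> (nat \<Rightarrow> real) \<Rightarrow> (nat \<Rightarrow> real)" where
  "mv n A x = (\<lambda>i\<in>{..<n}. \<Sum>j<n. A i j * x j)"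

text \<open>Determinants are only taken of triangular matrices with positive diagonal, where they
  are \<open>diag_prod\<close>. The class contains the Cholesky factors that define the ellipsoids
  and is stable under restriction to hyperplanes in adapted bases.\<close>

definition lower_tri :: "nat \<Rightarrow> (nat \<Rightarrow> nat \<Rightarrow> real) \<Rightarrow> bool" where
  "lower_tri n A \<longleftrightarrow> (\<forall>i<n. 0 < A i i) \<and> (\<forall>i<n. \<forall>j<n. i < j \<longrightarrow> A i j = 0)"

definition diag_prod :: "nat \<Rightarrow> (nat \<Rightarrow> nat \<Rightarrow> real) \<Rightarrow> real" where
  "diag_prod n A = (\<Prod>i<n. A i i)"

abbreviation (input) transp :: "(nat \<Rightarrow> nat \<Rightarrow> real) \<Rightarrow> nat \<Rightarrow> nat \<Rightarrow> real" where
  "transp A \<equiv> (\<lambda>i j. A j i)"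

text \<open>\<open>d\<close> plays the role of the absolute determinant. Stated as a change of
  variables for nonnegative integrals, it is multiplicative under composition and applies to affine
  maps and to products of matrices whose determinant is never expanded.\<close>

definition vol_scaling :: "nat \<Rightarrow> ((nat \<Rightarrow> real) \<Rightarrow> (nat \<Rightarrow> real)) \<Rightarrow> real \<Rightarrow> bool" where
  "vol_scaling n \<phi> d \<longleftrightarrow> 0 < d \<and> \<phi> \<in> lebn n \<rightarrow>\<^sub>M lebn n \<and>
     (\<forall>f\<in>borel_measurable (lebn n).
        (\<integral>\<^sup>+x. f (\<phi> x) \<partial>lebn n) = ennreal (1 / d) * (\<integral>\<^sup>+x. f x \<partial>lebn n))"

section \<open>Measurability and iterated integrals in the coordinate model\<close>

lemma space_lebn [simp]: "space (lebn n) = Rn n"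
  by (simp add: lebn_def Rn_def space_PiM)

lemma Rn_sets [measurable]: "Rn n \<in> sets (lebn n)"
  by (metis space_lebn sets.top)

lemma measurable_coord_lebn [measurable]:
  "i < n \<Longrightarrow> (\<lambda>x. x i) \<in> borel_measurable (lebn n)"
  unfolding lebn_def using measurable_component_singleton[of i "{..<n}" "\<lambda>_. lborel"] by simp

lemma measurable_to_lebn:
  assumes "\<And>i. i < n \<Longrightarrow> (\<lambda>x. f x i) \<in> borel_measurable M"
    and "\<And>x. x \<in> space M \<Longrightarrow> f x \<in> Rn n"
  shows "f \<in> M \<rightarrow>\<^sub>M lebn n"
  unfolding lebn_def
  by (rule measurable_PiM_single') (use assms in \<open>auto simp: Rn_def\<close>)

lemma mv_Rn [simp]: "mv n A x \<in> Rn n" by (simp add: mv_def Rn_def)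
lemma vadd_Rn [simp]: "vadd n x y \<in> Rn n" by (simp add: vadd_def Rn_def)
lemma vscale_Rn [simp]: "vscale n c x \<in> Rn n" by (simp add: vscale_def Rn_def)
lemma vneg_Rn [simp]: "vneg n x \<in> Rn n" by (simp add: vneg_def Rn_def)

lemma mv_nth: "i < n \<Longrightarrow> mv n A x i = (\<Sum>j<n. A i j * x j)" by (simp add: mv_def)
lemma vadd_nth [simp]: "i < n \<Longrightarrow> vadd n x y i = x i + y i" by (simp add: vadd_def)
lemma vscale_nth [simp]: "i < n \<Longrightarrow> vscale n c x i = c * x i" by (simp add: vscale_def)
lemma vneg_nth [simp]: "i < n \<Longrightarrow> vneg n x i = - x i" by (simp add: vneg_def)

lemma Rn_eqI: "x \<in> Rn n \<Longrightarrow> y \<in> Rn n \<Longrightarrow> (\<And>i. i < n \<Longrightarrow> x i = y i) \<Longrightarrow> x = y"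
  unfolding Rn_def by (rule PiE_ext) auto

lemma measurable_ipn [measurable]: "(\<lambda>x. ipn n x y) \<in> borel_measurable (lebn n)"
  "(\<lambda>x. ipn n y x) \<in> borel_measurable (lebn n)" "(\<lambda>x. ipn n x x) \<in> borel_measurable (lebn n)"
  unfolding ipn_def by (auto intro!: borel_measurable_sum borel_measurable_times measurable_coord_lebn)

lemma measurable_mv [measurable]: "mv n A \<in> lebn n \<rightarrow>\<^sub>M lebn n"
  by (rule measurable_to_lebn) (auto simp: mv_nth intro!: borel_measurable_sum borel_measurable_times)

lemma measurable_vadd [measurable]: "(\<lambda>x. vadd n x c) \<in> lebn n \<rightarrow>\<^sub>M lebn n"
  by (rule measurable_to_lebn) auto

interpretation lborel_prod: product_sigma_finite "\<lambda>_::nat. lborel :: real measure"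
  by standard

lemma sigma_finite_lebn: "sigma_finite_measure (lebn n)"
  unfolding lebn_def by (rule lborel_prod.sigma_finite) auto

lemma lebn_nn_Suc:
  assumes "f \<in> borel_measurable (lebn (Suc n))"
  shows "(\<integral>\<^sup>+x. f x \<partial>lebn (Suc n)) = (\<integral>\<^sup>+x. (\<integral>\<^sup>+y. f (x(n := y)) \<partial>lborel) \<partial>lebn n)"
  using lborel_prod.product_nn_integral_insert[of "{..<n}" n f] assms
  unfolding lebn_def lessThan_Suc by simp

lemma lebn_nn_Suc':
  assumes "f \<in> borel_measurable (lebn (Suc n))"
  shows "(\<integral>\<^sup>+x. f x \<partial>lebn (Suc n)) = (\<integral>\<^sup>+y. (\<integral>\<^sup>+x. f (x(n := y)) \<partial>lebn n) \<partial>lborel)"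
  using lborel_prod.product_nn_integral_insert_rev[of "{..<n}" n f] assms
  unfolding lebn_def lessThan_Suc by simp

lemma upd_Rn: "x \<in> Rn n \<Longrightarrow> x(n := y) \<in> Rn (Suc n)"
  by (auto simp: Rn_def PiE_def extensional_def)

lemma upd_Rn': "x \<in> Rn n \<Longrightarrow> i < n \<Longrightarrow> x(i := y) \<in> Rn n"
  by (auto simp: Rn_def PiE_def extensional_def)

lemma measurable_upd_pair [measurable]:
  "(\<lambda>(x, y). x(n := y)) \<in> lebn n \<Otimes>\<^sub>M borel \<rightarrow>\<^sub>M lebn (Suc n)"
proof (rule measurable_to_lebn)
  fix i assume "i < Suc n"
  then consider "i = n" | "i < n" by linarith
  then show "(\<lambda>p. (case p of (x, y) \<Rightarrow> x(n := y)) i) \<in> borel_measurable (lebn n \<Otimes>\<^sub>M borel)"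
    by cases (auto simp: case_prod_beta')
qed (auto simp: space_pair_measure upd_Rn)

lemma measurable_upd_snd [measurable]:
  "x \<in> Rn n \<Longrightarrow> (\<lambda>y. x(n := y)) \<in> borel \<rightarrow>\<^sub>M lebn (Suc n)"
  by (rule measurable_to_lebn) (auto simp: upd_Rn less_Suc_eq)

lemma measurable_upd_fst [measurable]:
  "(\<lambda>x. x(n := y)) \<in> lebn n \<rightarrow>\<^sub>M lebn (Suc n)"
  by (rule measurable_to_lebn) (auto simp: upd_Rn less_Suc_eq)

section \<open>Change of variables\<close>

lemma vol_scalingD:
  assumes "vol_scaling n \<phi> d"
  shows "0 < d" "\<phi> \<in> lebn n \<rightarrow>\<^sub>M lebn n"
    "f \<in> borel_measurable (lebn n) \<Longrightarrow>
      (\<integral>\<^sup>+x. f (\<phi> x) \<partial>lebn n) = ennreal (1 / d) * (\<integral>\<^sup>+x. f x \<partial>lebn n)"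
  using assms by (auto simp: vol_scaling_def)

lemma vol_scaling_emeasure:
  assumes "vol_scaling n \<phi> d" "S \<in> sets (lebn n)"
  shows "emeasure (lebn n) {x \<in> Rn n. \<phi> x \<in> S} = ennreal (1 / d) * emeasure (lebn n) S"
proof -
  have [measurable]: "\<phi> \<in> lebn n \<rightarrow>\<^sub>M lebn n" by (rule vol_scalingD[OF assms(1)])
  note assms(2)[measurable]
  have "{x \<in> Rn n. \<phi> x \<in> S} = \<phi> -` S \<inter> space (lebn n)" by auto
  then have m: "{x \<in> Rn n. \<phi> x \<in> S} \<in> sets (lebn n)" using assms(2) by simp
  have "emeasure (lebn n) {x \<in> Rn n. \<phi> x \<in> S} = (\<integral>\<^sup>+x. indicator {x \<in> Rn n. \<phi> x \<in> S} x \<partial>lebn n)"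
    using m by simp
  also have "\<dots> = (\<integral>\<^sup>+x. indicator S (\<phi> x) \<partial>lebn n)"
    by (rule nn_integral_cong) (auto simp: indicator_def)
  also have "\<dots> = ennreal (1 / d) * (\<integral>\<^sup>+x. indicator S x \<partial>lebn n)"
    by (rule vol_scalingD(3)[OF assms(1)]) simp
  finally show ?thesis using assms(2) by simp
qed

lemma ennreal_inverse_mult:
  "0 < a \<Longrightarrow> 0 < d \<Longrightarrow> ennreal (1 / d) * (ennreal (1 / a) * x) = ennreal (1 / (d * a)) * x"
  by (subst mult.assoc[symmetric]) (simp add: ennreal_mult''[symmetric])

lemma diag_prod_Suc: "diag_prod (Suc n) A = diag_prod n A * A n n"
  by (simp add: diag_prod_def)

lemma vol_scaling_comp:
  assumes "vol_scaling n \<phi> d" "vol_scaling n \<psi> e"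
  shows "vol_scaling n (\<lambda>x. \<phi> (\<psi> x)) (d * e)"
  unfolding vol_scaling_def
proof (intro conjI ballI)
  note [measurable] = vol_scalingD(2)[OF assms(1)] vol_scalingD(2)[OF assms(2)]
  show "0 < d * e" using assms by (simp add: vol_scaling_def)
  show "(\<lambda>x. \<phi> (\<psi> x)) \<in> lebn n \<rightarrow>\<^sub>M lebn n" by measurable
  fix f :: "(nat \<Rightarrow> real) \<Rightarrow> ennreal" assume [measurable]: "f \<in> borel_measurable (lebn n)"
  have "(\<integral>\<^sup>+x. f (\<phi> (\<psi> x)) \<partial>lebn n) = ennreal (1 / e) * (\<integral>\<^sup>+x. f (\<phi> x) \<partial>lebn n)"
    by (rule vol_scalingD(3)[OF assms(2)]) measurable
  also have "(\<integral>\<^sup>+x. f (\<phi> x) \<partial>lebn n) = ennreal (1 / d) * (\<integral>\<^sup>+x. f x \<partial>lebn n)"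
    by (rule vol_scalingD(3)[OF assms(1)]) measurable
  finally show "(\<integral>\<^sup>+x. f (\<phi> (\<psi> x)) \<partial>lebn n) = ennreal (1 / (d * e)) * (\<integral>\<^sup>+x. f x \<partial>lebn n)"
    using vol_scalingD(1)[OF assms(1)] vol_scalingD(1)[OF assms(2)]
    by (simp add: mult.assoc[symmetric] ennreal_mult''[symmetric] mult.commute)
qed

lemma vol_scaling_cong:
  assumes "vol_scaling n \<phi> d" "\<And>x. x \<in> Rn n \<Longrightarrow> \<psi> x = \<phi> x"
  shows "vol_scaling n \<psi> d"
proof -
  have 1: "\<psi> \<in> lebn n \<rightarrow>\<^sub>M lebn n"
    using measurable_cong[of "lebn n" \<psi> \<phi> "lebn n"] assms by (auto simp: vol_scaling_def)
  have 2: "(\<integral>\<^sup>+x. f (\<psi> x) \<partial>lebn n) = (\<integral>\<^sup>+x. f (\<phi> x) \<partial>lebn n)" for f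
    by (rule nn_integral_cong) (simp add: assms)
  show ?thesis using assms(1) 1 unfolding vol_scaling_def 2 by auto
qed

lemma vol_scaling_id: "vol_scaling n (\<lambda>x. x) 1"
  by (auto simp: vol_scaling_def)

lemma nn_integral_affine:
  fixes a b :: real
  assumes "f \<in> borel_measurable borel" "a > 0"
  shows "(\<integral>\<^sup>+y. f (a * y + b) \<partial>lborel) = ennreal (1 / a) * (\<integral>\<^sup>+y. f y \<partial>lborel)"
proof -
  have "(\<integral>\<^sup>+y. f y \<partial>lborel) = ennreal a * (\<integral>\<^sup>+y. f (a * y + b) \<partial>lborel)"
    using nn_integral_real_affine[OF assms(1), of a b] assms(2) by (simp add: add.commute)
  then show ?thesis using assms(2)
    by (simp add: mult.assoc[symmetric] ennreal_mult''[symmetric])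
qed

text \<open>Fubini with the last coordinate innermost: for fixed \<open>x\<close> the inner integral
  undergoes an affine substitution. The shift \<open>b x\<close> may depend on the earlier
  coordinates in any measurable way, which covers both translations and the last row of a triangular
  matrix.\<close>

lemma vol_scaling_Suc_lower:
  assumes \<psi>: "vol_scaling n \<psi> d" and "a > 0" and b[measurable]: "b \<in> borel_measurable (lebn n)"
    and \<phi>: "\<And>x y. x \<in> Rn n \<Longrightarrow> \<phi> (x(n := y)) = (\<psi> x)(n := a * y + b x)"
    and m: "\<phi> \<in> lebn (Suc n) \<rightarrow>\<^sub>M lebn (Suc n)"
  shows "vol_scaling (Suc n) \<phi> (d * a)"
  unfolding vol_scaling_def
proof (intro conjI ballI)
  note [measurable] = vol_scalingD(2)[OF \<psi>] m
  have \<psi>R: "x \<in> Rn n \<Longrightarrow> \<psi> x \<in> Rn n" for x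
    using measurable_space[OF vol_scalingD(2)[OF \<psi>], of x] by simp
  show "0 < d * a" using assms by (simp add: vol_scaling_def)
  show "\<phi> \<in> lebn (Suc n) \<rightarrow>\<^sub>M lebn (Suc n)" by fact
  fix f :: "(nat \<Rightarrow> real) \<Rightarrow> ennreal" assume f[measurable]: "f \<in> borel_measurable (lebn (Suc n))"
  have "(\<integral>\<^sup>+x. f (\<phi> x) \<partial>lebn (Suc n)) = (\<integral>\<^sup>+x. (\<integral>\<^sup>+y. f ((\<psi> x)(n := a * y + b x)) \<partial>lborel) \<partial>lebn n)"
    by (subst lebn_nn_Suc) (measurable, auto intro!: nn_integral_cong simp: \<phi>)
  also have "\<dots> = (\<integral>\<^sup>+x. ennreal (1/a) * (\<integral>\<^sup>+y. f ((\<psi> x)(n := y)) \<partial>lborel) \<partial>lebn n)"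
  proof (rule nn_integral_cong)
    fix x assume "x \<in> space (lebn n)"
    then have "(\<lambda>y. f ((\<psi> x)(n := y))) \<in> borel_measurable borel" using \<psi>R by simp
    from nn_integral_affine[OF this \<open>a > 0\<close>]
    show "(\<integral>\<^sup>+y. f ((\<psi> x)(n := a * y + b x)) \<partial>lborel) = ennreal (1/a) * (\<integral>\<^sup>+y. f ((\<psi> x)(n := y)) \<partial>lborel)" .
  qed
  also have "\<dots> = ennreal (1/a) * (\<integral>\<^sup>+x. (\<integral>\<^sup>+y. f ((\<psi> x)(n := y)) \<partial>lborel) \<partial>lebn n)"
    by (rule nn_integral_cmult) measurable
  also have "(\<integral>\<^sup>+x. (\<integral>\<^sup>+y. f ((\<psi> x)(n := y)) \<partial>lborel) \<partial>lebn n) =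
     ennreal (1/d) * (\<integral>\<^sup>+x. (\<integral>\<^sup>+y. f (x(n := y)) \<partial>lborel) \<partial>lebn n)"
    by (rule vol_scalingD(3)[OF \<psi>]) measurable
  also have "(\<integral>\<^sup>+x. (\<integral>\<^sup>+y. f (x(n := y)) \<partial>lborel) \<partial>lebn n) = (\<integral>\<^sup>+x. f x \<partial>lebn (Suc n))"
    by (rule lebn_nn_Suc[symmetric]) measurable
  finally show "(\<integral>\<^sup>+x. f (\<phi> x) \<partial>lebn (Suc n)) = ennreal (1 / (d * a)) * (\<integral>\<^sup>+x. f x \<partial>lebn (Suc n))"
    using \<open>a > 0\<close> vol_scalingD(1)[OF \<psi>]
    by (simp add: mult.assoc[symmetric] ennreal_mult''[symmetric] mult.commute)
qed

lemma vol_scaling_trans: "vol_scaling n (\<lambda>x. vadd n x c) 1"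
proof (induction n)
  case 0
  have "\<And>x. x \<in> Rn 0 \<Longrightarrow> vadd 0 x c = x" by (auto simp: Rn_def vadd_def)
  then show ?case by (intro vol_scaling_cong[OF vol_scaling_id])
next
  case (Suc n)
  have "vol_scaling (Suc n) (\<lambda>x. vadd (Suc n) x c) (1 * 1)"
  proof (rule vol_scaling_Suc_lower[OF Suc])
    fix x :: "nat \<Rightarrow> real" and y assume "x \<in> Rn n"
    then show "vadd (Suc n) (x(n := y)) c = (vadd n x c)(n := 1 * y + c n)"
      by (intro Rn_eqI[of _ "Suc n"]) (auto simp: upd_Rn less_Suc_eq)
  qed auto
  then show ?case by simp
qed

lemma vol_scaling_lower_tri:
  "lower_tri n A \<Longrightarrow> vol_scaling n (mv n A) (diag_prod n A)"
proof (induction n)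
  case 0
  have "\<And>x. x \<in> Rn 0 \<Longrightarrow> mv 0 A x = x" by (auto simp: Rn_def mv_def)
  then show ?case unfolding diag_prod_def by (simp add: vol_scaling_cong[OF vol_scaling_id])
next
  case (Suc n)
  then have A: "lower_tri n A" "A n n > 0" "\<And>i. i < n \<Longrightarrow> A i n = 0" by (auto simp: lower_tri_def)
  have "vol_scaling (Suc n) (mv (Suc n) A) (diag_prod n A * A n n)"
  proof (rule vol_scaling_Suc_lower[OF Suc.IH[OF A(1)] A(2)])
    show "(\<lambda>x. \<Sum>j<n. A n j * x j) \<in> borel_measurable (lebn n)" by measurable
    fix x :: "nat \<Rightarrow> real" and y assume "x \<in> Rn n"
    then show "mv (Suc n) A (x(n := y)) = (mv n A x)(n := A n n * y + (\<Sum>j<n. A n j * x j))"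
      by (intro Rn_eqI[of _ "Suc n"]) (auto simp: upd_Rn less_Suc_eq mv_nth A(3) lessThan_Suc)
  qed auto
  then show ?case by (simp add: diag_prod_def mult.commute)
qed

text \<open>Here the last coordinate enters all the others, so the order of integration is reversed:
  for fixed \<open>y\<close> the first \<open>n\<close> coordinates undergo the smaller upper
  triangular map followed by the translation \<open>c y\<close>, which leaves the integral
  unchanged.\<close>

lemma vol_scaling_upper_tri:
  "lower_tri n A \<Longrightarrow> vol_scaling n (mv n (transp A)) (diag_prod n A)"
proof (induction n)
  case 0
  have "\<And>x. x \<in> Rn 0 \<Longrightarrow> mv 0 (transp A) x = x" by (auto simp: Rn_def mv_def)
  then show ?case unfolding diag_prod_def by (simp add: vol_scaling_cong[OF vol_scaling_id])
next
  case (Suc n)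
  then have A: "lower_tri n A" "A n n > 0" "\<And>i. i < n \<Longrightarrow> A i n = 0" by (auto simp: lower_tri_def)
  note IH = Suc.IH[OF A(1)]
  let ?a = "A n n" and ?d = "diag_prod n A"
  define c where "c = (\<lambda>y::real. \<lambda>i. y * A n i)"
  have eq: "mv (Suc n) (transp A) (x(n := y)) = (vadd n (mv n (transp A) x) (c y))(n := ?a * y)"
    if "x \<in> Rn n" for x y
    using that by (intro Rn_eqI[of _ "Suc n"]) (auto simp: upd_Rn less_Suc_eq mv_nth A(3) lessThan_Suc c_def)
  have d: "0 < ?d" using vol_scalingD(1)[OF IH] .
  show ?case
    unfolding vol_scaling_def
  proof (intro conjI ballI)
    show "0 < diag_prod (Suc n) A" using d A by (simp add: diag_prod_def)
    show "mv (Suc n) (transp A) \<in> lebn (Suc n) \<rightarrow>\<^sub>M lebn (Suc n)" by measurable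
    fix f :: "(nat \<Rightarrow> real) \<Rightarrow> ennreal" assume f[measurable]: "f \<in> borel_measurable (lebn (Suc n))"
    have "(\<integral>\<^sup>+x. f (mv (Suc n) (transp A) x) \<partial>lebn (Suc n)) =
       (\<integral>\<^sup>+y. (\<integral>\<^sup>+x. f ((vadd n (mv n (transp A) x) (c y))(n := ?a * y)) \<partial>lebn n) \<partial>lborel)"
      by (subst lebn_nn_Suc') (measurable, auto intro!: nn_integral_cong simp: eq)
    also have "\<dots> = (\<integral>\<^sup>+y. ennreal (1 / ?d) * (\<integral>\<^sup>+x. f ((vadd n x (c y))(n := ?a * y)) \<partial>lebn n) \<partial>lborel)"
      by (intro nn_integral_cong vol_scalingD(3)[OF IH]) measurable
    also have "\<dots> = (\<integral>\<^sup>+y. ennreal (1 / ?d) * (\<integral>\<^sup>+x. f (x(n := ?a * y)) \<partial>lebn n) \<partial>lborel)"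
    proof (rule nn_integral_cong)
      fix y
      show "ennreal (1 / ?d) * (\<integral>\<^sup>+x. f ((vadd n x (c y))(n := ?a * y)) \<partial>lebn n) =
        ennreal (1 / ?d) * (\<integral>\<^sup>+x. f (x(n := ?a * y)) \<partial>lebn n)"
        using vol_scalingD(3)[OF vol_scaling_trans, of "\<lambda>x. f (x(n := ?a * y))" n "c y"] by simp
    qed
    also have "\<dots> = ennreal (1 / ?d) * (\<integral>\<^sup>+y. (\<integral>\<^sup>+x. f (x(n := ?a * y + 0)) \<partial>lebn n) \<partial>lborel)"
    proof -
      interpret sigma_finite_measure "lebn n" by (rule sigma_finite_lebn)
      have [measurable]: "(\<lambda>(y, x). f (x(n := ?a * y))) \<in> borel_measurable (borel \<Otimes>\<^sub>M lebn n)"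
      proof -
        have "(\<lambda>(y, x). f (x(n := ?a * y))) = f \<circ> ((\<lambda>(x, y). x(n := y)) \<circ> (\<lambda>(y, x). (x, ?a * y)))"
          by auto
        also have "\<dots> \<in> borel_measurable (borel \<Otimes>\<^sub>M lebn n)"
          by (intro measurable_comp[OF measurable_comp[OF _ measurable_upd_pair]] f) measurable
        finally show ?thesis .
      qed
      show ?thesis by (subst nn_integral_cmult[symmetric]) (auto intro!: borel_measurable_nn_integral)
    qed
    also have "(\<integral>\<^sup>+y. (\<integral>\<^sup>+x. f (x(n := ?a * y + 0)) \<partial>lebn n) \<partial>lborel) =
        ennreal (1 / ?a) * (\<integral>\<^sup>+y. (\<integral>\<^sup>+x. f (x(n := y)) \<partial>lebn n) \<partial>lborel)"
    proof (rule nn_integral_affine[OF _ A(2)])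
      interpret sigma_finite_measure "lebn n" by (rule sigma_finite_lebn)
      have [measurable]: "(\<lambda>(y, x). f (x(n := y))) \<in> borel_measurable (borel \<Otimes>\<^sub>M lebn n)"
      proof -
        have "(\<lambda>(y, x). f (x(n := y))) = f \<circ> ((\<lambda>(x, y). x(n := y)) \<circ> (\<lambda>(y, x). (x, y)))"
          by auto
        also have "\<dots> \<in> borel_measurable (borel \<Otimes>\<^sub>M lebn n)"
          by (intro measurable_comp[OF measurable_comp[OF _ measurable_upd_pair]] f) measurable
        finally show ?thesis .
      qed
      show "(\<lambda>y. \<integral>\<^sup>+x. f (x(n := y)) \<partial>lebn n) \<in> borel_measurable borel"
        by (rule borel_measurable_nn_integral) simp
    qed
    also have "(\<integral>\<^sup>+y. (\<integral>\<^sup>+x. f (x(n := y)) \<partial>lebn n) \<partial>lborel) = (\<integral>\<^sup>+x. f x \<partial>lebn (Suc n))"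
      by (rule lebn_nn_Suc'[symmetric]) measurable
    finally show "(\<integral>\<^sup>+x. f (mv (Suc n) (transp A) x) \<partial>lebn (Suc n)) =
        ennreal (1 / diag_prod (Suc n) A) * (\<integral>\<^sup>+x. f x \<partial>lebn (Suc n))"
      unfolding diag_prod_Suc ennreal_inverse_mult[OF A(2) d] .
  qed
qed

section \<open>Symmetric bodies and polars\<close>

lemma ipn_commute: "ipn n x y = ipn n y x"
  by (simp add: ipn_def mult.commute)

lemma ipn_cong: "(\<And>i. i < n \<Longrightarrow> x i = x' i) \<Longrightarrow> (\<And>i. i < n \<Longrightarrow> y i = y' i) \<Longrightarrow> ipn n x y = ipn n x' y'"
  by (simp add: ipn_def)

lemma ipn_add_left: "ipn n (\<lambda>i. x i + y i) z = ipn n x z + ipn n y z"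
  and ipn_diff_left: "ipn n (\<lambda>i. x i - y i) z = ipn n x z - ipn n y z"
  and ipn_scale_left: "ipn n (\<lambda>i. c * x i) z = c * ipn n x z"
  and ipn_add_right: "ipn n z (\<lambda>i. x i + y i) = ipn n z x + ipn n z y"
  and ipn_diff_right: "ipn n z (\<lambda>i. x i - y i) = ipn n z x - ipn n z y"
  and ipn_scale_right: "ipn n z (\<lambda>i. c * x i) = c * ipn n z x"
  by (simp_all add: ipn_def algebra_simps sum.distrib sum_subtractf sum_distrib_left)

lemmas ipn_linear = ipn_add_left ipn_diff_left ipn_scale_left ipn_add_right ipn_diff_right ipn_scale_right

lemma ipn_vadd: "ipn n (vadd n x y) z = ipn n x z + ipn n y z"
  and ipn_vscale: "ipn n (vscale n c x) z = c * ipn n x z"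
  and ipn_vneg: "ipn n (vneg n x) z = - ipn n x z"
  and ipn_vadd': "ipn n z (vadd n x y) = ipn n z x + ipn n z y"
  and ipn_vscale': "ipn n z (vscale n c x) = c * ipn n z x"
  and ipn_vneg': "ipn n z (vneg n x) = - ipn n z x"
  by (simp_all add: ipn_def algebra_simps sum.distrib sum_distrib_left sum_negf)

lemmas ipn_vec = ipn_vadd ipn_vscale ipn_vneg ipn_vadd' ipn_vscale' ipn_vneg'

lemma ipn_self_nonneg [simp]: "0 \<le> ipn n x x"
  by (simp add: ipn_def sum_nonneg)

lemma ipn_self_eq_0: "ipn n x x = 0 \<longleftrightarrow> (\<forall>i<n. x i = 0)"
  unfolding ipn_def by (subst sum_nonneg_eq_0_iff) auto

lemma Cauchy_Schwarz_ipn: "(ipn n x y)\<^sup>2 \<le> ipn n x x * ipn n y y"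
  using Cauchy_Schwarz_ineq_sum[of x y "{..<n}"] by (simp add: ipn_def power2_eq_square)

lemma abs_ipn_le:
  assumes "ipn n x x \<le> a\<^sup>2" "ipn n y y \<le> b\<^sup>2" "0 \<le> a" "0 \<le> b"
  shows "\<bar>ipn n x y\<bar> \<le> a * b"
proof -
  have "(ipn n x y)\<^sup>2 \<le> a\<^sup>2 * b\<^sup>2"
    by (rule order_trans[OF Cauchy_Schwarz_ipn]) (intro mult_mono assms; simp)
  then have "\<bar>ipn n x y\<bar>\<^sup>2 \<le> (a * b)\<^sup>2" by (simp add: power_mult_distrib)
  then show ?thesis by (rule power2_le_imp_le) (simp add: assms)
qed

lemma ipn_le_coord:
  assumes "\<And>i. i < n \<Longrightarrow> \<bar>x i\<bar> \<le> r"
  shows "ipn n x x \<le> real n * r\<^sup>2"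
proof -
  have "ipn n x x \<le> (\<Sum>i<n. r\<^sup>2)" unfolding ipn_def
  proof (rule sum_mono)
    fix i assume "i \<in> {..<n}"
    then have "\<bar>x i\<bar>\<^sup>2 \<le> r\<^sup>2" using assms[of i] by (intro power_mono) auto
    then show "x i * x i \<le> r\<^sup>2" by (simp add: power2_eq_square)
  qed
  then show ?thesis by simp
qed

lemma coord_le_ipn:
  assumes "ipn n x x \<le> r\<^sup>2" "i < n" "0 \<le> r" shows "\<bar>x i\<bar> \<le> r"
proof -
  have "x i * x i \<le> ipn n x x" unfolding ipn_def using assms by (intro member_le_sum) auto
  then have "\<bar>x i\<bar>\<^sup>2 \<le> r\<^sup>2" using assms by (simp add: power2_eq_square)
  then show ?thesis using assms by (rule_tac power2_le_imp_le)
qed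

lemma ipn_mv: "ipn n (mv n A x) y = ipn n x (mv n (transp A) y)"
proof -
  have "ipn n (mv n A x) y = (\<Sum>i<n. \<Sum>j<n. A i j * x j * y i)"
    by (simp add: ipn_def mv_nth sum_distrib_right)
  also have "\<dots> = (\<Sum>j<n. \<Sum>i<n. A i j * x j * y i)" by (rule sum.swap)
  also have "\<dots> = ipn n x (mv n (transp A) y)"
    by (simp add: ipn_def mv_nth sum_distrib_left mult_ac)
  finally show ?thesis .
qed

lemma ipn_mv_unfold: "ipn n (mv n A x) (mv n B y) = (\<Sum>i<n. (\<Sum>j<n. A i j * x j) * (\<Sum>j<n. B i j * y j))"
  by (simp add: ipn_def mv_nth)

lemma mv_cong: "(\<And>i. i < n \<Longrightarrow> x i = y i) \<Longrightarrow> mv n A x = mv n A y"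
  by (auto simp: mv_def)

lemma mv_add: "mv n A (\<lambda>i. x i + y i) = vadd n (mv n A x) (mv n A y)"
  and mv_diff: "mv n A (\<lambda>i. x i - y i) = vadd n (mv n A x) (vneg n (mv n A y))"
  and mv_scale: "mv n A (\<lambda>i. c * x i) = vscale n c (mv n A x)"
  by (auto intro!: Rn_eqI[of _ n] simp: mv_nth algebra_simps sum.distrib sum_subtractf sum_distrib_left)

lemma ipn_mv_add: "ipn n (mv n A (\<lambda>i. x i + y i)) z = ipn n (mv n A x) z + ipn n (mv n A y) z"
  and ipn_mv_diff: "ipn n (mv n A (\<lambda>i. x i - y i)) z = ipn n (mv n A x) z - ipn n (mv n A y) z"
  and ipn_mv_scale: "ipn n (mv n A (\<lambda>i. c * x i)) z = c * ipn n (mv n A x) z"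
  and ipn_mv_add': "ipn n z (mv n A (\<lambda>i. x i + y i)) = ipn n z (mv n A x) + ipn n z (mv n A y)"
  and ipn_mv_diff': "ipn n z (mv n A (\<lambda>i. x i - y i)) = ipn n z (mv n A x) - ipn n z (mv n A y)"
  and ipn_mv_scale': "ipn n z (mv n A (\<lambda>i. c * x i)) = c * ipn n z (mv n A x)"
  by (simp_all add: mv_add mv_diff mv_scale ipn_vec)

lemma mv_vscale: "mv n A (vscale n c x) = mv n A (\<lambda>i. c * x i)"
  by (rule mv_cong, simp)+

text \<open>The interior condition asks for a sup-norm cube about the origin, which symmetry and
  convexity produce from any interior ball. Cubes have an explicit product volume and are convenient
  for packing.\<close>

definition sym_body :: "nat \<Rightarrow> (nat \<Rightarrow> real) set \<Rightarrow> bool" where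
  "sym_body n L \<longleftrightarrow> L \<subseteq> Rn n \<and> compact L \<and> convex_n n L \<and> origin_symmetric n L \<and>
     (\<exists>r>0. \<forall>x\<in>Rn n. (\<forall>i<n. \<bar>x i\<bar> \<le> r) \<longrightarrow> x \<in> L)"

text \<open>This is \<open>s\<close> times the usual polar body. The level is kept as a parameter
  because on it the exponentials \<open>exp (ipn n x \<xi>)\<close> with \<open>x\<close> in
  \<open>L\<close> are at most \<open>exp s\<close>.\<close>

definition polar :: "nat \<Rightarrow> (nat \<Rightarrow> real) set \<Rightarrow> real \<Rightarrow> (nat \<Rightarrow> real) set" where
  "polar n L s = {\<xi> \<in> Rn n. \<forall>x\<in>L. ipn n x \<xi> \<le> s}"

section \<open>Topology, volume and projection for symmetric bodies\<close>

lemma continuous_on_coord [continuous_intros]: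
  "continuous_on S (\<lambda>x::nat \<Rightarrow> real. x i)"
  by (rule continuous_on_subset[OF continuous_on_product_coordinates subset_UNIV])

lemma abs_le_interval: "\<bar>x\<bar> \<le> (r::real) \<longleftrightarrow> - r \<le> x \<and> x \<le> r" by auto

lemma compact_cube: "compact {x \<in> Rn n. \<forall>i<n. \<bar>x i\<bar> \<le> R}"
proof -
  \<comment> \<open>Points of \<open>Rn n\<close> take the value \<open>undefined\<close> off the
    index set, so the cube is a product over all natural numbers with singleton factors beyond
    \<open>n\<close>, and Tychonoff applies.\<close>
  have "compact (PiE UNIV (\<lambda>i. if i < n then {-R..R} else {undefined}))"
    using compactin_PiE[of "\<lambda>_. euclidean" UNIV "\<lambda>i. if i < n then {-R..R} else {undefined::real}"]
    by (simp add: euclidean_product_topology)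
  also have "PiE UNIV (\<lambda>i. if i < n then {-R..R} else {undefined}) = {x \<in> Rn n. \<forall>i<n. \<bar>x i\<bar> \<le> R}"
    by (auto simp: Rn_def PiE_iff extensional_def abs_le_interval split: if_splits)
  finally show ?thesis .
qed

text \<open>This transfers Borel sets and functions of the full function space, where compactness
  and continuity live, to \<open>lebn n\<close>. The coordinates outside the index set are constant,
  hence measurable.\<close>

lemma measurable_id_lebn_borel: "(\<lambda>x. x) \<in> lebn n \<rightarrow>\<^sub>M borel"
proof (rule measurable_coordinatewise_then_product)
  fix i
  show "(\<lambda>x. x i) \<in> borel_measurable (lebn n)"
  proof (cases "i < n")
    case False
    then have "x \<in> Rn n \<Longrightarrow> x i = undefined" for x by (auto simp: Rn_def PiE_def extensional_def)
    then have "((\<lambda>x. x i) \<in> borel_measurable (lebn n)) = ((\<lambda>x. undefined::real) \<in> borel_measurable (lebn n))"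
      by (intro measurable_cong) auto
    then show ?thesis by simp
  qed simp
qed

lemma borel_imp_sets_lebn:
  assumes "S \<in> sets borel" "S \<subseteq> Rn n" shows "S \<in> sets (lebn n)"
  using measurable_sets[OF measurable_id_lebn_borel assms(1), of n] assms(2) by (simp add: Int_absorb2)

lemma sym_body_sets: "sym_body n L \<Longrightarrow> L \<in> sets (lebn n)"
  by (intro borel_imp_sets_lebn) (auto simp: sym_body_def borel_compact)

lemma sym_body_Rn: "sym_body n L \<Longrightarrow> x \<in> L \<Longrightarrow> x \<in> Rn n"
  by (auto simp: sym_body_def)

lemma sym_body_bounded:
  assumes "sym_body n L" obtains R where "R > 0" "\<And>x i. x \<in> L \<Longrightarrow> i < n \<Longrightarrow> \<bar>x i\<bar> \<le> R"
proof -
  have "\<exists>R. \<forall>x\<in>L. \<bar>x i\<bar> \<le> R" for i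
  proof -
    have "compact ((\<lambda>x. x i) ` L)"
      using assms by (intro compact_continuous_image continuous_on_coord) (auto simp: sym_body_def)
    then have "bounded ((\<lambda>x. x i) ` L)" by (rule compact_imp_bounded)
    then show ?thesis by (auto simp: bounded_iff)
  qed
  then obtain R where R: "\<And>i x. x \<in> L \<Longrightarrow> \<bar>x i\<bar> \<le> R i" by metis
  have "\<bar>x i\<bar> \<le> (\<Sum>i<n. \<bar>R i\<bar>) + 1" if "x \<in> L" "i < n" for x i
  proof -
    have "\<bar>R i\<bar> \<le> (\<Sum>i<n. \<bar>R i\<bar>)" using that by (intro member_le_sum) auto
    then show ?thesis using R[OF that(1), of i] by linarith
  qed
  moreover have "0 < (\<Sum>i<n. \<bar>R i\<bar>) + 1" by (smt (verit) sum_nonneg abs_ge_zero)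
  ultimately show thesis using that by blast
qed

text \<open>Signs are absorbed by symmetry and missing weight by shrinking towards the origin. This
  absolutely convex form is the one in which memberships in bodies are checked later.\<close>

lemma sym_body_comb:
  assumes "sym_body n L" "x \<in> L" "y \<in> L" "\<bar>a\<bar> + \<bar>b\<bar> \<le> 1"
  shows "(\<lambda>i\<in>{..<n}. a * x i + b * y i) \<in> L"
proof -
  have conv: "\<And>x y t. x \<in> L \<Longrightarrow> y \<in> L \<Longrightarrow> 0 \<le> t \<Longrightarrow> t \<le> 1 \<Longrightarrow> vadd n (vscale n (1 - t) x) (vscale n t y) \<in> L"
    and neg: "\<And>x. x \<in> L \<Longrightarrow> vneg n x \<in> L"
    using assms(1) by (auto simp: sym_body_def convex_n_def origin_symmetric_def)
  have sc: "vscale n t x \<in> L" if "x \<in> L" "\<bar>t\<bar> \<le> 1" for t x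
  proof -
    have "vadd n (vscale n (1 - (1-t)/2) x) (vscale n ((1-t)/2) (vneg n x)) \<in> L"
      using that by (intro conv neg) auto
    also have "vadd n (vscale n (1 - (1-t)/2) x) (vscale n ((1-t)/2) (vneg n x)) = vscale n t x"
      by (intro Rn_eqI[of _ n]) (auto simp: field_simps)
    finally show ?thesis .
  qed
  show ?thesis
  proof (cases "\<bar>a\<bar> + \<bar>b\<bar> = 0")
    case True
    then have "a = 0" "b = 0" by linarith+
    then have "(\<lambda>i\<in>{..<n}. a * x i + b * y i) = vscale n 0 x" by (auto simp: vscale_def)
    then show ?thesis using sc[of x 0] assms by simp
  next
    case False
    define c where "c = \<bar>a\<bar> + \<bar>b\<bar>"
    have c: "c > 0" "c \<le> 1" using False assms(4) by (auto simp: c_def)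
    let ?x = "vscale n (c * sgn a) x" and ?y = "vscale n (c * sgn b) y"
    have "?x \<in> L" "?y \<in> L" using c assms by (auto intro!: sc simp: sgn_if)
    then have "vadd n (vscale n (1 - \<bar>b\<bar>/c) ?x) (vscale n (\<bar>b\<bar>/c) ?y) \<in> L"
      using c by (intro conv) (auto simp: c_def)
    also have "vadd n (vscale n (1 - \<bar>b\<bar>/c) ?x) (vscale n (\<bar>b\<bar>/c) ?y) = (\<lambda>i\<in>{..<n}. a * x i + b * y i)"
    proof (rule Rn_eqI[of _ n])
      have 1: "(1 - \<bar>b\<bar>/c) * (c * sgn a) = a"
      proof -
        have "(1 - \<bar>b\<bar>/c) * c = \<bar>a\<bar>" using c by (simp add: c_def field_simps)
        then show ?thesis by (simp only: mult.assoc[symmetric] abs_mult_sgn)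
      qed
      have 2: "(\<bar>b\<bar>/c) * (c * sgn b) = b" using c by (simp add: abs_mult_sgn)
      fix i assume "i < n"
      have "(1 - \<bar>b\<bar>/c) * (c * sgn a * x i) + \<bar>b\<bar>/c * (c * sgn b * y i) =
        ((1 - \<bar>b\<bar>/c) * (c * sgn a)) * x i + ((\<bar>b\<bar>/c) * (c * sgn b)) * y i"
        by (simp only: mult.assoc)
      also have "\<dots> = a * x i + b * y i" by (simp only: 1 2)
      finally show "vadd n (vscale n (1 - \<bar>b\<bar>/c) ?x) (vscale n (\<bar>b\<bar>/c) ?y) i = (\<lambda>i\<in>{..<n}. a * x i + b * y i) i"
        using \<open>i < n\<close> by simp
    next
      show "(\<lambda>i\<in>{..<n}. a * x i + b * y i) \<in> Rn n" by (simp add: Rn_def)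
    qed simp
    finally show ?thesis .
  qed
qed

lemma sym_body_scale:
  assumes "sym_body n L" "x \<in> L" "\<bar>t\<bar> \<le> 1" shows "vscale n t x \<in> L"
proof -
  have "vscale n t x = (\<lambda>i\<in>{..<n}. t * x i + 0 * x i)" by (auto simp: vscale_def)
  then show ?thesis using sym_body_comb[OF assms(1,2,2), of t 0] assms(3) by simp
qed

lemma sym_body_nonempty: assumes "sym_body n L" shows "L \<noteq> {}"
proof -
  obtain r where "r > 0" "\<forall>x\<in>Rn n. (\<forall>i<n. \<bar>x i\<bar> \<le> r) \<longrightarrow> x \<in> L" using assms by (auto simp: sym_body_def)
  then have "(\<lambda>i\<in>{..<n}. 0) \<in> L" by (auto simp: Rn_def)
  then show ?thesis by auto
qed

lemma vol_scaling_vscale: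
  assumes "c > 0" shows "vol_scaling n (vscale n c) (c ^ n)"
proof -
  define A where "A = (\<lambda>i j::nat. if i = j then c else 0)"
  have "lower_tri n A" using assms by (auto simp: lower_tri_def A_def)
  from vol_scaling_lower_tri[OF this] have "vol_scaling n (mv n A) (c ^ n)"
    by (simp add: diag_prod_def A_def)
  moreover have "vscale n c x = mv n A x" for x
  proof (rule Rn_eqI[of _ n])
    fix i assume i: "i < n"
    have "mv n A x i = (\<Sum>j<n. if j = i then c * x i else 0)"
      unfolding mv_nth[OF i] by (rule sum.cong) (auto simp: A_def)
    then show "vscale n c x i = mv n A x i" using i by simp
  qed auto
  ultimately show ?thesis using vol_scaling_cong by blast
qed

lemma emeasure_cube:
  assumes "r \<ge> 0"
  shows "emeasure (lebn n) {x \<in> Rn n. \<forall>i<n. \<bar>x i\<bar> \<le> r} = ennreal ((2 * r) ^ n)"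
proof -
  have "{x \<in> Rn n. \<forall>i<n. \<bar>x i\<bar> \<le> r} = PiE {..<n} (\<lambda>_. {-r..r})"
    unfolding Rn_def PiE_def Pi_def by (auto simp: abs_le_interval)
  then have "emeasure (lebn n) {x \<in> Rn n. \<forall>i<n. \<bar>x i\<bar> \<le> r} = (\<Prod>i<n. emeasure lborel {-r..r})"
    unfolding lebn_def by (simp only:) (rule lborel_prod.emeasure_PiM, auto)
  also have "\<dots> = ennreal ((2 * r) ^ n)"
    using assms by (simp add: ennreal_power)
  finally show ?thesis .
qed

lemma emeasure_lebn_trans:
  assumes "S \<in> sets (lebn n)"
  shows "emeasure (lebn n) {x \<in> Rn n. vadd n x c \<in> S} = emeasure (lebn n) S"
  using vol_scaling_emeasure[OF vol_scaling_trans assms] by simp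

lemma sym_body_emeasure:
  assumes "sym_body n L"
  shows "emeasure (lebn n) L = ennreal (voln n L)" "0 < voln n L"
proof -
  obtain R where R: "R > 0" "\<And>x i. x \<in> L \<Longrightarrow> i < n \<Longrightarrow> \<bar>x i\<bar> \<le> R" using sym_body_bounded[OF assms] by blast
  obtain r where r: "r > 0" "\<forall>x\<in>Rn n. (\<forall>i<n. \<bar>x i\<bar> \<le> r) \<longrightarrow> x \<in> L" using assms by (auto simp: sym_body_def)
  have cs: "{x \<in> Rn n. \<forall>i<n. \<bar>x i\<bar> \<le> a} \<in> sets (lebn n)" for a
    by (intro borel_imp_sets_lebn borel_compact compact_cube) auto
  have "emeasure (lebn n) L \<le> emeasure (lebn n) {x \<in> Rn n. \<forall>i<n. \<bar>x i\<bar> \<le> R}"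
    using R assms by (intro emeasure_mono cs) (auto simp: sym_body_def)
  also have "\<dots> < \<infinity>" using R(1) emeasure_cube[of R n] by simp
  finally have fin: "emeasure (lebn n) L < \<infinity>" .
  then show 1: "emeasure (lebn n) L = ennreal (voln n L)"
    unfolding voln_def by (intro emeasure_eq_ennreal_measure) auto
  have "emeasure (lebn n) {x \<in> Rn n. \<forall>i<n. \<bar>x i\<bar> \<le> r} \<le> emeasure (lebn n) L"
    using r sym_body_sets[OF assms] by (intro emeasure_mono) auto
  then have "ennreal ((2*r)^n) \<le> ennreal (voln n L)" using emeasure_cube[of r n] r(1) 1 by simp
  then have "(2*r)^n \<le> voln n L" by (subst (asm) ennreal_le_iff) (auto simp: voln_def)
  then show "0 < voln n L" using r(1) by (smt (verit) zero_less_power)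
qed

lemma voln_le:
  assumes "S \<subseteq> T" "T \<in> sets (lebn n)" "emeasure (lebn n) T < \<infinity>"
  shows "voln n S \<le> voln n T"
  unfolding voln_def
proof (cases "S \<in> sets (lebn n)")
  case True
  then show "measure (lebn n) S \<le> measure (lebn n) T"
    using assms by (intro measure_mono_fmeasurable) (auto simp: fmeasurable_def)
next
  case False
  then show "measure (lebn n) S \<le> measure (lebn n) T" by (simp add: measure_notin_sets)
qed

text \<open>Projection onto \<open>L\<close> in the Euclidean structure \<open>|K x|\<close>; the
  conclusion is the variational inequality obtained by moving from \<open>p\<close> a little towards
  \<open>y\<close>. With \<open>K\<close> the identity it places barycentres in \<open>L\<close>; in
  the reverse Santalo argument it splits a point into a part in \<open>L\<close> and a residual in
  the polar.\<close>

lemma nearest_point: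
  fixes K :: "nat \<Rightarrow> nat \<Rightarrow> real"
  assumes "sym_body n L"
  obtains p where "p \<in> L"
    "\<And>y. y \<in> L \<Longrightarrow> ipn n (mv n K (\<lambda>i. x i - p i)) (mv n K (\<lambda>i. y i - p i)) \<le> 0"
proof -
  define q where "q = (\<lambda>p. ipn n (mv n K (\<lambda>i. x i - p i)) (mv n K (\<lambda>i. x i - p i)))"
  have "continuous_on L q" unfolding q_def ipn_mv_unfold by (intro continuous_intros)
  then obtain p where p: "p \<in> L" "\<And>y. y \<in> L \<Longrightarrow> q p \<le> q y"
    using continuous_attains_inf[of L q] assms sym_body_nonempty[OF assms] by (auto simp: sym_body_def)
  show thesis
  proof (rule that[OF p(1)])
    fix y assume y: "y \<in> L"
    let ?u = "\<lambda>i. x i - p i" and ?v = "\<lambda>i. y i - p i"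
    let ?B = "ipn n (mv n K ?u) (mv n K ?v)" and ?C = "ipn n (mv n K ?v) (mv n K ?v)"
    have main: "2 * ?B \<le> t * ?C" if t: "0 < t" "t \<le> 1" for t
    proof -
      let ?z = "vadd n (vscale n (1 - t) p) (vscale n t y)"
      have "?z \<in> L" using assms p(1) y t by (auto simp: sym_body_def convex_n_def)
      then have "q p \<le> q ?z" by (rule p(2))
      also have "mv n K (\<lambda>i. x i - ?z i) = mv n K (\<lambda>i. ?u i - t * ?v i)"
        by (rule mv_cong) (simp add: algebra_simps)
      then have "q ?z = ipn n (mv n K (\<lambda>i. ?u i - t * ?v i)) (mv n K (\<lambda>i. ?u i - t * ?v i))"
        unfolding q_def by simp
      also have "\<dots> = q p - 2 * t * ?B + t\<^sup>2 * ?C"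
        by (simp only: ipn_mv_diff[of n K ?u "\<lambda>i. t * ?v i"] ipn_mv_diff'[of n _ K ?u "\<lambda>i. t * ?v i"]
             ipn_mv_scale ipn_mv_scale' ipn_commute[of n "mv n K ?v" "mv n K ?u"] q_def)
           (simp add: algebra_simps power2_eq_square)
      finally have "t * (2 * ?B) \<le> t * (t * ?C)" by (simp add: power2_eq_square mult_ac)
      then show ?thesis using t by (simp only: mult_le_cancel_left_pos)
    qed
    show "?B \<le> 0"
    proof (rule ccontr)
      assume "\<not> ?B \<le> 0"
      then have B: "?B > 0" by simp
      have "?C \<ge> 0" by simp
      \<comment> \<open>Small enough that \<open>t * ?C\<close> stays below \<open>?B\<close>, which
        contradicts \<open>main\<close>; the \<open>+ 1\<close> takes care of
        \<open>?C = 0\<close>.\<close>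
      define t where "t = min 1 (?B / (?C + 1))"
      have t: "0 < t" "t \<le> 1" "t \<le> ?B / (?C + 1)"
        using B \<open>?C \<ge> 0\<close> divide_pos_pos[OF B, of "?C + 1"] unfolding t_def by linarith+
      have "t * ?C \<le> t * (?C + 1)" using t by simp
      also have "\<dots> \<le> ?B / (?C + 1) * (?C + 1)" using t \<open>?C \<ge> 0\<close> by (intro mult_right_mono) auto
      also have "\<dots> = ?B" using \<open>?C \<ge> 0\<close> by (intro nonzero_eq_divide_eq[THEN iffD1]) linarith+
      finally show False using main[OF t(1,2)] B by simp
    qed
  qed
qed

lemma sym_body_polar:
  assumes L: "sym_body n L" and s: "s > 0"
  shows "sym_body n (polar n L s)"
proof -
  obtain R where R: "R > 0" "\<And>x i. x \<in> L \<Longrightarrow> i < n \<Longrightarrow> \<bar>x i\<bar> \<le> R" using sym_body_bounded[OF L] by blast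
  obtain r where r: "r > 0" "\<forall>x\<in>Rn n. (\<forall>i<n. \<bar>x i\<bar> \<le> r) \<longrightarrow> x \<in> L" using L by (auto simp: sym_body_def)
  have bd: "\<bar>\<xi> i\<bar> \<le> s / r" if "\<xi> \<in> polar n L s" "i < n" for \<xi> i
  proof -
    let ?x = "\<lambda>j\<in>{..<n}. if j = i then r * sgn (\<xi> i) else 0"
    have "?x \<in> L" using r by (auto simp: Rn_def sgn_if)
    then have "ipn n ?x \<xi> \<le> s" using that by (auto simp: polar_def)
    moreover have "ipn n ?x \<xi> = r * \<bar>\<xi> i\<bar>"
    proof -
      have "ipn n ?x \<xi> = (\<Sum>j<n. if j = i then r * sgn (\<xi> i) * \<xi> i else 0)"
        unfolding ipn_def by (rule sum.cong) auto
      also have "\<dots> = r * \<bar>\<xi> i\<bar>" using that(2) by (simp add: abs_sgn mult_ac)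
      finally show ?thesis .
    qed
    ultimately show ?thesis using r by (simp add: field_simps)
  qed
  have cl: "closed {\<xi>. ipn n x \<xi> \<le> s}" for x
    unfolding ipn_def by (intro closed_Collect_le continuous_intros)
  have "polar n L s = {x \<in> Rn n. \<forall>i<n. \<bar>x i\<bar> \<le> s / r} \<inter> (\<Inter>x\<in>L. {\<xi>. ipn n x \<xi> \<le> s})"
    using bd by (auto simp: polar_def)
  moreover have "compact \<dots>" by (intro compact_Int_closed compact_cube closed_INT ballI cl)
  ultimately have "compact (polar n L s)" by simp
  moreover have "convex_n n (polar n L s)"
    unfolding convex_n_def polar_def
  proof (auto simp: ipn_vec)
    fix x y z t assume "\<forall>x\<in>L. ipn n x z \<le> s" "\<forall>x\<in>L. ipn n x y \<le> s" "0 \<le> (t::real)" "t \<le> 1" "x \<in> L"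
    then show "(1 - t) * ipn n x y + t * ipn n x z \<le> s"
      by (intro convex_bound_le) auto
  qed
  moreover have "origin_symmetric n (polar n L s)"
    unfolding origin_symmetric_def
  proof (intro ballI)
    fix \<xi> assume "\<xi> \<in> polar n L s"
    have "ipn n x (vneg n \<xi>) \<le> s" if "x \<in> L" for x
    proof -
      have "vneg n x \<in> L" using that L by (auto simp: sym_body_def origin_symmetric_def)
      then have "ipn n (vneg n x) \<xi> \<le> s" using \<open>\<xi> \<in> polar n L s\<close> by (auto simp: polar_def)
      then show ?thesis by (simp add: ipn_vec)
    qed
    then show "vneg n \<xi> \<in> polar n L s" by (auto simp: polar_def)
  qed
  moreover have "\<exists>r>0. \<forall>x\<in>Rn n. (\<forall>i<n. \<bar>x i\<bar> \<le> r) \<longrightarrow> x \<in> polar n L s"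
  proof (intro exI conjI ballI impI)
    show "0 < s / (R * (real n + 1))" using R s by simp
    fix \<xi> assume \<xi>: "\<xi> \<in> Rn n" "\<forall>i<n. \<bar>\<xi> i\<bar> \<le> s / (R * (real n + 1))"
    have "ipn n x \<xi> \<le> s" if "x \<in> L" for x
    proof -
      have "ipn n x \<xi> \<le> (\<Sum>i<n. R * (s / (R * (real n + 1))))" unfolding ipn_def
      proof (rule sum_mono)
        fix i assume "i \<in> {..<n}"
        then have "\<bar>x i\<bar> * \<bar>\<xi> i\<bar> \<le> R * (s / (R * (real n + 1)))"
          using R(1) R(2)[OF that] \<xi> by (intro mult_mono) auto
        then show "x i * \<xi> i \<le> R * (s / (R * (real n + 1)))" by (metis abs_mult abs_ge_self order_trans)
      qed
      also have "\<dots> = s * (real n / (real n + 1))" using R by simp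
      also have "\<dots> \<le> s * 1" using s by (intro mult_left_mono) auto
      finally show ?thesis by simp
    qed
    then show "\<xi> \<in> polar n L s" using \<xi> by (auto simp: polar_def)
  qed
  ultimately show ?thesis by (auto simp: sym_body_def polar_def)
qed

lemma sym_body_inter_ellipsoid:
  assumes L: "sym_body n L" and c: "c > 0"
  shows "sym_body n {x \<in> L. ipn n (mv n A x) (mv n A x) \<le> c}" (is "sym_body n ?M")
proof -
  obtain r where r: "r > 0" "\<forall>x\<in>Rn n. (\<forall>i<n. \<bar>x i\<bar> \<le> r) \<longrightarrow> x \<in> L" using L by (auto simp: sym_body_def)
  have "closed {x. ipn n (mv n A x) (mv n A x) \<le> c}"
    unfolding ipn_mv_unfold by (intro closed_Collect_le continuous_intros)
  moreover have "?M = L \<inter> {x. ipn n (mv n A x) (mv n A x) \<le> c}" by auto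
  ultimately have "compact ?M" using L by (auto simp: sym_body_def intro!: compact_Int_closed)
  moreover have "convex_n n ?M"
    unfolding convex_n_def
  proof (intro conjI ballI allI impI)
    show "?M \<subseteq> Rn n" using L by (auto simp: sym_body_def)
    fix x y and t :: real assume xy: "x \<in> ?M" "y \<in> ?M" and t: "0 \<le> t \<and> t \<le> 1"
    let ?z = "vadd n (vscale n (1 - t) x) (vscale n t y)"
    have 1: "?z \<in> L" using L xy t by (auto simp: sym_body_def convex_n_def)
    let ?X = "ipn n (mv n A x) (mv n A x)" and ?Y = "ipn n (mv n A y) (mv n A y)" and ?B = "ipn n (mv n A x) (mv n A y)"
    have z: "mv n A ?z = mv n A (\<lambda>i. (1 - t) * x i + t * y i)" by (rule mv_cong) simp
    have "ipn n (mv n A ?z) (mv n A ?z) = (1-t)\<^sup>2 * ?X + 2 * t * (1-t) * ?B + t\<^sup>2 * ?Y"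
      unfolding z
      by (simp only: ipn_mv_add[of n A "\<lambda>i. (1 - t) * x i" "\<lambda>i. t * y i"] ipn_mv_add'[of n _ A "\<lambda>i. (1 - t) * x i" "\<lambda>i. t * y i"]
         ipn_mv_scale ipn_mv_scale' ipn_commute[of n "mv n A y" "mv n A x"])
         (simp add: algebra_simps power2_eq_square)
    moreover have "\<bar>?B\<bar> \<le> sqrt c * sqrt c" using xy c by (intro abs_ipn_le) auto
    then have "?B \<le> c" using c by simp
    then have "2 * t * (1-t) * ?B \<le> 2 * t * (1-t) * c" using t by (intro mult_left_mono) auto
    moreover have "(1-t)\<^sup>2 * ?X \<le> (1-t)\<^sup>2 * c" "t\<^sup>2 * ?Y \<le> t\<^sup>2 * c" using xy by (auto intro!: mult_left_mono)
    ultimately have "ipn n (mv n A ?z) (mv n A ?z) \<le> (1-t)\<^sup>2 * c + 2 * t * (1-t) * c + t\<^sup>2 * c" by linarith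
    also have "\<dots> = c" by (simp add: algebra_simps power2_eq_square)
    finally show "?z \<in> ?M" using 1 by simp
  qed
  moreover have "origin_symmetric n ?M"
  proof -
    have "mv n A (vneg n x) = mv n A (\<lambda>i. (-1) * x i)" for x by (rule mv_cong) simp
    then have "mv n A (vneg n x) = vscale n (-1) (mv n A x)" for x by (simp only: mv_scale)
    then have "ipn n (mv n A (vneg n x)) (mv n A (vneg n x)) = ipn n (mv n A x) (mv n A x)" for x
      by (simp add: ipn_vec)
    then show ?thesis using L by (auto simp: sym_body_def origin_symmetric_def)
  qed
  moreover have "\<exists>r>0. \<forall>x\<in>Rn n. (\<forall>i<n. \<bar>x i\<bar> \<le> r) \<longrightarrow> x \<in> ?M"
  proof -
    define a where "a = (\<Sum>i<n. (\<Sum>j<n. \<bar>A i j\<bar>)\<^sup>2) + 1"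
    have a: "a > 0" unfolding a_def by (intro add_nonneg_pos sum_nonneg) auto
    define \<rho> where "\<rho> = min r (sqrt (c / a))"
    have \<rho>: "\<rho> > 0" "\<rho> \<le> r" "\<rho> \<le> sqrt (c / a)" using a c r by (auto simp: \<rho>_def)
    moreover have "x \<in> ?M" if x: "x \<in> Rn n" "\<forall>i<n. \<bar>x i\<bar> \<le> \<rho>" for x
    proof -
      have "x \<in> L" using r x \<rho>(2) by (meson order_trans)
      moreover have "ipn n (mv n A x) (mv n A x) \<le> c"
      proof -
        have "ipn n (mv n A x) (mv n A x) \<le> (\<Sum>i<n. (\<Sum>j<n. \<bar>A i j\<bar>)\<^sup>2 * \<rho>\<^sup>2)"
          unfolding ipn_def
        proof (rule sum_mono)
          fix i assume "i \<in> {..<n}"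
          then have "\<bar>mv n A x i\<bar> \<le> (\<Sum>j<n. \<bar>A i j\<bar> * \<rho>)"
            using x by (auto simp: mv_nth abs_mult intro!: order_trans[OF sum_abs] sum_mono mult_left_mono)
          then have "\<bar>mv n A x i\<bar>\<^sup>2 \<le> ((\<Sum>j<n. \<bar>A i j\<bar>) * \<rho>)\<^sup>2"
            by (intro power_mono) (auto simp: sum_distrib_right)
          then show "mv n A x i * mv n A x i \<le> (\<Sum>j<n. \<bar>A i j\<bar>)\<^sup>2 * \<rho>\<^sup>2"
            by (simp add: power2_eq_square mult_ac)
        qed
        also have "\<dots> = (\<Sum>i<n. (\<Sum>j<n. \<bar>A i j\<bar>)\<^sup>2) * \<rho>\<^sup>2" by (simp add: sum_distrib_right)
        also have "\<dots> \<le> a * \<rho>\<^sup>2" by (intro mult_right_mono) (auto simp: a_def)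
        also have "\<dots> \<le> a * (sqrt (c / a))\<^sup>2" using \<rho> a
          by (intro mult_left_mono power_mono) auto
        also have "\<dots> = c" using a c by simp
        finally show ?thesis .
      qed
      ultimately show ?thesis by simp
    qed
    ultimately show ?thesis by blast
  qed
  ultimately show ?thesis using L by (auto simp: sym_body_def)
qed

text \<open>The conclusion says \<open>T A^T A = I\<close>, so \<open>A^T A\<close> is the inverse
  of \<open>T\<close>. The induction borders the matrix: \<open>\<beta>\<close> solves the smaller
  system for the last column of \<open>T\<close>, and the Schur complement \<open>\<sigma>\<close>
  yields the new last row, \<open>- \<beta> / sqrt \<sigma>\<close> followed by
  \<open>1 / sqrt \<sigma>\<close>. The lower bound with \<open>\<epsilon>\<close> passes to leading
  blocks and keeps \<open>\<sigma>\<close> positive.\<close>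

lemma cholesky_inverse:
  assumes "\<And>i j. i < n \<Longrightarrow> j < n \<Longrightarrow> T i j = T j i" and "\<epsilon> > 0"
    and "\<And>v. \<epsilon> * ipn n v v \<le> (\<Sum>i<n. \<Sum>j<n. T i j * v i * v j)"
  shows "\<exists>A. lower_tri n A \<and>
    (\<forall>i<n. \<forall>j<n. (\<Sum>l<n. T i l * (\<Sum>k<n. A k l * A k j)) = (if i = j then 1 else 0))"
  using assms
proof (induction n)
  case 0
  then show ?case by (auto simp: lower_tri_def)
next
  case (Suc n)
  have pos': "\<epsilon> * ipn n v v \<le> (\<Sum>i<n. \<Sum>j<n. T i j * v i * v j)" for v
  proof -
    have "\<epsilon> * ipn (Suc n) (v(n := 0)) (v(n := 0)) \<le>
       (\<Sum>i<Suc n. \<Sum>j<Suc n. T i j * (v(n := 0)) i * (v(n := 0)) j)" by (rule Suc.prems(3))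
    then show ?thesis by (simp add: ipn_def)
  qed
  obtain A where A: "lower_tri n A"
    "\<And>i j. i < n \<Longrightarrow> j < n \<Longrightarrow> (\<Sum>l<n. T i l * (\<Sum>k<n. A k l * A k j)) = (if i = j then 1 else 0)"
    using Suc.IH[OF _ Suc.prems(2) pos'] Suc.prems(1) by force
  define G where "G = (\<lambda>l j. \<Sum>k<n. A k l * A k j)"
  have G_sym: "G i j = G j i" for i j by (simp add: G_def mult.commute)
  have TG: "(\<Sum>l<n. T i l * G l j) = (if i = j then 1 else 0)" if "i < n" "j < n" for i j
    using A(2)[OF that] by (simp add: G_def)
  define \<beta> where "\<beta> = (\<lambda>j. \<Sum>l<n. G j l * T l n)"
  have T\<beta>: "(\<Sum>l<n. T i l * \<beta> l) = T i n" if "i < n" for i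
  proof -
    have "(\<Sum>l<n. T i l * \<beta> l) = (\<Sum>l<n. \<Sum>m<n. T i l * G l m * T m n)"
      by (simp add: \<beta>_def sum_distrib_left mult.assoc)
    also have "\<dots> = (\<Sum>m<n. \<Sum>l<n. T i l * G l m * T m n)" by (rule sum.swap)
    also have "\<dots> = (\<Sum>m<n. (if i = m then 1 else 0) * T m n)"
      by (rule sum.cong) (auto simp: sum_distrib_right[symmetric] TG that)
    also have "\<dots> = (\<Sum>m<n. if m = i then T i n else 0)" by (rule sum.cong) auto
    finally show ?thesis using that by simp
  qed
  define \<sigma> where "\<sigma> = T n n - (\<Sum>l<n. T n l * \<beta> l)"
  have "\<sigma> > 0"
  proof -
    \<comment> \<open>The vector at which the quadratic form of \<open>T\<close> equals the Schur
      complement.\<close>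
    define v where "v = (\<lambda>i. if i = n then 1 else - \<beta> i)"
    have v: "v n = 1" "\<And>i. i < n \<Longrightarrow> v i = - \<beta> i" by (auto simp: v_def)
    have "(\<Sum>i<Suc n. \<Sum>j<Suc n. T i j * v i * v j) = (\<Sum>i<Suc n. v i * (\<Sum>j<Suc n. T i j * v j))"
      by (simp only: sum_distrib_left mult_ac)
    also have "\<dots> = (\<Sum>i<n. v i * (\<Sum>j<Suc n. T i j * v j)) + (\<Sum>j<Suc n. T n j * v j)" by (simp add: v)
    also have "(\<Sum>i<n. v i * (\<Sum>j<Suc n. T i j * v j)) = 0"
      by (intro sum.neutral) (auto simp: v sum_negf T\<beta>)
    also have "(\<Sum>j<Suc n. T n j * v j) = \<sigma>" by (simp add: v sum_negf \<sigma>_def)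
    finally have "\<epsilon> * ipn (Suc n) v v \<le> \<sigma>" using Suc.prems(3)[of v] by simp
    moreover have "0 < ipn (Suc n) v v" unfolding ipn_def by (simp add: v add_nonneg_pos sum_nonneg)
    ultimately show ?thesis using Suc.prems(2) by (smt (verit) mult_pos_pos)
  qed
  define B where "B = (\<lambda>i j. if i = n then (if j = n then 1 / sqrt \<sigma> else - \<beta> j / sqrt \<sigma>)
       else if j = n then 0 else A i j)"
  have ltB: "lower_tri (Suc n) B" using A(1) \<open>\<sigma> > 0\<close> by (auto simp: lower_tri_def B_def less_Suc_eq)
  have BB: "(\<Sum>k<Suc n. B k l * B k j) = (if l < n \<and> j < n then G l j else 0) + B n l * B n j" if "l < Suc n" "j < Suc n" for l j
    using that by (auto simp: B_def G_def intro!: sum.cong sum.neutral)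
  have ss: "sqrt \<sigma> * sqrt \<sigma> = \<sigma>" using \<open>\<sigma> > 0\<close> by simp
  have key: "(\<Sum>l<Suc n. T i l * (\<Sum>k<Suc n. B k l * B k j)) =
      (if j < n then (\<Sum>l<n. T i l * G l j) else 0) + B n j * (T i n - (\<Sum>l<n. T i l * \<beta> l)) / sqrt \<sigma>"
    if "i < Suc n" "j < Suc n" for i j
  proof -
    have "(\<Sum>l<Suc n. T i l * (\<Sum>k<Suc n. B k l * B k j)) =
      (\<Sum>l<Suc n. T i l * ((if l < n \<and> j < n then G l j else 0) + B n l * B n j))"
      by (rule sum.cong) (use that in \<open>auto simp only: BB lessThan_iff\<close>)
    also have "\<dots> = (\<Sum>l<n. T i l * (if j < n then G l j else 0)) + B n j * (\<Sum>l<Suc n. T i l * B n l)"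
      by (simp add: algebra_simps sum.distrib sum_distrib_left)
    also have "(\<Sum>l<Suc n. T i l * B n l) = (T i n - (\<Sum>l<n. T i l * \<beta> l)) / sqrt \<sigma>"
      by (simp add: B_def diff_divide_distrib sum_negf sum_divide_distrib)
    finally show ?thesis by simp
  qed
  have "(\<Sum>l<Suc n. T i l * (\<Sum>k<Suc n. B k l * B k j)) = (if i = j then 1 else 0)"
    if ij: "i < Suc n" "j < Suc n" for i j
  proof (cases "i < n")
    case True
    then show ?thesis using ij T\<beta>[OF True] by (subst key) (auto simp: TG)
  next
    case False
    then have i: "i = n" using ij by simp
    have "B n j * \<sigma> / sqrt \<sigma> = (if j < n then - \<beta> j else 1)"
      using ij \<open>\<sigma> > 0\<close> ss by (auto simp: B_def field_simps)
    moreover have "(\<Sum>l<n. T n l * G l j) = \<beta> j" if "j < n"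
      unfolding \<beta>_def using Suc.prems(1) by (intro sum.cong) (auto simp: G_sym[of j] mult.commute)
    ultimately show ?thesis unfolding i by (subst key) (use ij in \<open>auto simp: \<sigma>_def[symmetric]\<close>)
  qed
  then show ?case using ltB by blast
qed

text \<open>Take a separated set of greatest cardinality: a point separated from all of it could be
  added. The bound \<open>B\<close> is supplied by counting cells in one application and by a volume
  comparison in the other.\<close>

lemma maximal_separated:
  assumes bound: "\<And>P. finite P \<Longrightarrow> P \<subseteq> S \<Longrightarrow> (\<And>p q. p \<in> P \<Longrightarrow> q \<in> P \<Longrightarrow> p \<noteq> q \<Longrightarrow> sep p q) \<Longrightarrow> card P \<le> (B::nat)"
    and sym: "\<And>p q. sep p q \<Longrightarrow> sep q p" and irr: "\<And>p. p \<in> S \<Longrightarrow> \<not> sep p p"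
  shows "\<exists>P. finite P \<and> P \<subseteq> S \<and> (\<forall>p\<in>P. \<forall>q\<in>P. p \<noteq> q \<longrightarrow> sep p q) \<and> (\<forall>x\<in>S. \<exists>p\<in>P. \<not> sep x p)"
proof -
  let ?Q = "\<lambda>P. finite P \<and> P \<subseteq> S \<and> (\<forall>p\<in>P. \<forall>q\<in>P. p \<noteq> q \<longrightarrow> sep p q)"
  have "\<exists>P. ?Q P \<and> (\<forall>P'. ?Q P' \<longrightarrow> card P' \<le> card P)"
  proof (rule ex_has_greatest_nat[of ?Q "{}" card "Suc B"])
    show "\<forall>P. ?Q P \<longrightarrow> card P < Suc B" using bound by (simp add: less_Suc_eq_le)
  qed auto
  then obtain P where PP: "?Q P \<and> (\<forall>P'. ?Q P' \<longrightarrow> card P' \<le> card P)" by (rule exE)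
  have P: "?Q P" by (rule conjunct1[OF PP])
  have P2: "card P' \<le> card P" if "?Q P'" for P' by (rule mp[OF spec[OF conjunct2[OF PP]] that])
  have "\<exists>p\<in>P. \<not> sep x p" if "x \<in> S" for x
  proof (rule ccontr)
    assume "\<not> ?thesis"
    then have x: "\<forall>p\<in>P. sep x p" by blast
    then have "x \<notin> P" using irr that by blast
    have "?Q (insert x P)" using P x sym that by auto
    from P2[OF this] show False using \<open>x \<notin> P\<close> P by simp
  qed
  then show ?thesis using P by (intro exI[of _ P]) simp
qed

text \<open>Finiteness comes from the grid of side \<open>\<delta>\<close>: points of one cell
  differ by less than \<open>\<delta>\<close> in every coordinate, so a separated set meets each
  cell at most once.\<close>

lemma cube_packing:
  assumes S: "S \<subseteq> Rn n" "\<And>x i. x \<in> S \<Longrightarrow> i < n \<Longrightarrow> \<bar>x i\<bar> \<le> R" and \<delta>: "\<delta> > 0"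
  shows "\<exists>P. finite P \<and> P \<subseteq> S \<and> (\<forall>p\<in>P. \<forall>q\<in>P. p \<noteq> q \<longrightarrow> (\<exists>i<n. \<delta> \<le> \<bar>p i - q i\<bar>)) \<and>
    (\<forall>x\<in>S. \<exists>p\<in>P. \<forall>i<n. \<bar>x i - p i\<bar> < \<delta>)"
proof -
  define cell where "cell = (\<lambda>x::nat \<Rightarrow> real. \<lambda>i\<in>{..<n}. \<lfloor>x i / \<delta>\<rfloor>)"
  let ?F = "PiE {..<n} (\<lambda>_. {\<lfloor>-R/\<delta>\<rfloor>..\<lfloor>R/\<delta>\<rfloor>})"
  have fin: "finite ?F" by (intro finite_PiE) auto
  have cellF: "cell x \<in> ?F" if "x \<in> S" for x
  proof -
    have "\<lfloor>-R/\<delta>\<rfloor> \<le> \<lfloor>x i / \<delta>\<rfloor> \<and> \<lfloor>x i / \<delta>\<rfloor> \<le> \<lfloor>R/\<delta>\<rfloor>" if "i < n" for i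
    proof -
      have "-R \<le> x i" "x i \<le> R" using S(2)[OF \<open>x \<in> S\<close> that] by auto
      then show ?thesis using \<delta> by (intro conjI floor_mono divide_right_mono) auto
    qed
    then show ?thesis by (auto simp: cell_def)
  qed
  have close: "\<bar>x i - y i\<bar> < \<delta>" if "cell x = cell y" "i < n" for x y i
  proof -
    have "\<lfloor>x i / \<delta>\<rfloor> = \<lfloor>y i / \<delta>\<rfloor>" using fun_cong[OF that(1), of i] that(2) by (simp add: cell_def)
    then have "\<bar>x i / \<delta> - y i / \<delta>\<bar> < 1" by linarith
    then have "\<bar>(x i - y i) / \<delta>\<bar> < 1" by (simp add: diff_divide_distrib)
    then show ?thesis using \<delta> by (simp add: abs_divide divide_simps)
  qed
  have "\<exists>P. finite P \<and> P \<subseteq> S \<and> (\<forall>p\<in>P. \<forall>q\<in>P. p \<noteq> q \<longrightarrow> (\<exists>i<n. \<delta> \<le> \<bar>p i - q i\<bar>)) \<and>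
      (\<forall>x\<in>S. \<exists>p\<in>P. \<not> (\<exists>i<n. \<delta> \<le> \<bar>x i - p i\<bar>))"
  proof (rule maximal_separated[where S = S and sep = "\<lambda>p q. \<exists>i<n. \<delta> \<le> \<bar>p i - q i\<bar>" and B = "card ?F"])
    fix P assume P: "finite P" "P \<subseteq> S" "\<And>p q. p \<in> P \<Longrightarrow> q \<in> P \<Longrightarrow> p \<noteq> q \<Longrightarrow> \<exists>i<n. \<delta> \<le> \<bar>p i - q i\<bar>"
    have "inj_on cell P"
      by (rule inj_onI) (metis P(3) close not_less)
    moreover have "cell ` P \<subseteq> ?F" using P(2) cellF by auto
    ultimately show "card P \<le> card ?F" using fin card_inj_on_le by blast
  next
    fix p q :: "nat \<Rightarrow> real" assume "\<exists>i<n. \<delta> \<le> \<bar>p i - q i\<bar>"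
    then show "\<exists>i<n. \<delta> \<le> \<bar>q i - p i\<bar>" by (simp add: abs_minus_commute)
  next
    fix p :: "nat \<Rightarrow> real" assume "p \<in> S" show "\<not> (\<exists>i<n. \<delta> \<le> \<bar>p i - p i\<bar>)" using \<delta> by auto
  qed
  moreover have "(\<not> (\<exists>i<n. \<delta> \<le> \<bar>x i - p i\<bar>)) \<longleftrightarrow> (\<forall>i<n. \<bar>x i - p i\<bar> < \<delta>)" for x p :: "nat \<Rightarrow> real"
    by (auto simp: not_le)
  ultimately show ?thesis by simp
qed

section \<open>Exponential tilts\<close>

text \<open>\<open>s\<close> is both the level of the polar body and the scale in the map
  \<open>G\<close>. Centring is the form in which the symmetry of the measure enters: it makes the
  log-Laplace transform nonnegative.\<close>

locale body_measure = prob_space \<mu> for \<mu> :: "(nat \<Rightarrow> real) measure" +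
  fixes n :: nat and L :: "(nat \<Rightarrow> real) set" and s :: real
  assumes body: "sym_body n L"
    and sets_\<mu>: "sets \<mu> = sets (lebn n)"
    and supp: "AE x in \<mu>. x \<in> L"
    and centred: "\<And>i. i < n \<Longrightarrow> (\<integral>x. x i \<partial>\<mu>) = 0"
    and s_pos: "0 < s"
begin

section \<open>Functions bounded on the body and their tilted expectations\<close>

definition bdd :: "((nat \<Rightarrow> real) \<Rightarrow> real) \<Rightarrow> bool" where
  "bdd f \<longleftrightarrow> f \<in> borel_measurable (lebn n) \<and> (\<exists>B. \<forall>x\<in>L. \<bar>f x\<bar> \<le> B)"

lemma bdd_const: "bdd (\<lambda>x. c)" by (auto simp: bdd_def)

lemma bdd_coord: "i < n \<Longrightarrow> bdd (\<lambda>x. x i)"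
  using sym_body_bounded[OF body] unfolding bdd_def by (metis measurable_coord_lebn)

lemma bdd_add: assumes "bdd f" "bdd g" shows "bdd (\<lambda>x. f x + g x)"
proof -
  obtain B C where "\<forall>x\<in>L. \<bar>f x\<bar> \<le> B" "\<forall>x\<in>L. \<bar>g x\<bar> \<le> C" using assms by (auto simp: bdd_def)
  then have "\<forall>x\<in>L. \<bar>f x + g x\<bar> \<le> B + C" by (meson abs_triangle_ineq add_mono order_trans)
  then show ?thesis using assms by (auto simp: bdd_def)
qed

lemma bdd_mult: assumes "bdd f" "bdd g" shows "bdd (\<lambda>x. f x * g x)"
proof -
  obtain B C where B: "\<forall>x\<in>L. \<bar>f x\<bar> \<le> B" and C: "\<forall>x\<in>L. \<bar>g x\<bar> \<le> C" using assms by (auto simp: bdd_def)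
  have "\<bar>f x * g x\<bar> \<le> B * C" if "x \<in> L" for x
  proof -
    have "\<bar>f x\<bar> \<le> B" "\<bar>g x\<bar> \<le> C" using B C that by auto
    then show ?thesis unfolding abs_mult by (intro mult_mono) auto
  qed
  then show ?thesis using assms by (auto simp: bdd_def)
qed

lemma bdd_diff: assumes "bdd f" "bdd g" shows "bdd (\<lambda>x. f x - g x)"
  using bdd_add[OF assms(1) bdd_mult[OF bdd_const[of "-1"] assms(2)]] by simp

lemma bdd_exp: assumes "bdd f" shows "bdd (\<lambda>x. exp (f x))"
proof -
  obtain B where "\<forall>x\<in>L. \<bar>f x\<bar> \<le> B" using assms by (auto simp: bdd_def)
  then have "\<forall>x\<in>L. \<bar>exp (f x)\<bar> \<le> exp B" by (auto simp: abs_le_iff)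
  then show ?thesis using assms by (auto simp: bdd_def)
qed

lemma bdd_sum: "(\<And>i. i \<in> I \<Longrightarrow> bdd (f i)) \<Longrightarrow> bdd (\<lambda>x. \<Sum>i\<in>I. f i x)"
  by (induction I rule: infinite_finite_induct) (auto intro: bdd_const bdd_add)

lemma bdd_ipn: "bdd (\<lambda>x. ipn n x v)"
  unfolding ipn_def by (intro bdd_sum bdd_mult bdd_const bdd_coord) auto

lemmas bdd_intros = bdd_const bdd_coord bdd_add bdd_diff bdd_mult bdd_exp bdd_ipn bdd_sum

lemma bdd_integrable: assumes "bdd f" shows "integrable \<mu> f"
proof -
  obtain B where "\<forall>x\<in>L. \<bar>f x\<bar> \<le> B" using assms by (auto simp: bdd_def)
  then have "AE x in \<mu>. norm (f x) \<le> B" using supp by auto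
  moreover have "f \<in> borel_measurable \<mu>"
    using assms sets_\<mu> by (simp add: bdd_def cong: measurable_cong_sets)
  ultimately show ?thesis by (rule integrable_const_bound)
qed

text \<open>\<open>Z\<close> is the Laplace transform, \<open>E \<xi>\<close> the expectation under
  the tilted probability measure, \<open>b \<xi>\<close> its barycentre and \<open>lam\<close> the
  log-Laplace transform. The gradient of \<open>lam\<close> is \<open>b\<close> and its Hessian the
  tilted covariance, but the proof takes no derivatives: tangent inequalities and explicit remainder
  bounds replace them.\<close>

definition Z :: "(nat \<Rightarrow> real) \<Rightarrow> real" where "Z \<xi> = (\<integral>x. exp (ipn n x \<xi>) \<partial>\<mu>)"
definition E :: "(nat \<Rightarrow> real) \<Rightarrow> ((nat \<Rightarrow> real) \<Rightarrow> real) \<Rightarrow> real" where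
  "E \<xi> f = (\<integral>x. f x * exp (ipn n x \<xi>) \<partial>\<mu>) / Z \<xi>"
definition b :: "(nat \<Rightarrow> real) \<Rightarrow> nat \<Rightarrow> real" where "b \<xi> i = E \<xi> (\<lambda>x. x i)"
definition lam :: "(nat \<Rightarrow> real) \<Rightarrow> real" where "lam \<xi> = ln (Z \<xi>)"

lemma Z_pos: "0 < Z \<xi>"
proof -
  obtain B where B: "\<forall>x\<in>L. \<bar>ipn n x \<xi>\<bar> \<le> B" using bdd_ipn[of \<xi>] by (auto simp: bdd_def)
  have "(\<integral>x. exp (-B) \<partial>\<mu>) \<le> Z \<xi>" unfolding Z_def
  proof (rule integral_mono_AE)
    show "AE x in \<mu>. exp (- B) \<le> exp (ipn n x \<xi>)"
      using supp by eventually_elim (use B in \<open>auto simp: abs_le_iff\<close>)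
  qed (auto intro!: bdd_integrable bdd_intros)
  then have "exp (- B) \<le> Z \<xi>" by (simp add: prob_space)
  then show ?thesis by (rule less_le_trans[OF exp_gt_zero])
qed

lemma E_add: "bdd f \<Longrightarrow> bdd g \<Longrightarrow> E \<xi> (\<lambda>x. f x + g x) = E \<xi> f + E \<xi> g"
  unfolding E_def
  by (simp add: distrib_right add_divide_distrib bdd_integrable bdd_intros Bochner_Integration.integral_add)

lemma E_diff: "bdd f \<Longrightarrow> bdd g \<Longrightarrow> E \<xi> (\<lambda>x. f x - g x) = E \<xi> f - E \<xi> g"
  unfolding E_def
  by (simp add: left_diff_distrib diff_divide_distrib bdd_integrable bdd_intros Bochner_Integration.integral_diff)

lemma E_cmult: "E \<xi> (\<lambda>x. c * f x) = c * E \<xi> f"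
  unfolding E_def by (simp add: mult.assoc)

lemma E_const: "E \<xi> (\<lambda>x. c) = c"
  unfolding E_def using Z_pos[of \<xi>] by (simp add: Z_def[symmetric])

lemma E_sum: "(\<And>i. i \<in> I \<Longrightarrow> bdd (f i)) \<Longrightarrow> E \<xi> (\<lambda>x. \<Sum>i\<in>I. f i x) = (\<Sum>i\<in>I. E \<xi> (f i))"
proof (induction I rule: infinite_finite_induct)
  case (insert i I)
  then show ?case by (simp add: E_add bdd_sum)
qed (auto simp: E_const)

lemma E_mono: assumes "bdd f" "bdd g" "\<And>x. x \<in> L \<Longrightarrow> f x \<le> g x" shows "E \<xi> f \<le> E \<xi> g"
  unfolding E_def
proof (rule divide_right_mono)
  show "(\<integral>x. f x * exp (ipn n x \<xi>) \<partial>\<mu>) \<le> (\<integral>x. g x * exp (ipn n x \<xi>) \<partial>\<mu>)"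
  proof (rule integral_mono_AE)
    show "AE x in \<mu>. f x * exp (ipn n x \<xi>) \<le> g x * exp (ipn n x \<xi>)"
      using supp by eventually_elim (use assms in auto)
  qed (auto intro!: bdd_integrable bdd_intros assms)
qed (use Z_pos[of \<xi>] in simp)

lemma E_abs_le: assumes "bdd f" "\<And>x. x \<in> L \<Longrightarrow> \<bar>f x\<bar> \<le> B" shows "\<bar>E \<xi> f\<bar> \<le> B"
proof -
  have "E \<xi> f \<le> E \<xi> (\<lambda>x. B)" "E \<xi> (\<lambda>x. - B) \<le> E \<xi> f"
    using assms by (auto intro!: E_mono bdd_const simp: abs_le_interval)
  then show ?thesis by (simp add: E_const abs_le_interval)
qed

lemma E_ipn: "E \<xi> (\<lambda>x. ipn n x v) = ipn n (b \<xi>) v"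
  unfolding ipn_def
  by (subst E_sum) (auto intro!: bdd_intros simp: b_def mult.commute[of _ "v _"] E_cmult)

text \<open>The tilt at \<open>\<zeta>\<close> is the tilt at \<open>\<xi>\<close> tilted once more
  by the difference, so two tilts are compared through moments under a single one.\<close>

lemma Z_ratio: "Z \<zeta> = Z \<xi> * E \<xi> (\<lambda>x. exp (ipn n x (\<lambda>i. \<zeta> i - \<xi> i)))"
  unfolding E_def using Z_pos[of \<xi>] by (simp add: exp_add[symmetric] ipn_diff_right Z_def)

lemma E_ratio: "E \<zeta> f = E \<xi> (\<lambda>x. f x * exp (ipn n x (\<lambda>i. \<zeta> i - \<xi> i))) / E \<xi> (\<lambda>x. exp (ipn n x (\<lambda>i. \<zeta> i - \<xi> i)))"
proof -
  have "E \<xi> (\<lambda>x. f x * exp (ipn n x (\<lambda>i. \<zeta> i - \<xi> i))) = (\<integral>x. f x * exp (ipn n x \<zeta>) \<partial>\<mu>) / Z \<xi>"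
    unfolding E_def by (simp add: exp_add[symmetric] ipn_diff_right mult.assoc)
  then show ?thesis using Z_ratio[of \<zeta> \<xi>] Z_pos[of \<xi>] Z_pos[of \<zeta>] by (simp add: E_def field_simps)
qed

text \<open>Jensen's inequality for the tilt at \<open>\<xi>\<close>: \<open>lam\<close> is convex
  with subgradient \<open>b \<xi>\<close>.\<close>

lemma lam_tangent: "lam \<xi> + ipn n (b \<xi>) (\<lambda>i. \<zeta> i - \<xi> i) \<le> lam \<zeta>"
proof -
  let ?X = "\<lambda>x. ipn n x (\<lambda>i. \<zeta> i - \<xi> i)" and ?m = "ipn n (b \<xi>) (\<lambda>i. \<zeta> i - \<xi> i)"
  have "exp ?m * (1 + (?m - ?m)) = E \<xi> (\<lambda>x. exp ?m * (1 + (?X x - ?m)))"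
    by (simp only: E_cmult) (simp add: E_add E_diff E_const E_ipn bdd_intros)
  also have "\<dots> \<le> E \<xi> (\<lambda>x. exp (?X x))"
  proof (intro E_mono bdd_intros)
    fix x
    have "1 + (?X x - ?m) \<le> exp (?X x - ?m)" by (rule exp_ge_add_one_self)
    then have "exp ?m * (1 + (?X x - ?m)) \<le> exp ?m * exp (?X x - ?m)" by (intro mult_left_mono) auto
    then show "exp ?m * (1 + (?X x - ?m)) \<le> exp (?X x)" by (simp add: exp_add[symmetric])
  qed
  finally have 1: "exp ?m \<le> E \<xi> (\<lambda>x. exp (?X x))" by simp
  then have "Z \<xi> * exp ?m \<le> Z \<zeta>" unfolding Z_ratio[of \<zeta> \<xi>] using Z_pos[of \<xi>] by (intro mult_left_mono) auto
  then have "ln (Z \<xi> * exp ?m) \<le> ln (Z \<zeta>)" using Z_pos by (intro ln_mono) auto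
  then show ?thesis using Z_pos[of \<xi>] by (simp add: lam_def ln_mult)
qed

text \<open>The tangent at the origin is zero: there \<open>lam\<close> vanishes, and so does the
  barycentre by centring.\<close>

lemma lam_nonneg: "0 \<le> lam \<xi>"
proof -
  have "Z (\<lambda>_. 0) = 1" by (simp add: Z_def ipn_def prob_space)
  moreover have "b (\<lambda>_. 0) i = 0" if "i < n" for i
    using centred[OF that] by (simp add: b_def E_def ipn_def)
  then have "ipn n (b (\<lambda>_. 0)) v = 0" for v by (simp add: ipn_def)
  ultimately show ?thesis using lam_tangent[of "\<lambda>_. 0" \<xi>] by (simp add: lam_def)
qed

lemma lam_le: assumes "\<xi> \<in> polar n L s" shows "lam \<xi> \<le> s"
proof -
  have "Z \<xi> \<le> (\<integral>x. exp s \<partial>\<mu>)" unfolding Z_def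
  proof (rule integral_mono_AE)
    show "AE x in \<mu>. exp (ipn n x \<xi>) \<le> exp s"
      using supp by eventually_elim (use assms in \<open>auto simp: polar_def\<close>)
  qed (auto intro!: bdd_integrable bdd_intros)
  then have "Z \<xi> \<le> exp s" by (simp add: prob_space)
  then show ?thesis unfolding lam_def using Z_pos[of \<xi>] by (metis ln_exp ln_mono exp_gt_zero)
qed

text \<open>Averaging the variational inequality of the projection \<open>p\<close> over the tilted
  measure gives \<open>|b - p|^2 <= 0\<close>.\<close>

lemma b_in_body: "(\<lambda>i\<in>{..<n}. b \<xi> i) \<in> L"
proof -
  define K where "K = (\<lambda>i j::nat. if i = j then 1 else 0::real)"
  have mvK: "mv n K x i = x i" if "i < n" for x i
  proof -
    have "mv n K x i = (\<Sum>j<n. if j = i then x i else 0)"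
      unfolding mv_nth[OF that] by (rule sum.cong) (auto simp: K_def)
    then show ?thesis using that by simp
  qed
  have ipK: "ipn n (mv n K x) (mv n K y) = ipn n x y" for x y by (rule ipn_cong) (simp_all add: mvK)
  let ?b = "\<lambda>i\<in>{..<n}. b \<xi> i"
  obtain p where p: "p \<in> L" "\<And>y. y \<in> L \<Longrightarrow> ipn n (\<lambda>i. ?b i - p i) (\<lambda>i. y i - p i) \<le> 0"
    using nearest_point[OF body, where K=K and x="?b"] unfolding ipK by blast
  let ?u = "\<lambda>i. ?b i - p i"
  have "E \<xi> (\<lambda>x. ipn n x ?u - ipn n p ?u) \<le> E \<xi> (\<lambda>x. 0)"
  proof (intro E_mono bdd_intros)
    fix y assume "y \<in> L"
    from p(2)[OF this] have "ipn n ?u y - ipn n ?u p \<le> 0" by (simp only: ipn_diff_right)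
    then show "ipn n y ?u - ipn n p ?u \<le> 0" by (simp only: ipn_commute[of n y] ipn_commute[of n p])
  qed
  then have "ipn n (b \<xi>) ?u - ipn n p ?u \<le> 0"
    by (simp add: E_diff E_const E_ipn bdd_intros)
  moreover have "ipn n (b \<xi>) ?u = ipn n ?b ?u" by (rule ipn_cong) auto
  ultimately have "ipn n ?u ?u \<le> 0" by (simp only: ipn_diff_left)
  then have "ipn n ?u ?u = 0" using ipn_self_nonneg[of n ?u] by linarith
  then have "\<forall>i<n. ?b i = p i" by (simp add: ipn_self_eq_0)
  then have "?b = p" using sym_body_Rn[OF body p(1)] by (intro Rn_eqI[of _ n]) (auto simp: Rn_def)
  then show ?thesis using p(1) by simp
qed

text \<open>T is the Jacobian matrix of the monotone map G; the term with \<epsilon> makes G strictly monotone.\<close>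

definition T :: "real \<Rightarrow> (nat \<Rightarrow> real) \<Rightarrow> nat \<Rightarrow> nat \<Rightarrow> real" where
  "T \<epsilon> \<xi> i j = (1 + lam \<xi> / s) * (E \<xi> (\<lambda>x. x i * x j) - b \<xi> i * b \<xi> j) + b \<xi> i * b \<xi> j / s
     + (if i = j then \<epsilon> else 0)"

definition G :: "real \<Rightarrow> (nat \<Rightarrow> real) \<Rightarrow> nat \<Rightarrow> real" where
  "G \<epsilon> \<xi> i = (1 + lam \<xi> / s) * b \<xi> i + \<epsilon> * \<xi> i"

section \<open>The Jacobian as a quadratic form; monotonicity and Taylor expansion of the
  map\<close>

lemma quad_E: "(\<Sum>i<n. \<Sum>j<n. E \<xi> (\<lambda>x. x i * x j) * v i * v j) = E \<xi> (\<lambda>x. (ipn n x v)\<^sup>2)"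
proof -
  have "(\<lambda>x. (ipn n x v)\<^sup>2) = (\<lambda>x. \<Sum>i<n. \<Sum>j<n. (v i * v j) * (x i * x j))"
    by (simp add: ipn_def power2_eq_square sum_product mult_ac)
  then have "E \<xi> (\<lambda>x. (ipn n x v)\<^sup>2) = (\<Sum>i<n. \<Sum>j<n. E \<xi> (\<lambda>x. (v i * v j) * (x i * x j)))"
    by (simp only:) (subst E_sum, (intro bdd_intros, auto)[1], intro sum.cong refl, subst E_sum, (intro bdd_intros, auto))
  also have "\<dots> = (\<Sum>i<n. \<Sum>j<n. E \<xi> (\<lambda>x. x i * x j) * v i * v j)"
    by (simp only: E_cmult) (simp add: mult_ac)
  finally show ?thesis by (rule sym)
qed

lemma quad_b: "(\<Sum>i<n. \<Sum>j<n. b \<xi> i * b \<xi> j * v i * v j) = (ipn n (b \<xi>) v)\<^sup>2"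
  by (simp add: ipn_def power2_eq_square sum_product mult_ac)

lemma quad_T: "(\<Sum>i<n. \<Sum>j<n. T \<epsilon> \<xi> i j * v i * v j) =
   (1 + lam \<xi> / s) * (E \<xi> (\<lambda>x. (ipn n x v)\<^sup>2) - (ipn n (b \<xi>) v)\<^sup>2) + (ipn n (b \<xi>) v)\<^sup>2 / s + \<epsilon> * ipn n v v"
proof -
  have "(\<Sum>i<n. \<Sum>j<n. T \<epsilon> \<xi> i j * v i * v j) =
    (\<Sum>i<n. \<Sum>j<n. (1 + lam \<xi> / s) * (E \<xi> (\<lambda>x. x i * x j) * v i * v j) - (1 + lam \<xi> / s) * (b \<xi> i * b \<xi> j * v i * v j)
       + b \<xi> i * b \<xi> j * v i * v j / s + (if j = i then \<epsilon> * (v i * v i) else 0))"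
    by (intro sum.cong refl) (auto simp: T_def algebra_simps)
  also have "\<dots> = (1 + lam \<xi> / s) * (\<Sum>i<n. \<Sum>j<n. E \<xi> (\<lambda>x. x i * x j) * v i * v j)
      - (1 + lam \<xi> / s) * (\<Sum>i<n. \<Sum>j<n. b \<xi> i * b \<xi> j * v i * v j)
      + (\<Sum>i<n. \<Sum>j<n. b \<xi> i * b \<xi> j * v i * v j) / s + \<epsilon> * ipn n v v"
    by (simp add: sum.distrib sum_subtractf sum_distrib_left[symmetric] sum_divide_distrib[symmetric] ipn_def)
  finally show ?thesis unfolding quad_E quad_b by (simp add: algebra_simps)
qed

lemma variance_nonneg: "(ipn n (b \<xi>) v)\<^sup>2 \<le> E \<xi> (\<lambda>x. (ipn n x v)\<^sup>2)"
proof -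
  let ?m = "ipn n (b \<xi>) v"
  have "E \<xi> (\<lambda>x. 0) \<le> E \<xi> (\<lambda>x. (ipn n x v - ?m) * (ipn n x v - ?m))"
    by (intro E_mono bdd_intros) auto
  also have "(\<lambda>x. (ipn n x v - ?m) * (ipn n x v - ?m)) = (\<lambda>x. ipn n x v * ipn n x v - 2 * ?m * ipn n x v + ?m\<^sup>2)"
    by (auto simp: algebra_simps power2_eq_square)
  also have "E \<xi> \<dots> = E \<xi> (\<lambda>x. ipn n x v * ipn n x v) - 2 * ?m * ?m + ?m\<^sup>2"
    by (simp add: E_add E_diff E_const E_cmult E_ipn bdd_intros)
  finally show ?thesis by (simp add: E_const power2_eq_square)
qed

text \<open>Each bound keeps one of the three nonnegative parts of the form: the covariance, whose
  coefficient is at least 1 since \<open>lam >= 0\<close>, the rank-one part, and the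
  \<open>\<epsilon>\<close> part. The first two bound second moments about the origin, the third
  feeds \<open>cholesky_inverse\<close>.\<close>

lemma quad_T_ge:
  assumes "\<epsilon> \<ge> 0"
  shows "E \<xi> (\<lambda>x. (ipn n x v)\<^sup>2) \<le> (\<Sum>i<n. \<Sum>j<n. T \<epsilon> \<xi> i j * v i * v j) + (ipn n (b \<xi>) v)\<^sup>2"
    "(ipn n (b \<xi>) v)\<^sup>2 / s \<le> (\<Sum>i<n. \<Sum>j<n. T \<epsilon> \<xi> i j * v i * v j)"
    "\<epsilon> * ipn n v v \<le> (\<Sum>i<n. \<Sum>j<n. T \<epsilon> \<xi> i j * v i * v j)"
proof -
  let ?V = "E \<xi> (\<lambda>x. (ipn n x v)\<^sup>2) - (ipn n (b \<xi>) v)\<^sup>2"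
  have V: "0 \<le> ?V" using variance_nonneg[of \<xi> v] by simp
  have l: "0 \<le> lam \<xi> / s" using lam_nonneg s_pos by simp
  have 1: "?V \<le> (1 + lam \<xi> / s) * ?V" using V l by (simp add: mult_le_cancel_right1)
  have 2: "0 \<le> (ipn n (b \<xi>) v)\<^sup>2 / s" "0 \<le> \<epsilon> * ipn n v v" using s_pos assms by auto
  show "E \<xi> (\<lambda>x. (ipn n x v)\<^sup>2) \<le> (\<Sum>i<n. \<Sum>j<n. T \<epsilon> \<xi> i j * v i * v j) + (ipn n (b \<xi>) v)\<^sup>2"
    "(ipn n (b \<xi>) v)\<^sup>2 / s \<le> (\<Sum>i<n. \<Sum>j<n. T \<epsilon> \<xi> i j * v i * v j)"
    "\<epsilon> * ipn n v v \<le> (\<Sum>i<n. \<Sum>j<n. T \<epsilon> \<xi> i j * v i * v j)"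
    unfolding quad_T using 1 2 V by linarith+
qed

lemma T_sym: "T \<epsilon> \<xi> i j = T \<epsilon> \<xi> j i"
  by (simp add: T_def mult.commute)

text \<open>Without \<open>\<epsilon>\<close>, \<open>G\<close> is the gradient of the convex
  function \<open>lam + lam^2 / (2 * s)\<close>. Applying the tangent inequality at both points
  leaves the square \<open>(c - a)^2 / s\<close>, the contribution of \<open>lam^2\<close>, to be
  discarded.\<close>

lemma G_monotone:
  "\<epsilon> * ipn n (\<lambda>i. \<zeta> i - \<xi> i) (\<lambda>i. \<zeta> i - \<xi> i) \<le> ipn n (\<lambda>i. G \<epsilon> \<zeta> i - G \<epsilon> \<xi> i) (\<lambda>i. \<zeta> i - \<xi> i)"
proof -
  let ?d = "\<lambda>i. \<zeta> i - \<xi> i"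
  define a c where "a = lam \<xi>" and "c = lam \<zeta>"
  define m1 m2 where "m1 = ipn n (b \<xi>) ?d" and "m2 = ipn n (b \<zeta>) ?d"
  have a: "0 \<le> a" "0 \<le> c" by (auto simp: a_def c_def lam_nonneg)
  have m: "m1 \<le> c - a" "c - a \<le> m2"
    using lam_tangent[of \<xi> \<zeta>] lam_tangent[of \<zeta> \<xi>]
    by (auto simp: a_def c_def m1_def m2_def ipn_diff_right)
  have "ipn n (\<lambda>i. G \<epsilon> \<zeta> i - G \<epsilon> \<xi> i) ?d = (1 + c / s) * m2 - (1 + a / s) * m1 + \<epsilon> * ipn n ?d ?d"
  proof -
    have "(\<lambda>i. G \<epsilon> \<zeta> i - G \<epsilon> \<xi> i) = (\<lambda>i. ((1 + c / s) * b \<zeta> i - (1 + a / s) * b \<xi> i) + \<epsilon> * (\<zeta> i - \<xi> i))"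
      by (auto simp: G_def a_def c_def algebra_simps)
    then show ?thesis unfolding m1_def m2_def
      by (simp only: ipn_add_left[of n "\<lambda>i. (1 + c / s) * b \<zeta> i - (1 + a / s) * b \<xi> i"]
          ipn_diff_left[of n "\<lambda>i. (1 + c / s) * b \<zeta> i"] ipn_scale_left)
  qed
  moreover have "(1 + a / s) * m1 \<le> (1 + c / s) * m2"
  proof -
    have "(1 + a / s) * m1 \<le> (1 + a / s) * (c - a)" using a m s_pos by (intro mult_left_mono) auto
    also have "\<dots> \<le> (1 + a / s) * (c - a) + (c - a)\<^sup>2 / s" using s_pos by simp
    also have "\<dots> = (1 + c / s) * (c - a)" using s_pos by (simp add: field_simps power2_eq_square)
    also have "\<dots> \<le> (1 + c / s) * m2" using a m s_pos by (intro mult_left_mono) auto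
    finally show ?thesis .
  qed
  ultimately show ?thesis by simp
qed

text \<open>Moments at \<open>\<xi> + w\<close> are expanded in moments at \<open>\<xi>\<close> of
  the functional \<open>X\<close>, which is at most \<open>r\<close> on \<open>L\<close>. Over the
  polar \<open>lam <= s\<close> bounds the coefficient of \<open>b\<close> by 2, so the constant is
  uniform in \<open>\<xi>\<close>. Its size is immaterial: \<open>r\<close> is proportional to
  \<open>\<eta>\<close>, and an error of order \<open>\<eta>^2\<close> becomes negligible against
  the cells of size \<open>\<eta>\<close>.\<close>

lemma G_taylor:
  assumes \<xi>: "\<xi> \<in> polar n L s" and R: "R > 0" "\<And>x i. x \<in> L \<Longrightarrow> i < n \<Longrightarrow> \<bar>x i\<bar> \<le> R"
    and w: "\<And>i. i < n \<Longrightarrow> \<bar>w i\<bar> \<le> \<eta>" and r: "r = real n * R * \<eta>" "r \<le> 1/4" and i: "i < n"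
  shows "\<bar>G \<epsilon> (\<lambda>i. \<xi> i + w i) i - G \<epsilon> \<xi> i - (\<Sum>j<n. T \<epsilon> \<xi> i j * w j)\<bar> \<le> (24 * R + 26 * R / s) * r\<^sup>2"
proof -
  define \<zeta> where "\<zeta> = (\<lambda>i. \<xi> i + w i)"
  have d: "(\<lambda>i. \<zeta> i - \<xi> i) = w" by (auto simp: \<zeta>_def)
  define X where "X = (\<lambda>x. ipn n x w)"
  have bX: "bdd X" unfolding X_def by (rule bdd_ipn)
  have X: "\<bar>X x\<bar> \<le> r" if "x \<in> L" for x
  proof -
    have "\<bar>X x\<bar> \<le> (\<Sum>i<n. \<bar>x i * w i\<bar>)" unfolding X_def ipn_def by (rule sum_abs)
    also have "\<dots> \<le> (\<Sum>i<n. R * \<eta>)"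
      unfolding abs_mult using R(1) R(2)[OF that] w by (intro sum_mono mult_mono) auto
    finally show ?thesis by (simp add: r mult_ac)
  qed
  obtain x0 where "x0 \<in> L" using sym_body_nonempty[OF body] by auto
  then have r0: "0 \<le> r" using X[of x0] abs_ge_zero[of "X x0"] by linarith
  have r1: "r \<le> 1/4" by fact
  have eX: "0 \<le> exp (X x) - 1 - X x" "exp (X x) - 1 - X x \<le> r\<^sup>2" if "x \<in> L" for x
  proof -
    show "0 \<le> exp (X x) - 1 - X x" using exp_ge_add_one_self[of "X x"] by linarith
    have "\<bar>X x\<bar> \<le> 1" using X[OF that] r1 by linarith
    then have "exp (X x) \<le> 1 + X x + (X x)\<^sup>2"
    proof -
      consider "0 \<le> X x" | "X x < 0" by linarith
      then show ?thesis
      proof cases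
        case 1 then show ?thesis using exp_bound[of "X x"] \<open>\<bar>X x\<bar> \<le> 1\<close> by auto
      next
        case 2
        define t where "t = - X x"
        have t: "0 < t" "t \<le> 1" using 2 \<open>\<bar>X x\<bar> \<le> 1\<close> by (auto simp: t_def)
        have "1 + t \<le> exp t" by (rule exp_ge_add_one_self)
        then have "exp (- t) \<le> 1 / (1 + t)" using t by (simp add: exp_minus field_simps)
        also have "\<dots> \<le> 1 - t + t\<^sup>2"
        proof -
          have "1 \<le> (1 - t + t\<^sup>2) * (1 + t)" using t by (simp add: algebra_simps power2_eq_square)
          then show ?thesis using t by (simp add: divide_le_eq)
        qed
        finally show ?thesis by (simp add: t_def)
      qed
    qed
    moreover have "(X x)\<^sup>2 \<le> r\<^sup>2" using X[OF that] by (metis abs_ge_zero power2_abs power_mono)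
    ultimately show "exp (X x) - 1 - X x \<le> r\<^sup>2" by linarith
  qed
  define u m where "u = E \<xi> (\<lambda>x. exp (X x)) - 1" and "m = E \<xi> X"
  define p c where "p = E \<xi> (\<lambda>x. x i * X x)" and "c = E \<xi> (\<lambda>x. x i * exp (X x))"
  define \<beta> where "\<beta> = b \<xi> i"
  have rr: "0 \<le> r\<^sup>2" "r\<^sup>2 \<le> r / 4" "r\<^sup>2 \<le> 1/16"
    using r0 r1 mult_right_mono[of r "1/4" r] by (auto simp: power2_eq_square)
  have m: "\<bar>m\<bar> \<le> r" unfolding m_def by (rule E_abs_le[OF bX X])
  have um: "\<bar>u - m\<bar> \<le> r\<^sup>2"
  proof -
    have "u - m = E \<xi> (\<lambda>x. exp (X x) - 1 - X x)" unfolding u_def m_def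
      by (simp add: E_diff E_const bdd_intros bX)
    also have "\<bar>\<dots>\<bar> \<le> r\<^sup>2" using eX by (intro E_abs_le bdd_intros bX) auto
    finally show ?thesis .
  qed
  have u: "\<bar>u\<bar> \<le> 2 * r" "\<bar>u\<bar> \<le> 1/2" using um m rr r1 by linarith+
  have \<beta>: "\<bar>\<beta>\<bar> \<le> R" unfolding \<beta>_def b_def using i R by (intro E_abs_le bdd_intros) auto
  have p: "\<bar>p\<bar> \<le> R * r" unfolding p_def
    using i R X r0 by (intro E_abs_le bdd_intros bX) (auto simp: abs_mult intro!: mult_mono)
  have cp: "\<bar>c - \<beta> - p\<bar> \<le> R * r\<^sup>2"
  proof -
    have "c - \<beta> - p = E \<xi> (\<lambda>x. x i * exp (X x) - x i - x i * X x)" unfolding c_def \<beta>_def b_def p_def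
      by (simp add: E_diff bdd_intros bX i)
    also have "(\<lambda>x. x i * exp (X x) - x i - x i * X x) = (\<lambda>x. x i * (exp (X x) - 1 - X x))"
      by (auto simp: algebra_simps)
    also have "\<bar>E \<xi> \<dots>\<bar> \<le> R * r\<^sup>2" using eX R i
      by (intro E_abs_le bdd_intros bX) (auto simp: abs_mult intro!: mult_mono)
    finally show ?thesis .
  qed
  define q where "q = p - \<beta> * m"
  have \<beta>m: "\<bar>\<beta> * m\<bar> \<le> R * r" unfolding abs_mult using \<beta> m R by (intro mult_mono) auto
  have q: "\<bar>q\<bar> \<le> 2 * (R * r)" unfolding q_def using p \<beta>m by linarith
  have u1: "1/2 \<le> 1 + u" using u by linarith
  define e1 where "e1 = b \<zeta> i - (\<beta> + q)"
  have b\<zeta>: "b \<zeta> i = c / (1 + u)"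
    unfolding b_def by (subst E_ratio[of \<zeta> _ \<xi>]) (simp add: d c_def u_def X_def)
  have Rr: "0 \<le> R * r\<^sup>2" using R rr by simp
  have e1: "\<bar>e1\<bar> \<le> 12 * (R * r\<^sup>2)"
  proof -
    \<comment> \<open>Clearing the denominator of the tilted mean makes all first-order terms
      cancel, leaving three terms of order \<open>R * r^2\<close>.\<close>
    have "e1 * (1 + u) = (c - \<beta> - p) + \<beta> * (m - u) - u * q"
      unfolding e1_def b\<zeta> q_def using u1 by (simp add: field_simps)
    moreover have "\<bar>\<beta> * (m - u)\<bar> \<le> R * r\<^sup>2" unfolding abs_mult using \<beta> um R
      by (intro mult_mono) (auto simp: abs_minus_commute)
    moreover have "\<bar>u * q\<bar> \<le> (2 * r) * (2 * (R * r))" unfolding abs_mult using u q r0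
      by (intro mult_mono) auto
    moreover have "(2 * r) * (2 * (R * r)) = 4 * (R * r\<^sup>2)" by (simp add: power2_eq_square)
    ultimately have "\<bar>e1 * (1 + u)\<bar> \<le> 6 * (R * r\<^sup>2)" using cp by linarith
    moreover have "\<bar>e1\<bar> * (1/2) \<le> \<bar>e1 * (1 + u)\<bar>" unfolding abs_mult using u1 by (intro mult_left_mono) auto
    ultimately show ?thesis by linarith
  qed
  define e2 where "e2 = lam \<zeta> - lam \<xi> - m"
  have e2: "\<bar>e2\<bar> \<le> 9 * r\<^sup>2"
  proof -
    have "lam \<zeta> = lam \<xi> + ln (1 + u)"
      unfolding lam_def Z_ratio[of \<zeta> \<xi>] d using Z_pos[of \<xi>] u1
      by (subst ln_mult) (auto simp: u_def X_def)
    moreover have "\<bar>ln (1 + u) - u\<bar> \<le> 2 * u\<^sup>2"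
      using abs_ln_one_plus_x_minus_x_bound[of u] u by simp
    moreover have "u\<^sup>2 \<le> 4 * r\<^sup>2" using u(1) power_mono[of "\<bar>u\<bar>" "2 * r" 2] by (simp add: power_mult_distrib)
    ultimately show ?thesis unfolding e2_def using um by linarith
  qed
  define l where "l = 1 + lam \<xi> / s"
  have l: "\<bar>l\<bar> \<le> 2" using lam_nonneg[of \<xi>] lam_le[OF \<xi>] s_pos by (auto simp: l_def abs_le_iff field_simps)
  have Tw: "(\<Sum>j<n. T \<epsilon> \<xi> i j * w j) = l * q + \<beta> * m / s + \<epsilon> * w i"
  proof -
    have "(\<Sum>j<n. T \<epsilon> \<xi> i j * w j) = (\<Sum>j<n. l * (E \<xi> (\<lambda>x. x i * x j) * w j) - l * \<beta> * (b \<xi> j * w j)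
        + \<beta> / s * (b \<xi> j * w j) + (if j = i then \<epsilon> * w i else 0))"
      by (intro sum.cong refl) (auto simp: T_def l_def \<beta>_def algebra_simps)
    also have "\<dots> = l * (\<Sum>j<n. E \<xi> (\<lambda>x. x i * x j) * w j) - l * \<beta> * ipn n (b \<xi>) w + \<beta> / s * ipn n (b \<xi>) w + \<epsilon> * w i"
      unfolding ipn_def sum.distrib sum_subtractf sum_distrib_left[symmetric] using i by simp
    also have "(\<Sum>j<n. E \<xi> (\<lambda>x. x i * x j) * w j) = p"
    proof -
      have "(\<lambda>x. x i * X x) = (\<lambda>x. \<Sum>j<n. w j * (x i * x j))"
        by (auto simp: X_def ipn_def sum_distrib_left mult_ac)
      then have "p = (\<Sum>j<n. E \<xi> (\<lambda>x. w j * (x i * x j)))" unfolding p_def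
        by (simp only:) (rule E_sum, intro bdd_intros, use i in auto)
      then show ?thesis by (simp add: E_cmult mult.commute)
    qed
    also have "ipn n (b \<xi>) w = m" unfolding m_def X_def by (simp add: E_ipn)
    finally show ?thesis by (simp add: q_def algebra_simps)
  qed
  have "G \<epsilon> \<zeta> i - G \<epsilon> \<xi> i - (\<Sum>j<n. T \<epsilon> \<xi> i j * w j) =
     (l + m / s + e2 / s) * (\<beta> + q + e1) - l * \<beta> - l * q - \<beta> * m / s"
  proof -
    have "1 + lam \<zeta> / s = l + m / s + e2 / s" by (simp add: l_def e2_def diff_divide_distrib)
    moreover have "b \<zeta> i = \<beta> + q + e1" by (simp add: e1_def)
    ultimately show ?thesis unfolding Tw G_def by (simp add: l_def \<beta>_def \<zeta>_def algebra_simps)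
  qed
  also have "\<dots> = l * e1 + (m * (q + e1)) / s + (e2 * (\<beta> + q + e1)) / s"
    by (simp add: algebra_simps add_divide_distrib)
  also have "\<bar>\<dots>\<bar> \<le> \<bar>l * e1\<bar> + \<bar>m * (q + e1)\<bar> / s + \<bar>e2 * (\<beta> + q + e1)\<bar> / s"
    using s_pos by (intro order_trans[OF abs_triangle_ineq] add_mono) (auto simp: abs_divide)
  also have "\<dots> \<le> 24 * (R * r\<^sup>2) + 5 * (R * r\<^sup>2) / s + 21 * (R * r\<^sup>2) / s"
  proof (intro add_mono divide_right_mono)
    have "\<bar>l * e1\<bar> \<le> 2 * (12 * (R * r\<^sup>2))" unfolding abs_mult using l e1 by (intro mult_mono) auto
    then show "\<bar>l * e1\<bar> \<le> 24 * (R * r\<^sup>2)" by simp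
    have Rr2: "R * r\<^sup>2 \<le> R * (r / 4)" "R * r\<^sup>2 \<le> R * (1/16)" "R * r \<le> R * (1/4)"
      using rr R r1 by (auto intro!: mult_left_mono)
    have "\<bar>q + e1\<bar> \<le> 5 * (R * r)" using q e1 Rr2 by simp
    then have "\<bar>m * (q + e1)\<bar> \<le> r * (5 * (R * r))" unfolding abs_mult using m r0 by (intro mult_mono) auto
    then show "\<bar>m * (q + e1)\<bar> \<le> 5 * (R * r\<^sup>2)" by (simp add: power2_eq_square mult_ac)
    have "\<bar>\<beta> + q + e1\<bar> \<le> 9/4 * R" using \<beta> q e1 Rr2 by linarith
    then have "\<bar>e2 * (\<beta> + q + e1)\<bar> \<le> (9 * r\<^sup>2) * (9/4 * R)" unfolding abs_mult using e2 rr by (intro mult_mono) auto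
    also have "\<dots> \<le> 21 * (R * r\<^sup>2)" using Rr by simp
    finally show "\<bar>e2 * (\<beta> + q + e1)\<bar> \<le> 21 * (R * r\<^sup>2)" .
  qed (use s_pos in auto)
  also have "\<dots> = (24 * R + 26 * R / s) * r\<^sup>2" by (simp add: field_simps)
  finally show ?thesis unfolding \<zeta>_def .
qed

lemma ipn_row: "k < n \<Longrightarrow> mv n A x k = ipn n x (A k)"
  by (simp add: mv_nth ipn_def mult.commute)

text \<open>With \<open>A^T A = T^{-1}\<close> the left side is the trace of \<open>A M A^T\<close>,
  where \<open>M\<close> is the tilted second moment matrix, that is, covariance plus
  \<open>b b^T\<close>. The covariance is dominated by \<open>T\<close> and contributes at most the
  trace of the identity; \<open>b b^T\<close> is dominated by \<open>s * T\<close> and, having rank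
  one, contributes at most \<open>s\<close>.\<close>

lemma E_normal_form:
  assumes A: "\<And>i j. i < n \<Longrightarrow> j < n \<Longrightarrow> (\<Sum>l<n. T \<epsilon> \<xi> i l * (\<Sum>k<n. A k l * A k j)) = (if i = j then 1 else 0)"
    and \<epsilon>: "\<epsilon> \<ge> 0"
  shows "E \<xi> (\<lambda>x. ipn n (mv n A x) (mv n A x)) \<le> real n + s"
proof -
  let ?T = "\<lambda>v. \<Sum>i<n. \<Sum>j<n. T \<epsilon> \<xi> i j * v i * v j"
  have "(\<lambda>x. ipn n (mv n A x) (mv n A x)) = (\<lambda>x. \<Sum>k<n. (ipn n x (A k))\<^sup>2)"
    by (simp add: ipn_def[of n "mv n A _"] ipn_row power2_eq_square)
  then have "E \<xi> (\<lambda>x. ipn n (mv n A x) (mv n A x)) = (\<Sum>k<n. E \<xi> (\<lambda>x. (ipn n x (A k))\<^sup>2))"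
    by (simp only:) (rule E_sum, simp only: power2_eq_square, intro bdd_intros)
  also have "\<dots> \<le> (\<Sum>k<n. ?T (A k) + (ipn n (b \<xi>) (A k))\<^sup>2)"
    by (intro sum_mono quad_T_ge \<epsilon>)
  also have "\<dots> = (\<Sum>k<n. ?T (A k)) + (\<Sum>k<n. (ipn n (b \<xi>) (A k))\<^sup>2)" by (rule sum.distrib)
  also have "(\<Sum>k<n. ?T (A k)) = real n"
  proof -
    have "(\<Sum>k<n. ?T (A k)) = (\<Sum>i<n. \<Sum>k<n. \<Sum>j<n. T \<epsilon> \<xi> i j * A k i * A k j)" by (rule sum.swap)
    also have "\<dots> = (\<Sum>i<n. \<Sum>j<n. \<Sum>k<n. T \<epsilon> \<xi> i j * A k i * A k j)"
      by (intro sum.cong refl sum.swap)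
    also have "\<dots> = (\<Sum>i<n. \<Sum>j<n. T \<epsilon> \<xi> i j * (\<Sum>k<n. A k j * A k i))"
      by (simp add: sum_distrib_left mult_ac)
    also have "\<dots> = (\<Sum>i<n. 1)" by (intro sum.cong refl) (simp add: A)
    finally show ?thesis by simp
  qed
  also have "(\<Sum>k<n. (ipn n (b \<xi>) (A k))\<^sup>2) \<le> s"
  proof -
    define a where "a = mv n A (b \<xi>)"
    \<comment> \<open>\<open>v = T^{-1} b\<close>, at which the rank-one bound
      \<open>(b . v)^2 / s <= T(v)\<close> reads \<open>|a|^4 / s <= |a|^2\<close>.\<close>
    define v where "v = mv n (transp A) a"
    have eq: "(\<Sum>k<n. (ipn n (b \<xi>) (A k))\<^sup>2) = ipn n a a"
      by (simp add: a_def ipn_def[of n "mv n A _"] ipn_row power2_eq_square)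
    have bv: "ipn n (b \<xi>) v = ipn n a a" unfolding v_def a_def by (rule ipn_mv[symmetric])
    have Tv: "(\<Sum>j<n. T \<epsilon> \<xi> i j * v j) = b \<xi> i" if i: "i < n" for i
    proof -
      have "(\<Sum>j<n. T \<epsilon> \<xi> i j * v j) = (\<Sum>j<n. \<Sum>k<n. \<Sum>l<n. T \<epsilon> \<xi> i j * (A k j * A k l) * b \<xi> l)"
        by (simp add: v_def a_def mv_nth sum_distrib_left mult_ac)
      also have "\<dots> = (\<Sum>j<n. \<Sum>l<n. \<Sum>k<n. T \<epsilon> \<xi> i j * (A k j * A k l) * b \<xi> l)"
        by (intro sum.cong refl sum.swap)
      also have "\<dots> = (\<Sum>l<n. \<Sum>j<n. \<Sum>k<n. T \<epsilon> \<xi> i j * (A k j * A k l) * b \<xi> l)" by (rule sum.swap)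
      also have "\<dots> = (\<Sum>l<n. (\<Sum>j<n. T \<epsilon> \<xi> i j * (\<Sum>k<n. A k j * A k l)) * b \<xi> l)"
        by (simp add: sum_distrib_left sum_distrib_right mult_ac)
      also have "\<dots> = (\<Sum>l<n. if l = i then b \<xi> i else 0)" by (intro sum.cong refl) (auto simp: A i)
      finally show ?thesis using i by simp
    qed
    have "(ipn n (b \<xi>) v)\<^sup>2 / s \<le> ?T v" by (rule quad_T_ge(2)[OF \<epsilon>])
    also have "?T v = (\<Sum>i<n. v i * (\<Sum>j<n. T \<epsilon> \<xi> i j * v j))" by (simp add: sum_distrib_left mult_ac)
    also have "\<dots> = (\<Sum>i<n. v i * b \<xi> i)" by (intro sum.cong refl) (simp add: Tv)
    also have "\<dots> = ipn n (b \<xi>) v" by (simp add: ipn_def mult.commute)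
    finally have "(ipn n a a)\<^sup>2 \<le> s * ipn n a a" using s_pos unfolding bv by (simp add: field_simps)
    then have "ipn n a a \<le> s"
      using ipn_self_nonneg[of n a] s_pos by (cases "ipn n a a = 0") (auto simp: power2_eq_square)
    then show ?thesis unfolding eq .
  qed
  finally show ?thesis by simp
qed

text \<open>The Jacobian determinant is compared with the volume ratio by discretisation: a fine separated set
  in the polar body is mapped by the strictly monotone G to disjoint small parallelepipeds inside a
  multiple of L.\<close>

theorem small_covariance_tilt:
  assumes n: "n > 0"
  obtains A \<xi> where "lower_tri n A" "\<xi> \<in> polar n L s"
    "voln n (polar n L s) \<le> 12 ^ n * voln n L * (diag_prod n A)\<^sup>2"
    "E \<xi> (\<lambda>x. ipn n (mv n A x) (mv n A x)) \<le> real n + s"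
proof -
  let ?V = "polar n L s"
  have V: "sym_body n ?V" by (rule sym_body_polar[OF body s_pos])
  obtain R where R: "R > 0" "\<And>x i. x \<in> L \<Longrightarrow> i < n \<Longrightarrow> \<bar>x i\<bar> \<le> R" using sym_body_bounded[OF body] by blast
  obtain R' where R': "R' > 0" "\<And>x i. x \<in> ?V \<Longrightarrow> i < n \<Longrightarrow> \<bar>x i\<bar> \<le> R'" using sym_body_bounded[OF V] by blast
  obtain \<rho> where \<rho>: "\<rho> > 0" "\<And>x. x \<in> Rn n \<Longrightarrow> (\<forall>i<n. \<bar>x i\<bar> \<le> \<rho>) \<Longrightarrow> x \<in> L" using body by (auto simp: sym_body_def)
  \<comment> \<open>Chosen so that \<open>\<epsilon> * \<xi>\<close> uses at most half of the cube
    of radius \<open>\<rho>\<close> inside \<open>L\<close>, for every \<open>\<xi>\<close> in the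
    polar.\<close>
  define \<epsilon> where "\<epsilon> = \<rho> / (2 * R')"
  have \<epsilon>: "\<epsilon> > 0" using \<rho> R' by (simp add: \<epsilon>_def)
  define K where "K = 24 * R + 26 * R / s"
  have K: "K > 0" using R s_pos by (simp add: K_def add_pos_pos)
  define \<tau> where "\<tau> = 4 * R\<^sup>2 + R\<^sup>2 / s + \<epsilon>"
  have \<tau>: "\<tau> > 0" using R s_pos \<epsilon> by (simp add: \<tau>_def add_nonneg_pos)
  \<comment> \<open>In this order the bounds ensure \<open>r <= 1/4\<close> for
    \<open>G_taylor\<close>, keep the increments \<open>T w\<close> within the other half of the
    cube, and make the Taylor error, of order \<open>\<eta>^2\<close>, smaller than the monotonicity
    gap \<open>\<epsilon> * \<eta>\<close>.\<close>
  define \<eta> where "\<eta> = min (1 / (4 * real n * R)) (min (\<rho> / (2 * real n * \<tau>)) (\<epsilon> / (4 * real n * K * (real n * R)\<^sup>2)))"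
  have n1: "real n \<ge> 1" using n by simp
  have \<eta>: "\<eta> > 0" using n R \<rho> \<tau> \<epsilon> K by (simp add: \<eta>_def)
  define r where "r = real n * R * \<eta>"
  have r: "r \<le> 1/4"
  proof -
    have "\<eta> \<le> 1 / (4 * real n * R)" by (simp add: \<eta>_def)
    then have "real n * R * \<eta> \<le> real n * R * (1 / (4 * real n * R))" using R n by (intro mult_left_mono) auto
    also have "\<dots> = 1/4" using R n by simp
    finally show ?thesis by (simp add: r_def)
  qed
  have r2: "2 * real n * K * r\<^sup>2 < \<epsilon> * \<eta>"
  proof -
    have pos: "4 * real n * K * (real n * R)\<^sup>2 > 0" using n K R by simp
    have "\<eta> \<le> \<epsilon> / (4 * real n * K * (real n * R)\<^sup>2)" by (simp add: \<eta>_def)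
    then have "\<eta> * (4 * real n * K * (real n * R)\<^sup>2) \<le> \<epsilon>" using pos by (simp add: le_divide_eq)
    then have "\<eta> * (\<eta> * (4 * real n * K * (real n * R)\<^sup>2)) \<le> \<eta> * \<epsilon>" using \<eta> by (intro mult_left_mono) auto
    moreover have "\<eta> * (\<eta> * (4 * real n * K * (real n * R)\<^sup>2)) = 2 * (2 * real n * K * r\<^sup>2)"
      by (simp add: r_def power2_eq_square mult_ac)
    moreover have "0 < \<eta> * \<epsilon>" using \<eta> \<epsilon> by simp
    ultimately have "2 * real n * K * r\<^sup>2 < \<eta> * \<epsilon>" by linarith
    then show ?thesis by (simp add: mult.commute)
  qed
  have \<tau>\<eta>: "real n * \<tau> * \<eta> \<le> \<rho> / 2"
  proof -
    have "\<eta> \<le> \<rho> / (2 * real n * \<tau>)" by (simp add: \<eta>_def)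
    then have "real n * \<tau> * \<eta> \<le> real n * \<tau> * (\<rho> / (2 * real n * \<tau>))" using \<tau> n by (intro mult_left_mono) auto
    also have "\<dots> = \<rho> / 2" using \<tau> n by simp
    finally show ?thesis .
  qed
  have ex: "\<exists>A. lower_tri n A \<and>
     (\<forall>i<n. \<forall>j<n. (\<Sum>l<n. T \<epsilon> \<xi> i l * (\<Sum>k<n. A k l * A k j)) = (if i = j then 1 else 0))" for \<xi>
    using \<epsilon> by (intro cholesky_inverse[of n "T \<epsilon> \<xi>" \<epsilon>] T_sym quad_T_ge) auto
  from choice[OF allI[OF ex]] obtain A where A0: "\<forall>\<xi>. lower_tri n (A \<xi>) \<and>
     (\<forall>i<n. \<forall>j<n. (\<Sum>l<n. T \<epsilon> \<xi> i l * (\<Sum>k<n. A \<xi> k l * A \<xi> k j)) = (if i = j then 1 else 0))"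
    by (rule exE)
  have A: "lower_tri n (A \<xi>)" for \<xi> using A0 by simp
  have A2: "(\<Sum>l<n. T \<epsilon> \<xi> i l * (\<Sum>k<n. A \<xi> k l * A \<xi> k j)) = (if i = j then 1 else 0)"
    if "i < n" "j < n" for \<xi> i j using A0 that by simp
  define d where "d = (\<lambda>\<xi>. diag_prod n (A \<xi>))"
  have d: "0 < d \<xi>" for \<xi> using vol_scalingD(1)[OF vol_scaling_lower_tri[OF A]] by (simp add: d_def)
  \<comment> \<open>\<open>\<psi> \<xi> y = T^{-1} (y - G \<xi>)\<close>: the increment by which the
    linearisation of \<open>G\<close> at \<open>\<xi>\<close> reaches \<open>y\<close>.\<close>
  define \<psi> where "\<psi> = (\<lambda>\<xi> y. mv n (transp (A \<xi>)) (mv n (A \<xi>) (vadd n y (\<lambda>i. - G \<epsilon> \<xi> i))))"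
  have vs: "vol_scaling n (\<psi> \<xi>) (d \<xi> * (d \<xi> * 1))" for \<xi>
    unfolding \<psi>_def d_def
    by (intro vol_scaling_comp[OF vol_scaling_upper_tri[OF A] vol_scaling_comp[OF vol_scaling_lower_tri[OF A] vol_scaling_trans]])
  define Q where "Q = (\<lambda>a. {x \<in> Rn n. \<forall>i<n. \<bar>x i\<bar> \<le> a})"
  have Q: "Q a \<in> sets (lebn n)" for a unfolding Q_def
    by (intro borel_imp_sets_lebn borel_compact compact_cube) auto
  \<comment> \<open>The image of the sup-norm cube of radius \<open>\<eta>\<close> under the
    linearisation of \<open>G\<close> at \<open>\<xi>\<close>; its volume is
    \<open>(2 * \<eta>) ^ n\<close> times \<open>det T = 1 / (d \<xi>)^2\<close>.\<close>
  define Y where "Y = (\<lambda>\<xi>. {y \<in> Rn n. \<psi> \<xi> y \<in> Q \<eta>})"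
  have Ym: "Y \<xi> \<in> sets (lebn n)" for \<xi>
    using measurable_sets[OF vol_scalingD(2)[OF vs[of \<xi>]] Q[of \<eta>]] by (simp add: Y_def vimage_def Int_def conj_commute)
  have Ye: "emeasure (lebn n) (Y \<xi>) = ennreal ((2 * \<eta>) ^ n / (d \<xi>)\<^sup>2)" for \<xi>
    unfolding Y_def vol_scaling_emeasure[OF vs Q] using \<eta> d[of \<xi>]
    unfolding Q_def by (subst emeasure_cube) (auto simp: ennreal_mult''[symmetric] power2_eq_square)
  have rep: "y i = G \<epsilon> \<xi> i + (\<Sum>j<n. T \<epsilon> \<xi> i j * \<psi> \<xi> y j)" if i: "i < n" for y \<xi> i
  proof -
    have "(\<Sum>j<n. T \<epsilon> \<xi> i j * \<psi> \<xi> y j) =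
       (\<Sum>j<n. \<Sum>k<n. \<Sum>l<n. T \<epsilon> \<xi> i j * (A \<xi> k j * A \<xi> k l) * (y l - G \<epsilon> \<xi> l))"
      by (simp add: \<psi>_def mv_nth sum_distrib_left mult_ac)
    also have "\<dots> = (\<Sum>j<n. \<Sum>l<n. \<Sum>k<n. T \<epsilon> \<xi> i j * (A \<xi> k j * A \<xi> k l) * (y l - G \<epsilon> \<xi> l))"
      by (intro sum.cong refl sum.swap)
    also have "\<dots> = (\<Sum>l<n. \<Sum>j<n. \<Sum>k<n. T \<epsilon> \<xi> i j * (A \<xi> k j * A \<xi> k l) * (y l - G \<epsilon> \<xi> l))" by (rule sum.swap)
    also have "\<dots> = (\<Sum>l<n. (\<Sum>j<n. T \<epsilon> \<xi> i j * (\<Sum>k<n. A \<xi> k j * A \<xi> k l)) * (y l - G \<epsilon> \<xi> l))"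
      by (simp add: sum_distrib_left sum_distrib_right mult_ac)
    also have "\<dots> = (\<Sum>l<n. if l = i then y i - G \<epsilon> \<xi> i else 0)" by (intro sum.cong refl) (auto simp: A2 i)
    finally show ?thesis using i by simp
  qed
  have wb: "\<bar>\<psi> \<xi> y i\<bar> \<le> \<eta>" if "y \<in> Y \<xi>" "i < n" for \<xi> y i using that by (auto simp: Y_def Q_def)
  \<comment> \<open>\<open>y\<close> is the sum of \<open>(1 + lam \<xi> / s) * b \<xi>\<close>,
    which lies in \<open>2 L\<close> because \<open>lam <= s\<close> on the polar, and of a small
    vector \<open>z\<close> in \<open>L\<close>; hence \<open>y\<close> lies in
    \<open>3 L\<close>.\<close>
  have in3: "vscale n (1/3) y \<in> L" if y: "y \<in> Y \<xi>" and \<xi>: "\<xi> \<in> ?V" for \<xi> y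
  proof -
    define z where "z = (\<lambda>i\<in>{..<n}. \<epsilon> * \<xi> i + (\<Sum>j<n. T \<epsilon> \<xi> i j * \<psi> \<xi> y j))"
    have l: "0 \<le> lam \<xi> / s" "lam \<xi> / s \<le> 1" using lam_nonneg[of \<xi>] lam_le[OF \<xi>] s_pos by auto
    have bb: "\<bar>b \<xi> i\<bar> \<le> R" if "i < n" for i
      unfolding b_def using that R by (intro E_abs_le bdd_intros) auto
    have T\<tau>: "\<bar>T \<epsilon> \<xi> i j\<bar> \<le> \<tau>" if ij: "i < n" "j < n" for i j
    proof -
      have 1: "\<bar>E \<xi> (\<lambda>x. x i * x j)\<bar> \<le> R\<^sup>2" unfolding power2_eq_square using ij R
        by (intro E_abs_le bdd_intros) (auto simp: abs_mult intro!: mult_mono)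
      have 2: "\<bar>b \<xi> i * b \<xi> j\<bar> \<le> R\<^sup>2" unfolding power2_eq_square abs_mult using bb ij R by (intro mult_mono) auto
      have 3: "\<bar>(1 + lam \<xi> / s) * (E \<xi> (\<lambda>x. x i * x j) - b \<xi> i * b \<xi> j)\<bar> \<le> 2 * (2 * R\<^sup>2)"
        unfolding abs_mult using l 1 2 by (intro mult_mono) auto
      have 4: "\<bar>b \<xi> i * b \<xi> j / s\<bar> \<le> R\<^sup>2 / s" unfolding abs_divide using 2 s_pos by (simp add: divide_right_mono)
      have 5: "\<bar>if i = j then \<epsilon> else 0\<bar> \<le> \<epsilon>" using \<epsilon> by auto
      show ?thesis unfolding T_def \<tau>_def using 3 4 5 by linarith
    qed
    have "\<bar>z i\<bar> \<le> \<rho>" if i: "i < n" for i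
    proof -
      have "\<bar>\<Sum>j<n. T \<epsilon> \<xi> i j * \<psi> \<xi> y j\<bar> \<le> (\<Sum>j<n. \<tau> * \<eta>)"
        using T\<tau> i wb[OF y] \<tau> by (intro order_trans[OF sum_abs] sum_mono) (auto simp: abs_mult intro!: mult_mono)
      also have "\<dots> \<le> \<rho> / 2" using \<tau>\<eta> by (simp add: mult_ac)
      finally have 1: "\<bar>\<Sum>j<n. T \<epsilon> \<xi> i j * \<psi> \<xi> y j\<bar> \<le> \<rho> / 2" .
      have "\<bar>\<epsilon> * \<xi> i\<bar> \<le> \<epsilon> * R'" unfolding abs_mult using \<epsilon> R'(2)[OF \<xi> i] by (intro mult_mono) auto
      also have "\<dots> = \<rho> / 2" using R' by (simp add: \<epsilon>_def)
      finally show ?thesis using 1 i unfolding z_def by simp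
    qed
    then have zL: "z \<in> L" by (intro \<rho>(2)) (auto simp: z_def Rn_def)
    have "(\<lambda>i\<in>{..<n}. (1 + lam \<xi> / s) / 3 * (\<lambda>i\<in>{..<n}. b \<xi> i) i + 1/3 * z i) \<in> L"
    proof (rule sym_body_comb[OF body b_in_body zL])
      have "\<bar>(1 + q) / 3\<bar> + \<bar>1/3\<bar> \<le> 1" if "0 \<le> q" "q \<le> 1" for q :: real
        using that by (simp add: field_simps)
      from this[OF l] show "\<bar>(1 + lam \<xi> / s) / 3\<bar> + \<bar>1/3\<bar> \<le> 1" .
    qed
    also have "(\<lambda>i\<in>{..<n}. (1 + lam \<xi> / s) / 3 * (\<lambda>i\<in>{..<n}. b \<xi> i) i + 1/3 * z i) = vscale n (1/3) y"
    proof (rule Rn_eqI[of _ n])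
      fix i assume i: "i < n"
      show "(\<lambda>i\<in>{..<n}. (1 + lam \<xi> / s) / 3 * (\<lambda>i\<in>{..<n}. b \<xi> i) i + 1/3 * z i) i = vscale n (1/3) y i"
        using i unfolding vscale_nth[OF i] rep[OF i, of y \<xi>] by (simp add: z_def G_def add_divide_distrib distrib_right)
    next
      show "(\<lambda>i\<in>{..<n}. (1 + lam \<xi> / s) / 3 * (\<lambda>i\<in>{..<n}. b \<xi> i) i + 1/3 * z i) \<in> Rn n" by (simp add: Rn_def)
    qed simp
    finally show ?thesis .
  qed
  have V_Rn: "?V \<subseteq> Rn n" and \<eta>4: "4 * \<eta> > 0" using \<eta> by (auto simp: polar_def)
  have "\<exists>P. finite P \<and> P \<subseteq> ?V \<and> (\<forall>p\<in>P. \<forall>q\<in>P. p \<noteq> q \<longrightarrow> (\<exists>i<n. 4 * \<eta> \<le> \<bar>p i - q i\<bar>)) \<and>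
      (\<forall>x\<in>?V. \<exists>p\<in>P. \<forall>i<n. \<bar>x i - p i\<bar> < 4 * \<eta>)"
    by (rule cube_packing[of ?V n R' "4 * \<eta>", OF V_Rn _ \<eta>4]) (erule (1) R'(2))
  then obtain P where P: "finite P" "P \<subseteq> ?V" "\<forall>p\<in>P. \<forall>q\<in>P. p \<noteq> q \<longrightarrow> (\<exists>i<n. 4 * \<eta> \<le> \<bar>p i - q i\<bar>)"
    "\<forall>x\<in>?V. \<exists>p\<in>P. \<forall>i<n. \<bar>x i - p i\<bar> < 4 * \<eta>" by (elim exE conjE)
  have taylor: "\<bar>G \<epsilon> (\<lambda>i. \<xi> i + \<psi> \<xi> y i) i - y i\<bar> \<le> K * r\<^sup>2"
    if \<xi>: "\<xi> \<in> ?V" and y: "y \<in> Y \<xi>" and i: "i < n" for \<xi> y i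
  proof -
    have "\<bar>G \<epsilon> (\<lambda>i. \<xi> i + \<psi> \<xi> y i) i - G \<epsilon> \<xi> i - (\<Sum>j<n. T \<epsilon> \<xi> i j * \<psi> \<xi> y j)\<bar> \<le> K * r\<^sup>2"
      unfolding K_def
    proof (rule G_taylor[OF \<xi> R(1), where \<eta> = \<eta>])
      show "\<bar>x i\<bar> \<le> R" if "x \<in> L" "i < n" for x i using R(2) that by blast
      show "\<bar>\<psi> \<xi> y i\<bar> \<le> \<eta>" if "i < n" for i using wb[OF y that] .
    qed (rule r_def, rule r, rule i)
    then show ?thesis unfolding rep[OF i, of y \<xi>] by (simp add: algebra_simps)
  qed
  \<comment> \<open>If two cells shared \<open>y\<close>, then \<open>G\<close> would be within
    \<open>K * r^2\<close> of \<open>y\<close> at two perturbed points. These are still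
    \<open>2 * \<eta>\<close> apart, as the centres are \<open>4 * \<eta>\<close> apart and each
    moved by at most \<open>\<eta>\<close>; strict monotonicity then contradicts
    \<open>r2\<close>.\<close>
  have disj: "Y \<xi> \<inter> Y \<zeta> = {}" if \<xi>\<zeta>: "\<xi> \<in> P" "\<zeta> \<in> P" "\<xi> \<noteq> \<zeta>" for \<xi> \<zeta>
  proof (rule ccontr)
    assume "Y \<xi> \<inter> Y \<zeta> \<noteq> {}"
    then obtain y where y: "y \<in> Y \<xi>" "y \<in> Y \<zeta>" by auto
    define m m' where "m = (\<lambda>i. \<xi> i + \<psi> \<xi> y i)" and "m' = (\<lambda>i. \<zeta> i + \<psi> \<zeta> y i)"
    have Gm: "\<bar>G \<epsilon> m i - y i\<bar> \<le> K * r\<^sup>2" "\<bar>G \<epsilon> m' i - y i\<bar> \<le> K * r\<^sup>2" if "i < n" for i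
      unfolding m_def m'_def using taylor[OF _ y(1) that] taylor[OF _ y(2) that] \<xi>\<zeta> P(2) by auto
    let ?d = "\<lambda>i. m' i - m i" and ?e = "\<lambda>i. G \<epsilon> m' i - G \<epsilon> m i"
    define N where "N = sqrt (ipn n ?d ?d)"
    have N2: "ipn n ?d ?d = N\<^sup>2" by (simp add: N_def)
    obtain i where i: "i < n" "4 * \<eta> \<le> \<bar>\<xi> i - \<zeta> i\<bar>" using P(3) \<xi>\<zeta> by auto
    have "2 * \<eta> \<le> \<bar>?d i\<bar>" using i wb[OF y(1) i(1)] wb[OF y(2) i(1)] unfolding m_def m'_def by linarith
    also have "\<bar>?d i\<bar> \<le> N" by (rule coord_le_ipn[of n ?d N i]) (use i(1) in \<open>simp_all add: N_def\<close>)
    finally have N: "2 * \<eta> \<le> N" .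
    have "\<bar>?e i\<bar> \<le> 2 * (K * r\<^sup>2)" if "i < n" for i using Gm[OF that] by linarith
    then have "ipn n ?e ?e \<le> real n * (2 * (K * r\<^sup>2))\<^sup>2" by (rule ipn_le_coord[of n ?e])
    also have "\<dots> \<le> (real n)\<^sup>2 * (2 * (K * r\<^sup>2))\<^sup>2"
      using n1 by (intro mult_right_mono zero_le_power2) (simp add: power2_eq_square)
    finally have "ipn n ?e ?e \<le> (real n * (2 * (K * r\<^sup>2)))\<^sup>2" by (simp add: power_mult_distrib)
    then have "\<bar>ipn n ?e ?d\<bar> \<le> (real n * (2 * (K * r\<^sup>2))) * N"
      using K N \<eta> by (intro abs_ipn_le) (auto simp: N2)
    then have "\<epsilon> * N\<^sup>2 \<le> (2 * real n * K * r\<^sup>2) * N"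
      using G_monotone[of \<epsilon> m' m] by (simp add: N2 mult_ac)
    then have "N * (\<epsilon> * N) \<le> N * (2 * real n * K * r\<^sup>2)" by (simp add: power2_eq_square mult_ac)
    then have "\<epsilon> * N \<le> 2 * real n * K * r\<^sup>2" using N \<eta> by (subst (asm) mult_le_cancel_left_pos) auto
    moreover have "\<epsilon> * \<eta> \<le> \<epsilon> * N" using \<epsilon> N \<eta> by (intro mult_left_mono) auto
    ultimately show False using r2 by linarith
  qed
  define l v where "l = voln n L" and "v = voln n ?V"
  have lv: "l > 0" "v > 0" using sym_body_emeasure[OF body] sym_body_emeasure[OF V] by (auto simp: l_def v_def)
  have sumY: "(\<Sum>\<xi>\<in>P. (2 * \<eta>) ^ n / (d \<xi>)\<^sup>2) \<le> 3 ^ n * l"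
  proof -
    have "ennreal (\<Sum>\<xi>\<in>P. (2 * \<eta>) ^ n / (d \<xi>)\<^sup>2) = (\<Sum>\<xi>\<in>P. emeasure (lebn n) (Y \<xi>))"
      unfolding Ye using \<eta> by (subst sum_ennreal) auto
    also have "\<dots> = emeasure (lebn n) (\<Union>\<xi>\<in>P. Y \<xi>)"
      using disj by (intro sum_emeasure P(1)) (auto simp: disjoint_family_on_def Ym)
    also have "\<dots> \<le> emeasure (lebn n) {y \<in> Rn n. vscale n (1/3) y \<in> L}"
    proof (rule emeasure_mono)
      show "(\<Union>\<xi>\<in>P. Y \<xi>) \<subseteq> {y \<in> Rn n. vscale n (1/3) y \<in> L}"
        using in3 P(2) by (auto simp: Y_def)
      show "{y \<in> Rn n. vscale n (1/3) y \<in> L} \<in> sets (lebn n)"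
        using measurable_sets[OF vol_scalingD(2)[OF vol_scaling_vscale[of "1/3" n]] sym_body_sets[OF body]]
        by (simp add: vimage_def Int_def conj_commute)
    qed
    also have "\<dots> = ennreal (3 ^ n * l)"
      using vol_scaling_emeasure[OF vol_scaling_vscale[of "1/3" n] sym_body_sets[OF body]] lv
      by (simp add: sym_body_emeasure[OF body] power_one_over l_def[symmetric]) (simp add: ennreal_mult)
    finally show ?thesis using lv by (subst (asm) ennreal_le_iff) auto
  qed
  have cardP: "v \<le> real (card P) * (8 * \<eta>) ^ n"
  proof -
    define C where "C = (\<lambda>p. {x \<in> Rn n. vadd n x (\<lambda>i. - p i) \<in> Q (4 * \<eta>)})"
    have Cm: "C p \<in> sets (lebn n)" for p
      using measurable_sets[OF measurable_vadd Q[of "4 * \<eta>"]] by (simp add: C_def vimage_def Int_def conj_commute)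
    have Ce: "emeasure (lebn n) (C p) = ennreal ((8 * \<eta>) ^ n)" for p
      unfolding C_def emeasure_lebn_trans[OF Q] unfolding Q_def using \<eta> by (subst emeasure_cube) auto
    have "?V \<subseteq> (\<Union>p\<in>P. C p)"
    proof
      fix x assume x: "x \<in> ?V"
      then obtain p where "p \<in> P" "\<forall>i<n. \<bar>x i - p i\<bar> < 4 * \<eta>" using P(4) by blast
      then show "x \<in> (\<Union>p\<in>P. C p)" using sym_body_Rn[OF V x] by (auto simp: C_def Q_def intro!: bexI[of _ p] less_imp_le)
    qed
    then have "emeasure (lebn n) ?V \<le> emeasure (lebn n) (\<Union>p\<in>P. C p)"
      using Cm P(1) by (intro emeasure_mono) auto
    also have "\<dots> \<le> (\<Sum>p\<in>P. emeasure (lebn n) (C p))" using Cm P(1) by (intro emeasure_subadditive_finite) auto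
    also have "\<dots> = ennreal (real (card P) * (8 * \<eta>) ^ n)"
      unfolding Ce using \<eta> by (subst sum_ennreal) auto
    finally have "ennreal v \<le> ennreal (real (card P) * (8 * \<eta>) ^ n)" by (simp add: sym_body_emeasure[OF V] v_def)
    then show ?thesis using \<eta> by (subst (asm) ennreal_le_iff) auto
  qed
  \<comment> \<open>If all cells were too large, their total volume would contradict
    \<open>sumY\<close>, since the cubes of side \<open>8 * \<eta>\<close> about \<open>P\<close>
    cover the polar. The constant is \<open>12 = 3 * (8 / 2)\<close>.\<close>
  have "\<exists>\<xi>\<in>P. v \<le> 12 ^ n * l * (d \<xi>)\<^sup>2"
  proof (rule ccontr)
    assume "\<not> ?thesis"
    then have less: "12 ^ n * l * (d \<xi>)\<^sup>2 < v" if "\<xi> \<in> P" for \<xi> using that by (auto simp: not_le)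
    have "P \<noteq> {}" using cardP lv \<eta> by auto
    have "(\<Sum>\<xi>\<in>P. (2 * \<eta>) ^ n * (12 ^ n * l / v)) < (\<Sum>\<xi>\<in>P. (2 * \<eta>) ^ n / (d \<xi>)\<^sup>2)"
    proof (rule sum_strict_mono[OF P(1) \<open>P \<noteq> {}\<close>])
      fix \<xi> assume "\<xi> \<in> P"
      have "12 ^ n * l / v < 1 / (d \<xi>)\<^sup>2" using less[OF \<open>\<xi> \<in> P\<close>] lv d[of \<xi>] by (simp add: field_simps)
      then have "(2 * \<eta>) ^ n * (12 ^ n * l / v) < (2 * \<eta>) ^ n * (1 / (d \<xi>)\<^sup>2)"
        using \<eta> by (intro mult_strict_left_mono) auto
      then show "(2 * \<eta>) ^ n * (12 ^ n * l / v) < (2 * \<eta>) ^ n / (d \<xi>)\<^sup>2" by simp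
    qed
    also have "\<dots> \<le> 3 ^ n * l" by (rule sumY)
    finally have "real (card P) * ((2 * \<eta>) ^ n * (12 ^ n * l / v)) < 3 ^ n * l" by simp
    moreover have "3 ^ n * l \<le> real (card P) * ((2 * \<eta>) ^ n * (12 ^ n * l / v))"
    proof -
      have e: "(8 * \<eta>) ^ n * 3 ^ n = (2 * \<eta>) ^ n * 12 ^ n"
        unfolding power_mult_distrib[symmetric] by simp
      have "3 ^ n * l * v \<le> 3 ^ n * l * (real (card P) * (8 * \<eta>) ^ n)" using cardP lv by (intro mult_left_mono) auto
      also have "\<dots> = real (card P) * ((8 * \<eta>) ^ n * 3 ^ n) * l" by (simp add: mult_ac)
      also have "\<dots> = real (card P) * ((2 * \<eta>) ^ n * 12 ^ n) * l" by (simp only: e)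
      finally show ?thesis using lv by (simp add: pos_le_divide_eq mult_ac)
    qed
    ultimately show False by simp
  qed
  then obtain \<xi> where \<xi>: "\<xi> \<in> P" "v \<le> 12 ^ n * l * (d \<xi>)\<^sup>2" by blast
  show thesis
  proof (rule that[of "A \<xi>" \<xi>])
    show "E \<xi> (\<lambda>x. ipn n (mv n (A \<xi>) x) (mv n (A \<xi>) x)) \<le> real n + s"
      using \<epsilon> by (intro E_normal_form[of \<epsilon>] A2) auto
  qed (use \<xi> P(2) A in \<open>auto simp: l_def v_def d_def\<close>)
qed

text \<open>Markov's inequality for the tilted measure, followed by removal of the tilt: its density
  \<open>exp (ipn n x \<xi>) / Z \<xi>\<close> is at most \<open>exp s\<close> on \<open>L\<close>,
  because \<open>\<xi>\<close> lies in the polar and \<open>Z \<xi> >= 1\<close> by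
  \<open>lam_nonneg\<close>.\<close>

corollary mass_in_ellipsoid:
  assumes n: "n > 0" and \<kappa>: "\<kappa> > 1"
  obtains A where "lower_tri n A" "voln n (polar n L s) \<le> 12 ^ n * voln n L * (diag_prod n A)\<^sup>2"
    "(1 - 1 / \<kappa>) * exp (- s) \<le> measure \<mu> {x \<in> L. ipn n (mv n A x) (mv n A x) \<le> \<kappa> * (real n + s)}"
proof -
  obtain A \<xi> where A: "lower_tri n A" "\<xi> \<in> polar n L s"
    "voln n (polar n L s) \<le> 12 ^ n * voln n L * (diag_prod n A)\<^sup>2"
    "E \<xi> (\<lambda>x. ipn n (mv n A x) (mv n A x)) \<le> real n + s"
    using small_covariance_tilt[OF n] by blast
  define q where "q = (\<lambda>x. ipn n (mv n A x) (mv n A x))"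
  have bq: "bdd q" unfolding q_def ipn_mv_unfold by (intro bdd_intros) auto
  define c where "c = \<kappa> * (real n + s)"
  have c: "c > 0" using \<kappa> s_pos by (simp add: c_def)
  define S where "S = {x \<in> L. q x \<le> c}"
  have Sm: "S \<in> sets (lebn n)"
  proof -
    have [measurable]: "q \<in> borel_measurable (lebn n)" "L \<in> sets (lebn n)"
      using bq sym_body_sets[OF body] by (auto simp: bdd_def)
    have "S = L \<inter> {x \<in> space (lebn n). q x \<le> c}" using sym_body_Rn[OF body] by (auto simp: S_def)
    also have "\<dots> \<in> sets (lebn n)" by measurable
    finally show ?thesis .
  qed
  have bS: "bdd (indicator S :: _ \<Rightarrow> real)" unfolding bdd_def using Sm
    by (auto intro!: exI[of _ 1] simp: indicator_def)
  have q0: "0 \<le> q x" for x by (simp add: q_def)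
  have "1 - E \<xi> q / c = E \<xi> (\<lambda>x. 1 - 1/c * q x)"
    by (simp only: E_diff[OF bdd_const bdd_mult[OF bdd_const bq]] E_const E_cmult) simp
  also have "\<dots> \<le> E \<xi> (indicator S)"
  proof (intro E_mono bdd_intros bq bS)
    fix x assume "x \<in> L"
    then show "1 - 1/c * q x \<le> indicator S x" using c q0[of x] by (auto simp: S_def indicator_def field_simps)
  qed
  finally have 1: "1 - E \<xi> q / c \<le> E \<xi> (indicator S)" .
  have "E \<xi> q / c \<le> (real n + s) / c" using A(4) c unfolding q_def by (intro divide_right_mono) auto
  also have "\<dots> = 1 / \<kappa>" using s_pos \<kappa> by (simp add: c_def field_simps add_nonneg_eq_0_iff)
  finally have 2: "1 - 1 / \<kappa> \<le> E \<xi> (indicator S)" using 1 by linarith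
  have Z1: "1 \<le> Z \<xi>" using lam_nonneg[of \<xi>] Z_pos[of \<xi>] by (simp add: lam_def)
  have "E \<xi> (indicator S) * Z \<xi> = (\<integral>x. indicator S x * exp (ipn n x \<xi>) \<partial>\<mu>)"
    using Z_pos[of \<xi>] by (simp add: E_def)
  also have "\<dots> \<le> (\<integral>x. exp s * indicator S x \<partial>\<mu>)"
  proof (rule integral_mono_AE)
    show "AE x in \<mu>. indicator S x * exp (ipn n x \<xi>) \<le> exp s * indicator S x"
      using supp by eventually_elim (use A(2) in \<open>auto simp: polar_def indicator_def\<close>)
  qed (intro bdd_integrable bdd_intros bS)+
  also have "\<dots> = exp s * measure \<mu> S" using Sm sets_\<mu> by (simp add: Int_absorb2 sets.sets_into_space)
  finally have "E \<xi> (indicator S) * Z \<xi> \<le> exp s * measure \<mu> S" .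
  moreover have "1 - 1 / \<kappa> \<le> E \<xi> (indicator S) * Z \<xi>"
  proof -
    have "0 \<le> E \<xi> (indicator S)" using 2 \<kappa> by (smt (verit) divide_less_eq_1_pos)
    then have "E \<xi> (indicator S) * 1 \<le> E \<xi> (indicator S) * Z \<xi>" using Z1 by (intro mult_left_mono) auto
    then show ?thesis using 2 by linarith
  qed
  ultimately have "(1 - 1 / \<kappa>) * exp (- s) \<le> (exp s * measure \<mu> S) * exp (- s)" by (intro mult_right_mono) auto
  also have "\<dots> = measure \<mu> S" by (simp add: exp_minus)
  finally show thesis using that[OF A(1,3)] by (simp add: S_def q_def c_def)
qed

end

section \<open>M-ellipsoids\<close>

text \<open>The reflection has negative diagonal and so falls outside \<open>lower_tri\<close>; it
  is reversed one coordinate at a time.\<close>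

lemma vol_scaling_vneg: "vol_scaling n (vneg n) 1"
proof (induction n)
  case 0
  have "\<And>x. x \<in> Rn 0 \<Longrightarrow> vneg 0 x = x" by (auto simp: Rn_def vneg_def)
  then show ?case by (intro vol_scaling_cong[OF vol_scaling_id])
next
  case (Suc n)
  have m: "vneg k \<in> lebn k \<rightarrow>\<^sub>M lebn k" for k by (rule measurable_to_lebn) auto
  note [measurable] = m
  have eq: "vneg (Suc n) (x(n := y)) = (vneg n x)(n := - y)" if "x \<in> Rn n" for x y
    using that by (intro Rn_eqI[of _ "Suc n"]) (auto simp: upd_Rn less_Suc_eq)
  show ?case unfolding vol_scaling_def
  proof (intro conjI ballI)
    fix f :: "(nat \<Rightarrow> real) \<Rightarrow> ennreal" assume f[measurable]: "f \<in> borel_measurable (lebn (Suc n))"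
    have "(\<integral>\<^sup>+x. f (vneg (Suc n) x) \<partial>lebn (Suc n)) = (\<integral>\<^sup>+x. (\<integral>\<^sup>+y. f ((vneg n x)(n := - y)) \<partial>lborel) \<partial>lebn n)"
      by (subst lebn_nn_Suc) (measurable, auto intro!: nn_integral_cong simp: eq)
    also have "\<dots> = (\<integral>\<^sup>+x. (\<integral>\<^sup>+y. f ((vneg n x)(n := y)) \<partial>lborel) \<partial>lebn n)"
    proof (rule nn_integral_cong)
      fix x assume "x \<in> space (lebn n)"
      have "(\<lambda>y. f ((vneg n x)(n := y))) \<in> borel_measurable borel" by simp
      from nn_integral_real_affine[OF this, of "-1" 0]
      show "(\<integral>\<^sup>+y. f ((vneg n x)(n := - y)) \<partial>lborel) = (\<integral>\<^sup>+y. f ((vneg n x)(n := y)) \<partial>lborel)" by simp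
    qed
    also have "\<dots> = (\<integral>\<^sup>+x. (\<integral>\<^sup>+y. f (x(n := y)) \<partial>lborel) \<partial>lebn n)"
      using vol_scalingD(3)[OF Suc, of "\<lambda>x. \<integral>\<^sup>+y. f (x(n := y)) \<partial>lborel"] by simp
    also have "\<dots> = (\<integral>\<^sup>+x. f x \<partial>lebn (Suc n))" by (rule lebn_nn_Suc[symmetric]) measurable
    finally show "(\<integral>\<^sup>+x. f (vneg (Suc n) x) \<partial>lebn (Suc n)) = ennreal (1 / 1) * (\<integral>\<^sup>+x. f x \<partial>lebn (Suc n))" by simp
  qed (use m in auto)
qed

lemma distr_vneg: "distr (lebn n) (lebn n) (vneg n) = lebn n"
proof (rule measure_eqI)
  fix S assume "S \<in> sets (distr (lebn n) (lebn n) (vneg n))"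
  then have S: "S \<in> sets (lebn n)" by simp
  have "emeasure (distr (lebn n) (lebn n) (vneg n)) S = emeasure (lebn n) {x \<in> Rn n. vneg n x \<in> S}"
    using S vol_scalingD(2)[OF vol_scaling_vneg]
    by (simp add: emeasure_distr vimage_def Int_def conj_commute)
  then show "emeasure (distr (lebn n) (lebn n) (vneg n)) S = emeasure (lebn n) S"
    using vol_scaling_emeasure[OF vol_scaling_vneg S] by simp
qed simp

text \<open>Reflection invariance of Lebesgue measure turns the evenness of \<open>g\<close> into
  vanishing first moments, the only place where evenness is converted into the centring of the
  locale.\<close>

lemma body_measure_density:
  assumes L: "sym_body n L" and s: "s > 0"
    and int: "integrable (lebn n) (\<lambda>x. indicator L x * g x :: real)"
    and g0: "\<And>x. x \<in> L \<Longrightarrow> 0 \<le> g x" and even: "\<And>x. x \<in> L \<Longrightarrow> g (vneg n x) = g x"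
    and I: "I = (\<integral>x. indicator L x * g x \<partial>lebn n)" "I > 0"
  shows "body_measure (density (lebn n) (\<lambda>x. ennreal (indicator L x * g x / I))) n L s"
proof -
  let ?f = "\<lambda>x. indicator L x * g x / I"
  let ?\<mu> = "density (lebn n) (\<lambda>x. ennreal (?f x))"
  have f0: "0 \<le> ?f x" for x using g0 I(2) by (auto simp: indicator_def)
  have fint: "integrable (lebn n) ?f" using int by simp
  then have [measurable]: "?f \<in> borel_measurable (lebn n)" by (rule borel_measurable_integrable)
  have "prob_space ?\<mu>"
  proof
    have "emeasure ?\<mu> (space ?\<mu>) = (\<integral>\<^sup>+x. ennreal (?f x) \<partial>lebn n)"
      by (subst emeasure_density) (auto intro!: nn_integral_cong)
    also have "\<dots> = ennreal (\<integral>x. ?f x \<partial>lebn n)" by (rule nn_integral_eq_integral[OF fint]) (simp add: f0)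
    also have "(\<integral>x. ?f x \<partial>lebn n) = 1" using I by simp
    finally show "emeasure ?\<mu> (space ?\<mu>) = 1" by simp
  qed
  then interpret prob_space ?\<mu> .
  show ?thesis
  proof
    show "sym_body n L" by fact
    show "sets ?\<mu> = sets (lebn n)" by simp
    show "AE x in ?\<mu>. x \<in> L"
    proof (subst AE_density)
      show "(\<lambda>x. ennreal (?f x)) \<in> borel_measurable (lebn n)" by measurable
      show "AE x in lebn n. 0 < ennreal (?f x) \<longrightarrow> x \<in> L" by (rule AE_I2) (auto simp: indicator_def)
    qed
    show "0 < s" by fact
    fix i assume i: "i < n"
    have J: "(\<integral>x. x i \<partial>?\<mu>) = (\<integral>x. ?f x * x i \<partial>lebn n)"
      using i f0 by (subst integral_density) auto
    have fm: "(\<lambda>x. ?f x * x i) \<in> borel_measurable (lebn n)" using i by measurable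
    have "(\<integral>x. ?f x * x i \<partial>lebn n) = (\<integral>x. ?f x * x i \<partial>distr (lebn n) (lebn n) (vneg n))"
      by (simp add: distr_vneg)
    also have "\<dots> = (\<integral>x. ?f (vneg n x) * vneg n x i \<partial>lebn n)"
      by (rule integral_distr[OF vol_scalingD(2)[OF vol_scaling_vneg[of n]] fm])
    also have "\<dots> = (\<integral>x. - (?f x * x i) \<partial>lebn n)"
    proof (rule Bochner_Integration.integral_cong[OF refl])
      fix x assume x: "x \<in> space (lebn n)"
      have "vneg n x \<in> L \<longleftrightarrow> x \<in> L"
      proof
        assume "vneg n x \<in> L"
        then have "vneg n (vneg n x) \<in> L" using L by (auto simp: sym_body_def origin_symmetric_def)
        moreover have "vneg n (vneg n x) = x" using x by (intro Rn_eqI[of _ n]) auto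
        ultimately show "x \<in> L" by simp
      qed (use L in \<open>auto simp: sym_body_def origin_symmetric_def\<close>)
      then show "?f (vneg n x) * vneg n x i = - (?f x * x i)"
        using i even[of x] by (auto simp: indicator_def)
    qed
    also have "\<dots> = - (\<integral>x. ?f x * x i \<partial>lebn n)" by simp
    finally show "(\<integral>x. x i \<partial>?\<mu>) = 0" unfolding J by linarith
  qed
qed

lemma vol_in_ellipsoid:
  assumes L: "sym_body n L" and n: "n > 0" and s: "s > 0" and \<kappa>: "\<kappa> > 1"
  obtains A where "lower_tri n A" "voln n (polar n L s) \<le> 12 ^ n * voln n L * (diag_prod n A)\<^sup>2"
    "(1 - 1 / \<kappa>) * exp (- s) * voln n L \<le> voln n {x \<in> L. ipn n (mv n A x) (mv n A x) \<le> \<kappa> * (real n + s)}"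
proof -
  let ?l = "voln n L"
  have l: "?l > 0" "emeasure (lebn n) L = ennreal ?l" using sym_body_emeasure[OF L] by auto
  have Lm[measurable]: "L \<in> sets (lebn n)" by (rule sym_body_sets[OF L])
  have I: "?l = (\<integral>x. indicator L x * 1 \<partial>lebn n)"
    using sets.sets_into_space[OF Lm] by (simp add: voln_def Int_absorb2)
  let ?\<mu> = "density (lebn n) (\<lambda>x. ennreal (indicator L x * 1 / ?l))"
  interpret body_measure ?\<mu> n L s
  proof (rule body_measure_density[OF L s _ _ _ I l(1)])
    show "integrable (lebn n) (\<lambda>x. indicator L x * 1 :: real)" using l by simp
  qed auto
  obtain A where A: "lower_tri n A" "voln n (polar n L s) \<le> 12 ^ n * voln n L * (diag_prod n A)\<^sup>2"
    "(1 - 1 / \<kappa>) * exp (- s) \<le> measure ?\<mu> {x \<in> L. ipn n (mv n A x) (mv n A x) \<le> \<kappa> * (real n + s)}"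
    using mass_in_ellipsoid[OF n \<kappa>] by blast
  define S where "S = {x \<in> L. ipn n (mv n A x) (mv n A x) \<le> \<kappa> * (real n + s)}"
  have S: "sym_body n S" unfolding S_def using \<kappa> s by (intro sym_body_inter_ellipsoid[OF L]) auto
  have Sm[measurable]: "S \<in> sets (lebn n)" by (rule sym_body_sets[OF S])
  have "emeasure ?\<mu> S = (\<integral>\<^sup>+x. ennreal (1 / ?l) * indicator S x \<partial>lebn n)"
    by (subst emeasure_density) (auto intro!: nn_integral_cong simp: S_def indicator_def)
  also have "\<dots> = ennreal (1 / ?l) * ennreal (voln n S)"
    by (simp add: nn_integral_cmult sym_body_emeasure[OF S])
  also have "\<dots> = ennreal (voln n S / ?l)"
    using l(1) by (subst ennreal_mult[symmetric]) (auto simp: voln_def)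
  finally have eS: "emeasure ?\<mu> S = ennreal (voln n S / ?l)" .
  have "measure ?\<mu> S = voln n S / ?l"
    unfolding measure_def[of ?\<mu>] eS by (rule enn2real_ennreal) (simp add: voln_def)
  then have "(1 - 1 / \<kappa>) * exp (- s) \<le> voln n S / ?l" using A(3) by (simp add: S_def)
  then have "(1 - 1 / \<kappa>) * exp (- s) * ?l \<le> voln n S" using l by (simp add: pos_le_divide_eq)
  then show thesis using that[OF A(1,2)] by (simp add: S_def)
qed

text \<open>By Cauchy-Schwarz the polar of a body inside \<open>|A x|^2 <= n\<close> contains the
  image under \<open>A^T\<close> of the ball of radius \<open>s / sqrt n\<close>; a cube inscribed
  in that ball already gives the bound.\<close>

lemma polar_ellipsoid_volume:
  assumes L: "sym_body n L" and n: "n > 0" and s: "s > 0" and A: "lower_tri n A"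
    and inE: "\<And>x. x \<in> L \<Longrightarrow> ipn n (mv n A x) (mv n A x) \<le> real n"
  shows "(2 * s / real n) ^ n * diag_prod n A \<le> voln n (polar n L s)"
proof -
  let ?V = "polar n L s"
  have V: "sym_body n ?V" by (rule sym_body_polar[OF L s])
  let ?Q = "{x \<in> Rn n. \<forall>i<n. \<bar>x i\<bar> \<le> s / real n}"
  have d: "diag_prod n A > 0" using vol_scalingD(1)[OF vol_scaling_lower_tri[OF A]] .
  have "?Q \<subseteq> {x \<in> Rn n. mv n (transp A) x \<in> ?V}"
  proof (intro subsetI CollectI conjI)
    fix \<eta> assume \<eta>: "\<eta> \<in> ?Q"
    then show "\<eta> \<in> Rn n" by simp
    have "ipn n x (mv n (transp A) \<eta>) \<le> s" if x: "x \<in> L" for x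
    proof -
      have "ipn n \<eta> \<eta> \<le> real n * (s / real n)\<^sup>2" using \<eta> by (intro ipn_le_coord) auto
      also have "\<dots> = (s / sqrt (real n))\<^sup>2" using n by (simp add: power2_eq_square)
      finally have "\<bar>ipn n (mv n A x) \<eta>\<bar> \<le> sqrt (real n) * (s / sqrt (real n))"
        using inE[OF x] s by (intro abs_ipn_le) auto
      also have "\<dots> = s" using n by simp
      finally show ?thesis by (simp add: ipn_mv)
    qed
    then show "mv n (transp A) \<eta> \<in> ?V" by (simp add: polar_def)
  qed
  then have "emeasure (lebn n) ?Q \<le> emeasure (lebn n) {x \<in> Rn n. mv n (transp A) x \<in> ?V}"
    using measurable_sets[OF measurable_mv sym_body_sets[OF V], of "transp A"]
    by (intro emeasure_mono) (auto simp: vimage_def Int_def conj_commute)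
  also have "\<dots> = ennreal (voln n ?V / diag_prod n A)"
    using vol_scaling_emeasure[OF vol_scaling_upper_tri[OF A] sym_body_sets[OF V]] d sym_body_emeasure[OF V]
    by (simp add: ennreal_mult''[symmetric])
  also have "emeasure (lebn n) ?Q = ennreal ((2 * s / real n) ^ n)" using s by (subst emeasure_cube) auto
  finally have "(2 * s / real n) ^ n \<le> voln n ?V / diag_prod n A"
    using d sym_body_emeasure(2)[OF V] by (subst (asm) ennreal_le_iff) auto
  then show ?thesis using d by (simp add: pos_le_divide_eq)
qed

section \<open>Improving an ellipsoid\<close>

lemma diag_prod_pos: "lower_tri n A \<Longrightarrow> 0 < diag_prod n A"
  by (auto simp: diag_prod_def lower_tri_def intro!: prod_pos)

lemma lower_tri_scale: "lower_tri n A \<Longrightarrow> c > 0 \<Longrightarrow> lower_tri n (\<lambda>i j. c * A i j)"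
  by (auto simp: lower_tri_def)

lemma diag_prod_scale: "diag_prod n (\<lambda>i j. c * A i j) = c ^ n * diag_prod n A"
  by (simp add: diag_prod_def prod.distrib)

lemma ipn_mv_matrix_scale: "ipn n (mv n (\<lambda>i j. c * A i j) x) (mv n (\<lambda>i j. c * A i j) x) = c\<^sup>2 * ipn n (mv n A x) (mv n A x)"
  by (simp add: ipn_mv_unfold sum_distrib_left[symmetric] mult.assoc power2_eq_square)
     (simp add: sum_distrib_left mult_ac)

text \<open>Cutting \<open>L\<close> with the old ellipsoid yields a body \<open>M\<close> whose
  polar is large, since it contains the polar ellipsoid. Applied to \<open>M\<close>, the volume
  inequality bounds the square of the new determinant below by the volume of that polar, which is
  only linear in the old determinant; this is the source of the square on the right.\<close>

lemma ellipsoid_improve: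
  assumes L: "sym_body n L" and n: "n > 0" and \<epsilon>: "0 < \<epsilon>" "\<epsilon> \<le> 1" and A: "lower_tri n A"
    and mass: "exp (- \<epsilon> / 2 * real n) * voln n L \<le> voln n {x \<in> L. ipn n (mv n A x) (mv n A x) \<le> real n}"
  obtains B where "lower_tri n B"
    "exp (- \<epsilon> * real n) * voln n L \<le> voln n {x \<in> L. ipn n (mv n B x) (mv n B x) \<le> real n}"
    "(\<epsilon>\<^sup>2 / 168) ^ n * (diag_prod n A * voln n L) \<le> (diag_prod n B * voln n L)\<^sup>2"
proof -
  define M where "M = {x \<in> L. ipn n (mv n A x) (mv n A x) \<le> real n}"
  have M: "sym_body n M" unfolding M_def using n by (intro sym_body_inter_ellipsoid[OF L]) auto
  have M': "M \<subseteq> L" by (auto simp: M_def)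
  \<comment> \<open>The available loss \<open>exp (- \<epsilon> / 2 * n)\<close> is split evenly:
    \<open>exp (- s)\<close> pays for the tilt, and
    \<open>1 - 1 / \<kappa> = 1 / (1 + x) >= exp (- x)\<close> pays for Markov's inequality.\<close>
  define x s \<kappa> :: real where "x = \<epsilon> * real n / 4" and "s = x" and "\<kappa> = 1 + 1 / x"
  have x: "x > 0" using \<epsilon> n by (simp add: x_def)
  have s: "s > 0" and \<kappa>: "\<kappa> > 1" using x by (auto simp: s_def \<kappa>_def)
  obtain C where C: "lower_tri n C" "voln n (polar n M s) \<le> 12 ^ n * voln n M * (diag_prod n C)\<^sup>2"
    "(1 - 1 / \<kappa>) * exp (- s) * voln n M \<le> voln n {x \<in> M. ipn n (mv n C x) (mv n C x) \<le> \<kappa> * (real n + s)}"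
    using vol_in_ellipsoid[OF M n s \<kappa>] by blast
  define c where "c = sqrt (real n / (\<kappa> * (real n + s)))"
  have ks: "0 < \<kappa> * (real n + s)" using \<kappa> s by (simp add: add_nonneg_pos)
  have c: "c > 0" "c\<^sup>2 = real n / (\<kappa> * (real n + s))" using ks n by (auto simp: c_def)
  define B where "B = (\<lambda>i j. c * C i j)"
  have vL: "voln n L > 0" "voln n M > 0" using sym_body_emeasure[OF L] sym_body_emeasure[OF M] by auto
  have fin: "emeasure (lebn n) L < \<infinity>" using sym_body_emeasure[OF L] by simp
  have vML: "voln n M \<le> voln n L" by (rule voln_le[OF M' sym_body_sets[OF L] fin])
  have SB: "sym_body n {x \<in> L. ipn n (mv n B x) (mv n B x) \<le> real n}"
    using n by (intro sym_body_inter_ellipsoid[OF L]) auto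
  show thesis
  proof (rule that[of B])
    show "lower_tri n B" unfolding B_def by (rule lower_tri_scale[OF C(1) c(1)])
    have ek: "exp (- x) \<le> 1 - 1 / \<kappa>"
    proof -
      have "1 - 1 / \<kappa> = 1 / (1 + x)" using x by (simp add: \<kappa>_def field_simps)
      moreover have "exp (- x) \<le> 1 / (1 + x)"
        using x exp_ge_add_one_self[of x] by (simp add: exp_minus field_simps)
      ultimately show ?thesis by simp
    qed
    have "exp (- \<epsilon> * real n) * voln n L = (exp (-x) * exp (-s)) * (exp (- \<epsilon> / 2 * real n) * voln n L)"
    proof -
      have "exp (-x) * exp (-s) * exp (- \<epsilon> / 2 * real n) = exp (- \<epsilon> * real n)"
        unfolding exp_add[symmetric] by (simp add: s_def x_def)
      then show ?thesis by (simp only: mult.assoc[symmetric])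
    qed
    also have "\<dots> \<le> (exp (-x) * exp (-s)) * voln n M"
      using mass by (intro mult_left_mono) (auto simp: M_def)
    also have "\<dots> \<le> (1 - 1 / \<kappa>) * exp (- s) * voln n M"
      using ek vL by (intro mult_right_mono) auto
    also have "\<dots> \<le> voln n {x \<in> M. ipn n (mv n C x) (mv n C x) \<le> \<kappa> * (real n + s)}" by (rule C(3))
    also have "\<dots> \<le> voln n {x \<in> L. ipn n (mv n B x) (mv n B x) \<le> real n}"
    proof (rule voln_le[OF _ sym_body_sets[OF SB]])
      have "c\<^sup>2 * (\<kappa> * (real n + s)) = real n" unfolding c(2) using ks by (intro nonzero_eq_divide_eq[THEN iffD1]) auto
      then have "c\<^sup>2 * ipn n (mv n C x) (mv n C x) \<le> real n" if "ipn n (mv n C x) (mv n C x) \<le> \<kappa> * (real n + s)" for x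
        using mult_left_mono[OF that, of "c\<^sup>2"] by simp
      then show "{x \<in> M. ipn n (mv n C x) (mv n C x) \<le> \<kappa> * (real n + s)} \<subseteq> {x \<in> L. ipn n (mv n B x) (mv n B x) \<le> real n}"
        using M' by (auto simp: B_def ipn_mv_matrix_scale)
      show "emeasure (lebn n) {x \<in> L. ipn n (mv n B x) (mv n B x) \<le> real n} < \<infinity>"
        using sym_body_emeasure(1)[OF SB] by simp
    qed
    finally show "exp (- \<epsilon> * real n) * voln n L \<le> voln n {x \<in> L. ipn n (mv n B x) (mv n B x) \<le> real n}" .
    \<comment> \<open>Rescaling the squared radius from \<open>\<kappa> * (n + s)\<close> to
      \<open>n\<close> costs this factor. Together with \<open>2 * s / n = \<epsilon> / 2\<close>
      and the constant 12 it produces \<open>168 = 7 * 2 * 12\<close>.\<close>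
    have c2: "\<epsilon> / 7 \<le> c\<^sup>2"
    proof -
      have "\<kappa> \<le> 5 / \<epsilon>"
      proof -
        have "1 / x \<le> 4 / \<epsilon>" using \<epsilon> n by (simp add: x_def field_simps)
        moreover have "1 \<le> 1 / \<epsilon>" using \<epsilon> by simp
        ultimately show ?thesis unfolding \<kappa>_def by (simp add: add_divide_distrib[symmetric, of 1 4, simplified] field_simps)
      qed
      moreover have "real n + s \<le> 5/4 * real n" using \<epsilon> by (simp add: s_def x_def mult_left_le_one_le)
      ultimately have "\<kappa> * (real n + s) \<le> (5 / \<epsilon>) * (5/4 * real n)" using \<kappa> s \<epsilon> by (intro mult_mono) auto
      also have "\<dots> = (25/4 * real n) / \<epsilon>" by simp
      also have "\<dots> \<le> 7 * real n / \<epsilon>" using \<epsilon> by (intro divide_right_mono) auto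
      finally have "real n / (7 * real n / \<epsilon>) \<le> c\<^sup>2" unfolding c(2)
        using ks n \<epsilon>(1) by (intro divide_left_mono mult_pos_pos[OF _ ks] divide_pos_pos) auto
      then show ?thesis using n by simp
    qed
    have P: "(2 * s / real n) ^ n * diag_prod n A \<le> voln n (polar n M s)"
      by (rule polar_ellipsoid_volume[OF M n s A]) (simp add: M_def)
    have dA: "diag_prod n A > 0" by (rule diag_prod_pos[OF A])
    have "(\<epsilon>/2) ^ n * diag_prod n A \<le> 12 ^ n * voln n L * (diag_prod n C)\<^sup>2"
    proof -
      have "(\<epsilon>/2) ^ n * diag_prod n A \<le> voln n (polar n M s)" using P n by (simp add: s_def x_def)
      also have "\<dots> \<le> 12 ^ n * voln n M * (diag_prod n C)\<^sup>2" by (rule C(2))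
      also have "\<dots> \<le> 12 ^ n * voln n L * (diag_prod n C)\<^sup>2" using vML by (intro mult_right_mono mult_left_mono) auto
      finally show ?thesis .
    qed
    then have "(\<epsilon>/7) ^ n * ((\<epsilon>/2) ^ n * diag_prod n A) \<le> (c\<^sup>2) ^ n * (12 ^ n * voln n L * (diag_prod n C)\<^sup>2)"
      using c2 \<epsilon> dA by (intro mult_mono[OF power_mono]) auto
    then have "12 ^ n * ((\<epsilon>\<^sup>2 / 168) ^ n * diag_prod n A) \<le> 12 ^ n * (voln n L * (diag_prod n B)\<^sup>2)"
    proof -
      have X: "12 ^ n * ((\<epsilon>\<^sup>2 / 168) ^ n * diag_prod n A) = (\<epsilon>/7) ^ n * ((\<epsilon>/2) ^ n * diag_prod n A)"
        unfolding mult.assoc[symmetric] power_mult_distrib[symmetric] by (simp add: power2_eq_square)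
      have Y: "12 ^ n * (voln n L * (diag_prod n B)\<^sup>2) = (c\<^sup>2) ^ n * (12 ^ n * voln n L * (diag_prod n C)\<^sup>2)"
        by (simp add: B_def diag_prod_scale power_mult_distrib power_mult[symmetric] mult_ac)
      show ?thesis unfolding X Y by fact
    qed
    then have "(\<epsilon>\<^sup>2 / 168) ^ n * diag_prod n A \<le> voln n L * (diag_prod n B)\<^sup>2" by simp
    then have "((\<epsilon>\<^sup>2 / 168) ^ n * diag_prod n A) * voln n L \<le> (voln n L * (diag_prod n B)\<^sup>2) * voln n L"
      using vL by (intro mult_right_mono) auto
    then show "(\<epsilon>\<^sup>2 / 168) ^ n * (diag_prod n A * voln n L) \<le> (diag_prod n B * voln n L)\<^sup>2"
      by (simp add: power2_eq_square mult_ac)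
  qed
qed

text \<open>Each application of the improvement step replaces the defect q by its square root, so after
  finitely many steps only a constant to the power n remains.\<close>

theorem M_ellipsoid:
  assumes L: "sym_body n L" and n: "n > 0"
  obtains A where "lower_tri n A"
    "exp (- real n) * voln n L \<le> voln n {x \<in> L. ipn n (mv n A x) (mv n A x) \<le> real n}"
    "(1 / 5376) ^ n \<le> diag_prod n A * voln n L"
proof -
  let ?S = "\<lambda>A. {x \<in> L. ipn n (mv n A x) (mv n A x) \<le> real n}"
  \<comment> \<open>\<open>\<epsilon>\<close> is quantified inside because a step spends half of the
    mass exponent, obtaining the ellipsoid for \<open>\<epsilon>\<close> from the one for
    \<open>\<epsilon> / 2\<close>. With exponent 3 and \<open>1344 = 8 * 168\<close> the prefactor
    reproduces itself under this step.\<close>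
  define P where "P = (\<lambda>q::real. \<forall>\<epsilon>. 0 < \<epsilon> \<longrightarrow> \<epsilon> \<le> 1 \<longrightarrow> (\<exists>A. lower_tri n A \<and>
     exp (- \<epsilon> * real n) * voln n L \<le> voln n (?S A) \<and> (\<epsilon> ^ 3 / 1344) ^ n * q \<le> diag_prod n A * voln n L))"
  have vL: "voln n L > 0" using sym_body_emeasure[OF L] by auto
  obtain R where R: "R > 0" "\<And>x i. x \<in> L \<Longrightarrow> i < n \<Longrightarrow> \<bar>x i\<bar> \<le> R" using sym_body_bounded[OF L] by blast
  \<comment> \<open>The iteration starts from a ball large enough to contain \<open>L\<close>; its
    defect \<open>q0\<close> may be arbitrarily small.\<close>
  define A0 where "A0 = (\<lambda>i j::nat. if i = j then 1 / R else 0)"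
  have A0: "lower_tri n A0" using R by (auto simp: lower_tri_def A0_def)
  have "mv n A0 x i = x i / R" if "i < n" for x i
  proof -
    have "mv n A0 x i = (\<Sum>j<n. if j = i then x i / R else 0)"
      unfolding mv_nth[OF that] by (rule sum.cong) (auto simp: A0_def)
    then show ?thesis using that by simp
  qed
  then have "\<bar>mv n A0 x i\<bar> \<le> 1" if "i < n" "x \<in> L" for x i using R(2)[OF that(2,1)] R(1) that by simp
  then have "ipn n (mv n A0 x) (mv n A0 x) \<le> real n" if "x \<in> L" for x using that ipn_le_coord[of n "mv n A0 x" 1] by simp
  then have S0: "?S A0 = L" by auto
  define q0 where "q0 = diag_prod n A0 * voln n L"
  have q0: "q0 > 0" using vL diag_prod_pos[OF A0] by (simp add: q0_def)
  have "P q0" unfolding P_def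
  proof (intro allI impI exI[of _ A0] conjI A0)
    fix \<epsilon> :: real assume \<epsilon>: "0 < \<epsilon>" "\<epsilon> \<le> 1"
    show "exp (- \<epsilon> * real n) * voln n L \<le> voln n (?S A0)" unfolding S0 using \<epsilon> vL by simp
    have "\<epsilon> ^ 3 \<le> 1" using \<epsilon> by (simp add: power_le_one)
    then have "(\<epsilon> ^ 3 / 1344) ^ n \<le> 1" using \<epsilon> by (intro power_le_one) auto
    then show "(\<epsilon> ^ 3 / 1344) ^ n * q0 \<le> diag_prod n A0 * voln n L"
      using q0 unfolding q0_def[symmetric] by (simp add: mult_left_le_one_le)
  qed
  have step: "P (sqrt q)" if "P q" "q > 0" for q
    unfolding P_def
  proof (intro allI impI)
    fix \<epsilon> :: real assume \<epsilon>: "0 < \<epsilon>" "\<epsilon> \<le> 1"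
    then have "0 < \<epsilon>/2" "\<epsilon>/2 \<le> 1" by auto
    with \<open>P q\<close> obtain A where A: "lower_tri n A" "exp (- (\<epsilon>/2) * real n) * voln n L \<le> voln n (?S A)"
      "((\<epsilon>/2) ^ 3 / 1344) ^ n * q \<le> diag_prod n A * voln n L" unfolding P_def by blast
    obtain B where B: "lower_tri n B" "exp (- \<epsilon> * real n) * voln n L \<le> voln n (?S B)"
      "(\<epsilon>\<^sup>2 / 168) ^ n * (diag_prod n A * voln n L) \<le> (diag_prod n B * voln n L)\<^sup>2"
      using ellipsoid_improve[OF L n \<epsilon> A(1)] A(2) by auto
    have "((\<epsilon> ^ 3 / 1344) ^ n * sqrt q)\<^sup>2 \<le> (\<epsilon>\<^sup>2 / 168) ^ n * (((\<epsilon>/2) ^ 3 / 1344) ^ n * q)"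
    proof -
      have "(\<epsilon> ^ 3 / 1344)\<^sup>2 \<le> (\<epsilon>\<^sup>2 / 168) * ((\<epsilon>/2) ^ 3 / 1344)"
      proof -
        have "\<epsilon> ^ 6 \<le> \<epsilon> ^ 5" using \<epsilon> by (intro power_decreasing) auto
        moreover have "(\<epsilon> ^ 3 / 1344)\<^sup>2 = \<epsilon> ^ 6 / (1344 * 1344)" by (simp add: power2_eq_square power_add[symmetric])
        moreover have "(\<epsilon>\<^sup>2 / 168) * ((\<epsilon>/2) ^ 3 / 1344) = \<epsilon> ^ 5 / (1344 * 1344)" by (simp add: power_divide power_add[symmetric])
        ultimately show ?thesis by (simp add: divide_right_mono)
      qed
      then have "((\<epsilon> ^ 3 / 1344)\<^sup>2) ^ n \<le> ((\<epsilon>\<^sup>2 / 168) * ((\<epsilon>/2) ^ 3 / 1344)) ^ n" by (intro power_mono) auto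
      then have X: "((\<epsilon> ^ 3 / 1344)\<^sup>2) ^ n * q \<le> ((\<epsilon>\<^sup>2 / 168) * ((\<epsilon>/2) ^ 3 / 1344)) ^ n * q"
        using \<open>q > 0\<close> by (intro mult_right_mono) auto
      have Y: "((\<epsilon> ^ 3 / 1344) ^ n * sqrt q)\<^sup>2 = ((\<epsilon> ^ 3 / 1344)\<^sup>2) ^ n * q"
        using \<open>q > 0\<close> by (simp add: power_mult_distrib power_mult[symmetric] mult.commute)
      have W: "((\<epsilon>\<^sup>2 / 168) * ((\<epsilon>/2) ^ 3 / 1344)) ^ n * q = (\<epsilon>\<^sup>2 / 168) ^ n * (((\<epsilon>/2) ^ 3 / 1344) ^ n * q)"
        by (simp only: power_mult_distrib mult.assoc)
      show ?thesis unfolding Y W[symmetric] by (rule X)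
    qed
    also have "\<dots> \<le> (\<epsilon>\<^sup>2 / 168) ^ n * (diag_prod n A * voln n L)" using A(3) by (intro mult_left_mono) auto
    also have "\<dots> \<le> (diag_prod n B * voln n L)\<^sup>2" by (rule B(3))
    finally have "(\<epsilon> ^ 3 / 1344) ^ n * sqrt q \<le> diag_prod n B * voln n L"
      by (rule power2_le_imp_le) (use vL diag_prod_pos[OF B(1)] in simp)
    then show "\<exists>A. lower_tri n A \<and> exp (- \<epsilon> * real n) * voln n L \<le> voln n (?S A) \<and>
        (\<epsilon> ^ 3 / 1344) ^ n * sqrt q \<le> diag_prod n A * voln n L" using B by blast
  qed
  \<comment> \<open>\<open>J\<close> square roots raise \<open>(1/4) ^ (2 ^ J)\<close> to
    \<open>1/4\<close>; the number of steps leaves no trace because \<open>P\<close> has the same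
    form at every stage.\<close>
  have iter: "\<exists>q'\<ge>1/4. P q'" if "P q" "q > 0" "(1/4) ^ (2 ^ J) \<le> q" for J q
    using that
  proof (induction J arbitrary: q)
    case 0
    then show ?case by (intro exI[of _ q]) simp
  next
    case (Suc J)
    have "((1/4::real) ^ (2 ^ J))\<^sup>2 \<le> q" using Suc.prems(3) by (simp add: power_mult[symmetric] mult.commute)
    then have "(1/4::real) ^ (2 ^ J) \<le> sqrt q" by (rule real_le_rsqrt)
    then show ?case using Suc.IH[of "sqrt q"] step[OF Suc.prems(1,2)] Suc.prems(2) by simp
  qed
  obtain N where N: "(1/4::real) ^ N < q0" using real_arch_pow_inv[OF q0, of "1/4"] by auto
  have "(1/4::real) ^ (2 ^ N) \<le> (1/4) ^ N" by (intro power_decreasing) (auto simp: less_imp_le[OF less_exp])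
  then have "(1/4::real) ^ (2 ^ N) \<le> q0" using N by linarith
  from iter[OF \<open>P q0\<close> q0 this] obtain q where q: "q \<ge> 1/4" "P q" by blast
  then obtain A where A: "lower_tri n A" "exp (- 1 * real n) * voln n L \<le> voln n (?S A)"
      "(1 ^ 3 / 1344) ^ n * q \<le> diag_prod n A * voln n L" using q(2)[unfolded P_def, rule_format, of 1] by auto
  have "(1 / 5376) ^ n = (1/1344) ^ n * (1/4::real) ^ n" unfolding power_mult_distrib[symmetric] by simp
  also have "\<dots> \<le> (1/1344) ^ n * q"
  proof (intro mult_left_mono)
    have "(1/4::real) ^ n \<le> (1/4) ^ 1" using n by (intro power_decreasing) auto
    then show "(1/4::real) ^ n \<le> q" using q by simp
  qed auto
  also have "\<dots> \<le> diag_prod n A * voln n L" using A(3) by simp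
  finally show thesis using that[OF A(1)] A(2) by simp
qed

section \<open>The reverse Santalo inequality\<close>

text \<open>The sets \<open>H p = p + M / 2\<close> with \<open>p\<close> in \<open>L\<close> lie in
  \<open>2 L\<close>, so at most \<open>2 ^ n * 2 ^ n / \<gamma>\<close> of them are disjoint. For a
  maximal disjoint family, each \<open>H x\<close> meets some \<open>H p\<close>, and then
  \<open>x - p\<close> lies in \<open>M\<close> by symmetry and convexity.\<close>

lemma body_covering:
  assumes L: "sym_body n L" and M: "sym_body n M" and sub: "M \<subseteq> L"
    and \<gamma>: "\<gamma> > 0" "\<gamma> * voln n L \<le> voln n M"
  obtains P where "finite P" "P \<subseteq> L" "real (card P) \<le> 4 ^ n / \<gamma>"
    "\<And>x. x \<in> L \<Longrightarrow> \<exists>p\<in>P. vadd n x (vneg n p) \<in> M"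
proof -
  define H where "H = (\<lambda>p. {z \<in> Rn n. vscale n 2 (vadd n z (vneg n p)) \<in> M})"
  have vs: "vol_scaling n (\<lambda>z. vscale n 2 (vadd n z (vneg n p))) (2 ^ n * 1)" for p
    by (intro vol_scaling_comp[OF vol_scaling_vscale vol_scaling_trans]) auto
  have Hm: "H p \<in> sets (lebn n)" for p
    using measurable_sets[OF vol_scalingD(2)[OF vs[of p]] sym_body_sets[OF M]]
    by (simp add: H_def vimage_def Int_def conj_commute)
  have vM: "voln n M > 0" "voln n L > 0" using sym_body_emeasure[OF M] sym_body_emeasure[OF L] by auto
  have He: "emeasure (lebn n) (H p) = ennreal (voln n M / 2 ^ n)" for p
    unfolding H_def vol_scaling_emeasure[OF vs sym_body_sets[OF M]] sym_body_emeasure(1)[OF M]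
    using vM by (subst ennreal_mult[symmetric]) auto
  let ?L2 = "{z \<in> Rn n. vscale n (1/2) z \<in> L}"
  have L2m: "?L2 \<in> sets (lebn n)"
    using measurable_sets[OF vol_scalingD(2)[OF vol_scaling_vscale[of "1/2" n]] sym_body_sets[OF L]]
    by (simp add: vimage_def Int_def conj_commute)
  have L2e: "emeasure (lebn n) ?L2 = ennreal (2 ^ n * voln n L)"
    using vol_scaling_emeasure[OF vol_scaling_vscale[of "1/2" n] sym_body_sets[OF L]] vM
    by (simp add: sym_body_emeasure[OF L] power_one_over) (simp add: ennreal_mult voln_def)
  have HL2: "H p \<subseteq> ?L2" if "p \<in> L" for p
  proof
    fix z assume z: "z \<in> H p"
    let ?w = "vscale n 2 (vadd n z (vneg n p))"
    have w: "?w \<in> L" "z \<in> Rn n" using z sub by (auto simp: H_def)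
    have "(\<lambda>i\<in>{..<n}. 1/2 * p i + 1/4 * ?w i) \<in> L" by (rule sym_body_comb[OF L that w(1)]) auto
    also have "(\<lambda>i\<in>{..<n}. 1/2 * p i + 1/4 * ?w i) = vscale n (1/2) z"
      by (auto simp: vscale_def vadd_def vneg_def fun_eq_iff field_simps)
    finally show "z \<in> ?L2" using w by simp
  qed
  have cb: "real (card P) \<le> 4 ^ n / \<gamma>"
    if P: "finite P" "P \<subseteq> L" "\<And>p q. p \<in> P \<Longrightarrow> q \<in> P \<Longrightarrow> p \<noteq> q \<Longrightarrow> H p \<inter> H q = {}" for P
  proof -
    have "ennreal (real (card P) * (voln n M / 2 ^ n)) = (\<Sum>p\<in>P. emeasure (lebn n) (H p))"
      unfolding He using vM by (subst sum_ennreal) auto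
    also have "\<dots> = emeasure (lebn n) (\<Union>p\<in>P. H p)"
      using P by (intro sum_emeasure) (auto simp: disjoint_family_on_def Hm)
    also have "\<dots> \<le> emeasure (lebn n) ?L2" using HL2 P(2) by (intro emeasure_mono L2m) blast
    also have "\<dots> = ennreal (2 ^ n * voln n L)" by (rule L2e)
    finally have "real (card P) * (voln n M / 2 ^ n) \<le> 2 ^ n * voln n L"
      using vM by (subst (asm) ennreal_le_iff) auto
    then have "real (card P) * voln n M \<le> 2 ^ n * voln n L * 2 ^ n" by (simp add: pos_divide_le_eq)
    also have "\<dots> = (2 * 2) ^ n * voln n L" unfolding power_mult_distrib by simp
    finally have c: "real (card P) * voln n M \<le> 4 ^ n * voln n L" by simp
    have "real (card P) * (\<gamma> * voln n L) \<le> real (card P) * voln n M" using \<gamma> by (intro mult_left_mono) auto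
    then have "(real (card P) * \<gamma>) * voln n L \<le> 4 ^ n * voln n L" using c by (simp add: mult.assoc)
    then have "real (card P) * \<gamma> \<le> 4 ^ n" using vM by (simp only: mult_le_cancel_right_pos)
    then show ?thesis using \<gamma> by (simp add: pos_le_divide_eq)
  qed
  have "\<exists>P. finite P \<and> P \<subseteq> L \<and> (\<forall>p\<in>P. \<forall>q\<in>P. p \<noteq> q \<longrightarrow> H p \<inter> H q = {}) \<and> (\<forall>x\<in>L. \<exists>p\<in>P. \<not> H x \<inter> H p = {})"
  proof (rule maximal_separated[where S = L and sep = "\<lambda>p q. H p \<inter> H q = {}" and B = "nat \<lceil>4 ^ n / \<gamma>\<rceil>"])
    fix P assume P: "finite P" "P \<subseteq> L" "\<And>p q. p \<in> P \<Longrightarrow> q \<in> P \<Longrightarrow> p \<noteq> q \<Longrightarrow> H p \<inter> H q = {}"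
    from cb[OF P] show "card P \<le> nat \<lceil>4 ^ n / \<gamma>\<rceil>" by linarith
  next
    fix p assume p: "p \<in> L"
    have "p \<in> H p"
    proof -
      have "vscale n 2 (vadd n p (vneg n p)) = vscale n 0 p" by (auto simp: vscale_def vadd_def vneg_def)
      moreover obtain m where "m \<in> M" using sym_body_nonempty[OF M] by auto
      then have "vscale n 0 m \<in> M" using sym_body_scale[OF M] by simp
      moreover have "vscale n 0 m = vscale n 0 p" by (auto simp: vscale_def)
      ultimately show ?thesis using sym_body_Rn[OF L p] by (simp add: H_def)
    qed
    then show "\<not> H p \<inter> H p = {}" by auto
  qed auto
  then obtain P where P: "finite P" "P \<subseteq> L" "\<forall>p\<in>P. \<forall>q\<in>P. p \<noteq> q \<longrightarrow> H p \<inter> H q = {}"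
    "\<forall>x\<in>L. \<exists>p\<in>P. \<not> H x \<inter> H p = {}" by (elim exE conjE)
  have "\<exists>p\<in>P. vadd n x (vneg n p) \<in> M" if x: "x \<in> L" for x
  proof -
    obtain p z where p: "p \<in> P" "z \<in> H x" "z \<in> H p" using P(4) x by blast
    let ?a = "vscale n 2 (vadd n z (vneg n p))" and ?b = "vscale n 2 (vadd n z (vneg n x))"
    have "?a \<in> M" "?b \<in> M" using p by (auto simp: H_def)
    then have "(\<lambda>i\<in>{..<n}. 1/2 * ?a i + (-1/2) * ?b i) \<in> M" by (intro sym_body_comb[OF M]) auto
    also have "(\<lambda>i\<in>{..<n}. 1/2 * ?a i + (-1/2) * ?b i) = vadd n x (vneg n p)"
      by (auto simp: vscale_def vadd_def vneg_def fun_eq_iff field_simps)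
    finally show ?thesis using p by blast
  qed
  moreover have "real (card P) \<le> 4 ^ n / \<gamma>" using P by (intro cb) auto
  ultimately show thesis using that[of P] P(1,2) by simp
qed

section \<open>Planar rotations and orthogonal frames\<close>

lemma vol_scaling_row:
  assumes ij: "i < n" "j < n" "i \<noteq> j" and a: "a > 0"
  shows "vol_scaling n (\<lambda>x. x(i := a * x i + b * x j)) a"
  unfolding vol_scaling_def
proof (intro conjI ballI)
  show m: "(\<lambda>x. x(i := a * x i + b * x j)) \<in> lebn n \<rightarrow>\<^sub>M lebn n"
  proof (rule measurable_to_lebn)
    fix k assume "k < n"
    then show "(\<lambda>x. (x(i := a * x i + b * x j)) k) \<in> borel_measurable (lebn n)"
      using ij by (cases "k = i") auto
  qed (use ij in \<open>auto intro: upd_Rn'\<close>)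
  fix f :: "(nat \<Rightarrow> real) \<Rightarrow> ennreal" assume f: "f \<in> borel_measurable (lebn n)"
  let ?I = "{..<n} - {i}"
  have ins: "insert i ?I = {..<n}" using ij by auto
  have f': "f \<in> borel_measurable (PiM (insert i ?I) (\<lambda>_. lborel))" unfolding ins using f by (simp only: lebn_def)
  have mf: "(\<lambda>x. f (x(i := a * x i + b * x j))) \<in> borel_measurable (PiM (insert i ?I) (\<lambda>_. lborel))"
    unfolding ins using measurable_comp[OF m f] by (simp only: lebn_def comp_def)
  have "(\<integral>\<^sup>+x. f (x(i := a * x i + b * x j)) \<partial>lebn n) =
    (\<integral>\<^sup>+x. (\<integral>\<^sup>+y. f (x(i := a * y + b * x j)) \<partial>lborel) \<partial>PiM ?I (\<lambda>_. lborel))"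
    using lborel_prod.product_nn_integral_insert[OF _ _ mf] ij unfolding lebn_def ins by simp
  also have "\<dots> = (\<integral>\<^sup>+x. ennreal (1 / a) * (\<integral>\<^sup>+y. f (x(i := y)) \<partial>lborel) \<partial>PiM ?I (\<lambda>_. lborel))"
  proof (rule nn_integral_cong)
    fix x :: "nat \<Rightarrow> real" assume x: "x \<in> space (PiM ?I (\<lambda>_. lborel))"
    have "(\<lambda>y. x(i := y)) \<in> borel \<rightarrow>\<^sub>M lebn n"
    proof (rule measurable_to_lebn)
      fix k show "(\<lambda>y. (x(i := y)) k) \<in> borel_measurable borel" by (cases "k = i") auto
      show "x(i := y) \<in> Rn n" for y using x ij by (auto simp: space_PiM Rn_def PiE_def extensional_def)
    qed
    from measurable_comp[OF this f] have "(\<lambda>y. f (x(i := y))) \<in> borel_measurable borel" by (simp add: comp_def)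
    from nn_integral_affine[OF this a]
    show "(\<integral>\<^sup>+y. f (x(i := a * y + b * x j)) \<partial>lborel) = ennreal (1 / a) * (\<integral>\<^sup>+y. f (x(i := y)) \<partial>lborel)" .
  qed
  also have "\<dots> = ennreal (1 / a) * (\<integral>\<^sup>+x. (\<integral>\<^sup>+y. f (x(i := y)) \<partial>lborel) \<partial>PiM ?I (\<lambda>_. lborel))"
  proof (rule nn_integral_cmult)
    note [measurable] = f'
    show "(\<lambda>x. \<integral>\<^sup>+y. f (x(i := y)) \<partial>lborel) \<in> borel_measurable (PiM ?I (\<lambda>_. lborel))" by measurable
  qed
  also have "(\<integral>\<^sup>+x. (\<integral>\<^sup>+y. f (x(i := y)) \<partial>lborel) \<partial>PiM ?I (\<lambda>_. lborel)) = (\<integral>\<^sup>+x. f x \<partial>lebn n)"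
    using lborel_prod.product_nn_integral_insert[OF _ _ f'] unfolding lebn_def ins by simp
  finally show "(\<integral>\<^sup>+x. f (x(i := a * x i + b * x j)) \<partial>lebn n) = ennreal (1 / a) * (\<integral>\<^sup>+x. f x \<partial>lebn n)" .
qed (rule a)

text \<open>A rotation factors into two operations on single rows, with diagonal entries
  \<open>c\<close> and \<open>1 / c\<close>; therefore \<open>c > 0\<close> is assumed.\<close>

lemma vol_scaling_rotation:
  assumes ij: "i < n" "j < n" "i \<noteq> j" and cs: "c > 0" "c\<^sup>2 + s\<^sup>2 = 1"
  shows "vol_scaling n (\<lambda>x. x(i := c * x i - s * x j, j := s * x i + c * x j)) 1"
proof -
  let ?\<psi> = "\<lambda>x. x(i := c * x i + (- s) * x j)" and ?\<phi> = "\<lambda>x. x(j := (1 / c) * x j + (s / c) * x i)"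
  have "vol_scaling n (\<lambda>x. ?\<phi> (?\<psi> x)) (1 / c * c)"
    using assms by (intro vol_scaling_comp vol_scaling_row) auto
  moreover have "?\<phi> (?\<psi> x) = x(i := c * x i - s * x j, j := s * x i + c * x j)" for x
  proof -
    have "(1 / c) * x j + (s / c) * (c * x i + (- s) * x j) = s * x i + ((1 - s\<^sup>2) / c) * x j"
      using cs by (simp add: field_simps power2_eq_square)
    also have "(1 - s\<^sup>2) / c = c" using cs by (simp add: field_simps power2_eq_square)
    finally show ?thesis using ij by (auto simp: fun_eq_iff)
  qed
  ultimately show ?thesis using cs by simp
qed

definition mm :: "nat \<Rightarrow> (nat \<Rightarrow> nat \<Rightarrow> real) \<Rightarrow> (nat \<Rightarrow> nat \<Rightarrow> real) \<Rightarrow> nat \<Rightarrow> nat \<Rightarrow> real" where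
  "mm n A B i j = (\<Sum>k<n. A i k * B k j)"

lemma mv_mm: "mv n (mm n A B) x = mv n A (mv n B x)"
proof (rule Rn_eqI[of _ n])
  fix i assume i: "i < n"
  have "mv n (mm n A B) x i = (\<Sum>j<n. \<Sum>k<n. A i k * B k j * x j)"
    using i by (simp add: mv_nth mm_def sum_distrib_right)
  also have "\<dots> = (\<Sum>k<n. \<Sum>j<n. A i k * B k j * x j)" by (rule sum.swap)
  also have "\<dots> = mv n A (mv n B x) i" using i by (simp add: mv_nth sum_distrib_left mult.assoc)
  finally show "mv n (mm n A B) x i = mv n A (mv n B x) i" .
qed auto

lemma mv_transp_mm: "mv n (transp (mm n A B)) x = mv n (transp B) (mv n (transp A) x)"
proof -
  have "transp (mm n A B) = mm n (transp B) (transp A)" by (auto simp: mm_def fun_eq_iff mult.commute)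
  then show ?thesis by (simp only: mv_mm)
qed

text \<open>Orthogonal matrices, described by what \<open>Q\<close> and its transpose do to norms
  and volumes; these properties pass directly through a rotation of two rows.\<close>

definition frame :: "nat \<Rightarrow> (nat \<Rightarrow> nat \<Rightarrow> real) \<Rightarrow> bool" where
  "frame n Q \<longleftrightarrow> vol_scaling n (mv n Q) 1 \<and> vol_scaling n (mv n (transp Q)) 1 \<and>
     (\<forall>x. ipn n (mv n Q x) (mv n Q x) = ipn n x x) \<and>
     (\<forall>x. ipn n (mv n (transp Q) x) (mv n (transp Q) x) = ipn n x x)"

definition rot_rows :: "nat \<Rightarrow> nat \<Rightarrow> real \<Rightarrow> real \<Rightarrow> (nat \<Rightarrow> nat \<Rightarrow> real) \<Rightarrow> nat \<Rightarrow> nat \<Rightarrow> real" where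
  "rot_rows i j c s Q = Q(i := (\<lambda>k. c * Q i k - s * Q j k), j := (\<lambda>k. s * Q i k + c * Q j k))"

lemma frame_id: "frame n (\<lambda>i j. if i = j then 1 else 0)"
proof -
  have "mv n (\<lambda>i j. if i = j then 1 else 0) x i = x i" if "i < n" for x i
  proof -
    have "mv n (\<lambda>i j. if i = j then 1 else 0) x i = (\<Sum>j<n. if j = i then x i else 0)"
      unfolding mv_nth[OF that] by (rule sum.cong) auto
    then show ?thesis using that by simp
  qed
  then have id: "mv n (\<lambda>i j. if i = j then 1 else 0) x = x" if "x \<in> Rn n" for x
    using that by (intro Rn_eqI[of _ n]) auto
  have e: "transp (\<lambda>i j::nat. if i = j then 1 else 0::real) = (\<lambda>i j. if i = j then 1 else 0)" by (auto simp: fun_eq_iff)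
  show ?thesis unfolding frame_def e
    using vol_scaling_cong[OF vol_scaling_id id] \<open>\<And>x i. i < n \<Longrightarrow> mv n _ x i = x i\<close>
    by (auto intro!: ipn_cong)
qed

lemma sum_two:
  assumes "i < (n::nat)" "j < n" "i \<noteq> j"
  shows "(\<Sum>k<n. f k) = f i + f j + (\<Sum>k\<in>{..<n} - {i, j}. f k :: real)"
proof -
  have "(\<Sum>k<n. f k) = (\<Sum>k\<in>{..<n} - {i, j}. f k) + (\<Sum>k\<in>{i, j}. f k)"
    using assms by (intro sum.subset_diff) auto
  then show ?thesis using assms by simp
qed

lemma frame_rot:
  assumes Q: "frame n Q" and ij: "i < n" "j < n" "i \<noteq> j" and cs: "c > 0" "c\<^sup>2 + s\<^sup>2 = 1"
  shows "frame n (rot_rows i j c s Q)"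
proof -
  let ?R = "rot_rows i j c s Q"
  let ?g = "\<lambda>s x. x(i := c * x i - s * x j, j := s * x i + c * x j)"
  have vg: "vol_scaling n (?g s) 1" by (rule vol_scaling_rotation[OF ij cs])
  have vg': "vol_scaling n (?g (- s)) 1" by (rule vol_scaling_rotation[OF ij cs(1)]) (simp add: cs(2))
  have R: "?R i k = c * Q i k - s * Q j k" "?R j k = s * Q i k + c * Q j k" "l \<noteq> i \<Longrightarrow> l \<noteq> j \<Longrightarrow> ?R l k = Q l k" for k l
    using ij by (auto simp: rot_rows_def)
  have 1: "mv n ?R x = ?g s (mv n Q x)" for x
  proof (rule Rn_eqI[of _ n])
    show "?g s (mv n Q x) \<in> Rn n" using ij by (intro upd_Rn') auto
    fix k assume "k < n"
    then show "mv n ?R x k = ?g s (mv n Q x) k"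
      using ij by (cases "k = i"; cases "k = j")
        (auto simp: mv_nth R left_diff_distrib distrib_right sum.distrib sum_subtractf sum_distrib_left mult.assoc)
  qed auto
  have 2: "mv n (transp ?R) x = mv n (transp Q) (?g (- s) x)" for x
  proof (rule Rn_eqI[of _ n])
    fix k assume k: "k < n"
    have "mv n (transp ?R) x k = (\<Sum>l<n. ?R l k * x l)" using k by (simp add: mv_nth)
    also have "\<dots> = ?R i k * x i + ?R j k * x j + (\<Sum>l\<in>{..<n} - {i, j}. ?R l k * x l)" by (rule sum_two[OF ij])
    also have "(\<Sum>l\<in>{..<n} - {i, j}. ?R l k * x l) = (\<Sum>l\<in>{..<n} - {i, j}. Q l k * ?g (- s) x l)"
      by (intro sum.cong refl) (auto simp: R)
    also have "?R i k * x i + ?R j k * x j = Q i k * ?g (- s) x i + Q j k * ?g (- s) x j"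
      using ij by (simp add: R algebra_simps)
    also have "\<dots> + (\<Sum>l\<in>{..<n} - {i, j}. Q l k * ?g (- s) x l) = (\<Sum>l<n. Q l k * ?g (- s) x l)"
      by (rule sum_two[OF ij, symmetric])
    also have "\<dots> = mv n (transp Q) (?g (- s) x) k" using k by (simp add: mv_nth)
    finally show "mv n (transp ?R) x k = mv n (transp Q) (?g (- s) x) k" .
  qed auto
  have 3: "ipn n (?g s y) (?g s y) = ipn n y y" if "c\<^sup>2 + s\<^sup>2 = 1" for y s
  proof -
    have "ipn n (?g s y) (?g s y) = (c * y i - s * y j)\<^sup>2 + (s * y i + c * y j)\<^sup>2 + (\<Sum>l\<in>{..<n} - {i, j}. y l * y l)"
      unfolding ipn_def using ij by (subst sum_two[OF ij]) (auto simp: power2_eq_square intro!: sum.cong)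
    also have "(c * y i - s * y j)\<^sup>2 + (s * y i + c * y j)\<^sup>2 = (c\<^sup>2 + s\<^sup>2) * (y i)\<^sup>2 + (c\<^sup>2 + s\<^sup>2) * (y j)\<^sup>2"
      by (simp add: power2_eq_square algebra_simps)
    also have "\<dots> + (\<Sum>l\<in>{..<n} - {i, j}. y l * y l) = ipn n y y"
      unfolding ipn_def that by (subst sum_two[OF ij, of "\<lambda>l. y l * y l"]) (simp add: power2_eq_square)
    finally show ?thesis .
  qed
  have "vol_scaling n (\<lambda>x. ?g s (mv n Q x)) (1 * 1)" "vol_scaling n (\<lambda>x. mv n (transp Q) (?g (- s) x)) (1 * 1)"
    using Q by (intro vol_scaling_comp[OF vg] vol_scaling_comp[OF _ vg']; simp add: frame_def)+
  then show ?thesis unfolding frame_def 1 2 using 3[of s] 3[of "- s"] Q cs by (simp add: frame_def)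
qed

text \<open>The Jacobi rotation for a symmetric 2 by 2 matrix with diagonal \<open>a\<close>,
  \<open>b\<close> and off-diagonal \<open>m\<close>. The rotated off-diagonal entry goes from
  \<open>m\<close> to \<open>- m\<close> between angle 0 and a right angle, so it vanishes in
  between, and not at the right angle itself.\<close>

lemma rotation_diag_exists:
  fixes a b m :: real assumes "m \<noteq> 0"
  obtains c s where "c > 0" "c\<^sup>2 + s\<^sup>2 = 1" "c * s * (a - b) + (c\<^sup>2 - s\<^sup>2) * m = 0"
proof -
  define f where "f = (\<lambda>t. cos t * sin t * (a - b) + ((cos t)\<^sup>2 - (sin t)\<^sup>2) * m)"
  have cont: "continuous_on {0..pi/2} f" unfolding f_def by (intro continuous_intros)
  have f0: "f 0 = m" "f (pi/2) = - m" by (simp_all add: f_def)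
  have "\<exists>t\<ge>0. t \<le> pi/2 \<and> f t = 0"
  proof (cases "m > 0")
    case True
    then show ?thesis using IVT2'[of f "pi/2" 0 0] f0 cont by auto
  next
    case False
    then show ?thesis using IVT'[of f 0 0 "pi/2"] f0 cont assms by auto
  qed
  then obtain t where t: "0 \<le> t" "t \<le> pi/2" "f t = 0" by blast
  have "t \<noteq> pi/2"
  proof
    assume e: "t = pi/2"
    show False using t(3)[unfolded e] f0(2) assms by simp
  qed
  then have "cos t > 0" using t by (intro cos_gt_zero_pi) auto
  then show thesis using that[of "cos t" "sin t"] t(3) by (simp add: f_def)
qed

section \<open>Volumes of ellipsoids and approximate diagonalisation\<close>

lemma emeasure_ball:
  assumes "r > 0"
  shows "emeasure (lebn n) {x \<in> Rn n. ipn n x x \<le> r\<^sup>2} = ennreal (Ball_Volume.unit_ball_vol (real n) * r ^ n)"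
proof -
  have "{x \<in> Rn n. ipn n x x \<le> r\<^sup>2} = {f. sqrt (\<Sum>i\<in>{..<n}. (f i)\<^sup>2) \<le> r} \<inter> space (PiM {..<n} (\<lambda>_. lborel))"
    using assms by (auto simp: ipn_def power2_eq_square[symmetric] real_sqrt_le_iff' sum_nonneg space_PiM Rn_def)
  then show ?thesis using emeasure_cball_aux[of "{..<n}" r] assms by (simp add: lebn_def)
qed

definition diag_mat :: "(nat \<Rightarrow> real) \<Rightarrow> nat \<Rightarrow> nat \<Rightarrow> real" where
  "diag_mat d i j = (if i = j then d i else 0)"

lemma mv_diag: "i < n \<Longrightarrow> mv n (diag_mat d) x i = d i * x i"
proof -
  assume i: "i < n"
  have "mv n (diag_mat d) x i = (\<Sum>j<n. if j = i then d i * x i else 0)"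
    unfolding mv_nth[OF i] by (rule sum.cong) (auto simp: diag_mat_def)
  then show ?thesis using i by simp
qed

lemma vol_scaling_diag:
  assumes "\<And>i. i < n \<Longrightarrow> d i > 0"
  shows "vol_scaling n (mv n (diag_mat d)) (\<Prod>i<n. d i)"
proof -
  have "lower_tri n (diag_mat d)" using assms by (auto simp: lower_tri_def diag_mat_def)
  from vol_scaling_lower_tri[OF this] show ?thesis by (simp add: diag_prod_def diag_mat_def)
qed

lemma ipn_diag: "ipn n (mv n (diag_mat d) x) (mv n (diag_mat d) x) = (\<Sum>i<n. (d i)\<^sup>2 * (x i)\<^sup>2)"
  unfolding ipn_def by (intro sum.cong refl) (simp add: mv_diag power2_eq_square)

lemma ellipsoid_sets:
  assumes "vol_scaling n \<phi> d" shows "{x \<in> Rn n. ipn n (\<phi> x) (\<phi> x) \<le> c} \<in> sets (lebn n)"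
proof -
  note [measurable] = vol_scalingD(2)[OF assms]
  have "{x \<in> Rn n. ipn n (\<phi> x) (\<phi> x) \<le> c} = {x \<in> space (lebn n). ipn n (\<phi> x) (\<phi> x) \<le> c}" by simp
  also have "\<dots> \<in> sets (lebn n)" by measurable
  finally show ?thesis .
qed

lemma emeasure_ellipsoid:
  assumes \<phi>: "vol_scaling n \<phi> d" and r: "r > 0"
  shows "emeasure (lebn n) {x \<in> Rn n. ipn n (\<phi> x) (\<phi> x) \<le> r\<^sup>2} = ennreal (Ball_Volume.unit_ball_vol (real n) * r ^ n / d)"
proof -
  have R: "x \<in> Rn n \<Longrightarrow> \<phi> x \<in> Rn n" for x using measurable_space[OF vol_scalingD(2)[OF \<phi>], of x] by simp
  have "{x \<in> Rn n. ipn n (\<phi> x) (\<phi> x) \<le> r\<^sup>2} = {x \<in> Rn n. \<phi> x \<in> {y \<in> Rn n. ipn n y y \<le> r\<^sup>2}}" using R by auto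
  also have "emeasure (lebn n) \<dots> = ennreal (1 / d) * emeasure (lebn n) {y \<in> Rn n. ipn n y y \<le> r\<^sup>2}"
    by (rule vol_scaling_emeasure[OF \<phi> ellipsoid_sets[OF vol_scaling_id]])
  also have "\<dots> = ennreal (Ball_Volume.unit_ball_vol (real n) * r ^ n / d)"
    unfolding emeasure_ball[OF r] using r vol_scalingD(1)[OF \<phi>]
    by (subst ennreal_mult[symmetric]) auto
  finally show ?thesis .
qed

text \<open>Inclusion of ellipsoids compares their volumes; this takes the place of the monotonicity
  of determinants of positive definite forms.\<close>

lemma vol_scaling_le_prod:
  assumes \<phi>: "vol_scaling n \<phi> \<Delta>" and d: "\<And>i. i < n \<Longrightarrow> d i > 0" and c: "c > 0"
    and le: "\<And>t. ipn n (\<phi> t) (\<phi> t) \<le> c\<^sup>2 * (\<Sum>i<n. (d i)\<^sup>2 * (t i)\<^sup>2)"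
  shows "\<Delta> \<le> c ^ n * (\<Prod>i<n. d i)"
proof -
  let ?V = "Ball_Volume.unit_ball_vol (real n)"
  let ?P = "\<Prod>i<n. d i"
  have V: "?V > 0" by simp
  have P: "?P > 0" using d by (intro prod_pos) auto
  have D: "\<Delta> > 0" by (rule vol_scalingD(1)[OF \<phi>])
  have "{x \<in> Rn n. ipn n (mv n (diag_mat d) x) (mv n (diag_mat d) x) \<le> (1 / c)\<^sup>2} \<subseteq> {x \<in> Rn n. ipn n (\<phi> x) (\<phi> x) \<le> 1\<^sup>2}"
  proof (intro subsetI CollectI conjI; elim CollectE conjE)
    fix x assume "ipn n (mv n (diag_mat d) x) (mv n (diag_mat d) x) \<le> (1 / c)\<^sup>2"
    then have "c\<^sup>2 * (\<Sum>i<n. (d i)\<^sup>2 * (x i)\<^sup>2) \<le> c\<^sup>2 * (1 / c)\<^sup>2" unfolding ipn_diag by (intro mult_left_mono) auto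
    also have "\<dots> = 1\<^sup>2" using c by (simp add: power_divide)
    finally show "ipn n (\<phi> x) (\<phi> x) \<le> 1\<^sup>2" using le[of x] by linarith
  qed
  then have "emeasure (lebn n) {x \<in> Rn n. ipn n (mv n (diag_mat d) x) (mv n (diag_mat d) x) \<le> (1 / c)\<^sup>2} \<le>
     emeasure (lebn n) {x \<in> Rn n. ipn n (\<phi> x) (\<phi> x) \<le> 1\<^sup>2}"
    by (rule emeasure_mono) (rule ellipsoid_sets[OF \<phi>])
  then have "ennreal (?V * (1 / c) ^ n / ?P) \<le> ennreal (?V * 1 ^ n / \<Delta>)"
    using emeasure_ellipsoid[OF vol_scaling_diag[OF d], where r = "1 / c"] emeasure_ellipsoid[OF \<phi>, where r = 1] c by simp
  then have "?V * (1 / c) ^ n / ?P \<le> ?V / \<Delta>" using V D by (subst (asm) ennreal_le_iff) auto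
  then have "?V * \<Delta> \<le> ?V * (c ^ n * ?P)" using P D c by (simp add: field_simps power_one_over)
  then show ?thesis using V by (simp only: mult_le_cancel_left_pos)
qed

text \<open>An approximate singular value decomposition: a frame that nearly minimises the product of the
  squared lengths of the images is nearly mapped to an orthogonal system, since otherwise a planar
  rotation would decrease the product.\<close>

lemma near_orthogonal_frame:
  assumes S: "vol_scaling n (mv n S) \<Delta>" and n: "n > 0"
    and inj: "\<And>v. (\<exists>i<n. v i \<noteq> 0) \<Longrightarrow> ipn n (mv n S v) (mv n S v) > 0"
  obtains Q d where "frame n Q" "\<And>i. i < n \<Longrightarrow> d i > 0"
    "\<And>t. (\<Sum>i<n. (d i)\<^sup>2 * (t i)\<^sup>2) \<le> 2 * ipn n (mv n S (mv n (transp Q) t)) (mv n S (mv n (transp Q) t))"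
    "\<Delta> \<le> 2 ^ n * (\<Prod>i<n. d i)"
proof -
  \<comment> \<open>The Gram matrix of the images under \<open>S\<close> of the rows of
    \<open>Q\<close>.\<close>
  define N where "N = (\<lambda>(Q :: nat \<Rightarrow> nat \<Rightarrow> real) i j. ipn n (mv n S (Q i)) (mv n S (Q j)))"
  define \<Phi> where "\<Phi> = (\<lambda>Q. \<Prod>i<n. N Q i i)"
  have quad: "ipn n (mv n S (mv n (transp Q) t)) (mv n S (mv n (transp Q) t)) = (\<Sum>i<n. \<Sum>j<n. t i * t j * N Q i j)" for Q t
  proof -
    have e: "mv n S (mv n (transp Q) t) l = (\<Sum>i<n. t i * mv n S (Q i) l)" if "l < n" for l
    proof -
      have "mv n S (mv n (transp Q) t) l = (\<Sum>k<n. \<Sum>i<n. S l k * (Q i k * t i))"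
        using that by (simp add: mv_nth sum_distrib_left)
      also have "\<dots> = (\<Sum>i<n. \<Sum>k<n. S l k * (Q i k * t i))" by (rule sum.swap)
      also have "\<dots> = (\<Sum>i<n. t i * mv n S (Q i) l)" using that by (simp add: mv_nth sum_distrib_left mult_ac)
      finally show ?thesis .
    qed
    have "ipn n (mv n S (mv n (transp Q) t)) (mv n S (mv n (transp Q) t)) =
       (\<Sum>l<n. \<Sum>i<n. \<Sum>j<n. t i * mv n S (Q i) l * (t j * mv n S (Q j) l))"
      unfolding ipn_def by (intro sum.cong refl) (simp add: e sum_product)
    also have "\<dots> = (\<Sum>i<n. \<Sum>l<n. \<Sum>j<n. t i * mv n S (Q i) l * (t j * mv n S (Q j) l))" by (rule sum.swap)
    also have "\<dots> = (\<Sum>i<n. \<Sum>j<n. \<Sum>l<n. t i * mv n S (Q i) l * (t j * mv n S (Q j) l))" by (intro sum.cong refl sum.swap)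
    also have "\<dots> = (\<Sum>i<n. \<Sum>j<n. t i * t j * N Q i j)" unfolding N_def ipn_def by (simp add: sum_distrib_left mult_ac)
    finally show ?thesis .
  qed
  have N_pos: "N Q i i > 0" if "frame n Q" "i < n" for Q i
  proof -
    have "ipn n (mv n (transp Q) (\<lambda>k. if k = i then 1 else 0)) (mv n (transp Q) (\<lambda>k. if k = i then 1 else 0)) =
       ipn n (\<lambda>k. if k = i then 1 else 0) (\<lambda>k. if k = i then 1 else 0)" using that(1) by (simp add: frame_def)
    also have "\<dots> = (\<Sum>k<n. if k = i then 1 else 0)" unfolding ipn_def by (rule sum.cong) auto
    also have "\<dots> = 1" using that by simp
    also have "ipn n (mv n (transp Q) (\<lambda>k. if k = i then 1 else 0)) (mv n (transp Q) (\<lambda>k. if k = i then 1 else 0)) = ipn n (Q i) (Q i)"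
    proof -
      have "mv n (transp Q) (\<lambda>k. if k = i then 1 else 0) l = Q i l" if "l < n" for l
      proof -
        have "mv n (transp Q) (\<lambda>k. if k = i then 1 else 0) l = (\<Sum>k<n. if k = i then Q i l else 0)"
          unfolding mv_nth[OF that] by (rule sum.cong) auto
        then show ?thesis using \<open>i < n\<close> by simp
      qed
      then show ?thesis by (intro ipn_cong) auto
    qed
    finally have "ipn n (Q i) (Q i) = 1" .
    then have "\<exists>k<n. Q i k \<noteq> 0" using ipn_self_eq_0[of n "Q i"] by auto
    from inj[OF this] show ?thesis by (simp add: N_def)
  qed
  have CS: "(\<Sum>i<n. \<bar>t i\<bar> * d i)\<^sup>2 \<le> real n * (\<Sum>i<n. (d i)\<^sup>2 * (t i)\<^sup>2)" for t d :: "nat \<Rightarrow> real"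
  proof -
    have "(\<Sum>i<n. 1 * (\<bar>t i\<bar> * d i))\<^sup>2 \<le> (\<Sum>i<n. 1\<^sup>2) * (\<Sum>i<n. (\<bar>t i\<bar> * d i)\<^sup>2)" by (rule Cauchy_Schwarz_ineq_sum)
    then show ?thesis by (simp add: power_mult_distrib mult.commute)
  qed
  have vsQ: "vol_scaling n (\<lambda>t. mv n S (mv n (transp Q) t)) (\<Delta> * 1)" if "frame n Q" for Q
    using that S by (intro vol_scaling_comp) (auto simp: frame_def)
  \<comment> \<open>Off-diagonal entries bounded by \<open>\<theta> * (d i * d j)\<close> perturb
    the diagonal part of the quadratic form by at most the proportion
    \<open>\<theta> * n = 1/2\<close>.\<close>
  define \<theta> where "\<theta> = 1 / (2 * real n)"
  have "\<theta> \<le> 1/2" "0 < \<theta>" using n by (auto simp: \<theta>_def field_simps)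
  then have "\<theta>\<^sup>2 \<le> (1/2)\<^sup>2" by (intro power_mono) auto
  then have \<theta>: "\<theta> > 0" "\<theta>\<^sup>2 < 1" "\<theta> * real n = 1/2"
    using n \<open>0 < \<theta>\<close> by (auto simp: power2_eq_square) (simp add: \<theta>_def)
  \<comment> \<open>Cauchy-Schwarz bounds the Gram form by a multiple of its diagonal part, so
    volume keeps the product away from 0. Only with a positive infimum can a frame be minimal up to
    a factor.\<close>
  have lower: "(\<Delta> / real n ^ n)\<^sup>2 \<le> \<Phi> Q" if Q: "frame n Q" for Q
  proof -
    define d where "d = (\<lambda>i. sqrt (N Q i i))"
    have d: "d i > 0" "(d i)\<^sup>2 = N Q i i" if "i < n" for i using N_pos[OF Q that] by (auto simp: d_def)
    have "\<Delta> * 1 \<le> real n ^ n * (\<Prod>i<n. d i)"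
    proof (rule vol_scaling_le_prod[OF vsQ[OF Q]])
      fix t
      have "(\<Sum>i<n. \<Sum>j<n. t i * t j * N Q i j) \<le> (\<Sum>i<n. \<Sum>j<n. (\<bar>t i\<bar> * d i) * (\<bar>t j\<bar> * d j))"
      proof (intro sum_mono)
        fix i j assume ij: "i \<in> {..<n}" "j \<in> {..<n}"
        have "\<bar>N Q i j\<bar> \<le> d i * d j" unfolding N_def using d ij by (intro abs_ipn_le) (auto simp: N_def less_imp_le)
        then have "\<bar>t i * t j\<bar> * \<bar>N Q i j\<bar> \<le> \<bar>t i * t j\<bar> * (d i * d j)" by (intro mult_left_mono) auto
        then have "\<bar>t i * t j * N Q i j\<bar> \<le> (\<bar>t i\<bar> * d i) * (\<bar>t j\<bar> * d j)" by (simp add: abs_mult mult_ac)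
        then show "t i * t j * N Q i j \<le> (\<bar>t i\<bar> * d i) * (\<bar>t j\<bar> * d j)" by linarith
      qed
      also have "\<dots> = (\<Sum>i<n. \<bar>t i\<bar> * d i)\<^sup>2" by (simp add: power2_eq_square sum_product)
      also have "\<dots> \<le> real n * (\<Sum>i<n. (d i)\<^sup>2 * (t i)\<^sup>2)" by (rule CS)
      also have "\<dots> \<le> (real n)\<^sup>2 * (\<Sum>i<n. (d i)\<^sup>2 * (t i)\<^sup>2)"
        using n by (intro mult_right_mono sum_nonneg) (auto simp: power2_eq_square)
      finally show "ipn n (mv n S (mv n (transp Q) t)) (mv n S (mv n (transp Q) t)) \<le> (real n)\<^sup>2 * (\<Sum>i<n. (d i)\<^sup>2 * (t i)\<^sup>2)"
        unfolding quad .
    qed (use d n in auto)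
    then have "\<Delta> / real n ^ n \<le> (\<Prod>i<n. d i)" using n by (simp add: pos_divide_le_eq mult.commute)
    then have "(\<Delta> / real n ^ n)\<^sup>2 \<le> (\<Prod>i<n. d i)\<^sup>2" using vol_scalingD(1)[OF S] by (intro power_mono) auto
    also have "\<dots> = \<Phi> Q" unfolding \<Phi>_def prod_power_distrib by (intro prod.cong refl) (simp add: d)
    finally show ?thesis .
  qed
  define I where "I = Inf (\<Phi> ` {Q. frame n Q})"
  have ne: "\<Phi> ` {Q. frame n Q} \<noteq> {}" using frame_id by blast
  have bb: "bdd_below (\<Phi> ` {Q. frame n Q})" using lower by (auto simp: bdd_below_def)
  have I0: "0 < I"
  proof -
    have "(\<Delta> / real n ^ n)\<^sup>2 \<le> I" unfolding I_def by (rule cInf_greatest[OF ne]) (use lower in auto)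
    moreover have "0 < (\<Delta> / real n ^ n)\<^sup>2" using vol_scalingD(1)[OF S] n by simp
    ultimately show ?thesis by linarith
  qed
  have "I < I / (1 - \<theta>\<^sup>2)" using I0 \<theta> by (simp add: less_divide_eq mult_less_cancel_left1)
  then obtain Q where Q: "frame n Q" "\<Phi> Q < I / (1 - \<theta>\<^sup>2)"
    using cInf_lessD[OF ne, of "I / (1 - \<theta>\<^sup>2)"] unfolding I_def by blast
  have Qmin: "(1 - \<theta>\<^sup>2) * \<Phi> Q \<le> \<Phi> Q'" if "frame n Q'" for Q'
  proof -
    have "(1 - \<theta>\<^sup>2) * \<Phi> Q \<le> I" using Q(2) \<theta> by (simp add: less_divide_eq mult.commute)
    also have "I \<le> \<Phi> Q'" unfolding I_def by (rule cInf_lower[OF _ bb]) (use that in auto)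
    finally show ?thesis .
  qed
  define d where "d = (\<lambda>i. sqrt (N Q i i))"
  have d: "d i > 0" "(d i)\<^sup>2 = N Q i i" if "i < n" for i using N_pos[OF Q(1) that] by (auto simp: d_def)
  have off: "\<bar>N Q i j\<bar> \<le> \<theta> * (d i * d j)" if ij: "i < n" "j < n" "i \<noteq> j" for i j
  proof (cases "N Q i j = 0")
    case True then show ?thesis using d ij \<theta> by (simp add: less_imp_le)
  next
    case False
    define a b m where "a = N Q i i" and "b = N Q j j" and "m = N Q i j"
    have m': "N Q j i = m" by (simp add: m_def N_def ipn_commute)
    obtain c s where cs: "c > 0" "c\<^sup>2 + s\<^sup>2 = 1" "c * s * (a - b) + (c\<^sup>2 - s\<^sup>2) * m = 0"
      using rotation_diag_exists[of m a b] False unfolding m_def by blast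
    let ?R = "rot_rows i j c s Q"
    have R: "?R i = (\<lambda>k. c * Q i k - s * Q j k)" "?R j = (\<lambda>k. s * Q i k + c * Q j k)" "\<And>l. l \<noteq> i \<Longrightarrow> l \<noteq> j \<Longrightarrow> ?R l = Q l"
      using ij by (auto simp: rot_rows_def)
    have Nii: "N ?R i i = c\<^sup>2 * a - 2 * c * s * m + s\<^sup>2 * b"
      unfolding N_def R(1) ipn_mv_diff[of n S "\<lambda>k. c * Q i k"] ipn_mv_diff'[of n _ S "\<lambda>k. c * Q i k"] ipn_mv_scale ipn_mv_scale'
      using m' by (simp add: a_def b_def m_def N_def power2_eq_square algebra_simps)
    have Njj: "N ?R j j = s\<^sup>2 * a + 2 * c * s * m + c\<^sup>2 * b"
      unfolding N_def R(2) ipn_mv_add[of n S "\<lambda>k. s * Q i k"] ipn_mv_add'[of n _ S "\<lambda>k. s * Q i k"] ipn_mv_scale ipn_mv_scale'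
      using m' by (simp add: a_def b_def m_def N_def power2_eq_square algebra_simps)
    \<comment> \<open>The determinant of the rotated 2 by 2 block, which equals the old one, plus
      the square of its off-diagonal entry, which the chosen angle makes 0.\<close>
    have "N ?R i i * N ?R j j = (c\<^sup>2 + s\<^sup>2)\<^sup>2 * (a * b - m\<^sup>2) + (c * s * (a - b) + (c\<^sup>2 - s\<^sup>2) * m)\<^sup>2"
      unfolding Nii Njj by (simp add: power2_eq_square algebra_simps)
    then have prod: "N ?R i i * N ?R j j = a * b - m\<^sup>2" unfolding cs(2,3) by simp
    define P where "P = (\<Prod>k\<in>{..<n} - {i, j}. N Q k k)"
    have P: "P > 0" unfolding P_def using N_pos[OF Q(1)] by (intro prod_pos) auto
    have two: "(\<Prod>k<n. f k) = (\<Prod>k\<in>{..<n} - {i, j}. f k) * (f i * f j)" for f :: "nat \<Rightarrow> real"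
    proof -
      have "(\<Prod>k<n. f k) = (\<Prod>k\<in>{..<n} - {i, j}. f k) * (\<Prod>k\<in>{i, j}. f k)"
        using ij by (intro prod.subset_diff) auto
      then show ?thesis using ij by simp
    qed
    have 1: "\<Phi> Q = P * (a * b)" unfolding \<Phi>_def two P_def a_def b_def by simp
    have 2: "\<Phi> ?R = P * (a * b - m\<^sup>2)"
      unfolding \<Phi>_def two prod P_def using R(3) by (intro arg_cong2[where f="(*)"] prod.cong refl) (auto simp: N_def)
    have "P * ((1 - \<theta>\<^sup>2) * (a * b)) \<le> P * (a * b - m\<^sup>2)"
      using Qmin[OF frame_rot[OF Q(1) ij cs(1,2)]] unfolding 1 2 by (simp add: mult_ac)
    then have "(1 - \<theta>\<^sup>2) * (a * b) \<le> a * b - m\<^sup>2" using P by (simp only: mult_le_cancel_left_pos)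
    then have "m\<^sup>2 \<le> \<theta>\<^sup>2 * (a * b)" by (simp add: algebra_simps)
    also have "\<dots> = (\<theta> * (d i * d j))\<^sup>2" using d ij by (simp add: a_def b_def power_mult_distrib)
    finally have "\<bar>m\<bar>\<^sup>2 \<le> (\<theta> * (d i * d j))\<^sup>2" by simp
    then have "\<bar>m\<bar> \<le> \<theta> * (d i * d j)" by (rule power2_le_imp_le) (use d ij \<theta> in \<open>simp add: less_imp_le\<close>)
    then show ?thesis by (simp add: m_def)
  qed
  have main: "\<bar>(\<Sum>i<n. \<Sum>j<n. t i * t j * N Q i j) - (\<Sum>i<n. (d i)\<^sup>2 * (t i)\<^sup>2)\<bar> \<le> (\<Sum>i<n. (d i)\<^sup>2 * (t i)\<^sup>2) / 2" for t
  proof -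
    have "(\<Sum>i<n. (d i)\<^sup>2 * (t i)\<^sup>2) = (\<Sum>i<n. \<Sum>j<n. if j = i then (d i)\<^sup>2 * (t i)\<^sup>2 else 0)" by simp
    then have "(\<Sum>i<n. \<Sum>j<n. t i * t j * N Q i j) - (\<Sum>i<n. (d i)\<^sup>2 * (t i)\<^sup>2) =
      (\<Sum>i<n. \<Sum>j<n. t i * t j * N Q i j - (if j = i then (d i)\<^sup>2 * (t i)\<^sup>2 else 0))" by (simp add: sum_subtractf)
    also have "\<bar>\<dots>\<bar> \<le> (\<Sum>i<n. \<Sum>j<n. \<theta> * ((\<bar>t i\<bar> * d i) * (\<bar>t j\<bar> * d j)))"
    proof (intro order_trans[OF sum_abs] sum_mono)
      fix i j assume ij: "i \<in> {..<n}" "j \<in> {..<n}"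
      show "\<bar>t i * t j * N Q i j - (if j = i then (d i)\<^sup>2 * (t i)\<^sup>2 else 0)\<bar> \<le> \<theta> * ((\<bar>t i\<bar> * d i) * (\<bar>t j\<bar> * d j))"
      proof (cases "i = j")
        case True
        have "t i * t i * N Q i i - (d i)\<^sup>2 * (t i)\<^sup>2 = 0" using d ij by (simp add: power2_eq_square)
        then show ?thesis using True \<theta> d ij by (auto simp: less_imp_le)
      next
        case False
        have "\<bar>t i * t j\<bar> * \<bar>N Q i j\<bar> \<le> \<bar>t i * t j\<bar> * (\<theta> * (d i * d j))" using off[of i j] ij False by (intro mult_left_mono) auto
        then show ?thesis using False by (simp add: abs_mult mult_ac)
      qed
    qed
    also have "\<dots> = \<theta> * (\<Sum>i<n. \<bar>t i\<bar> * d i)\<^sup>2"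
      by (simp only: power2_eq_square sum_product) (simp only: sum_distrib_left)
    also have "\<dots> \<le> \<theta> * (real n * (\<Sum>i<n. (d i)\<^sup>2 * (t i)\<^sup>2))" using \<theta> CS by (intro mult_left_mono) auto
    also have "\<dots> = (\<theta> * real n) * (\<Sum>i<n. (d i)\<^sup>2 * (t i)\<^sup>2)" by (simp only: mult.assoc)
    finally show ?thesis unfolding \<theta>(3) by simp
  qed
  show thesis
  proof (rule that[of Q d])
    show "frame n Q" by (rule Q(1))
    show "d i > 0" if "i < n" for i using d that by blast
    show "(\<Sum>i<n. (d i)\<^sup>2 * (t i)\<^sup>2) \<le> 2 * ipn n (mv n S (mv n (transp Q) t)) (mv n S (mv n (transp Q) t))" for t
      unfolding quad power2_eq_square[of "2::real"] using main[of t, unfolded abs_le_iff] by linarith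
    have "\<Delta> * 1 \<le> 2 ^ n * (\<Prod>i<n. d i)"
    proof (rule vol_scaling_le_prod[OF vsQ[OF Q(1)]])
      fix t
      have "0 \<le> (\<Sum>i<n. (d i)\<^sup>2 * (t i)\<^sup>2)" by (intro sum_nonneg) auto
      then show "ipn n (mv n S (mv n (transp Q) t)) (mv n S (mv n (transp Q) t)) \<le> 2\<^sup>2 * (\<Sum>i<n. (d i)\<^sup>2 * (t i)\<^sup>2)"
        unfolding quad power2_eq_square[of "2::real"] using main[of t, unfolded abs_le_iff] by linarith
    qed (use d in auto)
    then show "\<Delta> \<le> 2 ^ n * (\<Prod>i<n. d i)" by simp
  qed
qed

lemma lower_tri_inj:
  assumes A: "lower_tri n A" and z: "\<And>i. i < n \<Longrightarrow> mv n A v i = 0" and i: "i < n"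
  shows "v i = 0"
  using i
proof (induction i rule: less_induct)
  case (less i)
  have "0 = (\<Sum>j<n. A i j * v j)" using z[OF less.prems] by (simp add: mv_nth less.prems)
  also have "\<dots> = (\<Sum>j<n. if j = i then A i i * v i else 0)"
  proof (rule sum.cong[OF refl])
    fix j assume "j \<in> {..<n}"
    then show "A i j * v j = (if j = i then A i i * v i else 0)"
      using less A by (cases j i rule: linorder_cases) (auto simp: lower_tri_def)
  qed
  also have "\<dots> = A i i * v i" using less.prems by simp
  finally show ?case using A less.prems by (auto simp: lower_tri_def)
qed

lemma upper_tri_inj:
  assumes A: "lower_tri n A" and z: "\<And>i. i < n \<Longrightarrow> mv n (transp A) v i = 0" and i: "i < n"
  shows "v i = 0"
  using i
proof (induction "n - i" arbitrary: i rule: less_induct)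
  case (less i)
  have "0 = (\<Sum>j<n. A j i * v j)" using z[OF less.prems] by (simp add: mv_nth less.prems)
  also have "\<dots> = (\<Sum>j<n. if j = i then A i i * v i else 0)"
  proof (rule sum.cong[OF refl])
    fix j assume j: "j \<in> {..<n}"
    then show "A j i * v j = (if j = i then A i i * v i else 0)"
      using less.hyps[of j] A less.prems by (cases j i rule: linorder_cases) (auto simp: lower_tri_def)
  qed
  also have "\<dots> = A i i * v i" using less.prems by simp
  finally show ?case using A less.prems by (auto simp: lower_tri_def)
qed

text \<open>The M-ellipsoids bound \<open>det A * |L|\<close> and \<open>det F * |U|\<close> from
  below, so it suffices to bound \<open>\<Delta> = det F * det A\<close> from above. In the
  coordinates \<open>K\<close> the truncated body \<open>L'\<close> and the dual translates of
  \<open>U'\<close> are controlled by the same diagonal form \<open>q\<close>. Projecting onto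
  \<open>L\<close> writes every point of a Euclidean ball as a point of \<open>L\<close> plus a
  residual that \<open>K^T K\<close> sends into \<open>U\<close>; the two coverings then cover the
  ball by at most \<open>144 ^ n\<close> translates of a \<open>q\<close>-ellipsoid, and comparing
  volumes bounds the product of the \<open>d i\<close>.\<close>

theorem reverse_santalo:
  assumes L: "sym_body n L" and n: "n > 0"
  shows "(1 / 10 ^ 14) ^ n \<le> voln n L * voln n (polar n L (real n))"
proof -
  define U where "U = polar n L (real n)"
  have U: "sym_body n U" unfolding U_def using n by (intro sym_body_polar[OF L]) auto
  have vLU: "voln n L > 0" "voln n U > 0" using sym_body_emeasure[OF L] sym_body_emeasure[OF U] by auto
  obtain A where A: "lower_tri n A"
    "exp (- real n) * voln n L \<le> voln n {x \<in> L. ipn n (mv n A x) (mv n A x) \<le> real n}"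
    "(1 / 5376) ^ n \<le> diag_prod n A * voln n L" using M_ellipsoid[OF L n] by blast
  obtain F where F: "lower_tri n F"
    "exp (- real n) * voln n U \<le> voln n {x \<in> U. ipn n (mv n F x) (mv n F x) \<le> real n}"
    "(1 / 5376) ^ n \<le> diag_prod n F * voln n U" using M_ellipsoid[OF U n] by blast
  define L' where "L' = {x \<in> L. ipn n (mv n A x) (mv n A x) \<le> real n}"
  define U' where "U' = {x \<in> U. ipn n (mv n F x) (mv n F x) \<le> real n}"
  have L': "sym_body n L'" "L' \<subseteq> L" unfolding L'_def using n by (auto intro!: sym_body_inter_ellipsoid[OF L])
  have U': "sym_body n U'" "U' \<subseteq> U" unfolding U'_def using n by (auto intro!: sym_body_inter_ellipsoid[OF U])
  have e0: "exp (- real n) > 0" by simp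
  obtain P where P: "finite P" "P \<subseteq> L" "real (card P) \<le> 4 ^ n / exp (- real n)"
    "\<And>x. x \<in> L \<Longrightarrow> \<exists>p\<in>P. vadd n x (vneg n p) \<in> L'"
    using body_covering[OF L L'(1,2) e0] A(2) unfolding L'_def by blast
  obtain P' where P': "finite P'" "P' \<subseteq> U" "real (card P') \<le> 4 ^ n / exp (- real n)"
    "\<And>x. x \<in> U \<Longrightarrow> \<exists>p\<in>P'. vadd n x (vneg n p) \<in> U'"
    using body_covering[OF U U'(1,2) e0] F(2) unfolding U'_def by blast
  define S where "S = mm n F (transp A)"
  define \<Delta> where "\<Delta> = diag_prod n F * diag_prod n A"
  have S: "mv n S x = mv n F (mv n (transp A) x)" for x unfolding S_def by (rule mv_mm)
  have vS: "vol_scaling n (mv n S) \<Delta>" unfolding \<Delta>_def S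
    using vol_scaling_comp[OF vol_scaling_lower_tri[OF F(1)] vol_scaling_upper_tri[OF A(1)]]
    by (rule vol_scaling_cong) (simp add: S)
  have inj: "ipn n (mv n S v) (mv n S v) > 0" if "\<exists>i<n. v i \<noteq> 0" for v
  proof (rule ccontr)
    assume "\<not> ?thesis"
    then have "ipn n (mv n S v) (mv n S v) = 0" using ipn_self_nonneg[of n "mv n S v"] by linarith
    then have "\<And>i. i < n \<Longrightarrow> mv n F (mv n (transp A) v) i = 0" by (simp add: ipn_self_eq_0 S)
    then have "\<And>i. i < n \<Longrightarrow> mv n (transp A) v i = 0" using lower_tri_inj[OF F(1)] by blast
    then have "\<And>i. i < n \<Longrightarrow> v i = 0" using upper_tri_inj[OF A(1)] by blast
    then show False using that by blast
  qed
  obtain Q d where Q: "frame n Q" and d: "\<And>i. i < n \<Longrightarrow> d i > 0"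
    and dS: "\<And>t. (\<Sum>i<n. (d i)\<^sup>2 * (t i)\<^sup>2) \<le> 2 * ipn n (mv n S (mv n (transp Q) t)) (mv n S (mv n (transp Q) t))"
    and \<Delta>: "\<Delta> \<le> 2 ^ n * (\<Prod>i<n. d i)"
    using near_orthogonal_frame[OF vS n inj] by blast
  \<comment> \<open>Splitting the approximate singular values \<open>d i\<close> evenly between the
    body and its polar gives both truncated bodies the weights \<open>d i\<close> in
    \<open>q\<close>.\<close>
  define h where "h = (\<lambda>i. 1 / sqrt (d i))"
  have h: "h i > 0" "d i * (h i)\<^sup>2 = 1" "(d i)\<^sup>2 * (h i)\<^sup>2 = d i" if "i < n" for i
    using d[OF that] by (auto simp: h_def power_divide power2_eq_square)
  define K where "K = mm n (diag_mat h) (mm n Q A)"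
  have K: "mv n K x = mv n (diag_mat h) (mv n Q (mv n A x))" for x unfolding K_def mv_mm ..
  have KT: "mv n (transp K) x = mv n (transp A) (mv n (transp Q) (mv n (diag_mat h) x))" for x
  proof -
    have "transp (diag_mat h) = diag_mat h" by (auto simp: diag_mat_def fun_eq_iff)
    then show ?thesis unfolding K_def mv_transp_mm by simp
  qed
  define k where "k = (\<Prod>i<n. h i) * (1 * diag_prod n A)"
  have vK: "vol_scaling n (mv n K) k" unfolding k_def
  proof (rule vol_scaling_cong[OF vol_scaling_comp[OF vol_scaling_diag vol_scaling_comp[OF _ vol_scaling_lower_tri[OF A(1)]]]])
    show "vol_scaling n (mv n Q) 1" using Q by (simp add: frame_def)
  qed (auto simp: h K)
  define g where "g = (\<lambda>i. sqrt (d i))"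
  have g: "g i > 0" "(g i)\<^sup>2 = d i" if "i < n" for i using d[OF that] by (auto simp: g_def)
  define q where "q = (\<lambda>z. \<Sum>i<n. (g i)\<^sup>2 * (z i)\<^sup>2)"
  have q_L': "q (mv n K x) \<le> real n" if "x \<in> L'" for x
  proof -
    have "q (mv n K x) = (\<Sum>i<n. (mv n Q (mv n A x) i)\<^sup>2)" unfolding q_def
    proof (rule sum.cong[OF refl])
      fix i assume "i \<in> {..<n}"
      then have i: "i < n" by simp
      have "(g i)\<^sup>2 * (mv n K x i)\<^sup>2 = (d i * (h i)\<^sup>2) * (mv n Q (mv n A x) i)\<^sup>2"
        by (simp add: K mv_diag i g power_mult_distrib)
      then show "(g i)\<^sup>2 * (mv n K x i)\<^sup>2 = (mv n Q (mv n A x) i)\<^sup>2" by (simp add: h i)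
    qed
    also have "\<dots> = ipn n (mv n Q (mv n A x)) (mv n Q (mv n A x))" by (simp add: ipn_def power2_eq_square)
    also have "\<dots> = ipn n (mv n A x) (mv n A x)" using Q by (simp add: frame_def)
    finally show ?thesis using that by (simp add: L'_def)
  qed
  have q_U': "q \<zeta> \<le> 8 * real n" if v: "v \<in> U'" and eq: "mv n (transp K) \<zeta> = vscale n 2 v" for \<zeta> v
  proof -
    define t where "t = mv n (diag_mat h) \<zeta>"
    have "q \<zeta> = (\<Sum>i<n. (d i)\<^sup>2 * (t i)\<^sup>2)" unfolding q_def
      by (rule sum.cong[OF refl]) (simp add: t_def mv_diag g power_mult_distrib mult.assoc[symmetric] h)
    also have "\<dots> \<le> 2 * ipn n (mv n S (mv n (transp Q) t)) (mv n S (mv n (transp Q) t))" by (rule dS)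
    also have "mv n S (mv n (transp Q) t) = mv n F (mv n (transp K) \<zeta>)" by (simp add: S KT t_def)
    also have "\<dots> = vscale n 2 (mv n F v)" unfolding eq mv_vscale mv_scale ..
    also have "2 * ipn n (vscale n 2 (mv n F v)) (vscale n 2 (mv n F v)) = 8 * ipn n (mv n F v) (mv n F v)"
      by (simp add: ipn_vec)
    also have "\<dots> \<le> 8 * real n" using v by (simp add: U'_def)
    finally show ?thesis .
  qed
  have q_add: "q (\<lambda>i. y i + z i) \<le> 2 * (q y + q z)" for y z
  proof -
    have "q (\<lambda>i. y i + z i) \<le> (\<Sum>i<n. (g i)\<^sup>2 * (2 * ((y i)\<^sup>2 + (z i)\<^sup>2)))" unfolding q_def
    proof (intro sum_mono mult_left_mono)
      fix i
      have "0 \<le> (y i - z i)\<^sup>2" by simp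
      then show "(y i + z i)\<^sup>2 \<le> 2 * ((y i)\<^sup>2 + (z i)\<^sup>2)" by (simp add: power2_eq_square algebra_simps)
    qed auto
    also have "\<dots> = 2 * (q y + q z)" unfolding q_def
      by (simp add: sum_distrib_left sum.distrib[symmetric] algebra_simps)
    finally show ?thesis .
  qed
  define B where "B = {x \<in> Rn n. ipn n (mv n K x) (mv n K x) \<le> (2 * sqrt (real n))\<^sup>2}"
  \<comment> \<open>\<open>C u\<close> is the part of the preimage of \<open>u + U'\<close> under
    \<open>K^T K\<close> that lands in \<open>U\<close>. Selecting a point \<open>c u\<close> in it
    avoids inverting \<open>K^T K\<close>: differences from \<open>c u\<close> are sent into
    \<open>2 U'\<close>.\<close>
  define C where "C = (\<lambda>u. {x. mv n (transp K) (mv n K x) \<in> U \<and> vadd n (mv n (transp K) (mv n K x)) (vneg n u) \<in> U'})"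
  define c where "c = (\<lambda>u. SOME x. x \<in> C u)"
  define E where "E = (\<lambda>(p, u). {x \<in> Rn n. ipn n (mv n (diag_mat g) (mv n K (vadd n x (\<lambda>i. - (p i + c u i))))) (mv n (diag_mat g) (mv n K (vadd n x (\<lambda>i. - (p i + c u i))))) \<le> (5 * sqrt (real n))\<^sup>2})"
  have vE: "vol_scaling n (\<lambda>x. mv n (diag_mat g) (mv n K (vadd n x b))) ((\<Prod>i<n. g i) * (k * 1))" for b
    by (intro vol_scaling_comp[OF vol_scaling_diag vol_scaling_comp[OF vK vol_scaling_trans]]) (simp add: g)
  have cover: "B \<subseteq> (\<Union>pu\<in>P \<times> P'. E pu)"
  proof
    fix x assume x: "x \<in> B"
    obtain p where p: "p \<in> L"
      "\<And>y. y \<in> L \<Longrightarrow> ipn n (mv n K (\<lambda>i. x i - p i)) (mv n K (\<lambda>i. y i - p i)) \<le> 0"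
      using nearest_point[OF L, where K=K and x=x] by blast
    define w where "w = (\<lambda>i. x i - p i)"
    \<comment> \<open>The variational inequality says that \<open>ipn n y (K^T K w)\<close> is
      largest over \<open>L\<close> at \<open>y = p\<close>, with value
      \<open>(K x - K p) . K p\<close>. Completing the square bounds this by
      \<open>|K x|^2 / 4 <= n\<close>, which explains the radius \<open>2 * sqrt n\<close> of
      \<open>B\<close>.\<close>
    have u: "mv n (transp K) (mv n K w) \<in> U"
      unfolding U_def polar_def
    proof (intro CollectI conjI ballI)
      fix y assume y: "y \<in> L"
      have "ipn n y (mv n (transp K) (mv n K w)) = ipn n (mv n K y) (mv n K w)" by (rule ipn_mv[symmetric])
      also have "\<dots> = ipn n (mv n K w) (mv n K y)" by (rule ipn_commute)
      also have "\<dots> \<le> ipn n (mv n K w) (mv n K p)"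
        using p(2)[OF y] unfolding w_def[symmetric] ipn_mv_diff'[of n _ K y p] by simp
      also have "\<dots> \<le> ipn n (mv n K x) (mv n K x) / 4"
      proof -
        let ?X = "mv n K x" and ?P = "mv n K p"
        have "0 \<le> ipn n (\<lambda>i. ?X i - 2 * ?P i) (\<lambda>i. ?X i - 2 * ?P i)" by simp
        also have "\<dots> = ipn n ?X ?X - 4 * ipn n ?X ?P + 4 * ipn n ?P ?P"
          unfolding ipn_diff_left[of n ?X "\<lambda>i. 2 * ?P i"] ipn_diff_right[of n _ ?X "\<lambda>i. 2 * ?P i"] ipn_scale_left ipn_scale_right
          using ipn_commute[of n ?P ?X] by simp
        finally show ?thesis unfolding w_def ipn_mv_diff[of n K x p] by simp
      qed
      also have "\<dots> \<le> real n" using x by (simp add: B_def power_mult_distrib)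
      finally show "ipn n y (mv n (transp K) (mv n K w)) \<le> real n" .
    qed simp
    obtain p' where p': "p' \<in> P" "vadd n p (vneg n p') \<in> L'" using P(4)[OF p(1)] by blast
    obtain u' where u': "u' \<in> P'" "vadd n (mv n (transp K) (mv n K w)) (vneg n u') \<in> U'" using P'(4)[OF u] by blast
    have "w \<in> C u'" using u u' by (simp add: C_def)
    then have cu: "c u' \<in> C u'" unfolding c_def by (rule someI[of "\<lambda>x. x \<in> C u'"])
    define \<zeta> where "\<zeta> = mv n K (\<lambda>i. w i - c u' i)"
    let ?a = "vadd n (mv n (transp K) (mv n K w)) (vneg n u')" and ?b = "vadd n (mv n (transp K) (mv n K (c u'))) (vneg n u')"
    define v where "v = (\<lambda>i\<in>{..<n}. 1/2 * ?a i + (-1/2) * ?b i)"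
    have v: "v \<in> U'" unfolding v_def using u'(2) cu by (intro sym_body_comb[OF U'(1)]) (auto simp: C_def)
    have "mv n (transp K) \<zeta> = vscale n 2 v"
    proof (rule Rn_eqI[of _ n])
      fix i assume i: "i < n"
      have z: "mv n (transp K) \<zeta> = mv n (transp K) (\<lambda>i. mv n K w i - mv n K (c u') i)"
        by (rule mv_cong) (simp add: \<zeta>_def mv_diff)
      show "mv n (transp K) \<zeta> i = vscale n 2 v i" unfolding z mv_diff using i by (simp add: v_def field_simps)
    qed auto
    then have q1: "q \<zeta> \<le> 8 * real n" using v by (intro q_U') auto
    have q2: "q (mv n K (vadd n p (vneg n p'))) \<le> real n" by (rule q_L'[OF p'(2)])
    have "mv n K (vadd n x (\<lambda>i. - (p' i + c u' i))) i = mv n K (vadd n p (vneg n p')) i + \<zeta> i" if i: "i < n" for i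
    proof -
      have "mv n K (vadd n x (\<lambda>i. - (p' i + c u' i))) = mv n K (\<lambda>i. vadd n p (vneg n p') i + (w i - c u' i))"
        by (rule mv_cong) (simp add: w_def)
      then show ?thesis using i unfolding mv_add \<zeta>_def by simp
    qed
    then have "q (mv n K (vadd n x (\<lambda>i. - (p' i + c u' i)))) = q (\<lambda>i. mv n K (vadd n p (vneg n p')) i + \<zeta> i)"
      unfolding q_def by (intro sum.cong refl) simp
    also have "\<dots> \<le> 2 * (q (mv n K (vadd n p (vneg n p'))) + q \<zeta>)" by (rule q_add)
    also have "\<dots> \<le> 2 * (real n + 8 * real n)" using q1 q2 by (intro mult_left_mono add_mono) auto
    also have "\<dots> \<le> (5 * sqrt (real n))\<^sup>2" by (simp add: power_mult_distrib)
    finally have "x \<in> E (p', u')" using x unfolding E_def B_def ipn_diag q_def by simp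
    then show "x \<in> (\<Union>pu\<in>P \<times> P'. E pu)" using p'(1) u'(1) by blast
  qed
  let ?V = "Ball_Volume.unit_ball_vol (real n)"
  have V: "?V > 0" by simp
  have kp: "k > 0" by (rule vol_scalingD(1)[OF vK])
  let ?G = "\<Prod>i<n. g i"
  have G: "?G > 0" using g by (intro prod_pos) auto
  have sn: "sqrt (real n) > 0" using n by simp
  have Em: "E pu \<in> sets (lebn n)" for pu unfolding E_def by (cases pu) (simp only: prod.case, rule ellipsoid_sets[OF vE])
  have Ee: "emeasure (lebn n) (E pu) = ennreal (?V * (5 * sqrt (real n)) ^ n / (?G * (k * 1)))" for pu
    unfolding E_def by (cases pu) (simp only: prod.case, rule emeasure_ellipsoid[OF vE], use sn in simp)
  have "ennreal (?V * (2 * sqrt (real n)) ^ n / k) = emeasure (lebn n) B"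
    unfolding B_def using sn by (intro emeasure_ellipsoid[OF vK, symmetric]) simp
  also have "\<dots> \<le> emeasure (lebn n) (\<Union>pu\<in>P \<times> P'. E pu)"
    using cover Em P(1) P'(1) by (intro emeasure_mono) auto
  also have "\<dots> \<le> (\<Sum>pu\<in>P \<times> P'. emeasure (lebn n) (E pu))"
    using Em P(1) P'(1) by (intro emeasure_subadditive_finite) auto
  also have "\<dots> = ennreal (real (card P * card P') * (?V * (5 * sqrt (real n)) ^ n / (?G * (k * 1))))"
    unfolding Ee using V G kp sn by (subst sum_ennreal) (auto simp: card_cartesian_product)
  finally have "?V * (2 * sqrt (real n)) ^ n / k \<le> real (card P * card P') * (?V * (5 * sqrt (real n)) ^ n / (?G * (k * 1)))"
    using V G kp sn by (subst (asm) ennreal_le_iff) auto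
  then have "(?V * sqrt (real n) ^ n / k) * (2 ^ n * ?G) \<le> (?V * sqrt (real n) ^ n / k) * (real (card P) * real (card P') * 5 ^ n)"
    using G kp by (simp add: power_mult_distrib field_simps)
  moreover have "?V * sqrt (real n) ^ n / k > 0" using V kp sn by simp
  ultimately have "2 ^ n * ?G \<le> real (card P) * real (card P') * 5 ^ n" by (simp only: mult_le_cancel_left_pos)
  also have "\<dots> \<le> 12 ^ n * 12 ^ n * 5 ^ n"
  proof (intro mult_mono)
    have "4 ^ n / exp (- real n) = (4 * exp 1) ^ n"
      by (simp add: power_mult_distrib exp_minus exp_of_nat_mult[symmetric] divide_inverse)
    also have "\<dots> \<le> 12 ^ n" using exp_le by (intro power_mono) auto
    finally have *: "4 ^ n / exp (- real n) \<le> 12 ^ n" .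
    show "real (card P) \<le> 12 ^ n" "real (card P') \<le> 12 ^ n" using * P(3) P'(3) by linarith+
  qed auto
  also have "\<dots> = 720 ^ n" unfolding power_mult_distrib[symmetric] by simp
  finally have "2 ^ n * ?G \<le> 720 ^ n" .
  then have "(2 ^ n * ?G)\<^sup>2 \<le> (720 ^ n)\<^sup>2" using G by (intro power_mono) auto
  moreover have "?G\<^sup>2 = (\<Prod>i<n. d i)" unfolding prod_power_distrib by (intro prod.cong refl) (simp add: g)
  moreover have "(2 ^ n * ?G)\<^sup>2 = 2 ^ n * (2 ^ n * ?G\<^sup>2)" by (simp add: power2_eq_square)
  ultimately have "2 ^ n * (2 ^ n * (\<Prod>i<n. d i)) \<le> (720 ^ n)\<^sup>2" by simp
  then have "2 ^ n * \<Delta> \<le> (720 ^ n)\<^sup>2" using \<Delta> by (smt (verit) mult_left_mono zero_le_power)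
  moreover have "0 < \<Delta>" by (rule vol_scalingD(1)[OF vS])
  moreover have "1 * \<Delta> \<le> 2 ^ n * \<Delta>" using \<open>0 < \<Delta>\<close> by (intro mult_right_mono) auto
  ultimately have D: "\<Delta> \<le> (720 ^ n)\<^sup>2" by linarith
  have "(1 / 5376) ^ n * (1 / 5376) ^ n \<le> (diag_prod n A * voln n L) * (diag_prod n F * voln n U)"
    using A(3) F(3) diag_prod_pos[OF A(1)] vLU by (intro mult_mono) auto
  also have "\<dots> = \<Delta> * (voln n L * voln n U)" by (simp add: \<Delta>_def mult_ac)
  also have "\<dots> \<le> (720 ^ n)\<^sup>2 * (voln n L * voln n U)" using D vLU by (intro mult_right_mono) auto
  finally have 1: "(1 / 5376) ^ n * (1 / 5376) ^ n \<le> (720 ^ n)\<^sup>2 * (voln n L * voln n U)" .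
  have "(1 / 10 ^ 14 :: real) ^ n \<le> ((1 / 5376) * (1 / 5376) / (720 * 720)) ^ n" by (intro power_mono) auto
  also have "\<dots> = ((1 / 5376) ^ n * (1 / 5376) ^ n) / (720 ^ n)\<^sup>2"
    by (simp only: power_divide power_mult_distrib power2_eq_square)
  also have "\<dots> \<le> voln n L * voln n U" using 1 by (simp add: pos_divide_le_eq mult.commute)
  finally show ?thesis unfolding U_def .
qed

section \<open>Gaussian averages over hyperplanes\<close>

abbreviation \<phi>\<^sub>N :: "real \<Rightarrow> real" where "\<phi>\<^sub>N \<equiv> normal_density 0 1"

section \<open>Negative moments of Gaussian vectors\<close>

lemma normal_density_le: "\<phi>\<^sub>N t \<le> 1 / 2"
proof -
  have "sqrt (2 * pi) \<ge> sqrt (2 * 2)" using pi_ge_two by (intro real_sqrt_le_mono) auto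
  then have "1 / sqrt (2 * pi) \<le> 1 / 2" by (simp add: frac_le)
  moreover have "\<phi>\<^sub>N t \<le> 1 / sqrt (2 * pi)" by (simp add: normal_density_def divide_right_mono)
  ultimately show ?thesis by linarith
qed

lemma nn_normal: "\<sigma> > 0 \<Longrightarrow> (\<integral>\<^sup>+t. ennreal (normal_density 0 \<sigma> t) \<partial>lborel) = 1"
  by (subst nn_integral_eq_integral) (auto simp: integrable_normal_density)

text \<open>The value at 0 is infinite because 0 powr a = 0 would destroy the bound of the norm by the geometric mean.\<close>

definition ksing :: "real \<Rightarrow> real \<Rightarrow> ennreal" where
  "ksing \<alpha> t = (if t = 0 then \<top> else ennreal (\<bar>t\<bar> powr (- \<alpha>)))"

lemma ksing_measurable [measurable]: "ksing \<alpha> \<in> borel_measurable borel"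
  unfolding ksing_def by measurable

lemma nn_powr_01:
  assumes "0 < \<alpha>" "\<alpha> < 1"
  shows "(\<integral>\<^sup>+v. ennreal (v powr (- \<alpha>)) * indicator {0..1} v \<partial>lborel) = ennreal (1 / (1 - \<alpha>))"
proof -
  have "((\<lambda>x. x powr (- \<alpha>)) has_integral (1 powr (- \<alpha> + 1) / (- \<alpha> + 1))) {0..1}"
    using assms by (intro has_integral_powr_from_0) auto
  then have "((\<lambda>x. x powr (- \<alpha>)) has_integral (1 / (1 - \<alpha>))) {0..1}" by simp
  from nn_integral_has_integral_lebesgue[OF _ this]
  have "(\<integral>\<^sup>+v. ennreal (indicator {0..1} v * v powr (- \<alpha>)) \<partial>lborel) = ennreal (1 / (1 - \<alpha>))" by simp
  moreover have "ennreal (v powr (- \<alpha>)) * indicator {0..1} v = ennreal (indicator {0..1} v * v powr (- \<alpha>))" for v :: real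
    by (auto simp: indicator_def)
  ultimately show ?thesis by simp
qed

text \<open>Off 0 the singularity is at most \<open>1 + h\<close>, with \<open>h\<close> its excess
  over 1 on \<open>[-1, 1]\<close>. The Gaussian mass gives 1, and the density bound
  \<open>1/2\<close> gives half of the integral \<open>2 * \<alpha> / (1 - \<alpha>)\<close> of
  \<open>h\<close>. The bound does not see \<open>c\<close>, as the later induction over coordinates
  requires.\<close>

lemma nn_ksing_le:
  assumes \<alpha>: "0 < \<alpha>" "\<alpha> < 1"
  shows "(\<integral>\<^sup>+t. ennreal (\<phi>\<^sub>N t) * ksing \<alpha> (t + c) \<partial>lborel) \<le> ennreal (1 / (1 - \<alpha>))"
proof -
  define h where "h = (\<lambda>u::real. ennreal (\<bar>u\<bar> powr (- \<alpha>) - 1) * indicator {-1..1} u)"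
  have hm[measurable]: "h \<in> borel_measurable borel" unfolding h_def by measurable
  have AE0: "AE t in lborel. t + c \<noteq> 0"
  proof -
    have "AE t in lborel. t \<noteq> - c" by (rule AE_lborel_singleton)
    then show ?thesis by eventually_elim auto
  qed
  have le1: "ksing \<alpha> u \<le> 1 + h u" if "u \<noteq> 0" for u
  proof (cases "\<bar>u\<bar> \<le> 1")
    case True
    then have "1 \<le> \<bar>u\<bar> powr (- \<alpha>)" using \<alpha> that by (simp add: powr_minus one_le_inverse powr_le1)
    then show ?thesis using True that
      by (auto simp: ksing_def h_def indicator_def abs_le_iff ennreal_plus[symmetric] simp del: ennreal_plus ennreal_1)
         (simp add: ennreal_1[symmetric] ennreal_plus[symmetric] del: ennreal_1 ennreal_plus)
  next
    case False
    then have "\<bar>u\<bar> powr (- \<alpha>) \<le> 1" using \<alpha> by (simp add: powr_minus inverse_le_1_iff ge_one_powr_ge_zero)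
    then have "ksing \<alpha> u \<le> 1" using that by (simp add: ksing_def)
    also have "1 \<le> 1 + h u" by simp
    finally show ?thesis .
  qed
  have "(\<integral>\<^sup>+t. ennreal (\<phi>\<^sub>N t) * ksing \<alpha> (t + c) \<partial>lborel) \<le> (\<integral>\<^sup>+t. ennreal (\<phi>\<^sub>N t) + ennreal (1/2) * h (t + c) \<partial>lborel)"
  proof (rule nn_integral_mono_AE)
    show "AE t in lborel. ennreal (\<phi>\<^sub>N t) * ksing \<alpha> (t + c) \<le> ennreal (\<phi>\<^sub>N t) + ennreal (1/2) * h (t + c)"
      using AE0
    proof eventually_elim
      fix t assume "t + c \<noteq> 0"
      from le1[OF this] have "ennreal (\<phi>\<^sub>N t) * ksing \<alpha> (t + c) \<le> ennreal (\<phi>\<^sub>N t) * (1 + h (t + c))" by (rule mult_left_mono) simp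
      also have "\<dots> = ennreal (\<phi>\<^sub>N t) + ennreal (\<phi>\<^sub>N t) * h (t + c)" by (simp add: distrib_left)
      also have "\<dots> \<le> ennreal (\<phi>\<^sub>N t) + ennreal (1/2) * h (t + c)"
        by (intro add_left_mono mult_right_mono ennreal_leI normal_density_le) simp
      finally show "ennreal (\<phi>\<^sub>N t) * ksing \<alpha> (t + c) \<le> ennreal (\<phi>\<^sub>N t) + ennreal (1/2) * h (t + c)" .
    qed
  qed
  also have "\<dots> = (\<integral>\<^sup>+t. ennreal (\<phi>\<^sub>N t) \<partial>lborel) + ennreal (1/2) * (\<integral>\<^sup>+t. h (t + c) \<partial>lborel)"
    by (subst nn_integral_add) (auto simp: nn_integral_cmult)
  also have "(\<integral>\<^sup>+t. h (t + c) \<partial>lborel) = (\<integral>\<^sup>+t. h t \<partial>lborel)"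
    using nn_integral_affine[of h 1 c] by simp
  also have "(\<integral>\<^sup>+t. h t \<partial>lborel) = ennreal (2 * (\<alpha> / (1 - \<alpha>)))"
  proof -
    define h1 where "h1 = (\<lambda>u::real. ennreal (u powr (- \<alpha>) - 1) * indicator {0<..1} u)"
    have [measurable]: "h1 \<in> borel_measurable borel" unfolding h1_def by measurable
    have I1: "(\<integral>\<^sup>+u. h1 u \<partial>lborel) = ennreal (\<alpha> / (1 - \<alpha>))"
    proof -
      have "(\<integral>\<^sup>+u. h1 u \<partial>lborel) + 1 = (\<integral>\<^sup>+u. h1 u \<partial>lborel) + (\<integral>\<^sup>+u. indicator {0<..1::real} u \<partial>lborel)" by simp
      also have "\<dots> = (\<integral>\<^sup>+u. h1 u + indicator {0<..1} u \<partial>lborel)" by (rule nn_integral_add[symmetric]) auto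
      also have "\<dots> = (\<integral>\<^sup>+v. ennreal (v powr (- \<alpha>)) * indicator {0..1} v \<partial>lborel)"
      proof (rule nn_integral_cong)
        fix u :: real
        show "h1 u + indicator {0<..1} u = ennreal (u powr (- \<alpha>)) * indicator {0..1} u"
        proof (cases "0 < u \<and> u \<le> 1")
          case True
          then have "1 \<le> u powr (- \<alpha>)" using \<alpha> by (simp add: powr_minus one_le_inverse powr_le1)
          then have "ennreal (u powr (- \<alpha>) - 1) + ennreal 1 = ennreal (u powr (- \<alpha>))"
            by (subst ennreal_plus[symmetric]) auto
          then show ?thesis using True by (simp add: h1_def)
        next
          case False then show ?thesis by (auto simp: h1_def indicator_def)
        qed
      qed
      also have "\<dots> = ennreal (1 / (1 - \<alpha>))" by (rule nn_powr_01[OF \<alpha>])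
      also have "\<dots> = ennreal (\<alpha> / (1 - \<alpha>)) + 1"
        using \<alpha> by (simp add: ennreal_1[symmetric] ennreal_plus[symmetric] field_simps del: ennreal_1 ennreal_plus)
      finally have "(\<integral>\<^sup>+u. h1 u \<partial>lborel) + 1 - 1 = ennreal (\<alpha> / (1 - \<alpha>)) + 1 - 1" by simp
      then show ?thesis by (simp only: ennreal_add_diff_cancel_right ennreal_one_neq_top not_False_eq_True)
    qed
    have "(\<integral>\<^sup>+t. h t \<partial>lborel) = (\<integral>\<^sup>+t. h1 t + h1 (- t) \<partial>lborel)"
    proof (rule nn_integral_cong_AE)
      have "AE t in lborel. t \<noteq> (0::real)" by (rule AE_lborel_singleton)
      then show "AE t in lborel. h t = h1 t + h1 (- t)"
        by eventually_elim (auto simp: h_def h1_def indicator_def)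
    qed
    also have "\<dots> = (\<integral>\<^sup>+t. h1 t \<partial>lborel) + (\<integral>\<^sup>+t. h1 (- t) \<partial>lborel)" by (rule nn_integral_add) auto
    also have "(\<integral>\<^sup>+t. h1 (- t) \<partial>lborel) = (\<integral>\<^sup>+t. h1 t \<partial>lborel)"
      using nn_integral_real_affine[of h1 "-1" 0] by simp
    finally show ?thesis unfolding I1 using \<alpha> by (simp add: ennreal_plus[symmetric] del: ennreal_plus)
  qed
  also have "(\<integral>\<^sup>+t. ennreal (\<phi>\<^sub>N t) \<partial>lborel) + ennreal (1/2) * ennreal (2 * (\<alpha> / (1 - \<alpha>))) = ennreal (1 / (1 - \<alpha>))"
  proof -
    have "ennreal (1/2) * ennreal (2 * (\<alpha> / (1 - \<alpha>))) = ennreal (1/2 * (2 * (\<alpha> / (1 - \<alpha>))))"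
      using \<alpha> by (intro ennreal_mult[symmetric]) auto
    moreover have "ennreal 1 + ennreal (1/2 * (2 * (\<alpha> / (1 - \<alpha>)))) = ennreal (1 + 1/2 * (2 * (\<alpha> / (1 - \<alpha>))))"
      using \<alpha> by (intro ennreal_plus[symmetric]) auto
    moreover have "1 + 1/2 * (2 * (\<alpha> / (1 - \<alpha>))) = 1 / (1 - \<alpha>)" using \<alpha> by (simp add: field_simps)
    ultimately show ?thesis by (simp only: nn_normal[OF zero_less_one] ennreal_1)
  qed
  finally show ?thesis .
qed

lemma nn_ksing_affine_le:
  assumes \<alpha>: "0 < \<alpha>" "\<alpha> < 1" and a: "a > 0"
  shows "(\<integral>\<^sup>+t. ennreal (\<phi>\<^sub>N t) * ksing \<alpha> (a * t + c) \<partial>lborel) \<le> ennreal (a powr (- \<alpha>) * (1 / (1 - \<alpha>)))"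
proof -
  have k: "ksing \<alpha> (a * t + c) = ennreal (a powr (- \<alpha>)) * ksing \<alpha> (t + c / a)" for t
  proof -
    have e: "a * t + c = a * (t + c / a)" using a by (simp add: field_simps)
    show ?thesis
    proof (cases "t + c / a = 0")
      case True then show ?thesis unfolding e using a by (simp add: ksing_def ennreal_mult_top)
    next
      case False
      then have "ksing \<alpha> (a * (t + c / a)) = ennreal ((a * \<bar>t + c / a\<bar>) powr (- \<alpha>))" using a by (simp add: ksing_def abs_mult)
      also have "\<dots> = ennreal (a powr (- \<alpha>) * \<bar>t + c / a\<bar> powr (- \<alpha>))" using a by (simp add: powr_mult)
      finally show ?thesis unfolding e using False by (simp add: ksing_def ennreal_mult)
    qed
  qed
  have "(\<integral>\<^sup>+t. ennreal (\<phi>\<^sub>N t) * ksing \<alpha> (a * t + c) \<partial>lborel) = (\<integral>\<^sup>+t. ennreal (a powr (- \<alpha>)) * (ennreal (\<phi>\<^sub>N t) * ksing \<alpha> (t + c / a)) \<partial>lborel)"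
    unfolding k by (simp add: mult_ac)
  also have "\<dots> = ennreal (a powr (- \<alpha>)) * (\<integral>\<^sup>+t. ennreal (\<phi>\<^sub>N t) * ksing \<alpha> (t + c / a) \<partial>lborel)"
    by (rule nn_integral_cmult) simp
  also have "\<dots> \<le> ennreal (a powr (- \<alpha>)) * ennreal (1 / (1 - \<alpha>))" by (intro mult_left_mono nn_ksing_le \<alpha>) simp
  also have "\<dots> = ennreal (a powr (- \<alpha>) * (1 / (1 - \<alpha>)))" using \<alpha> by (subst ennreal_mult) auto
  finally show ?thesis .
qed

text \<open>Coordinate \<open>i\<close> of \<open>A^T \<gamma>\<close> involves only
  \<open>\<gamma> j\<close> with \<open>j >= i\<close>. Fixing the last variable \<open>y\<close>
  leaves the same product in one dimension less with shifts \<open>A n i * y\<close>; the arbitrary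
  shift \<open>c\<close> is there so that the induction closes.\<close>

lemma triangular_moment:
  assumes \<alpha>: "0 < \<alpha>" "\<alpha> < 1"
  shows "lower_tri n A \<Longrightarrow> (\<integral>\<^sup>+\<gamma>. (\<Prod>i<n. ennreal (\<phi>\<^sub>N (\<gamma> i)) * ksing \<alpha> (mv n (transp A) \<gamma> i + c i)) \<partial>lebn n)
    \<le> (\<Prod>i<n. ennreal (A i i powr (- \<alpha>) * (1 / (1 - \<alpha>))))"
proof (induction n arbitrary: c)
  case 0
  have "emeasure (lebn 0) (Rn 0) = 1" by (simp add: lebn_def Rn_def emeasure_PiM_empty)
  then show ?case using nn_integral_const[of "lebn 0" 1] by simp
next
  case (Suc n)
  then have A: "lower_tri n A" "A n n > 0" "\<And>i. i < n \<Longrightarrow> A i n = 0" by (auto simp: lower_tri_def)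
  define f where "f = (\<lambda>n c \<gamma>. (\<Prod>i<n. ennreal (\<phi>\<^sub>N (\<gamma> i)) * ksing \<alpha> (mv n (transp A) \<gamma> i + c i)))"
  have m1: "(\<lambda>\<gamma>. mv k (transp A) \<gamma> i) \<in> borel_measurable (lebn k)" if "i < k" for i k
    using that by (simp add: mv_nth)
  have fm: "f k c' \<in> borel_measurable (lebn k)" for k c' unfolding f_def
    by (intro borel_measurable_prod_ennreal borel_measurable_times measurable_compose[OF _ ksing_measurable]
         borel_measurable_add m1 measurable_compose[OF _ measurable_ennreal] measurable_compose[OF _ borel_measurable_normal_density] measurable_coord_lebn) auto
  have split: "f (Suc n) c (x(n := y)) = ennreal (\<phi>\<^sub>N y) * ksing \<alpha> (A n n * y + c n) * f n (\<lambda>i. A n i * y + c i) x" for x y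
  proof -
    have "(\<Prod>i<n. ennreal (\<phi>\<^sub>N ((x(n := y)) i)) * ksing \<alpha> (mv (Suc n) (transp A) (x(n := y)) i + c i)) = f n (\<lambda>i. A n i * y + c i) x"
      unfolding f_def by (intro prod.cong refl) (auto simp: mv_nth add_ac)
    moreover have "mv (Suc n) (transp A) (x(n := y)) n = A n n * y" by (simp add: mv_nth A(3))
    ultimately show ?thesis unfolding f_def by (simp add: mult_ac)
  qed
  have "(\<integral>\<^sup>+\<gamma>. f (Suc n) c \<gamma> \<partial>lebn (Suc n)) = (\<integral>\<^sup>+y. (\<integral>\<^sup>+x. f (Suc n) c (x(n := y)) \<partial>lebn n) \<partial>lborel)"
    by (rule lebn_nn_Suc'[OF fm])
  also have "\<dots> = (\<integral>\<^sup>+y. ennreal (\<phi>\<^sub>N y) * ksing \<alpha> (A n n * y + c n) * (\<integral>\<^sup>+x. f n (\<lambda>i. A n i * y + c i) x \<partial>lebn n) \<partial>lborel)"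
    unfolding split by (intro nn_integral_cong nn_integral_cmult fm)
  also have "\<dots> \<le> (\<integral>\<^sup>+y. ennreal (\<phi>\<^sub>N y) * ksing \<alpha> (A n n * y + c n) * (\<Prod>i<n. ennreal (A i i powr (- \<alpha>) * (1 / (1 - \<alpha>)))) \<partial>lborel)"
    using Suc.IH[OF A(1)] by (intro nn_integral_mono mult_left_mono) (auto simp: f_def)
  also have "\<dots> = (\<integral>\<^sup>+y. ennreal (\<phi>\<^sub>N y) * ksing \<alpha> (A n n * y + c n) \<partial>lborel) * (\<Prod>i<n. ennreal (A i i powr (- \<alpha>) * (1 / (1 - \<alpha>))))"
    by (rule nn_integral_multc) simp
  also have "\<dots> \<le> ennreal (A n n powr (- \<alpha>) * (1 / (1 - \<alpha>))) * (\<Prod>i<n. ennreal (A i i powr (- \<alpha>) * (1 / (1 - \<alpha>))))"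
    by (intro mult_right_mono nn_ksing_affine_le \<alpha> A) simp
  also have "\<dots> = (\<Prod>i<Suc n. ennreal (A i i powr (- \<alpha>) * (1 / (1 - \<alpha>))))" by (simp add: mult.commute)
  finally show ?case unfolding f_def .
qed

text \<open>By the arithmetic-geometric mean \<open>1 / |g| <= n^{-1/2}\<close> times the product of
  the \<open>|g i|^{-1/n}\<close>, and the moment of the product is handled by
  \<open>triangular_moment\<close> although the coordinates are dependent. The constant 9 bounds
  \<open>(1 - 1/n)^{-n} <= exp (n / (n - 1)) <= exp 2\<close> for \<open>n >= 2\<close>.\<close>

lemma gaussian_inverse_norm:
  assumes A: "lower_tri n A" and n: "n \<ge> 2"
  shows "(\<integral>\<^sup>+\<gamma>. (\<Prod>i<n. ennreal (\<phi>\<^sub>N (\<gamma> i))) * ennreal (1 / sqrt (ipn n (mv n (transp A) \<gamma>) (mv n (transp A) \<gamma>))) \<partial>lebn n)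
    \<le> ennreal (9 / sqrt (real n) * diag_prod n A powr (- 1 / real n))"
proof -
  define \<alpha> where "\<alpha> = 1 / real n"
  have \<alpha>: "0 < \<alpha>" "\<alpha> < 1" using n by (auto simp: \<alpha>_def)
  have am: "ennreal (1 / sqrt (ipn n g g)) \<le> ennreal (1 / sqrt (real n)) * (\<Prod>i<n. ksing \<alpha> (g i))" for g
  proof (cases "\<exists>i<n. g i = 0")
    case True
    then obtain i where i: "i < n" "g i = 0" by blast
    have "(\<Prod>i<n. ksing \<alpha> (g i)) = ksing \<alpha> (g i) * (\<Prod>j\<in>{..<n} - {i}. ksing \<alpha> (g j))"
      using i by (intro prod.remove) auto
    moreover have "(\<Prod>j\<in>{..<n} - {i}. ksing \<alpha> (g j)) \<noteq> 0" by (auto simp: ksing_def)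
    ultimately have "(\<Prod>i<n. ksing \<alpha> (g i)) = \<top>" using i by (simp add: ksing_def ennreal_top_mult)
    then show ?thesis using n by (simp add: ennreal_mult_top)
  next
    case False
    then have g: "\<And>i. i < n \<Longrightarrow> g i \<noteq> 0" by blast
    have "(\<Prod>i<n. (g i)\<^sup>2) powr (1 / real n) \<le> (\<Sum>i<n. (g i)\<^sup>2 / real n)"
      using arith_geom_mean[of "{..<n}" "\<lambda>i. (g i)\<^sup>2"] n by (auto simp: lessThan_empty_iff)
    also have "\<dots> = ipn n g g / real n" by (simp add: ipn_def power2_eq_square sum_divide_distrib)
    finally have 1: "real n * (\<Prod>i<n. (g i)\<^sup>2) powr (1 / real n) \<le> ipn n g g" using n by (simp add: field_simps)
    define p where "p = (\<Prod>i<n. \<bar>g i\<bar>)"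
    have p: "p > 0" unfolding p_def using g by (intro prod_pos) auto
    have "(\<Prod>i<n. (g i)\<^sup>2) = p\<^sup>2" unfolding p_def prod_power_distrib by simp
    then have "(\<Prod>i<n. (g i)\<^sup>2) powr (1 / real n) = (p powr \<alpha>)\<^sup>2"
      using p by (simp add: \<alpha>_def power2_eq_square powr_mult)
    then have "sqrt (real n) * p powr \<alpha> \<le> sqrt (ipn n g g)"
      using 1 by (intro real_le_rsqrt) (simp add: power_mult_distrib)
    then have "1 / sqrt (ipn n g g) \<le> 1 / (sqrt (real n) * p powr \<alpha>)" using n p by (intro divide_left_mono) (auto intro!: mult_pos_pos order.strict_trans2[OF _ \<open>sqrt (real n) * p powr \<alpha> \<le> sqrt (ipn n g g)\<close>])
    also have "\<dots> = 1 / sqrt (real n) * p powr (- \<alpha>)" by (simp add: powr_minus field_simps)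
    finally have 2: "1 / sqrt (ipn n g g) \<le> 1 / sqrt (real n) * p powr (- \<alpha>)" .
    have "p powr (- \<alpha>) = (\<Prod>i<n. \<bar>g i\<bar> powr (- \<alpha>))" unfolding p_def by (rule prod_powr_distrib)
    then have "ennreal (p powr (- \<alpha>)) = (\<Prod>i<n. ksing \<alpha> (g i))"
      using g by (simp add: ksing_def prod_ennreal[symmetric])
    moreover have "ennreal (1 / sqrt (real n) * p powr (- \<alpha>)) = ennreal (1 / sqrt (real n)) * ennreal (p powr (- \<alpha>))"
      by (rule ennreal_mult) auto
    ultimately show ?thesis using ennreal_leI[OF 2] by (simp only:)
  qed
  let ?g = "\<lambda>\<gamma>. mv n (transp A) \<gamma>"
  have m1: "(\<lambda>\<gamma>. ?g \<gamma> i) \<in> borel_measurable (lebn n)" if "i < n" for i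
    using that by (simp add: mv_nth)
  have fm: "(\<lambda>\<gamma>. \<Prod>i<n. ennreal (\<phi>\<^sub>N (\<gamma> i)) * ksing \<alpha> (?g \<gamma> i)) \<in> borel_measurable (lebn n)"
    by (intro borel_measurable_prod_ennreal borel_measurable_times measurable_compose[OF _ ksing_measurable]
         m1 measurable_compose[OF _ measurable_ennreal] measurable_compose[OF _ borel_measurable_normal_density] measurable_coord_lebn) auto
  have "(\<integral>\<^sup>+\<gamma>. (\<Prod>i<n. ennreal (\<phi>\<^sub>N (\<gamma> i))) * ennreal (1 / sqrt (ipn n (?g \<gamma>) (?g \<gamma>))) \<partial>lebn n)
    \<le> (\<integral>\<^sup>+\<gamma>. ennreal (1 / sqrt (real n)) * (\<Prod>i<n. ennreal (\<phi>\<^sub>N (\<gamma> i)) * ksing \<alpha> (?g \<gamma> i)) \<partial>lebn n)"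
  proof (rule nn_integral_mono)
    fix \<gamma>
    have "(\<Prod>i<n. ennreal (\<phi>\<^sub>N (\<gamma> i))) * ennreal (1 / sqrt (ipn n (?g \<gamma>) (?g \<gamma>))) \<le>
      (\<Prod>i<n. ennreal (\<phi>\<^sub>N (\<gamma> i))) * (ennreal (1 / sqrt (real n)) * (\<Prod>i<n. ksing \<alpha> (?g \<gamma> i)))"
      by (rule mult_left_mono[OF am]) simp
    then show "(\<Prod>i<n. ennreal (\<phi>\<^sub>N (\<gamma> i))) * ennreal (1 / sqrt (ipn n (?g \<gamma>) (?g \<gamma>))) \<le>
      ennreal (1 / sqrt (real n)) * (\<Prod>i<n. ennreal (\<phi>\<^sub>N (\<gamma> i)) * ksing \<alpha> (?g \<gamma> i))"
      by (simp add: prod.distrib mult_ac)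
  qed
  also have "\<dots> = ennreal (1 / sqrt (real n)) * (\<integral>\<^sup>+\<gamma>. (\<Prod>i<n. ennreal (\<phi>\<^sub>N (\<gamma> i)) * ksing \<alpha> (?g \<gamma> i)) \<partial>lebn n)"
    by (rule nn_integral_cmult[OF fm])
  also have "\<dots> \<le> ennreal (1 / sqrt (real n)) * (\<Prod>i<n. ennreal (A i i powr (- \<alpha>) * (1 / (1 - \<alpha>))))"
    using triangular_moment[OF \<alpha> A, of "\<lambda>_. 0"] by (intro mult_left_mono) auto
  also have "(\<Prod>i<n. ennreal (A i i powr (- \<alpha>) * (1 / (1 - \<alpha>)))) = ennreal (diag_prod n A powr (- \<alpha>) * (1 / (1 - \<alpha>)) ^ n)"
  proof -
    have "(\<Prod>i<n. ennreal (A i i powr (- \<alpha>) * (1 / (1 - \<alpha>)))) = ennreal (\<Prod>i<n. A i i powr (- \<alpha>) * (1 / (1 - \<alpha>)))"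
      using \<alpha> by (intro prod_ennreal) auto
    also have "(\<Prod>i<n. A i i powr (- \<alpha>) * (1 / (1 - \<alpha>))) = (\<Prod>i<n. A i i powr (- \<alpha>)) * (1 / (1 - \<alpha>)) ^ n"
      by (simp only: prod.distrib prod_constant card_lessThan)
    also have "(\<Prod>i<n. A i i powr (- \<alpha>)) = diag_prod n A powr (- \<alpha>)"
      unfolding diag_prod_def by (rule prod_powr_distrib[symmetric])
    finally show ?thesis .
  qed
  also have "ennreal (1 / sqrt (real n)) * \<dots> = ennreal (1 / sqrt (real n) * (diag_prod n A powr (- \<alpha>) * (1 / (1 - \<alpha>)) ^ n))"
    using \<alpha> by (subst ennreal_mult) auto
  also have "\<dots> \<le> ennreal (9 / sqrt (real n) * diag_prod n A powr (- 1 / real n))"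
  proof (rule ennreal_leI)
    have "(1 / (1 - \<alpha>)) ^ n \<le> 9"
    proof -
      have "1 + \<alpha> / (1 - \<alpha>) \<le> exp (\<alpha> / (1 - \<alpha>))" by (rule exp_ge_add_one_self)
      then have "1 / (1 - \<alpha>) \<le> exp (\<alpha> / (1 - \<alpha>))" using \<alpha> by (simp add: field_simps)
      then have "(1 / (1 - \<alpha>)) ^ n \<le> exp (\<alpha> / (1 - \<alpha>)) ^ n" using \<alpha> by (intro power_mono) auto
      also have "\<dots> = exp (real n * (\<alpha> / (1 - \<alpha>)))" by (rule exp_of_nat_mult[symmetric])
      also have "\<dots> \<le> exp (real 2 * 1)"
      proof -
        have "real n * (\<alpha> / (1 - \<alpha>)) = real n / (real n - 1)" using n by (simp add: \<alpha>_def field_simps)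
        also have "\<dots> \<le> 2" using n by (simp add: field_simps)
        finally show ?thesis by simp
      qed
      also have "\<dots> = exp 1 ^ 2" by (rule exp_of_nat_mult)
      also have "\<dots> \<le> 3 ^ 2" using exp_le by (intro power_mono) auto
      finally show ?thesis by simp
    qed
    then have "1 / sqrt (real n) * (diag_prod n A powr (- \<alpha>) * (1 / (1 - \<alpha>)) ^ n) \<le> 1 / sqrt (real n) * (diag_prod n A powr (- \<alpha>) * 9)"
      by (intro mult_left_mono) auto
    then show "1 / sqrt (real n) * (diag_prod n A powr (- \<alpha>) * (1 / (1 - \<alpha>)) ^ n) \<le> 9 / sqrt (real n) * diag_prod n A powr (- 1 / real n)"
      by (simp add: \<alpha>_def mult.commute)
  qed
  finally show ?thesis .
qed

abbreviation gaussw :: "nat \<Rightarrow> (nat \<Rightarrow> real) \<Rightarrow> ennreal" where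
  "gaussw n \<gamma> \<equiv> (\<Prod>i<n. ennreal (\<phi>\<^sub>N (\<gamma> i)))"

section \<open>Linear functionals of Gaussian vectors\<close>

lemma gaussw_measurable [measurable]: "gaussw n \<in> borel_measurable (lebn n)"
  by (intro borel_measurable_prod_ennreal measurable_compose[OF _ measurable_ennreal]
      measurable_compose[OF _ borel_measurable_normal_density] measurable_coord_lebn) auto

lemma gaussw_cong: "(\<And>i. i < n \<Longrightarrow> x i = y i) \<Longrightarrow> gaussw n x = gaussw n y"
  by (intro prod.cong) auto

lemma nn_gaussw: "(\<integral>\<^sup>+\<gamma>. gaussw n \<gamma> \<partial>lebn n) = 1"
proof (induction n)
  case 0
  have "emeasure (lebn 0) (Rn 0) = 1" by (simp add: lebn_def Rn_def emeasure_PiM_empty)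
  then show ?case using nn_integral_const[of "lebn 0" 1] by simp
next
  case (Suc n)
  have e: "gaussw (Suc n) (x(n := y)) = gaussw n x * ennreal (\<phi>\<^sub>N y)" for x y
    using gaussw_cong[of n "x(n := y)" x] by simp
  have "(\<integral>\<^sup>+\<gamma>. gaussw (Suc n) \<gamma> \<partial>lebn (Suc n)) = (\<integral>\<^sup>+x. (\<integral>\<^sup>+y. gaussw n x * ennreal (\<phi>\<^sub>N y) \<partial>lborel) \<partial>lebn n)"
    unfolding e[symmetric] by (rule lebn_nn_Suc[OF gaussw_measurable])
  also have "\<dots> = (\<integral>\<^sup>+x. gaussw n x \<partial>lebn n)"
    by (intro nn_integral_cong) (simp add: nn_integral_cmult nn_normal)
  finally show ?case using Suc by simp
qed

lemma normal_scale:
  assumes F[measurable]: "F \<in> borel_measurable borel" and b: "b \<noteq> (0::real)"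
  shows "(\<integral>\<^sup>+t. ennreal (\<phi>\<^sub>N t) * F (b * t) \<partial>lborel) = (\<integral>\<^sup>+s. ennreal (normal_density 0 \<bar>b\<bar> s) * F s \<partial>lborel)"
proof -
  have *: "ennreal \<bar>b\<bar> * ennreal (normal_density 0 \<bar>b\<bar> (b * t)) = ennreal (\<phi>\<^sub>N t)" for t
  proof -
    have "\<bar>b\<bar> * normal_density 0 \<bar>b\<bar> (b * t) = \<phi>\<^sub>N t"
      using b by (simp add: normal_density_def real_sqrt_mult field_simps power_mult_distrib)
    then show ?thesis by (subst ennreal_mult''[symmetric]) auto
  qed
  have "(\<integral>\<^sup>+s. ennreal (normal_density 0 \<bar>b\<bar> s) * F s \<partial>lborel) =
    ennreal \<bar>b\<bar> * (\<integral>\<^sup>+t. ennreal (normal_density 0 \<bar>b\<bar> (0 + b * t)) * F (0 + b * t) \<partial>lborel)"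
    by (rule nn_integral_real_affine) (use b in auto)
  also have "\<dots> = (\<integral>\<^sup>+t. ennreal \<bar>b\<bar> * (ennreal (normal_density 0 \<bar>b\<bar> (0 + b * t)) * F (0 + b * t)) \<partial>lborel)"
    by (rule nn_integral_cmult[symmetric]) simp
  finally show ?thesis by (simp add: mult.assoc[symmetric] *)
qed

lemma normal_add:
  assumes F[measurable]: "F \<in> borel_measurable borel" and \<tau>: "\<tau> > (0::real)"
  shows "(\<integral>\<^sup>+t. ennreal (\<phi>\<^sub>N t) * (\<integral>\<^sup>+s. ennreal (normal_density 0 \<tau> s) * F (s + t * b) \<partial>lborel) \<partial>lborel)
    = (\<integral>\<^sup>+s. ennreal (normal_density 0 (sqrt (\<tau>\<^sup>2 + b\<^sup>2)) s) * F s \<partial>lborel)"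
proof (cases "b = 0")
  case True
  then show ?thesis using \<tau> by (simp add: nn_integral_multc nn_normal)
next
  case False
  let ?N = "\<lambda>\<sigma> s. ennreal (normal_density 0 \<sigma> s)"
  have "(\<integral>\<^sup>+t. ennreal (\<phi>\<^sub>N t) * (\<integral>\<^sup>+s. ?N \<tau> s * F (s + t * b) \<partial>lborel) \<partial>lborel) =
    (\<integral>\<^sup>+t. ennreal (\<phi>\<^sub>N t) * (\<lambda>r. \<integral>\<^sup>+s. ?N \<tau> s * F (s + r) \<partial>lborel) (b * t) \<partial>lborel)" by (simp add: mult.commute)
  also have "\<dots> = (\<integral>\<^sup>+r. ?N \<bar>b\<bar> r * (\<integral>\<^sup>+s. ?N \<tau> s * F (s + r) \<partial>lborel) \<partial>lborel)"
    by (rule normal_scale[OF _ False]) simp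
  also have "\<dots> = (\<integral>\<^sup>+r. (\<integral>\<^sup>+s. ?N \<bar>b\<bar> r * (?N \<tau> (s - r) * F s) \<partial>lborel) \<partial>lborel)"
  proof (rule nn_integral_cong)
    fix r
    have "(\<integral>\<^sup>+s. ?N \<tau> (s - r) * F s \<partial>lborel) = (\<integral>\<^sup>+s. ?N \<tau> s * F (s + r) \<partial>lborel)"
      using nn_integral_real_affine[of "\<lambda>s. ?N \<tau> (s - r) * F s" 1 r] by (simp add: add.commute)
    then show "?N \<bar>b\<bar> r * (\<integral>\<^sup>+s. ?N \<tau> s * F (s + r) \<partial>lborel) = (\<integral>\<^sup>+s. ?N \<bar>b\<bar> r * (?N \<tau> (s - r) * F s) \<partial>lborel)"
      by (simp add: nn_integral_cmult)
  qed
  also have "\<dots> = (\<integral>\<^sup>+s. (\<integral>\<^sup>+r. ?N \<bar>b\<bar> r * (?N \<tau> (s - r) * F s) \<partial>lborel) \<partial>lborel)"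
    by (rule lborel_pair.Fubini') simp
  also have "\<dots> = (\<integral>\<^sup>+s. ?N (sqrt (\<tau>\<^sup>2 + \<bar>b\<bar>\<^sup>2)) s * F s \<partial>lborel)"
  proof (rule nn_integral_cong)
    fix s
    have "(\<integral>\<^sup>+r. ?N \<bar>b\<bar> r * (?N \<tau> (s - r) * F s) \<partial>lborel) = (\<integral>\<^sup>+r. ennreal (normal_density 0 \<tau> (s - r) * normal_density 0 \<bar>b\<bar> r) * F s \<partial>lborel)"
      by (intro nn_integral_cong) (simp add: ennreal_mult mult_ac)
    also have "\<dots> = (\<integral>\<^sup>+r. ennreal (normal_density 0 \<tau> (s - r) * normal_density 0 \<bar>b\<bar> r) \<partial>lborel) * F s"
      by (rule nn_integral_multc) simp
    also have "\<dots> = ?N (sqrt (\<tau>\<^sup>2 + \<bar>b\<bar>\<^sup>2)) s * F s"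
      using fun_cong[OF conv_normal_density_zero_mean[of \<tau> "\<bar>b\<bar>"], of s] \<tau> False by simp
    finally show "(\<integral>\<^sup>+r. ?N \<bar>b\<bar> r * (?N \<tau> (s - r) * F s) \<partial>lborel) = ?N (sqrt (\<tau>\<^sup>2 + \<bar>b\<bar>\<^sup>2)) s * F s" .
  qed
  finally show ?thesis by simp
qed

lemma ipn_Suc_upd: "ipn (Suc m) (x(m := t)) y = ipn m x y + t * y m"
  by (simp add: ipn_def)

text \<open>Coordinates are added one at a time as independent normal summands. Vanishing earlier
  coefficients form a separate case, because \<open>normal_density 0 0\<close> is the zero function
  and not a point mass.\<close>

lemma gaussian_projection:
  assumes "F \<in> borel_measurable borel" "ipn n y y > 0"
  shows "(\<integral>\<^sup>+\<gamma>. gaussw n \<gamma> * F (ipn n \<gamma> y) \<partial>lebn n) = (\<integral>\<^sup>+s. ennreal (normal_density 0 (sqrt (ipn n y y)) s) * F s \<partial>lborel)"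
  using assms
proof (induction n arbitrary: F)
  case 0 then show ?case by (simp add: ipn_def)
next
  case (Suc n)
  note F[measurable] = Suc.prems(1)
  have e: "gaussw (Suc n) (x(n := t)) * F (ipn (Suc n) (x(n := t)) y) = ennreal (\<phi>\<^sub>N t) * (gaussw n x * F (ipn n x y + t * y n))" for x t
    using gaussw_cong[of n "x(n := t)" x] by (simp add: ipn_Suc_upd mult_ac)
  have sq: "ipn (Suc n) y y = ipn n y y + (y n)\<^sup>2" by (simp add: ipn_def power2_eq_square)
  have "(\<integral>\<^sup>+\<gamma>. gaussw (Suc n) \<gamma> * F (ipn (Suc n) \<gamma> y) \<partial>lebn (Suc n)) =
    (\<integral>\<^sup>+t. (\<integral>\<^sup>+x. ennreal (\<phi>\<^sub>N t) * (gaussw n x * F (ipn n x y + t * y n)) \<partial>lebn n) \<partial>lborel)"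
    unfolding e[symmetric] by (rule lebn_nn_Suc') measurable
  also have "\<dots> = (\<integral>\<^sup>+t. ennreal (\<phi>\<^sub>N t) * (\<integral>\<^sup>+x. gaussw n x * F (ipn n x y + t * y n) \<partial>lebn n) \<partial>lborel)"
    by (intro nn_integral_cong nn_integral_cmult) measurable
  also have "\<dots> = (\<integral>\<^sup>+s. ennreal (normal_density 0 (sqrt (ipn (Suc n) y y)) s) * F s \<partial>lborel)"
  proof (cases "ipn n y y = 0")
    case True
    then have y0: "\<forall>i<n. y i = 0" by (simp add: ipn_self_eq_0)
    then have "ipn n x y = 0" for x by (simp add: ipn_def)
    moreover have "y n \<noteq> 0" using True Suc.prems(2) sq by auto
    ultimately show ?thesis using normal_scale[OF F, of "y n"] True
      by (simp add: nn_integral_cmult nn_gaussw sq mult.commute)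
  next
    case False
    then have p: "ipn n y y > 0" using ipn_self_nonneg[of n y] by linarith
    have "(\<integral>\<^sup>+x. gaussw n x * F (ipn n x y + t * y n) \<partial>lebn n) =
      (\<integral>\<^sup>+s. ennreal (normal_density 0 (sqrt (ipn n y y)) s) * F (s + t * y n) \<partial>lborel)" for t
      by (rule Suc.IH[of "\<lambda>s. F (s + t * y n)", OF _ p]) simp
    then show ?thesis using normal_add[OF F, of "sqrt (ipn n y y)" "y n"] p by (simp add: sq)
  qed
  finally show ?case .
qed

lemma AE_coord_nonzero: "i < n \<Longrightarrow> AE x in lebn n. x i \<noteq> 0"
proof -
  have "i < n \<Longrightarrow> (\<integral>\<^sup>+x. indicator {0::real} (x i) \<partial>lebn n) = 0"
  proof (induction n)
    case (Suc n)
    have "(\<integral>\<^sup>+x. indicator {0::real} (x i) \<partial>lebn (Suc n)) = (\<integral>\<^sup>+x. (\<integral>\<^sup>+y. indicator {0::real} ((x(n := y)) i) \<partial>lborel) \<partial>lebn n)"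
      using Suc.prems by (intro lebn_nn_Suc) measurable
    also have "\<dots> = 0"
    proof (cases "i = n")
      case True then show ?thesis by simp
    next
      case False
      then have "i < n" using Suc.prems by simp
      then have "(\<integral>\<^sup>+x. indicator {0::real} (x i) * \<infinity> \<partial>lebn n) = 0" using Suc.IH by (subst nn_integral_multc) auto
      then show ?thesis using False by simp
    qed
    finally show ?case .
  qed simp
  moreover assume i: "i < n"
  ultimately have "AE x in lebn n. indicator {0::real} (x i) = (0::ennreal)" using i by (subst (asm) nn_integral_0_iff_AE) auto
  then show ?thesis by eventually_elim (auto simp: indicator_def split: if_splits)
qed

lemma measurable_upd_comp:
  assumes "f \<in> borel_measurable (lebn (Suc m))" "X \<in> M \<rightarrow>\<^sub>M lebn m" "Y \<in> borel_measurable M"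
  shows "(\<lambda>p. f ((X p)(m := Y p))) \<in> borel_measurable M"
proof -
  have "(\<lambda>p. (X p, Y p)) \<in> M \<rightarrow>\<^sub>M lebn m \<Otimes>\<^sub>M borel" using assms by simp
  from measurable_compose[OF measurable_compose[OF this measurable_upd_pair] assms(1)] show ?thesis by simp
qed

lemma measurable_ipn_comp [measurable (raw)]:
  assumes "X \<in> M \<rightarrow>\<^sub>M lebn m" "Y \<in> M \<rightarrow>\<^sub>M lebn m"
  shows "(\<lambda>p. ipn m (X p) (Y p)) \<in> borel_measurable M"
  unfolding ipn_def
  by (intro borel_measurable_sum borel_measurable_times measurable_compose[OF assms(1)] measurable_compose[OF assms(2)] measurable_coord_lebn) auto

text \<open>The integrand is, up to this constant, the centred normal density in \<open>w\<close>
  with standard deviation \<open>\<sigma> / sqrt (\<sigma>^2 + q^2)\<close>.\<close>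

lemma normal_product_integral:
  assumes "\<sigma> > 0"
  shows "(\<integral>\<^sup>+w. ennreal (\<phi>\<^sub>N w) * ennreal (normal_density 0 \<sigma> (w * q)) \<partial>lborel) = ennreal (1 / (sqrt (2 * pi) * sqrt (\<sigma>\<^sup>2 + q\<^sup>2)))"
proof -
  let ?r = "sqrt (\<sigma>\<^sup>2 + q\<^sup>2)"
  have r: "?r > 0" using assms by (simp add: add_pos_nonneg)
  have r2: "?r\<^sup>2 = \<sigma>\<^sup>2 + q\<^sup>2" by simp
  have pt: "\<phi>\<^sub>N w * normal_density 0 \<sigma> (w * q) = 1 / (sqrt (2 * pi) * ?r) * normal_density 0 (\<sigma> / ?r) w" for w
  proof -
    have "- w\<^sup>2 / 2 + - (w * q)\<^sup>2 / (2 * \<sigma>\<^sup>2) = - w\<^sup>2 / (2 * (\<sigma> / ?r)\<^sup>2)"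
      unfolding power_divide r2 using assms by (simp add: field_simps power_mult_distrib)
    then have "exp (- w\<^sup>2 / 2) * exp (- (w * q)\<^sup>2 / (2 * \<sigma>\<^sup>2)) = exp (- w\<^sup>2 / (2 * (\<sigma> / ?r)\<^sup>2))"
      unfolding exp_add[symmetric] by simp
    moreover have "sqrt (2 * pi * (\<sigma> / ?r)\<^sup>2) = sqrt (2 * pi) * (\<sigma> / ?r)" using assms r by (simp add: real_sqrt_mult)
    moreover have "sqrt (2 * pi * \<sigma>\<^sup>2) = sqrt (2 * pi) * \<sigma>" using assms by (simp add: real_sqrt_mult)
    ultimately show ?thesis using assms r unfolding normal_density_def by (simp add: field_simps)
  qed
  have "(\<integral>\<^sup>+w. ennreal (\<phi>\<^sub>N w) * ennreal (normal_density 0 \<sigma> (w * q)) \<partial>lborel) =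
    (\<integral>\<^sup>+w. ennreal (1 / (sqrt (2 * pi) * ?r)) * ennreal (normal_density 0 (\<sigma> / ?r) w) \<partial>lborel)"
    using r by (intro nn_integral_cong) (simp add: ennreal_mult[symmetric] pt)
  also have "\<dots> = ennreal (1 / (sqrt (2 * pi) * ?r))"
    using assms r by (subst nn_integral_cmult) (auto simp: nn_normal)
  finally show ?thesis .
qed

text \<open>With \<open>g = A^T \<gamma>\<close>, the integral of \<open>f\<close> over the
  hyperplane orthogonal to \<open>g\<close>, divided by \<open>|g|\<close>, is formally the integral
  of \<open>f x\<close> against a delta function of \<open>ipn n g x\<close>, a normal variable of
  variance \<open>|A x|^2\<close>; the right side shows its density at 0. To stay with functions,
  the hyperplane is a graph over the first \<open>m\<close> coordinates with weight
  \<open>1 / |g m|\<close>. Since \<open>g m\<close> depends only on the last coordinate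
  \<open>w\<close> of \<open>\<gamma>\<close>, the other coordinates are integrated first, and
  \<open>w\<close> last.\<close>

lemma gaussian_hyperplane_average:
  assumes A: "lower_tri (Suc m) A" and m: "m > 0" and f[measurable]: "f \<in> borel_measurable (lebn (Suc m))"
  shows "(\<integral>\<^sup>+\<gamma>. gaussw (Suc m) \<gamma> * (ennreal (1 / \<bar>mv (Suc m) (transp A) \<gamma> m\<bar>) *
      (\<integral>\<^sup>+y. f (y(m := - ipn m (mv (Suc m) (transp A) \<gamma>) y / mv (Suc m) (transp A) \<gamma> m)) \<partial>lebn m)) \<partial>lebn (Suc m))
    = (\<integral>\<^sup>+x. f x * ennreal (1 / (sqrt (2 * pi) * sqrt (ipn (Suc m) (mv (Suc m) A x) (mv (Suc m) A x)))) \<partial>lebn (Suc m))"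
proof -
  interpret sm: sigma_finite_measure "lebn m" by (rule sigma_finite_lebn)
  interpret sn: sigma_finite_measure "lebn (Suc m)" by (rule sigma_finite_lebn)
  interpret pm: pair_sigma_finite "lebn m" "lebn m" ..
  interpret pn: pair_sigma_finite "lborel :: real measure" "lebn (Suc m)" ..
  have A': "A m m > 0" "\<And>i. i < m \<Longrightarrow> A i m = 0" "A 0 0 > 0" "\<And>j. 0 < j \<Longrightarrow> j < Suc m \<Longrightarrow> A 0 j = 0"
    using A by (auto simp: lower_tri_def)
  let ?g = "mv (Suc m) (transp A)" and ?a = "A m m"
  define b where "b = (\<lambda>y. \<Sum>j<m. A m j * y j)"
  have bm[measurable]: "b \<in> borel_measurable (lebn m)" unfolding b_def
    by (intro borel_measurable_sum borel_measurable_times measurable_coord_lebn) auto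
  have gm: "?g (x(m := w)) m = ?a * w" for x w by (simp add: mv_nth A'(2))
  have gi: "ipn m (?g (x(m := w))) y = ipn m x (mv m A y) + w * b y" for x w y
  proof -
    have "ipn m (?g (x(m := w))) y = ipn m (\<lambda>i. mv m (transp A) x i + w * A m i) y"
      by (rule ipn_cong) (auto simp: mv_nth)
    also have "\<dots> = ipn m (mv m (transp A) x) y + w * ipn m (A m) y" by (simp only: ipn_linear)
    also have "ipn m (mv m (transp A) x) y = ipn m x (mv m A y)" using ipn_mv[of m "transp A" x y] by simp
    also have "ipn m (A m) y = b y" by (simp add: ipn_def b_def)
    finally show ?thesis .
  qed
  \<comment> \<open>The last coordinate of the hyperplane point above \<open>y\<close>, when
    \<open>\<gamma>\<close> ends in \<open>w\<close> and its first \<open>m\<close> coordinates have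
    inner product \<open>v\<close> with \<open>A y\<close>.\<close>
  define z where "z = (\<lambda>w y v. - (v + w * b y) / (?a * w))"
  have gn[measurable]: "(\<lambda>\<gamma>. ?g \<gamma> m) \<in> borel_measurable (lebn (Suc m))"
    by (rule measurable_compose[OF measurable_mv measurable_coord_lebn]) simp
  have gR: "(\<lambda>\<gamma>. restrict (?g \<gamma>) {..<m}) \<in> lebn (Suc m) \<rightarrow>\<^sub>M lebn m"
    by (rule measurable_to_lebn) (auto simp: Rn_def intro!: measurable_compose[OF measurable_mv measurable_coord_lebn])
  have ipg: "ipn m (restrict (?g \<gamma>) {..<m}) y = ipn m (?g \<gamma>) y" for \<gamma> y by (rule ipn_cong) auto
  have M1[measurable]: "(\<lambda>(\<gamma>, y). f (y(m := - ipn m (?g \<gamma>) y / ?g \<gamma> m))) \<in> borel_measurable (lebn (Suc m) \<Otimes>\<^sub>M lebn m)"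
    unfolding ipg[symmetric] case_prod_beta'
    by (intro measurable_upd_comp[OF f] measurable_snd borel_measurable_divide borel_measurable_uminus measurable_ipn_comp
      measurable_compose[OF measurable_fst gR] measurable_compose[OF measurable_fst gn])
  let ?N = "\<lambda>\<sigma> s. ennreal (normal_density 0 \<sigma> s)"
  let ?\<sigma> = "\<lambda>y. sqrt (ipn m (mv m A y) (mv m A y))"
  have \<sigma>m[measurable]: "?\<sigma> \<in> borel_measurable (lebn m)" by measurable
  \<comment> \<open>Row 0 of a lower triangular matrix consists of its diagonal entry, so the almost
    sure condition \<open>y 0 \<noteq> 0\<close> already keeps \<open>A y\<close> away from
    0.\<close>
  have pos: "ipn m (mv k A y) (mv k A y) > 0" if "y 0 \<noteq> 0" "k \<in> {m, Suc m}" for y k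
  proof -
    have k: "0 < k" "k \<le> Suc m" using that m by auto
    have "mv k A y 0 = (\<Sum>j<k. A 0 j * y j)" by (rule mv_nth[OF k(1)])
    also have "\<dots> = (\<Sum>j<k. if j = 0 then A 0 0 * y 0 else 0)"
    proof (rule sum.cong)
      fix j assume "j \<in> {..<k}"
      then show "A 0 j * y j = (if j = 0 then A 0 0 * y 0 else 0)" using A'(4)[of j] k by (cases "j = 0") auto
    qed simp
    also have "\<dots> = A 0 0 * y 0" using k by simp
    finally have "mv k A y 0 \<noteq> 0" using that A'(3) by simp
    then have "ipn m (mv k A y) (mv k A y) \<noteq> 0" using m by (auto simp: ipn_self_eq_0)
    then show ?thesis using ipn_self_nonneg[of m "mv k A y"] by linarith
  qed
  have fix_w: "(\<integral>\<^sup>+x. gaussw (Suc m) (x(m := w)) * (ennreal (1 / \<bar>?g (x(m := w)) m\<bar>) *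
      (\<integral>\<^sup>+y. f (y(m := - ipn m (?g (x(m := w))) y / ?g (x(m := w)) m)) \<partial>lebn m)) \<partial>lebn m)
    = (\<integral>\<^sup>+x. ennreal (\<phi>\<^sub>N w) * ?N (sqrt (ipn m (mv (Suc m) A x) (mv (Suc m) A x))) (w * mv (Suc m) A x m) * f x \<partial>lebn (Suc m))"
    (is "?L = ?R") if w: "w \<noteq> 0" for w
  proof -
    have M2: "(\<lambda>(x, y). gaussw m x * f (y(m := z w y (ipn m x (mv m A y))))) \<in> borel_measurable (lebn m \<Otimes>\<^sub>M lebn m)"
      unfolding z_def case_prod_beta'
      by (intro borel_measurable_times_ennreal measurable_upd_comp[OF f] measurable_snd borel_measurable_divide borel_measurable_uminus
        borel_measurable_add borel_measurable_times borel_measurable_const measurable_ipn_comp measurable_fst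
        measurable_compose[OF measurable_snd bm] measurable_compose[OF measurable_snd measurable_mv] measurable_compose[OF measurable_fst gaussw_measurable])
    have M3: "(\<lambda>x. f (y(m := z w y (ipn m x (mv m A y))))) \<in> borel_measurable (lebn m)" if "y \<in> Rn m" for y
      unfolding z_def using that
      by (intro measurable_upd_comp[OF f] borel_measurable_divide borel_measurable_uminus
        borel_measurable_add borel_measurable_times borel_measurable_const measurable_ipn) auto
    have M4: "(\<lambda>y. f (y(m := z w y (ipn m x (mv m A y))))) \<in> borel_measurable (lebn m)" for x
      unfolding z_def
      by (intro measurable_upd_comp[OF f] borel_measurable_divide borel_measurable_uminus
        borel_measurable_add borel_measurable_times borel_measurable_const bm measurable_ident_sets[OF refl]
        measurable_compose[OF measurable_mv measurable_ipn(2)])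
    have M5: "(\<lambda>x. ?N (sqrt (ipn m (mv (Suc m) A x) (mv (Suc m) A x))) (w * mv (Suc m) A x m) * f x) \<in> borel_measurable (lebn (Suc m))"
    proof -
      have c: "(\<lambda>x. mv (Suc m) A x i) \<in> borel_measurable (lebn (Suc m))" if "i < Suc m" for i
        by (rule measurable_compose[OF measurable_mv measurable_coord_lebn[OF that]])
      have [measurable]: "(\<lambda>x. mv (Suc m) A x m) \<in> borel_measurable (lebn (Suc m))" by (rule c) simp
      have [measurable]: "(\<lambda>x. ipn m (mv (Suc m) A x) (mv (Suc m) A x)) \<in> borel_measurable (lebn (Suc m))"
        unfolding ipn_def by (intro borel_measurable_sum borel_measurable_times c) auto
      show ?thesis unfolding normal_density_def by measurable
    qed
    have zz: "- (ipn m x (mv m A y) + w * b y) / (?a * w) = z w y (ipn m x (mv m A y))" for x y by (simp add: z_def)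
    have "?L = (\<integral>\<^sup>+x. ennreal (\<phi>\<^sub>N w * (1 / (?a * \<bar>w\<bar>))) * (\<integral>\<^sup>+y. gaussw m x * f (y(m := z w y (ipn m x (mv m A y)))) \<partial>lebn m) \<partial>lebn m)"
    proof (rule nn_integral_cong)
      fix x
      have "gaussw (Suc m) (x(m := w)) = gaussw m x * ennreal (\<phi>\<^sub>N w)" using gaussw_cong[of m "x(m := w)" x] by simp
      moreover have "\<bar>?a * w\<bar> = ?a * \<bar>w\<bar>" using A'(1) by (simp add: abs_mult)
      moreover have "(\<integral>\<^sup>+y. gaussw m x * f (y(m := z w y (ipn m x (mv m A y)))) \<partial>lebn m) = gaussw m x * (\<integral>\<^sup>+y. f (y(m := z w y (ipn m x (mv m A y)))) \<partial>lebn m)"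
        by (rule nn_integral_cmult[OF M4])
      moreover have "ennreal (\<phi>\<^sub>N w * (1 / (?a * \<bar>w\<bar>))) = ennreal (\<phi>\<^sub>N w) * ennreal (1 / (?a * \<bar>w\<bar>))"
        using A'(1) by (intro ennreal_mult) auto
      ultimately show "gaussw (Suc m) (x(m := w)) * (ennreal (1 / \<bar>?g (x(m := w)) m\<bar>) *
          (\<integral>\<^sup>+y. f (y(m := - ipn m (?g (x(m := w))) y / ?g (x(m := w)) m)) \<partial>lebn m))
        = ennreal (\<phi>\<^sub>N w * (1 / (?a * \<bar>w\<bar>))) * (\<integral>\<^sup>+y. gaussw m x * f (y(m := z w y (ipn m x (mv m A y)))) \<partial>lebn m)"
        unfolding gm gi zz by (simp only: mult_ac)
    qed
    also have "\<dots> = ennreal (\<phi>\<^sub>N w * (1 / (?a * \<bar>w\<bar>))) * (\<integral>\<^sup>+x. (\<integral>\<^sup>+y. gaussw m x * f (y(m := z w y (ipn m x (mv m A y)))) \<partial>lebn m) \<partial>lebn m)"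
      by (rule nn_integral_cmult) (rule sm.borel_measurable_nn_integral[OF M2])
    also have "(\<integral>\<^sup>+x. (\<integral>\<^sup>+y. gaussw m x * f (y(m := z w y (ipn m x (mv m A y)))) \<partial>lebn m) \<partial>lebn m)
      = (\<integral>\<^sup>+y. (\<integral>\<^sup>+x. gaussw m x * f (y(m := z w y (ipn m x (mv m A y)))) \<partial>lebn m) \<partial>lebn m)"
      by (rule pm.Fubini'[symmetric]) (rule M2)
    also have "\<dots> = (\<integral>\<^sup>+y. ennreal (?a * \<bar>w\<bar>) * (\<integral>\<^sup>+v. ?N (?\<sigma> y) (w * (?a * v + b y)) * f (y(m := v)) \<partial>lborel) \<partial>lebn m)"
    proof (rule nn_integral_cong_AE)
      have "AE y in lebn m. y 0 \<noteq> 0" using m by (rule AE_coord_nonzero)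
      moreover have "AE y in lebn m. y \<in> Rn m" using AE_space[of "lebn m"] by simp
      ultimately show "AE y in lebn m. (\<integral>\<^sup>+x. gaussw m x * f (y(m := z w y (ipn m x (mv m A y)))) \<partial>lebn m) =
        ennreal (?a * \<bar>w\<bar>) * (\<integral>\<^sup>+v. ?N (?\<sigma> y) (w * (?a * v + b y)) * f (y(m := v)) \<partial>lborel)"
      proof eventually_elim
        fix y assume y0: "y 0 \<noteq> 0" and y: "y \<in> Rn m"
        have F: "(\<lambda>v. f (y(m := z w y v))) \<in> borel_measurable borel"
          unfolding z_def using y by (intro measurable_upd_comp[OF f]) auto
        have p: "ipn m (mv m A y) (mv m A y) > 0" using pos[of y m, OF y0] by simp
        have "(\<integral>\<^sup>+x. gaussw m x * f (y(m := z w y (ipn m x (mv m A y)))) \<partial>lebn m) = (\<integral>\<^sup>+s. ?N (?\<sigma> y) s * f (y(m := z w y s)) \<partial>lborel)"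
          by (rule gaussian_projection[OF F p])
        \<comment> \<open>The substitution is chosen so that the new variable \<open>v\<close> is
          the last coordinate of the hyperplane point; its Jacobian cancels the weight
          \<open>1 / |g m|\<close>.\<close>
        also have "\<dots> = ennreal \<bar>- (w * ?a)\<bar> * (\<integral>\<^sup>+v. ?N (?\<sigma> y) (- (w * b y) + - (w * ?a) * v) * f (y(m := z w y (- (w * b y) + - (w * ?a) * v))) \<partial>lborel)"
          using w A'(1) F by (intro nn_integral_real_affine) auto
        also have "\<bar>- (w * ?a)\<bar> = ?a * \<bar>w\<bar>" using A'(1) by (simp add: abs_mult)
        also have "(\<integral>\<^sup>+v. ?N (?\<sigma> y) (- (w * b y) + - (w * ?a) * v) * f (y(m := z w y (- (w * b y) + - (w * ?a) * v))) \<partial>lborel)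
          = (\<integral>\<^sup>+v. ?N (?\<sigma> y) (w * (?a * v + b y)) * f (y(m := v)) \<partial>lborel)"
        proof (rule nn_integral_cong)
          fix v
          have 1: "z w y (- (w * b y) + - (w * ?a) * v) = v" using w A'(1) by (simp add: z_def field_simps)
          have 2: "- (w * b y) + - (w * ?a) * v = - (w * (?a * v + b y))" by (simp add: algebra_simps)
          show "?N (?\<sigma> y) (- (w * b y) + - (w * ?a) * v) * f (y(m := z w y (- (w * b y) + - (w * ?a) * v))) = ?N (?\<sigma> y) (w * (?a * v + b y)) * f (y(m := v))"
            unfolding 1 unfolding 2 by (simp add: normal_density_def)
        qed
        finally show "(\<integral>\<^sup>+x. gaussw m x * f (y(m := z w y (ipn m x (mv m A y)))) \<partial>lebn m) =
          ennreal (?a * \<bar>w\<bar>) * (\<integral>\<^sup>+v. ?N (?\<sigma> y) (w * (?a * v + b y)) * f (y(m := v)) \<partial>lborel)" .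
      qed
    qed
    also have "\<dots> = ennreal (?a * \<bar>w\<bar>) * (\<integral>\<^sup>+y. (\<integral>\<^sup>+v. ?N (?\<sigma> y) (w * (?a * v + b y)) * f (y(m := v)) \<partial>lborel) \<partial>lebn m)"
    proof (rule nn_integral_cmult)
      have "(\<lambda>(y, v). ?N (?\<sigma> y) (w * (?a * v + b y)) * f (y(m := v))) \<in> borel_measurable (lebn m \<Otimes>\<^sub>M lborel)"
        unfolding normal_density_def case_prod_beta'
        by (intro borel_measurable_times_ennreal measurable_upd_comp[OF f]) measurable
      then show "(\<lambda>y. \<integral>\<^sup>+v. ?N (?\<sigma> y) (w * (?a * v + b y)) * f (y(m := v)) \<partial>lborel) \<in> borel_measurable (lebn m)"
        by (rule lborel.borel_measurable_nn_integral)
    qed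
    also have "ennreal (\<phi>\<^sub>N w * (1 / (?a * \<bar>w\<bar>))) * (ennreal (?a * \<bar>w\<bar>) * (\<integral>\<^sup>+y. (\<integral>\<^sup>+v. ?N (?\<sigma> y) (w * (?a * v + b y)) * f (y(m := v)) \<partial>lborel) \<partial>lebn m))
      = ennreal (\<phi>\<^sub>N w) * (\<integral>\<^sup>+y. (\<integral>\<^sup>+v. ?N (?\<sigma> y) (w * (?a * v + b y)) * f (y(m := v)) \<partial>lborel) \<partial>lebn m)"
    proof -
      have "ennreal (\<phi>\<^sub>N w * (1 / (?a * \<bar>w\<bar>))) * ennreal (?a * \<bar>w\<bar>) = ennreal (\<phi>\<^sub>N w)"
        using w A'(1) by (subst ennreal_mult''[symmetric]) auto
      then show ?thesis by (subst mult.assoc[symmetric]) (simp only:)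
    qed
    also have "(\<integral>\<^sup>+y. (\<integral>\<^sup>+v. ?N (?\<sigma> y) (w * (?a * v + b y)) * f (y(m := v)) \<partial>lborel) \<partial>lebn m)
      = (\<integral>\<^sup>+x. ?N (sqrt (ipn m (mv (Suc m) A x) (mv (Suc m) A x))) (w * mv (Suc m) A x m) * f x \<partial>lebn (Suc m))"
    proof (subst lebn_nn_Suc)
      show "(\<lambda>x. ?N (sqrt (ipn m (mv (Suc m) A x) (mv (Suc m) A x))) (w * mv (Suc m) A x m) * f x) \<in> borel_measurable (lebn (Suc m))"
        by (rule M5)
      have 1: "ipn m (mv (Suc m) A (y(m := v))) (mv (Suc m) A (y(m := v))) = ipn m (mv m A y) (mv m A y)" for y v
        by (rule ipn_cong) (auto simp: mv_nth A'(2))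
      have 2: "mv (Suc m) A (y(m := v)) m = ?a * v + b y" for y v by (simp add: mv_nth b_def)
      show "(\<integral>\<^sup>+y. (\<integral>\<^sup>+v. ?N (?\<sigma> y) (w * (?a * v + b y)) * f (y(m := v)) \<partial>lborel) \<partial>lebn m) =
        (\<integral>\<^sup>+x. (\<integral>\<^sup>+y. ?N (sqrt (ipn m (mv (Suc m) A (x(m := y))) (mv (Suc m) A (x(m := y))))) (w * mv (Suc m) A (x(m := y)) m) * f (x(m := y)) \<partial>lborel) \<partial>lebn m)"
        unfolding 1 2 ..
    qed
    also have "ennreal (\<phi>\<^sub>N w) * (\<integral>\<^sup>+x. ?N (sqrt (ipn m (mv (Suc m) A x) (mv (Suc m) A x))) (w * mv (Suc m) A x m) * f x \<partial>lebn (Suc m)) = ?R"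
    proof (subst nn_integral_cmult[symmetric])
      show "(\<lambda>x. ?N (sqrt (ipn m (mv (Suc m) A x) (mv (Suc m) A x))) (w * mv (Suc m) A x m) * f x) \<in> borel_measurable (lebn (Suc m))"
        by (rule M5)
    qed (simp add: mult.assoc)
    finally show ?thesis .
  qed
  have "(\<integral>\<^sup>+\<gamma>. gaussw (Suc m) \<gamma> * (ennreal (1 / \<bar>?g \<gamma> m\<bar>) * (\<integral>\<^sup>+y. f (y(m := - ipn m (?g \<gamma>) y / ?g \<gamma> m)) \<partial>lebn m)) \<partial>lebn (Suc m))
    = (\<integral>\<^sup>+w. (\<integral>\<^sup>+x. gaussw (Suc m) (x(m := w)) * (ennreal (1 / \<bar>?g (x(m := w)) m\<bar>) *
      (\<integral>\<^sup>+y. f (y(m := - ipn m (?g (x(m := w))) y / ?g (x(m := w)) m)) \<partial>lebn m)) \<partial>lebn m) \<partial>lborel)"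
    by (rule lebn_nn_Suc') (intro borel_measurable_times_ennreal gaussw_measurable sm.borel_measurable_nn_integral[OF M1], measurable)
  also have "\<dots> = (\<integral>\<^sup>+w. (\<integral>\<^sup>+x. ennreal (\<phi>\<^sub>N w) * ?N (sqrt (ipn m (mv (Suc m) A x) (mv (Suc m) A x))) (w * mv (Suc m) A x m) * f x \<partial>lebn (Suc m)) \<partial>lborel)"
  proof (rule nn_integral_cong_AE)
    have "AE w in lborel. w \<noteq> (0::real)" by (rule AE_lborel_singleton)
    then show "AE w in lborel. (\<integral>\<^sup>+x. gaussw (Suc m) (x(m := w)) * (ennreal (1 / \<bar>?g (x(m := w)) m\<bar>) *
      (\<integral>\<^sup>+y. f (y(m := - ipn m (?g (x(m := w))) y / ?g (x(m := w)) m)) \<partial>lebn m)) \<partial>lebn m)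
      = (\<integral>\<^sup>+x. ennreal (\<phi>\<^sub>N w) * ?N (sqrt (ipn m (mv (Suc m) A x) (mv (Suc m) A x))) (w * mv (Suc m) A x m) * f x \<partial>lebn (Suc m))"
      by eventually_elim (rule fix_w)
  qed
  also have "\<dots> = (\<integral>\<^sup>+x. (\<integral>\<^sup>+w. ennreal (\<phi>\<^sub>N w) * ?N (sqrt (ipn m (mv (Suc m) A x) (mv (Suc m) A x))) (w * mv (Suc m) A x m) * f x \<partial>lborel) \<partial>lebn (Suc m))"
  proof (rule pn.Fubini'[symmetric])
    have c: "(\<lambda>p. mv (Suc m) A (snd p) i) \<in> borel_measurable (lborel \<Otimes>\<^sub>M lebn (Suc m))" if "i < Suc m" for i
      by (rule measurable_compose[OF measurable_snd measurable_compose[OF measurable_mv measurable_coord_lebn[OF that]]])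
    have [measurable]: "(\<lambda>p. mv (Suc m) A (snd p) m) \<in> borel_measurable (lborel \<Otimes>\<^sub>M lebn (Suc m))" by (rule c) simp
    have [measurable]: "(\<lambda>p. ipn m (mv (Suc m) A (snd p)) (mv (Suc m) A (snd p))) \<in> borel_measurable (lborel \<Otimes>\<^sub>M lebn (Suc m))"
      unfolding ipn_def by (intro borel_measurable_sum borel_measurable_times c) auto
    have [measurable]: "(\<lambda>p. f (snd p)) \<in> borel_measurable (lborel \<Otimes>\<^sub>M lebn (Suc m))"
      by (rule measurable_compose[OF measurable_snd f])
    show "(\<lambda>(w, x). ennreal (\<phi>\<^sub>N w) * ?N (sqrt (ipn m (mv (Suc m) A x) (mv (Suc m) A x))) (w * mv (Suc m) A x m) * f x) \<in> borel_measurable (lborel \<Otimes>\<^sub>M lebn (Suc m))"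
      unfolding normal_density_def case_prod_beta' by measurable
  qed
  also have "\<dots> = (\<integral>\<^sup>+x. f x * ennreal (1 / (sqrt (2 * pi) * sqrt (ipn (Suc m) (mv (Suc m) A x) (mv (Suc m) A x)))) \<partial>lebn (Suc m))"
  proof (rule nn_integral_cong_AE)
    have "AE x in lebn (Suc m). x 0 \<noteq> 0" by (rule AE_coord_nonzero) simp
    then show "AE x in lebn (Suc m). (\<integral>\<^sup>+w. ennreal (\<phi>\<^sub>N w) * ?N (sqrt (ipn m (mv (Suc m) A x) (mv (Suc m) A x))) (w * mv (Suc m) A x m) * f x \<partial>lborel)
      = f x * ennreal (1 / (sqrt (2 * pi) * sqrt (ipn (Suc m) (mv (Suc m) A x) (mv (Suc m) A x))))"
    proof eventually_elim
      fix x :: "nat \<Rightarrow> real" assume x0: "x 0 \<noteq> 0"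
      let ?y = "mv (Suc m) A x"
      have "ipn m ?y ?y > 0" using pos[of x "Suc m", OF x0] by simp
      then have "(\<integral>\<^sup>+w. ennreal (\<phi>\<^sub>N w) * ?N (sqrt (ipn m ?y ?y)) (w * ?y m) \<partial>lborel) = ennreal (1 / (sqrt (2 * pi) * sqrt ((sqrt (ipn m ?y ?y))\<^sup>2 + (?y m)\<^sup>2)))"
        by (intro normal_product_integral) simp
      also have "(sqrt (ipn m ?y ?y))\<^sup>2 + (?y m)\<^sup>2 = ipn (Suc m) ?y ?y" by (simp add: power2_eq_square) (simp add: ipn_def)
      finally have *: "(\<integral>\<^sup>+w. ennreal (\<phi>\<^sub>N w) * ?N (sqrt (ipn m ?y ?y)) (w * ?y m) \<partial>lborel) = ennreal (1 / (sqrt (2 * pi) * sqrt (ipn (Suc m) ?y ?y)))" .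
      show "(\<integral>\<^sup>+w. ennreal (\<phi>\<^sub>N w) * ?N (sqrt (ipn m ?y ?y)) (w * ?y m) * f x \<partial>lborel) = f x * ennreal (1 / (sqrt (2 * pi) * sqrt (ipn (Suc m) ?y ?y)))"
        by (subst nn_integral_multc) (simp_all add: * mult.commute)
    qed
  qed
  finally show ?thesis .
qed

section \<open>Slicing an ellipsoid\<close>

definition tail_norm :: "nat \<Rightarrow> (nat \<Rightarrow> real) \<Rightarrow> nat \<Rightarrow> real" where
  "tail_norm n g j = sqrt (\<Sum>i\<in>{j..<n}. (g i)\<^sup>2)"

text \<open>Closed form of an orthonormal basis of the complement of \<open>g\<close> adapted to the
  coordinate flag: vector \<open>j\<close> has no coordinates before \<open>j\<close> and is
  orthogonal to the part of the hyperplane supported after \<open>j\<close>. It is used for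
  \<open>n = Suc m\<close>, \<open>g m \<noteq> 0\<close> and \<open>j < m\<close>, where all tail
  norms in it are positive.\<close>

definition hyper_basis :: "nat \<Rightarrow> (nat \<Rightarrow> real) \<Rightarrow> nat \<Rightarrow> nat \<Rightarrow> real" where
  "hyper_basis n g j = (\<lambda>i\<in>{..<n}. if i < j then 0 else if i = j then tail_norm n g (Suc j) / tail_norm n g j
     else - (g j * g i) / (tail_norm n g j * tail_norm n g (Suc j)))"

lemma tail_norm_Suc: "j < n \<Longrightarrow> (tail_norm n g j)\<^sup>2 = (g j)\<^sup>2 + (tail_norm n g (Suc j))\<^sup>2"
  by (simp add: tail_norm_def sum_nonneg sum.atLeast_Suc_lessThan)

lemma tail_norm_pos: assumes "g m \<noteq> 0" "j \<le> m" shows "tail_norm (Suc m) g j > 0"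
proof -
  have "0 < (\<Sum>i\<in>{j..<Suc m}. (g i)\<^sup>2)" by (rule sum_pos2[of _ m]) (use assms in auto)
  then show ?thesis unfolding tail_norm_def by (simp only: real_sqrt_gt_0_iff)
qed

lemma tail_norm_last: "tail_norm (Suc m) g m = \<bar>g m\<bar>" by (simp add: tail_norm_def)

lemma tail_norm_0: "tail_norm n g 0 = sqrt (ipn n g g)"
  by (simp add: tail_norm_def ipn_def power2_eq_square lessThan_atLeast0)

lemma sum_lessThan_split3:
  fixes f :: "nat \<Rightarrow> real"
  assumes "j < n" shows "(\<Sum>i<n. f i) = (\<Sum>i<j. f i) + f j + (\<Sum>i\<in>{Suc j..<n}. f i)"
proof -
  have "(\<Sum>i<n. f i) = (\<Sum>i<j. f i) + (\<Sum>i\<in>{j..<n}. f i)"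
    using assms sum.atLeastLessThan_concat[of 0 j n f] by (simp add: lessThan_atLeast0)
  then show ?thesis using assms by (simp add: sum.atLeast_Suc_lessThan)
qed

lemma ipn_hyper_basis:
  assumes "j < n"
  shows "ipn n (hyper_basis n g j) x = x j * (tail_norm n g (Suc j) / tail_norm n g j)
    - g j * (\<Sum>i\<in>{Suc j..<n}. g i * x i) / (tail_norm n g j * tail_norm n g (Suc j))"
proof -
  have 1: "(\<Sum>i<j. hyper_basis n g j i * x i) = 0" using assms by (intro sum.neutral) (auto simp: hyper_basis_def)
  have 2: "(\<Sum>i\<in>{Suc j..<n}. hyper_basis n g j i * x i) = (\<Sum>i\<in>{Suc j..<n}. (- g j / (tail_norm n g j * tail_norm n g (Suc j))) * (g i * x i))"
    by (intro sum.cong refl) (auto simp: hyper_basis_def)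
  show ?thesis unfolding ipn_def sum_lessThan_split3[OF assms] 1 2 sum_distrib_left[symmetric] using assms
    by (simp add: hyper_basis_def)
qed

lemma hyper_basis_perp:
  assumes "g m \<noteq> 0" "j < m" shows "ipn (Suc m) (hyper_basis (Suc m) g j) g = 0"
proof -
  let ?s = "tail_norm (Suc m) g"
  have s: "?s j > 0" "?s (Suc j) > 0" using tail_norm_pos[of g m] assms by auto
  have "(\<Sum>i\<in>{Suc j..<Suc m}. g i * g i) = (?s (Suc j))\<^sup>2" by (simp add: tail_norm_def sum_nonneg power2_eq_square)
  then show ?thesis using s assms by (subst ipn_hyper_basis) (auto simp: field_simps power2_eq_square)
qed

text \<open>For a vector of the hyperplane that vanishes before \<open>j\<close>, orthogonality to
  \<open>g\<close> evaluates the tail sum in \<open>ipn_hyper_basis\<close>. The two parts give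
  orthonormality here, and later the triangular shape and the diagonal of the restricted
  matrix.\<close>

lemma hyper_basis_tail:
  assumes g: "g m \<noteq> 0" and j: "j < m" and x: "\<And>i. i < j \<Longrightarrow> x i = 0" and xg: "ipn (Suc m) g x = 0"
  shows "i < j \<Longrightarrow> ipn (Suc m) (hyper_basis (Suc m) g i) x = 0"
    and "ipn (Suc m) (hyper_basis (Suc m) g j) x = x j * (tail_norm (Suc m) g j / tail_norm (Suc m) g (Suc j))"
proof -
  let ?s = "tail_norm (Suc m) g"
  have tail: "(\<Sum>k\<in>{Suc i..<Suc m}. g k * x k) = - g i * x i" if "i \<le> j" for i
  proof -
    have "(\<Sum>k<i. g k * x k) = 0" using x that by (intro sum.neutral) auto
    then show ?thesis using xg sum_lessThan_split3[of i "Suc m" "\<lambda>k. g k * x k"] that j by (simp add: ipn_def)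
  qed
  show "ipn (Suc m) (hyper_basis (Suc m) g i) x = 0" if "i < j"
    using that j by (simp add: ipn_hyper_basis tail x del: sum.op_ivl_Suc)
  have s: "?s j > 0" "?s (Suc j) > 0" using tail_norm_pos[of g m] assms by auto
  have "(?s j)\<^sup>2 = (g j)\<^sup>2 + (?s (Suc j))\<^sup>2" using j by (intro tail_norm_Suc) simp
  then have e: "?s j * ?s j = g j * g j + ?s (Suc j) * ?s (Suc j)" by (simp add: power2_eq_square)
  have "ipn (Suc m) (hyper_basis (Suc m) g j) x = x j * (?s (Suc j) / ?s j) - g j * (- g j * x j) / (?s j * ?s (Suc j))"
    using j by (subst ipn_hyper_basis) (simp_all only: tail order_refl less_SucI)
  also have "\<dots> = x j * (g j * g j + ?s (Suc j) * ?s (Suc j)) / (?s j * ?s (Suc j))" using s by (simp add: field_simps)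
  also have "\<dots> = x j * (?s j / ?s (Suc j))" unfolding e[symmetric] using s by simp
  finally show "ipn (Suc m) (hyper_basis (Suc m) g j) x = x j * (?s j / ?s (Suc j))" .
qed

lemma hyper_basis_orthonormal:
  assumes g: "g m \<noteq> 0" shows "orthonormal_n (Suc m) m (hyper_basis (Suc m) g)"
proof -
  let ?u = "hyper_basis (Suc m) g"
  have 0: "?u j i = 0" if "i < j" "j < m" for i j using that by (simp add: hyper_basis_def)
  have p: "ipn (Suc m) g (?u j) = 0" if "j < m" for j using hyper_basis_perp[of g m j] g that by (simp add: ipn_commute)
  have 1: "ipn (Suc m) (?u i) (?u j) = 0" if "i < j" "j < m" for i j
    by (rule hyper_basis_tail(1)[OF g that(2) _ p[OF that(2)] that(1)]) (simp add: 0 that)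
  have 2: "ipn (Suc m) (?u j) (?u j) = 1" if "j < m" for j
  proof -
    have "tail_norm (Suc m) g j > 0" "tail_norm (Suc m) g (Suc j) > 0" using tail_norm_pos[of g m] g that by auto
    moreover have "?u j j = tail_norm (Suc m) g (Suc j) / tail_norm (Suc m) g j" using that by (simp add: hyper_basis_def)
    moreover have "ipn (Suc m) (?u j) (?u j) = ?u j j * (tail_norm (Suc m) g j / tail_norm (Suc m) g (Suc j))"
      by (rule hyper_basis_tail(2)[OF g that _ p[OF that]]) (simp add: 0 that)
    ultimately show ?thesis by simp
  qed
  have "ipn (Suc m) (?u i) (?u j) = (if i = j then 1 else 0)" if "i < m" "j < m" for i j
    using 1[of i j] 1[of j i] 2[of i] that by (cases i j rule: linorder_cases) (auto simp: ipn_commute)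
  then show ?thesis unfolding orthonormal_n_def by (auto simp: hyper_basis_def Rn_def)
qed

text \<open>\<open>D j\<close> is the squared norm of the tail of \<open>x\<close> from
  \<open>j\<close> on after removing its component along the tail of \<open>g\<close>. Passing to
  \<open>Suc j\<close> loses exactly the squared coefficient on basis vector \<open>j\<close>, so
  the sum telescopes.\<close>

lemma hyper_basis_parseval:
  assumes g: "g m \<noteq> 0" and xg: "ipn (Suc m) g x = 0"
  shows "ipn (Suc m) x x = (\<Sum>j<m. (ipn (Suc m) (hyper_basis (Suc m) g j) x)\<^sup>2)"
proof -
  let ?s = "tail_norm (Suc m) g"
  define r where "r = (\<lambda>j. \<Sum>i\<in>{j..<Suc m}. g i * x i)"
  define N where "N = (\<lambda>j. \<Sum>i\<in>{j..<Suc m}. x i * x i)"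
  define D where "D = (\<lambda>j. N j - (r j)\<^sup>2 / (?s j)\<^sup>2)"
  have step: "D j - D (Suc j) = (ipn (Suc m) (hyper_basis (Suc m) g j) x)\<^sup>2" if j: "j < m" for j
  proof -
    have s: "?s j > 0" "?s (Suc j) > 0" using tail_norm_pos[of g m] g j by auto
    have e: "(?s j)\<^sup>2 = (g j)\<^sup>2 + (?s (Suc j))\<^sup>2" using j by (intro tail_norm_Suc) simp
    have rj: "r j = g j * x j + r (Suc j)" "N j = x j * x j + N (Suc j)"
      unfolding r_def N_def using j by (auto simp: sum.atLeast_Suc_lessThan)
    have h: "ipn (Suc m) (hyper_basis (Suc m) g j) x = (x j * (?s (Suc j))\<^sup>2 - g j * r (Suc j)) / (?s j * ?s (Suc j))"
    proof -
      have "(\<Sum>i\<in>{Suc j..<Suc m}. g i * x i) = r (Suc j)" by (simp only: r_def)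
      then show ?thesis using j s by (subst ipn_hyper_basis) (auto simp: field_simps power2_eq_square simp del: sum.op_ivl_Suc)
    qed
    define S where "S = (?s (Suc j))\<^sup>2"
    have S: "S > 0" "(g j)\<^sup>2 + S > 0" using s by (auto simp: S_def add_nonneg_pos)
    have "D j - D (Suc j) = x j * x j - (g j * x j + r (Suc j))\<^sup>2 / ((g j)\<^sup>2 + S) + (r (Suc j))\<^sup>2 / S"
      unfolding D_def rj e S_def by simp
    also have "\<dots> = (x j * S - g j * r (Suc j))\<^sup>2 / (((g j)\<^sup>2 + S) * S)"
      using S by (simp add: field_simps power2_eq_square)
    also have "\<dots> = (ipn (Suc m) (hyper_basis (Suc m) g j) x)\<^sup>2"
      unfolding h power_divide power_mult_distrib S_def e by simp
    finally show ?thesis .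
  qed
  have "(\<Sum>j<m. (ipn (Suc m) (hyper_basis (Suc m) g j) x)\<^sup>2) = (\<Sum>j<m. D j - D (Suc j))"
    by (intro sum.cong refl) (simp add: step)
  also have "\<dots> = D 0 - D m" by (rule sum_lessThan_telescope')
  also have "D m = 0" unfolding D_def N_def r_def tail_norm_last using g by (simp add: power2_eq_square)
  also have "D 0 = ipn (Suc m) x x" unfolding D_def N_def r_def using xg by (simp add: ipn_def lessThan_atLeast0)
  finally show ?thesis by simp
qed

section \<open>Orthonormal coordinates on subspaces and hyperplanes\<close>

lemma lincomb_Rn [simp]: "lincomb n m u t \<in> Rn n" by (simp add: lincomb_def Rn_def)

lemma lincomb_nth: "i < n \<Longrightarrow> lincomb n m u t i = (\<Sum>j<m. t j * u j i)" by (simp add: lincomb_def)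

lemma measurable_lincomb [measurable]: "lincomb n m u \<in> lebn m \<rightarrow>\<^sub>M lebn n"
  by (rule measurable_to_lebn) (auto simp: lincomb_nth)

lemma ipn_lincomb: "ipn n (lincomb n m u t) x = (\<Sum>j<m. t j * ipn n (u j) x)"
proof -
  have "ipn n (lincomb n m u t) x = (\<Sum>i<n. \<Sum>j<m. t j * (u j i * x i))"
    unfolding ipn_def by (intro sum.cong refl) (simp add: lincomb_nth sum_distrib_right mult.assoc)
  also have "\<dots> = (\<Sum>j<m. t j * ipn n (u j) x)" unfolding ipn_def sum_distrib_left by (rule sum.swap)
  finally show ?thesis .
qed

lemma ipn_lincomb2:
  assumes "orthonormal_n n m u" shows "ipn n (lincomb n m u a) (lincomb n m u b) = ipn m a b"
proof -
  have "ipn n (u j) (lincomb n m u b) = b j" if "j < m" for j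
  proof -
    have "ipn n (u j) (lincomb n m u b) = (\<Sum>i<m. b i * ipn n (u i) (u j))" by (subst ipn_commute) (rule ipn_lincomb)
    also have "\<dots> = (\<Sum>i<m. if i = j then b j else 0)"
      using assms that by (intro sum.cong refl) (auto simp: orthonormal_n_def)
    also have "\<dots> = b j" using that by simp
    finally show ?thesis .
  qed
  then show ?thesis unfolding ipn_lincomb unfolding ipn_def[of m] by (intro sum.cong refl) simp
qed

lemma lincomb_lincomb: "lincomb n m u (lincomb m p w s) = lincomb n p (\<lambda>j. lincomb n m u (w j)) s"
proof (rule Rn_eqI[of _ n])
  fix i assume i: "i < n"
  have "lincomb n m u (lincomb m p w s) i = (\<Sum>j<m. \<Sum>l<p. s l * (w l j * u j i))"
    unfolding lincomb_nth[OF i] by (intro sum.cong refl) (simp add: lincomb_nth sum_distrib_right mult.assoc)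
  also have "\<dots> = (\<Sum>l<p. s l * (\<Sum>j<m. w l j * u j i))" unfolding sum_distrib_left by (rule sum.swap)
  finally show "lincomb n m u (lincomb m p w s) i = lincomb n p (\<lambda>j. lincomb n m u (w j)) s i" using i by (simp add: lincomb_nth)
qed auto

lemma orthonormal_comp:
  assumes "orthonormal_n n m u" "orthonormal_n m p w"
  shows "orthonormal_n n p (\<lambda>j. lincomb n m u (w j))"
  using assms(2) unfolding orthonormal_n_def by (auto simp: ipn_lincomb2[OF assms(1)])

lemma mv_lincomb: "mv n A (lincomb n m u t) = lincomb n m (\<lambda>j. mv n A (u j)) t"
proof (rule Rn_eqI[of _ n])
  fix i assume i: "i < n"
  have "mv n A (lincomb n m u t) i = (\<Sum>k<n. \<Sum>j<m. t j * (A i k * u j k))"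
    unfolding mv_nth[OF i] by (intro sum.cong refl) (simp add: lincomb_nth sum_distrib_left mult_ac)
  also have "\<dots> = (\<Sum>j<m. t j * (\<Sum>k<n. A i k * u j k))" unfolding sum_distrib_left by (rule sum.swap)
  finally show "mv n A (lincomb n m u t) i = lincomb n m (\<lambda>j. mv n A (u j)) t i" using i by (simp add: lincomb_nth mv_nth)
qed auto

lemma prod_tail_norm:
  assumes g: "g m \<noteq> 0" and "k \<le> m"
  shows "(\<Prod>j<k. tail_norm (Suc m) g (Suc j) / tail_norm (Suc m) g j) = tail_norm (Suc m) g k / tail_norm (Suc m) g 0"
  using assms(2)
proof (induction k)
  case 0
  have "tail_norm (Suc m) g 0 > 0" using tail_norm_pos[of g m 0] g by simp
  then show ?case by simp
next
  case (Suc k)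
  have "tail_norm (Suc m) g k > 0" using tail_norm_pos[of g m k] g Suc.prems by simp
  then show ?case using Suc by simp
qed

text \<open>The first \<open>m\<close> coordinates of a point are a lower triangular function
  \<open>U\<close> of its orthonormal coordinates, because the basis follows the flag; the last one
  is forced by orthogonality to \<open>g\<close>. The diagonal of \<open>U\<close> telescopes to
  \<open>|g m| / |g|\<close>, which exchanges the graph weight for \<open>1 / |g|\<close>.\<close>

lemma hyperplane_integral:
  assumes g: "g m \<noteq> 0" and f[measurable]: "f \<in> borel_measurable (lebn (Suc m))"
  shows "ennreal (1 / \<bar>g m\<bar>) * (\<integral>\<^sup>+y. f (y(m := - ipn m g y / g m)) \<partial>lebn m)
    = ennreal (1 / sqrt (ipn (Suc m) g g)) * (\<integral>\<^sup>+t. f (lincomb (Suc m) m (hyper_basis (Suc m) g) t) \<partial>lebn m)"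
proof -
  let ?u = "hyper_basis (Suc m) g" and ?s = "tail_norm (Suc m) g"
  define U where "U = (\<lambda>i j. ?u j i)"
  have s: "?s j > 0" if "j \<le> m" for j using tail_norm_pos[of g m] g that by auto
  have U: "lower_tri m U" unfolding lower_tri_def U_def using s by (auto simp: hyper_basis_def)
  have d: "diag_prod m U = \<bar>g m\<bar> / sqrt (ipn (Suc m) g g)"
  proof -
    have "diag_prod m U = (\<Prod>j<m. ?s (Suc j) / ?s j)" unfolding diag_prod_def U_def by (intro prod.cong refl) (simp add: hyper_basis_def)
    then show ?thesis using prod_tail_norm[of g m m] g by (simp add: tail_norm_last tail_norm_0)
  qed
  have pg: "sqrt (ipn (Suc m) g g) > 0" using s[of 0] by (simp add: tail_norm_0)
  have eq: "lincomb (Suc m) m ?u t = (mv m U t)(m := - ipn m g (mv m U t) / g m)" for t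
  proof (rule Rn_eqI[of _ "Suc m"])
    let ?x = "lincomb (Suc m) m ?u t"
    have lo: "?x i = mv m U t i" if "i < m" for i using that by (simp add: lincomb_nth mv_nth U_def mult.commute)
    have "ipn (Suc m) ?x g = 0" unfolding ipn_lincomb using hyper_basis_perp[of g m] g by simp
    moreover have "ipn (Suc m) ?x g = ipn m g ?x + g m * ?x m" by (simp add: ipn_def mult.commute)
    moreover have "ipn m g ?x = ipn m g (mv m U t)" by (rule ipn_cong) (auto simp: lo)
    ultimately have hi: "?x m = - ipn m g (mv m U t) / g m" using g by (simp add: field_simps)
    fix i assume "i < Suc m"
    then show "?x i = ((mv m U t)(m := - ipn m g (mv m U t) / g m)) i" using lo hi by (cases "i = m") auto
  qed (auto intro: upd_Rn)
  have "(\<integral>\<^sup>+t. f (lincomb (Suc m) m ?u t) \<partial>lebn m) = ennreal (1 / diag_prod m U) * (\<integral>\<^sup>+y. f (y(m := - ipn m g y / g m)) \<partial>lebn m)"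
    unfolding eq
    by (rule vol_scalingD(3)[OF vol_scaling_lower_tri[OF U], of "\<lambda>y. f (y(m := - ipn m g y / g m))"])
       (intro measurable_upd_comp[OF f] borel_measurable_divide borel_measurable_uminus measurable_ipn measurable_ident_sets[OF refl] borel_measurable_const)
  then have "ennreal (1 / sqrt (ipn (Suc m) g g)) * (\<integral>\<^sup>+t. f (lincomb (Suc m) m ?u t) \<partial>lebn m) =
    (ennreal (1 / sqrt (ipn (Suc m) g g)) * ennreal (1 / diag_prod m U)) * (\<integral>\<^sup>+y. f (y(m := - ipn m g y / g m)) \<partial>lebn m)"
    by (simp only: mult.assoc)
  also have "ennreal (1 / sqrt (ipn (Suc m) g g)) * ennreal (1 / diag_prod m U) = ennreal (1 / \<bar>g m\<bar>)"
    using pg g unfolding d by (subst ennreal_mult[symmetric]) auto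
  finally show ?thesis ..
qed

text \<open>In the bases of the hyperplanes orthogonal to the transpose of A applied to \<gamma> and to \<gamma> that respect the coordinate flag,
  the restriction of a lower triangular A is again lower triangular.\<close>

lemma hyperplane_restriction:
  assumes A: "lower_tri (Suc m) A" and \<gamma>: "\<gamma> m \<noteq> 0"
  defines "g \<equiv> mv (Suc m) (transp A) \<gamma>"
  obtains B where "lower_tri m B"
    "\<And>t. ipn (Suc m) (mv (Suc m) A (lincomb (Suc m) m (hyper_basis (Suc m) g) t)) (mv (Suc m) A (lincomb (Suc m) m (hyper_basis (Suc m) g) t))
      = ipn m (mv m B t) (mv m B t)"
    "diag_prod m B = diag_prod (Suc m) A * sqrt (ipn (Suc m) \<gamma> \<gamma>) / sqrt (ipn (Suc m) g g)"
proof -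
  have A': "A m m > 0" "\<And>i. i < m \<Longrightarrow> A i m = 0" using A by (auto simp: lower_tri_def)
  have gm: "g m = A m m * \<gamma> m" unfolding g_def by (simp add: mv_nth A'(2))
  then have g: "g m \<noteq> 0" using A' \<gamma> by simp
  let ?u = "hyper_basis (Suc m) g" and ?v = "hyper_basis (Suc m) \<gamma>"
  let ?s = "tail_norm (Suc m) g" and ?r = "tail_norm (Suc m) \<gamma>"
  define a where "a = (\<lambda>j. mv (Suc m) A (?u j))"
  define B where "B = (\<lambda>i j. ipn (Suc m) (?v i) (a j))"
  have s: "?s j > 0" "?r j > 0" if "j \<le> m" for j using tail_norm_pos[of g m] tail_norm_pos[of \<gamma> m] g \<gamma> that by auto
  \<comment> \<open>\<open>A\<close> maps the hyperplane orthogonal to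
    \<open>g = A^T \<gamma>\<close> into the one orthogonal to \<open>\<gamma>\<close>, so the
    second basis suffices to express the image.\<close>
  have perp: "ipn (Suc m) \<gamma> (mv (Suc m) A x) = ipn (Suc m) g x" for x
    unfolding g_def using ipn_mv[of "Suc m" A x \<gamma>] by (simp add: ipn_commute)
  have pa: "ipn (Suc m) \<gamma> (a j) = 0" if "j < m" for j
    unfolding a_def perp using hyper_basis_perp[of g m j, OF g that] by (simp add: ipn_commute)
  have lo: "a j i = 0" if "i < j" "j < m" for i j
  proof -
    have "A i k * ?u j k = 0" if k: "k < Suc m" for k
    proof (cases "k < j")
      case True then show ?thesis using k by (simp add: hyper_basis_def)
    next
      case False
      then have "A i k = 0" using A k \<open>i < j\<close> \<open>j < m\<close> by (auto simp: lower_tri_def)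
      then show ?thesis by simp
    qed
    then have "(\<Sum>k<Suc m. A i k * ?u j k) = 0" by (intro sum.neutral) auto
    moreover have "a j i = (\<Sum>k<Suc m. A i k * ?u j k)" unfolding a_def by (rule mv_nth) (use that in simp)
    ultimately show ?thesis by (simp only:)
  qed
  have dg: "a j j = A j j * (?s (Suc j) / ?s j)" if "j < m" for j
  proof -
    have "a j j = (\<Sum>k<Suc m. A j k * ?u j k)" unfolding a_def using that by (subst mv_nth) auto
    also have "\<dots> = (\<Sum>k<Suc m. if k = j then A j j * ?u j j else 0)"
    proof (intro sum.cong refl)
      fix k assume k: "k \<in> {..<Suc m}"
      consider "k < j" | "k = j" | "k > j" by linarith
      then show "A j k * ?u j k = (if k = j then A j j * ?u j j else 0)"
      proof cases
        case 1 then show ?thesis using k by (simp add: hyper_basis_def)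
      next
        case 3 then have "A j k = 0" using A k that by (auto simp: lower_tri_def)
        then show ?thesis using 3 by simp
      qed simp
    qed
    also have "\<dots> = A j j * ?u j j" using that by simp
    finally show ?thesis using that by (simp add: hyper_basis_def)
  qed
  have Bd: "B j j = A j j * (?s (Suc j) / ?s j) * (?r j / ?r (Suc j))" if "j < m" for j
    unfolding B_def using hyper_basis_tail(2)[of \<gamma> m j "a j"] \<gamma> that lo pa dg by simp
  have B0: "B i j = 0" if "i < j" "j < m" for i j
    unfolding B_def using hyper_basis_tail(1)[of \<gamma> m j "a j" i] \<gamma> that lo pa by simp
  have "lower_tri m B" unfolding lower_tri_def
  proof (intro conjI allI impI)
    fix i assume i: "i < m"
    have "A i i > 0" using A i by (auto simp: lower_tri_def)
    then show "0 < B i i" unfolding Bd[OF i] using s[of i] s[of "Suc i"] i by simp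
  qed (simp add: B0)
  moreover have "ipn (Suc m) (mv (Suc m) A (lincomb (Suc m) m ?u t)) (mv (Suc m) A (lincomb (Suc m) m ?u t)) = ipn m (mv m B t) (mv m B t)" for t
  proof -
    let ?x = "mv (Suc m) A (lincomb (Suc m) m ?u t)"
    have x: "?x = lincomb (Suc m) m a t" unfolding mv_lincomb a_def ..
    have "ipn (Suc m) \<gamma> ?x = 0"
      unfolding x by (subst ipn_commute) (unfold ipn_lincomb, simp add: pa ipn_commute)
    then have "ipn (Suc m) ?x ?x = (\<Sum>i<m. (ipn (Suc m) (?v i) ?x)\<^sup>2)" by (rule hyper_basis_parseval[of \<gamma> m, OF \<gamma>])
    also have "\<dots> = (\<Sum>i<m. (mv m B t i)\<^sup>2)"
    proof (intro sum.cong refl)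
      fix i assume i: "i \<in> {..<m}"
      have "ipn (Suc m) (?v i) ?x = (\<Sum>j<m. t j * ipn (Suc m) (a j) (?v i))"
        unfolding x by (subst ipn_commute) (rule ipn_lincomb)
      also have "\<dots> = mv m B t i" using i by (simp add: mv_nth B_def ipn_commute mult.commute)
      finally show "(ipn (Suc m) (?v i) ?x)\<^sup>2 = (mv m B t i)\<^sup>2" by simp
    qed
    finally show ?thesis by (simp add: ipn_def power2_eq_square)
  qed
  \<comment> \<open>The two diagonal products telescope to \<open>|g m| / |g|\<close> and
    \<open>|\<gamma> m| / |\<gamma>|\<close>; since \<open>g m = A m m * \<gamma> m\<close>, their
    quotient restores the missing diagonal entry of \<open>A\<close>.\<close>
  moreover have "diag_prod m B = diag_prod (Suc m) A * sqrt (ipn (Suc m) \<gamma> \<gamma>) / sqrt (ipn (Suc m) g g)"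
  proof -
    have "diag_prod m B = (\<Prod>j<m. A j j * (?s (Suc j) / ?s j) / (?r (Suc j) / ?r j))"
      unfolding diag_prod_def by (intro prod.cong refl) (simp add: Bd)
    also have "\<dots> = (\<Prod>j<m. A j j) * (\<Prod>j<m. ?s (Suc j) / ?s j) / (\<Prod>j<m. ?r (Suc j) / ?r j)"
      by (simp only: prod_dividef prod.distrib)
    also have "\<dots> = diag_prod m A * (\<bar>g m\<bar> / ?s 0) / (\<bar>\<gamma> m\<bar> / ?r 0)"
      unfolding prod_tail_norm[of g m m, OF g order_refl] prod_tail_norm[of \<gamma> m m, OF \<gamma> order_refl] tail_norm_last diag_prod_def ..
    also have "\<bar>g m\<bar> = A m m * \<bar>\<gamma> m\<bar>" unfolding gm using A' by (simp add: abs_mult)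
    finally show ?thesis using \<gamma> by (simp add: diag_prod_Suc tail_norm_0)
  qed
  ultimately show thesis using that by blast
qed

text \<open>The left side is \<open>D\<close> to the stated power times
  \<open>(D^{1/n} / G)^{1 - q} * (1 / \<Gamma>)^q\<close>, and Young's inequality splits the
  product. With \<open>G = |A^T \<gamma>|\<close> and \<open>\<Gamma> = |\<gamma>|\<close> the two
  dependent norms thereby separate, and \<open>gaussian_inverse_norm\<close> bounds each
  expectation.\<close>

lemma slicing_weight:
  fixes D G \<Gamma> q :: real and n :: nat
  assumes "D > 0" "G > 0" "\<Gamma> > 0" "0 \<le> q" "q \<le> 1"
  shows "1 / G * (D * \<Gamma> / G) powr (- q) \<le> D powr (- (q + (1 - q) / real n)) * ((1 - q) * D powr (1 / real n) * (1 / G) + q * (1 / \<Gamma>))"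
proof -
  let ?a = "D powr (1 / real n) * (1 / G)" and ?b = "1 / \<Gamma>"
  have l: "ln (D * \<Gamma> / G) = ln D + ln \<Gamma> - ln G" "ln ?a = 1 / real n * ln D - ln G" "ln ?b = - ln \<Gamma>"
    using assms by (simp_all add: ln_mult ln_div ln_powr)
  have iG: "1 / G = exp (- ln G)" using assms by (simp add: exp_minus divide_inverse)
  have "1 / G * (D * \<Gamma> / G) powr (- q) = exp (- ln G + - q * (ln D + ln \<Gamma> - ln G))"
    using assms unfolding iG exp_add by (simp add: powr_def l)
  also have "- ln G + - q * (ln D + ln \<Gamma> - ln G) = - (q + (1 - q) / real n) * ln D + ((1 - q) * (1 / real n * ln D - ln G) + q * (- ln \<Gamma>))"
    by (simp add: algebra_simps diff_divide_distrib)
  also have "exp \<dots> = D powr (- (q + (1 - q) / real n)) * (?a powr (1 - q) * ?b powr q)"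
  proof -
    have "D powr (- (q + (1 - q) / real n)) = exp (- (q + (1 - q) / real n) * ln D)" using assms by (simp add: powr_def)
    moreover have "?a powr (1 - q) = exp ((1 - q) * (1 / real n * ln D - ln G))" unfolding l(2)[symmetric] using assms by (simp add: powr_def)
    moreover have "?b powr q = exp (q * (- ln \<Gamma>))" unfolding l(3)[symmetric] using assms by (simp add: powr_def)
    ultimately show ?thesis by (simp only: exp_add)
  qed
  also have "\<dots> \<le> D powr (- (q + (1 - q) / real n)) * ((1 - q) * ?a + q * ?b)"
    using assms by (intro mult_left_mono Youngs_inequality_0) auto
  finally show ?thesis by (simp only: mult.assoc)
qed

lemma orthonormal_std:
  assumes "m \<le> n" shows "orthonormal_n n m (\<lambda>j. \<lambda>i\<in>{..<n}. if i = j then 1 else 0)" (is "orthonormal_n n m ?e")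
  unfolding orthonormal_n_def
proof (intro conjI allI impI)
  fix i j assume "i < m" "j < m"
  then have "ipn n (?e i) (?e j) = (\<Sum>k<n. if k = i then (if i = j then 1 else 0) else 0)"
    unfolding ipn_def by (intro sum.cong refl) auto
  also have "\<dots> = (if i = j then 1 else 0)" using \<open>i < m\<close> assms by simp
  finally show "ipn n (?e i) (?e j) = (if i = j then 1 else 0)" .
qed (auto simp: Rn_def)

text \<open>Induction on the codimension. On the support \<open>1 <= R / |A x|\<close>, so the
  integral is at most \<open>sqrt (2 * pi) * R\<close> times the Gaussian average of hyperplane
  integrals. Each of these is bounded by the induction hypothesis in orthonormal coordinates, where
  the matrix is \<open>B\<close>, the radius is again \<open>R\<close>, and sections of the section
  are sections of the whole. The power of \<open>diag_prod m B\<close> is averaged by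
  \<open>slicing_weight\<close>; \<open>27 = 3 * 9\<close> combines
  \<open>sqrt (2 * pi) <= 3\<close> with the constant of
  \<open>gaussian_inverse_norm\<close>.\<close>

lemma ellipsoid_slicing:
  fixes S :: ennreal
  assumes "lower_tri n A" "k < n" "R > 0" "f \<in> borel_measurable (lebn n)"
    and "\<forall>x\<in>Rn n. f x \<noteq> 0 \<longrightarrow> ipn n (mv n A x) (mv n A x) \<le> R\<^sup>2"
    and "\<forall>u. orthonormal_n n (n - k) u \<longrightarrow> (\<integral>\<^sup>+t. f (lincomb n (n - k) u t) \<partial>lebn (n - k)) \<le> S"
  shows "(\<integral>\<^sup>+x. f x \<partial>lebn n) \<le> ennreal ((\<Prod>j<k. 27 * R / sqrt (real (n - j))) * diag_prod n A powr (- (real k / real n))) * S"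
  using assms
proof (induction k arbitrary: n A f)
  case 0
  define e where "e = (\<lambda>j. \<lambda>i\<in>{..<n}. if i = j then 1 else (0::real))"
  have "orthonormal_n n n e" unfolding e_def by (rule orthonormal_std) simp
  then have "(\<integral>\<^sup>+t. f (lincomb n n e t) \<partial>lebn n) \<le> S" using 0 by simp
  also have "(\<integral>\<^sup>+t. f (lincomb n n e t) \<partial>lebn n) = (\<integral>\<^sup>+t. f t \<partial>lebn n)"
  proof (rule nn_integral_cong)
    fix t assume "t \<in> space (lebn n)"
    then have t: "t \<in> Rn n" by simp
    have "lincomb n n e t = t"
    proof (rule Rn_eqI[of _ n, OF _ t])
      fix i assume i: "i < n"
      have "lincomb n n e t i = (\<Sum>j<n. if j = i then t i else 0)"
        unfolding lincomb_nth[OF i] by (intro sum.cong refl) (use i in \<open>auto simp: e_def\<close>)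
      then show "lincomb n n e t i = t i" using i by simp
    qed simp
    then show "f (lincomb n n e t) = f t" by simp
  qed
  finally show ?case using diag_prod_pos[OF 0(1)] by simp
next
  case (Suc k)
  then obtain m where n: "n = Suc m" by (cases n) auto
  have km: "k < m" and m: "m > 0" and n2: "n \<ge> 2" using Suc.prems(2) n by auto
  note A = Suc.prems(1) and R = Suc.prems(3) and f[measurable] = Suc.prems(4) and supp = Suc.prems(5) and sec = Suc.prems(6)
  define q where "q = real k / real m"
  have q: "0 \<le> q" "q \<le> 1" using km by (auto simp: q_def)
  define D where "D = diag_prod n A"
  have D: "D > 0" unfolding D_def by (rule diag_prod_pos[OF A])
  define c where "c = (\<Prod>j<k. 27 * R / sqrt (real (m - j)))"
  have c: "c \<ge> 0" unfolding c_def using R by (intro prod_nonneg) auto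
  define e where "e = q + (1 - q) / real n"
  \<comment> \<open>The exponent reproduces itself: starting from \<open>q = k / (n - 1)\<close>,
    the weight turns it into \<open>(k + 1) / n\<close>.\<close>
  have e: "e = real (Suc k) / real n"
  proof -
    have "e * real n = q * real n + (1 - q)" unfolding e_def using n by (simp add: distrib_right)
    also have "\<dots> = q * real m + 1" unfolding n by (simp add: algebra_simps)
    also have "q * real m = real k" unfolding q_def using m by simp
    finally show ?thesis using n by (simp add: field_simps)
  qed
  define G where "G = (\<lambda>\<gamma>. sqrt (ipn n (mv n (transp A) \<gamma>) (mv n (transp A) \<gamma>)))"
  define \<Gamma> where "\<Gamma> = (\<lambda>\<gamma>. sqrt (ipn n \<gamma> \<gamma>))"
  have Gm[measurable]: "G \<in> borel_measurable (lebn n)" "\<Gamma> \<in> borel_measurable (lebn n)" unfolding G_def \<Gamma>_def by measurable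
  define W where "W = (\<lambda>\<gamma>. ennreal ((1 - q) * D powr (1 / real n)) * ennreal (1 / G \<gamma>) + ennreal q * ennreal (1 / \<Gamma> \<gamma>))"
  have Wm[measurable]: "W \<in> borel_measurable (lebn n)" unfolding W_def by measurable
  have key: "ennreal (1 / \<bar>mv n (transp A) \<gamma> m\<bar>) * (\<integral>\<^sup>+y. f (y(m := - ipn m (mv n (transp A) \<gamma>) y / mv n (transp A) \<gamma> m)) \<partial>lebn m)
    \<le> ennreal (c * D powr (- e)) * S * W \<gamma>" if \<gamma>: "\<gamma> m \<noteq> 0" for \<gamma>
  proof -
    define g where "g = mv n (transp A) \<gamma>"
    let ?u = "hyper_basis (Suc m) g"
    have "A m m > 0" "\<And>i. i < m \<Longrightarrow> A i m = 0" using A unfolding n by (auto simp: lower_tri_def)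
    then have gm: "g m \<noteq> 0" unfolding g_def n using \<gamma> by (simp add: mv_nth)
    have ou: "orthonormal_n n m ?u" unfolding n by (rule hyper_basis_orthonormal[of g m, OF gm])
    obtain B where B: "lower_tri m B"
      "\<And>t. ipn n (mv n A (lincomb n m ?u t)) (mv n A (lincomb n m ?u t)) = ipn m (mv m B t) (mv m B t)"
      "diag_prod m B = D * \<Gamma> \<gamma> / G \<gamma>"
      using hyperplane_restriction[of m A \<gamma>] A \<gamma> unfolding n g_def D_def G_def \<Gamma>_def by metis
    have "ipn n g g \<noteq> 0" "ipn n \<gamma> \<gamma> \<noteq> 0" using gm \<gamma> unfolding ipn_self_eq_0 n by auto
    then have pos: "G \<gamma> > 0" "\<Gamma> \<gamma> > 0" unfolding G_def \<Gamma>_def g_def using ipn_self_nonneg[of n] by (simp_all add: less_le)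
    have "(\<integral>\<^sup>+t. f (lincomb n m ?u t) \<partial>lebn m) \<le> ennreal (c * diag_prod m B powr (- (real k / real m))) * S"
      unfolding c_def
    proof (rule Suc.IH[OF B(1) km R])
      show "(\<lambda>t. f (lincomb n m ?u t)) \<in> borel_measurable (lebn m)" by measurable
      show "\<forall>t\<in>Rn m. f (lincomb n m ?u t) \<noteq> 0 \<longrightarrow> ipn m (mv m B t) (mv m B t) \<le> R\<^sup>2"
        using supp lincomb_Rn[of n m ?u] unfolding B(2)[symmetric] by blast
      show "\<forall>w. orthonormal_n m (m - k) w \<longrightarrow> (\<integral>\<^sup>+t. f (lincomb n m ?u (lincomb m (m - k) w t)) \<partial>lebn (m - k)) \<le> S"
      proof (intro allI impI)
        fix w assume "orthonormal_n m (m - k) w"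
        from orthonormal_comp[OF ou this] have "orthonormal_n n (n - Suc k) (\<lambda>j. lincomb n m ?u (w j))" unfolding n by simp
        then have "(\<integral>\<^sup>+t. f (lincomb n (n - Suc k) (\<lambda>j. lincomb n m ?u (w j)) t) \<partial>lebn (n - Suc k)) \<le> S" using sec by blast
        then show "(\<integral>\<^sup>+t. f (lincomb n m ?u (lincomb m (m - k) w t)) \<partial>lebn (m - k)) \<le> S"
          unfolding lincomb_lincomb n by simp
      qed
    qed
    then have "ennreal (1 / G \<gamma>) * (\<integral>\<^sup>+t. f (lincomb n m ?u t) \<partial>lebn m) \<le> ennreal (1 / G \<gamma>) * (ennreal (c * diag_prod m B powr (- (real k / real m))) * S)"
      by (rule mult_left_mono) simp
    also have "\<dots> = ennreal (c * (1 / G \<gamma> * (D * \<Gamma> \<gamma> / G \<gamma>) powr (- q))) * S"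
      unfolding B(3) q_def[symmetric] mult.assoc[symmetric] using pos c by (subst ennreal_mult[symmetric]) (auto simp: mult_ac)
    also have "\<dots> \<le> ennreal (c * (D powr (- e) * ((1 - q) * D powr (1 / real n) * (1 / G \<gamma>) + q * (1 / \<Gamma> \<gamma>)))) * S"
      using slicing_weight[OF D pos q, of n] c unfolding e_def
      by (intro mult_right_mono ennreal_leI mult_left_mono) auto
    also have "ennreal (c * (D powr (- e) * ((1 - q) * D powr (1 / real n) * (1 / G \<gamma>) + q * (1 / \<Gamma> \<gamma>)))) = ennreal (c * D powr (- e)) * W \<gamma>"
    proof -
      have "W \<gamma> = ennreal ((1 - q) * D powr (1 / real n) * (1 / G \<gamma>)) + ennreal (q * (1 / \<Gamma> \<gamma>))"
        unfolding W_def using q pos by (subst (1 2) ennreal_mult) auto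
      also have "\<dots> = ennreal ((1 - q) * D powr (1 / real n) * (1 / G \<gamma>) + q * (1 / \<Gamma> \<gamma>))"
        using q pos by (intro ennreal_plus[symmetric]) auto
      finally have "ennreal (c * D powr (- e)) * W \<gamma> = ennreal (c * D powr (- e) * ((1 - q) * D powr (1 / real n) * (1 / G \<gamma>) + q * (1 / \<Gamma> \<gamma>)))"
        using c q pos by (simp only:) (intro ennreal_mult[symmetric], auto)
      then show ?thesis by (simp only: mult.assoc)
    qed
    also have "ennreal (c * D powr (- e)) * W \<gamma> * S = ennreal (c * D powr (- e)) * S * W \<gamma>" by (simp only: mult_ac)
    also have "ennreal (1 / G \<gamma>) * (\<integral>\<^sup>+t. f (lincomb n m ?u t) \<partial>lebn m) = ennreal (1 / \<bar>g m\<bar>) * (\<integral>\<^sup>+y. f (y(m := - ipn m g y / g m)) \<partial>lebn m)"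
    proof -
      have "G \<gamma> = sqrt (ipn (Suc m) g g)" unfolding G_def g_def n ..
      then show ?thesis using hyperplane_integral[of g m f, OF gm] f unfolding n by simp
    qed
    finally show ?thesis unfolding g_def .
  qed
  have W: "(\<integral>\<^sup>+\<gamma>. gaussw n \<gamma> * W \<gamma> \<partial>lebn n) \<le> ennreal (9 / sqrt (real n))"
  proof -
    \<comment> \<open>The term with \<open>\<Gamma>\<close> is the same inverse moment for the
      identity matrix. The power of \<open>D\<close> in front of the other term cancels its
      determinant factor, so both contribute the same bound.\<close>
    let ?I = "\<lambda>i j::nat. if i = j then 1 else (0::real)"
    have I: "lower_tri n ?I" "diag_prod n ?I = 1" by (auto simp: lower_tri_def diag_prod_def)
    have "ipn n (mv n (transp ?I) \<gamma>) (mv n (transp ?I) \<gamma>) = ipn n \<gamma> \<gamma>" for \<gamma>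
      by (rule ipn_cong) (simp_all add: mv_nth if_distrib[of "\<lambda>x. x * _"] cong: if_cong)
    then have 2: "(\<integral>\<^sup>+\<gamma>. gaussw n \<gamma> * ennreal (1 / \<Gamma> \<gamma>) \<partial>lebn n) \<le> ennreal (9 / sqrt (real n))"
      using gaussian_inverse_norm[OF I(1) n2] unfolding I(2) \<Gamma>_def by simp
    have 1: "(\<integral>\<^sup>+\<gamma>. gaussw n \<gamma> * ennreal (1 / G \<gamma>) \<partial>lebn n) \<le> ennreal (9 / sqrt (real n) * D powr (- 1 / real n))"
      using gaussian_inverse_norm[OF A n2] unfolding G_def D_def .
    have "(\<integral>\<^sup>+\<gamma>. gaussw n \<gamma> * W \<gamma> \<partial>lebn n) = (\<integral>\<^sup>+\<gamma>. ennreal ((1 - q) * D powr (1 / real n)) * (gaussw n \<gamma> * ennreal (1 / G \<gamma>)) + ennreal q * (gaussw n \<gamma> * ennreal (1 / \<Gamma> \<gamma>)) \<partial>lebn n)"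
      unfolding W_def distrib_left by (intro nn_integral_cong) (simp only: mult_ac)
    also have "\<dots> = ennreal ((1 - q) * D powr (1 / real n)) * (\<integral>\<^sup>+\<gamma>. gaussw n \<gamma> * ennreal (1 / G \<gamma>) \<partial>lebn n) + ennreal q * (\<integral>\<^sup>+\<gamma>. gaussw n \<gamma> * ennreal (1 / \<Gamma> \<gamma>) \<partial>lebn n)"
      by (subst nn_integral_add) (auto simp: nn_integral_cmult)
    also have "\<dots> \<le> ennreal ((1 - q) * D powr (1 / real n)) * ennreal (9 / sqrt (real n) * D powr (- 1 / real n)) + ennreal q * ennreal (9 / sqrt (real n))"
      by (intro add_mono mult_left_mono 1 2) auto
    also have "\<dots> = ennreal ((1 - q) * D powr (1 / real n) * (9 / sqrt (real n) * D powr (- 1 / real n)) + q * (9 / sqrt (real n)))"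
    proof -
      have "ennreal a * ennreal b + ennreal c * ennreal d = ennreal (a * b + c * d)"
        if "0 \<le> a" "0 \<le> b" "0 \<le> c" "0 \<le> d" for a b c d :: real
        using that by (simp add: ennreal_mult ennreal_plus)
      then show ?thesis using q by simp
    qed
    also have "(1 - q) * D powr (1 / real n) * (9 / sqrt (real n) * D powr (- 1 / real n)) = (1 - q) * (9 / sqrt (real n)) * (D powr (1 / real n) * D powr (- 1 / real n))"
      by (simp only: mult_ac)
    also have "D powr (1 / real n) * D powr (- 1 / real n) = 1" using D by (simp add: powr_add[symmetric])
    also have "(1 - q) * (9 / sqrt (real n)) * 1 + q * (9 / sqrt (real n)) = 9 / sqrt (real n)" by (simp only: mult_1_right distrib_right[symmetric] diff_add_cancel mult_1_left)
    finally show ?thesis .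
  qed
  let ?N = "\<lambda>x. sqrt (ipn n (mv n A x) (mv n A x))"
  have "(\<integral>\<^sup>+x. f x \<partial>lebn n) \<le> (\<integral>\<^sup>+x. ennreal (sqrt (2 * pi) * R) * (f x * ennreal (1 / (sqrt (2 * pi) * ?N x))) \<partial>lebn n)"
  proof (rule nn_integral_mono_AE)
    have "AE x in lebn n. x 0 \<noteq> 0" using n by (intro AE_coord_nonzero) simp
    moreover have "AE x in lebn n. x \<in> Rn n" using AE_space[of "lebn n"] by simp
    ultimately show "AE x in lebn n. f x \<le> ennreal (sqrt (2 * pi) * R) * (f x * ennreal (1 / (sqrt (2 * pi) * ?N x)))"
    proof eventually_elim
      fix x assume x0: "x 0 \<noteq> 0" and x: "x \<in> Rn n"
      show "f x \<le> ennreal (sqrt (2 * pi) * R) * (f x * ennreal (1 / (sqrt (2 * pi) * ?N x)))"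
      proof (cases "f x = 0")
        case False
        have "ipn n (mv n A x) (mv n A x) \<noteq> 0"
          using lower_tri_inj[OF A, of x 0] x0 n by (auto simp: ipn_self_eq_0)
        then have p: "?N x > 0" using ipn_self_nonneg[of n "mv n A x"] by (simp add: less_le)
        have "?N x \<le> R" using supp x False R by (intro real_le_lsqrt) auto
        then have "1 \<le> (sqrt (2 * pi) * R) * (1 / (sqrt (2 * pi) * ?N x))" using p by simp
        then have "f x * 1 \<le> f x * ennreal ((sqrt (2 * pi) * R) * (1 / (sqrt (2 * pi) * ?N x)))"
          by (intro mult_left_mono) (auto simp del: times_divide_eq_right)
        also have "\<dots> = ennreal (sqrt (2 * pi) * R) * (f x * ennreal (1 / (sqrt (2 * pi) * ?N x)))"
          using R p by (subst ennreal_mult) (auto simp: mult_ac)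
        finally show ?thesis by simp
      qed simp
    qed
  qed
  also have "\<dots> = ennreal (sqrt (2 * pi) * R) * (\<integral>\<^sup>+x. f x * ennreal (1 / (sqrt (2 * pi) * ?N x)) \<partial>lebn n)"
    by (rule nn_integral_cmult) measurable
  also have "(\<integral>\<^sup>+x. f x * ennreal (1 / (sqrt (2 * pi) * ?N x)) \<partial>lebn n) =
    (\<integral>\<^sup>+\<gamma>. gaussw n \<gamma> * (ennreal (1 / \<bar>mv n (transp A) \<gamma> m\<bar>) *
      (\<integral>\<^sup>+y. f (y(m := - ipn m (mv n (transp A) \<gamma>) y / mv n (transp A) \<gamma> m)) \<partial>lebn m)) \<partial>lebn n)"
    using gaussian_hyperplane_average[of m A f] A m f unfolding n by simp
  also have "\<dots> \<le> (\<integral>\<^sup>+\<gamma>. ennreal (c * D powr (- e)) * S * (gaussw n \<gamma> * W \<gamma>) \<partial>lebn n)"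
  proof (rule nn_integral_mono_AE)
    have "AE \<gamma> in lebn n. \<gamma> m \<noteq> 0" using n by (intro AE_coord_nonzero) simp
    then show "AE \<gamma> in lebn n. gaussw n \<gamma> * (ennreal (1 / \<bar>mv n (transp A) \<gamma> m\<bar>) *
      (\<integral>\<^sup>+y. f (y(m := - ipn m (mv n (transp A) \<gamma>) y / mv n (transp A) \<gamma> m)) \<partial>lebn m))
      \<le> ennreal (c * D powr (- e)) * S * (gaussw n \<gamma> * W \<gamma>)"
    proof eventually_elim
      fix \<gamma> :: "nat \<Rightarrow> real" assume "\<gamma> m \<noteq> 0"
      from mult_left_mono[OF key[of \<gamma>, OF this], of "gaussw n \<gamma>"]
      show "gaussw n \<gamma> * (ennreal (1 / \<bar>mv n (transp A) \<gamma> m\<bar>) *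
        (\<integral>\<^sup>+y. f (y(m := - ipn m (mv n (transp A) \<gamma>) y / mv n (transp A) \<gamma> m)) \<partial>lebn m))
        \<le> ennreal (c * D powr (- e)) * S * (gaussw n \<gamma> * W \<gamma>)"
        by (simp only: zero_le mult.left_commute[of "ennreal (c * D powr (- e)) * S"])
    qed
  qed
  also have "\<dots> = ennreal (c * D powr (- e)) * S * (\<integral>\<^sup>+\<gamma>. gaussw n \<gamma> * W \<gamma> \<partial>lebn n)"
    by (rule nn_integral_cmult) measurable
  also have "\<dots> \<le> ennreal (c * D powr (- e)) * S * ennreal (9 / sqrt (real n))" by (intro mult_left_mono W) simp
  finally have "(\<integral>\<^sup>+x. f x \<partial>lebn n) \<le> ennreal (sqrt (2 * pi) * R) * (ennreal (c * D powr (- e)) * S * ennreal (9 / sqrt (real n)))"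
    by (simp only: mult_left_mono zero_le)
  also have "\<dots> = ennreal (sqrt (2 * pi) * R * (c * D powr (- e)) * (9 / sqrt (real n))) * S"
    using R c by (simp only: ennreal_mult mult_nonneg_nonneg less_imp_le powr_ge_zero real_sqrt_ge_zero pi_ge_zero zero_le_numeral divide_nonneg_nonneg of_nat_0_le_iff mult_ac)
  also have "\<dots> \<le> ennreal (27 * R / sqrt (real n) * c * D powr (- e)) * S"
  proof (intro mult_right_mono ennreal_leI)
    have "sqrt (2 * pi) \<le> sqrt (3\<^sup>2)" using pi_less_4 by (intro real_sqrt_le_mono) (simp add: power2_eq_square)
    then have "sqrt (2 * pi) \<le> 3" by simp
    then have "sqrt (2 * pi) * (R * (c * D powr (- e)) * (9 / sqrt (real n))) \<le> 3 * (R * (c * D powr (- e)) * (9 / sqrt (real n)))"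
      using R c by (intro mult_right_mono) auto
    then show "sqrt (2 * pi) * R * (c * D powr (- e)) * (9 / sqrt (real n)) \<le> 27 * R / sqrt (real n) * c * D powr (- e)"
      by (simp add: mult_ac)
  qed simp
  also have "27 * R / sqrt (real n) * c = (\<Prod>j<Suc k. 27 * R / sqrt (real (n - j)))"
    unfolding prod.lessThan_Suc_shift c_def n by simp
  finally show ?case unfolding D_def e .
qed

section \<open>Constants\<close>

text \<open>The unqualified \<open>unit_ball_vol\<close> is the constant in the statement; it is
  identified here with the explicit \<open>Ball_Volume.unit_ball_vol\<close> that governs the
  ellipsoids above.\<close>

lemma unit_ball_vol_pos: "unit_ball_vol n > 0"
  and emeasure_ball_scaled: "r > 0 \<Longrightarrow> emeasure (lebn n) {x \<in> Rn n. ipn n x x \<le> r\<^sup>2} = ennreal (unit_ball_vol n * r ^ n)"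
proof -
  have s: "{x \<in> Rn n. enorm n x \<le> 1} = {x \<in> Rn n. ipn n x x \<le> 1\<^sup>2}" by (simp add: enorm_def)
  have "unit_ball_vol n = Ball_Volume.unit_ball_vol (real n)"
    unfolding unit_ball_vol_def voln_def measure_def s using emeasure_ball[of 1 n] by simp
  then show "unit_ball_vol n > 0"
    "r > 0 \<Longrightarrow> emeasure (lebn n) {x \<in> Rn n. ipn n x x \<le> r\<^sup>2} = ennreal (unit_ball_vol n * r ^ n)"
    using emeasure_ball[of 1 n] emeasure_ball[of r n] unfolding s by simp_all
qed

lemma ball_sets: "{x \<in> Rn n. ipn n x x \<le> c} \<in> sets (lebn n)"
proof -
  have "{x \<in> space (lebn n). ipn n x x \<le> c} \<in> sets (lebn n)" by measurable
  then show ?thesis by simp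
qed

text \<open>The ball of dimension j + 1 contains the product of a ball of dimension j and an interval of
  half-length 1 / sqrt (j + 1).\<close>

lemma unit_ball_vol_Suc_ge: "unit_ball_vol j / sqrt (real (Suc j)) \<le> unit_ball_vol (Suc j)"
proof (cases "j = 0")
  case True
  have "emeasure (lebn 0) (Rn 0) = 1" by (simp add: lebn_def Rn_def emeasure_PiM_empty)
  moreover have "{x \<in> Rn 0. ipn 0 x x \<le> 1\<^sup>2} = Rn 0" by (auto simp: ipn_def)
  ultimately have 0: "unit_ball_vol 0 = 1" using emeasure_ball_scaled[of 1 0] unit_ball_vol_pos[of 0] by (simp add: ennreal_eq_1)
  have "{x \<in> Rn 1. ipn 1 x x \<le> 1\<^sup>2} = {x \<in> Rn 1. \<forall>i<1. \<bar>x i\<bar> \<le> 1}"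
    by (auto simp: ipn_def abs_le_square_iff[of _ 1, simplified] power2_eq_square)
  then have "ennreal (unit_ball_vol 1) = ennreal 2" using emeasure_ball_scaled[of 1 1] emeasure_cube[of 1 1] by simp
  then have "unit_ball_vol 1 = 2" using unit_ball_vol_pos[of 1] by (subst (asm) ennreal_inj) auto
  then show ?thesis using 0 True by simp
next
  case False
  let ?h = "1 / sqrt (real (Suc j))" and ?\<rho> = "sqrt (real j / real (Suc j))"
  have \<rho>: "?\<rho> > 0" using False by simp
  have "ennreal (unit_ball_vol j * ?\<rho> ^ j * (2 * ?h)) = ennreal (2 * ?h) * emeasure (lebn j) {x \<in> Rn j. ipn j x x \<le> ?\<rho>\<^sup>2}"
    unfolding emeasure_ball_scaled[OF \<rho>] using unit_ball_vol_pos[of j] \<rho> by (subst ennreal_mult[symmetric]) (auto simp: mult_ac)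
  also have "\<dots> = (\<integral>\<^sup>+x. ennreal (2 * ?h) * indicator {x \<in> Rn j. ipn j x x \<le> ?\<rho>\<^sup>2} x \<partial>lebn j)"
    using ball_sets[of j "?\<rho>\<^sup>2"] by (simp add: nn_integral_cmult)
  also have "\<dots> = (\<integral>\<^sup>+x. (\<integral>\<^sup>+y. indicator {x \<in> Rn j. ipn j x x \<le> ?\<rho>\<^sup>2} x * indicator {- ?h..?h} y \<partial>lborel) \<partial>lebn j)"
  proof -
    have "(\<integral>\<^sup>+y. c * indicator {- h..h} y \<partial>lborel) = ennreal (2 * h) * c" if "h \<ge> 0" for c :: ennreal and h :: real
      using that by (subst nn_integral_cmult) (auto simp: mult.commute)
    then show ?thesis by (intro nn_integral_cong) simp
  qed
  also have "\<dots> \<le> (\<integral>\<^sup>+x. (\<integral>\<^sup>+y. indicator {x \<in> Rn (Suc j). ipn (Suc j) x x \<le> 1\<^sup>2} (x(j := y)) \<partial>lborel) \<partial>lebn j)"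
  proof (intro nn_integral_mono)
    fix x y assume x: "x \<in> space (lebn j)"
    show "indicator {x \<in> Rn j. ipn j x x \<le> ?\<rho>\<^sup>2} x * indicator {- ?h..?h} y \<le> (indicator {x \<in> Rn (Suc j). ipn (Suc j) x x \<le> 1\<^sup>2} (x(j := y)) :: ennreal)"
    proof (cases "ipn j x x \<le> ?\<rho>\<^sup>2 \<and> y \<in> {- ?h..?h}")
      case True
      then have "\<bar>y\<bar> \<le> ?h" by (simp add: abs_le_interval)
      then have "\<bar>y\<bar>\<^sup>2 \<le> ?h\<^sup>2" by (intro power_mono) auto
      then have "y\<^sup>2 \<le> 1 / real (Suc j)" by (simp add: power_divide)
      moreover have "ipn j x x \<le> real j / real (Suc j)" using True by simp
      moreover have "ipn (Suc j) (x(j := y)) (x(j := y)) = ipn j x x + y\<^sup>2"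
        unfolding ipn_def power2_eq_square by simp
      moreover have "real j / real (Suc j) + 1 / real (Suc j) = 1" by (simp add: add_divide_distrib[symmetric])
      ultimately have "ipn (Suc j) (x(j := y)) (x(j := y)) \<le> 1\<^sup>2" by simp
      then show ?thesis using x upd_Rn[of x j y] by (auto simp: indicator_def)
    qed (auto simp: indicator_def)
  qed
  also have "\<dots> = (\<integral>\<^sup>+x. indicator {x \<in> Rn (Suc j). ipn (Suc j) x x \<le> 1\<^sup>2} x \<partial>lebn (Suc j))"
    by (rule lebn_nn_Suc[symmetric]) (use ball_sets[of "Suc j" "1\<^sup>2"] in simp)
  also have "\<dots> = ennreal (unit_ball_vol (Suc j))"
    using ball_sets[of "Suc j" "1\<^sup>2"] emeasure_ball_scaled[of 1 "Suc j"] by simp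
  finally have 1: "unit_ball_vol j * ?\<rho> ^ j * (2 * ?h) \<le> unit_ball_vol (Suc j)"
    using unit_ball_vol_pos[of "Suc j"] by (subst (asm) ennreal_le_iff) auto
  \<comment> \<open>\<open>?\<rho> ^ j\<close> is the inverse square root of
    \<open>(1 + 1/j) ^ j <= 4\<close>; the loss of a factor 2 is made up by the full length
    \<open>2 * ?h\<close> of the interval.\<close>
  have "1 / 2 \<le> ?\<rho> ^ j"
  proof -
    have "(real (Suc j) / real j) ^ j = (1 + 1 / real j) ^ j" using False by (simp add: add_divide_distrib add.commute)
    also have "\<dots> \<le> exp (1 / real j) ^ j" by (intro power_mono) (auto simp: exp_ge_add_one_self)
    also have "\<dots> = exp 1" using False by (simp add: exp_of_nat_mult[symmetric])
    also have "\<dots> \<le> 4" using exp_le by simp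
    finally have "(real (Suc j) / real j) ^ j \<le> 4" .
    then have "1 / 4 \<le> 1 / (real (Suc j) / real j) ^ j" using False by (intro divide_left_mono) auto
    also have "\<dots> = (real j / real (Suc j)) ^ j" by (simp add: power_divide)
    finally have "sqrt (1 / 4) \<le> sqrt ((real j / real (Suc j)) ^ j)" by (rule real_sqrt_le_mono)
    moreover have "sqrt (1 / 4) = 1 / 2" by (simp add: real_sqrt_divide)
    ultimately show ?thesis by (simp add: real_sqrt_power)
  qed
  then have "unit_ball_vol j * (1 / 2) * (2 * ?h) \<le> unit_ball_vol j * ?\<rho> ^ j * (2 * ?h)"
    using unit_ball_vol_pos[of j] by (intro mult_right_mono mult_left_mono) auto
  then show ?thesis using 1 by simp
qed

lemma unit_ball_vol_add_ge:
  assumes "m + k \<le> n" "n > 0" shows "unit_ball_vol m * (1 / sqrt (real n)) ^ k \<le> unit_ball_vol (m + k)"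
  using assms
proof (induction k)
  case (Suc k)
  have "unit_ball_vol m * (1 / sqrt (real n)) ^ Suc k = unit_ball_vol m * (1 / sqrt (real n)) ^ k * (1 / sqrt (real n))" by simp
  also have "\<dots> \<le> unit_ball_vol (m + k) * (1 / sqrt (real (Suc (m + k))))"
    using Suc unit_ball_vol_pos[of "m + k"] by (intro mult_mono divide_left_mono) auto
  also have "\<dots> \<le> unit_ball_vol (Suc (m + k))" using unit_ball_vol_Suc_ge[of "m + k"] by simp
  finally show ?case by simp
qed simp

text \<open>On the ball of radius \<open>sqrt n\<close> the standard Gaussian density is at least
  \<open>(2 * pi * e)^{-n/2} >= 6^{-n}\<close>, and its total mass is 1.\<close>

lemma unit_ball_vol_le:
  assumes "n > 0" shows "unit_ball_vol n \<le> (6 / sqrt (real n)) ^ n"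
proof -
  let ?r = "sqrt (real n)" and ?B = "{x \<in> Rn n. ipn n x x \<le> (sqrt (real n))\<^sup>2}"
  have r: "?r > 0" using assms by simp
  have "ennreal ((1/6) ^ n * (unit_ball_vol n * ?r ^ n)) = ennreal ((1/6) ^ n) * emeasure (lebn n) ?B"
    unfolding emeasure_ball_scaled[OF r] using unit_ball_vol_pos[of n] by (intro ennreal_mult) auto
  also have "\<dots> = (\<integral>\<^sup>+x. ennreal ((1/6) ^ n) * indicator ?B x \<partial>lebn n)"
    using ball_sets[of n] by (simp add: nn_integral_cmult)
  also have "\<dots> \<le> (\<integral>\<^sup>+x. gaussw n x \<partial>lebn n)"
  proof (rule nn_integral_mono)
    fix x
    show "ennreal ((1/6) ^ n) * indicator ?B x \<le> gaussw n x"
    proof (cases "x \<in> ?B")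
      case True
      have "sqrt (2 * pi) \<le> sqrt (3\<^sup>2)" using pi_less_4 by (intro real_sqrt_le_mono) (simp add: power2_eq_square)
      then have p: "sqrt (2 * pi) \<le> 3" by simp
      have "exp 1 \<le> (2::real)\<^sup>2" using exp_le by simp
      then have "exp (1/2) ^ 2 \<le> (2::real)\<^sup>2" by (simp add: exp_of_nat_mult[symmetric])
      then have e: "exp (1/2) \<le> (2::real)" by (rule power2_le_imp_le) simp
      have "(1/6) ^ n \<le> (1 / (sqrt (2 * pi) * exp (1/2))) ^ n"
      proof (intro power_mono)
        have "sqrt (2 * pi) * exp (1/2) \<le> 3 * 2" using p e by (intro mult_mono) auto
        then show "1/6 \<le> 1 / (sqrt (2 * pi) * exp (1/2))" by (intro divide_left_mono) auto
      qed simp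
      also have "\<dots> = (1 / sqrt (2 * pi)) ^ n * exp (- (real n / 2))"
      proof -
        have "exp (- (real n / 2)) = exp (real n * - (1/2))" by simp
        also have "\<dots> = exp (- (1/2)) ^ n" by (rule exp_of_nat_mult)
        also have "exp (- (1/2)) = 1 / exp (1/2 :: real)" unfolding exp_minus inverse_eq_divide ..
        finally show ?thesis by (simp only: power_mult_distrib[symmetric] times_divide_times_eq mult_1_left)
      qed
      also have "\<dots> \<le> (1 / sqrt (2 * pi)) ^ n * exp (\<Sum>i<n. - (x i)\<^sup>2 / 2)"
      proof (intro mult_left_mono)
        have "(\<Sum>i<n. - (x i)\<^sup>2 / 2) = - (ipn n x x / 2)"
          unfolding ipn_def power2_eq_square sum_divide_distrib sum_negf[symmetric] by simp
        moreover have "ipn n x x \<le> real n" using True by simp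
        ultimately show "exp (- (real n / 2)) \<le> exp (\<Sum>i<n. - (x i)\<^sup>2 / 2)" by simp
      qed simp
      also have "\<dots> = (\<Prod>i<n. \<phi>\<^sub>N (x i))" by (simp add: normal_density_def exp_sum prod_dividef power_divide)
      finally have "ennreal ((1/6) ^ n) \<le> ennreal (\<Prod>i<n. \<phi>\<^sub>N (x i))" by (rule ennreal_leI)
      also have "\<dots> = gaussw n x" by (simp add: prod_ennreal)
      finally show ?thesis using True by simp
    qed simp
  qed
  also have "\<dots> = ennreal 1" by (simp add: nn_gaussw)
  finally have "(1/6) ^ n * (unit_ball_vol n * ?r ^ n) \<le> 1" by (subst (asm) ennreal_le_iff) auto
  then show ?thesis using r by (simp add: power_divide field_simps)
qed

text \<open>This lets \<open>c_const\<close> be introduced at the price of \<open>12 ^ k\<close>.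
  With \<open>m = n - k\<close>, bounding the larger ball below by the smaller one reduces the
  constant to \<open>(\<omega>_m * n^{m/2})^{-k/n}\<close>, where \<open>\<omega>_m\<close> is the
  volume in dimension \<open>m\<close>. By \<open>unit_ball_vol_le\<close> and
  \<open>(n/m)^m <= e^k\<close> the base is at most \<open>(6 * sqrt e)^n\<close>, and
  \<open>6 * sqrt e <= 12\<close>.\<close>

lemma c_const_ge:
  assumes "1 \<le> k" "k < n" shows "(1 / 12) ^ k \<le> c_const n k"
proof -
  define m where "m = n - k"
  have m: "m > 0" "n = m + k" "m < n" "real n = real m + real k" using assms by (auto simp: m_def)
  let ?\<omega> = unit_ball_vol
  have w: "?\<omega> m > 0" "?\<omega> n > 0" by (rule unit_ball_vol_pos)+
  define a where "a = ln (?\<omega> m)"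
  have rn: "real n > 0" "real m > 0" using m by auto
  have "?\<omega> m * (1 / sqrt (real n)) ^ k \<le> ?\<omega> n" using unit_ball_vol_add_ge[of m k n, folded m(2)] assms by simp
  then have "ln (?\<omega> m * (1 / sqrt (real n)) ^ k) \<le> ln (?\<omega> n)" using w rn by (subst ln_le_cancel_iff) auto
  moreover have "ln (?\<omega> m * (1 / sqrt (real n)) ^ k) = a - real k * (ln (real n) / 2)"
    unfolding a_def using w rn by (simp add: ln_mult ln_realpow ln_div ln_sqrt)
  ultimately have 1: "a - real k * (ln (real n) / 2) \<le> ln (?\<omega> n)" by simp
  have "ln (?\<omega> m) \<le> ln ((6 / sqrt (real m)) ^ m)" using unit_ball_vol_le[OF m(1)] w rn by (subst ln_le_cancel_iff) auto
  also have "\<dots> = real m * (ln 6 - ln (real m) / 2)" using rn by (simp add: ln_realpow ln_div ln_sqrt)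
  finally have 2: "a \<le> real m * (ln 6 - ln (real m) / 2)" unfolding a_def .
  have "ln (real n / real m) \<le> real n / real m - 1" using rn by (intro ln_le_minus_one) simp
  then have "real m * ln (real n / real m) \<le> real m * (real n / real m - 1)" using rn by (intro mult_left_mono) auto
  also have "\<dots> = real k" using rn m by (simp add: field_simps)
  finally have 3: "real m * (ln (real n) - ln (real m)) \<le> real k" using rn by (simp add: ln_div)
  have "- (ln 6 + 1/2) * real k \<le> (real m / real n) * ln (?\<omega> n) - a"
  proof -
    have "(real m / real n) * (a - real k * (ln (real n) / 2)) \<le> (real m / real n) * ln (?\<omega> n)" using 1 rn by (intro mult_left_mono) auto
    moreover have "(real m / real n) * (a - real k * (ln (real n) / 2)) - a = - (real k / real n) * (a + real m * (ln (real n) / 2))"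
    proof -
      have "real m / real n = 1 - real k / real n" using rn m by (simp add: field_simps)
      then have "(real m / real n) * a - a = - (real k / real n) * a" by (simp only: left_diff_distrib)
      then show ?thesis by (simp add: algebra_simps)
    qed
    moreover have "(real k / real n) * (a + real m * (ln (real n) / 2)) \<le> (real k / real n) * (real n * (ln 6 + 1/2))"
    proof (intro mult_left_mono)
      have "a + real m * (ln (real n) / 2) \<le> real m * ln 6 + real k / 2" using 2 3 by (simp add: algebra_simps)
      also have "\<dots> \<le> real n * ln 6 + real n / 2" using m(4) by (intro add_mono mult_right_mono) auto
      finally show "a + real m * (ln (real n) / 2) \<le> real n * (ln 6 + 1/2)" by (simp add: algebra_simps)
    qed auto
    moreover have "(real k / real n) * (real n * (ln 6 + 1/2)) = real k * (ln 6 + 1/2)" using rn by simp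
    ultimately show ?thesis by (simp add: algebra_simps)
  qed
  moreover have "- ln 12 \<le> - (ln 6 + 1/2 :: real)"
  proof -
    have "ln (12::real) = ln 6 + ln 2" using ln_mult[of 6 "2::real"] by simp
    moreover have "ln 2 \<ge> (1/2::real)" using ln_le_minus_one[of "1/2::real"] by (simp add: ln_div)
    ultimately show ?thesis by linarith
  qed
  then have "- ln 12 * real k \<le> - (ln 6 + 1/2) * real k" by (rule mult_right_mono) simp
  ultimately have "- ln 12 * real k \<le> (real m / real n) * ln (?\<omega> n) - a" by linarith
  then have "exp (- ln 12 * real k) \<le> exp ((real m / real n) * ln (?\<omega> n) - a)" by simp
  also have "\<dots> = c_const n k"
  proof -
    have "real n - real k = real m" using m by simp
    then show ?thesis unfolding c_const_def m_def[symmetric] a_def using w by (simp add: exp_diff powr_def)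
  qed
  also have "exp (- ln 12 * real k) = (1 / 12) ^ k"
  proof -
    have "exp (- ln 12 * real k) = exp (- ln (12::real)) ^ k"
      unfolding exp_of_nat_mult[symmetric] by (simp only: mult.commute)
    moreover have "exp (- ln (12::real)) = 1 / 12" by (simp add: exp_minus)
    ultimately show ?thesis by (simp only:)
  qed
  finally show ?thesis .
qed

text \<open>The product is the binomial coefficient times \<open>k!\<close>; the first factor is at
  least \<open>(n/k)^k\<close>, the second at least \<open>(k/e)^k\<close> by a single term of the
  exponential series.\<close>

lemma falling_factorial_ge:
  assumes "k \<le> n" "0 < n" shows "(real n / exp 1) ^ k \<le> (\<Prod>j<k. real (n - j))"
proof (cases "k = 0")
  case False
  have "(real n / exp 1) ^ k = (real n / real k) ^ k * (real k / exp 1) ^ k"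
    unfolding power_mult_distrib[symmetric] using False by simp
  also have "\<dots> \<le> real (n choose k) * fact k"
  proof (intro mult_mono)
    show "(real n / real k) ^ k \<le> real (n choose k)" using binomial_ge_n_over_k_pow_k[OF assms(1)] by simp
    have "sum (\<lambda>i. real k ^ i /\<^sub>R fact i) {k} \<le> (\<Sum>i. real k ^ i /\<^sub>R fact i)"
      by (rule sum_le_suminf[OF summable_exp_generic]) auto
    then have "real k ^ k / fact k \<le> exp (real k)" unfolding exp_def by (simp add: divide_inverse mult.commute)
    also have "\<dots> = exp 1 ^ k" using exp_of_nat_mult[of k "1::real"] by simp
    finally show "(real k / exp 1) ^ k \<le> fact k" by (simp add: power_divide field_simps)
  qed auto
  also have "\<dots> = (\<Prod>j<k. real (n - j))"
  proof -
    have "real (n choose k) * fact k = (\<Prod>i = 0..<k. real n - real i)"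
      by (simp add: binomial_gbinomial gbinomial_prod_rev)
    also have "\<dots> = (\<Prod>j<k. real (n - j))" using assms by (intro prod.cong) (auto simp: of_nat_diff)
    finally show ?thesis .
  qed
  finally show ?thesis .
qed simp

section \<open>The slicing inequality\<close>

text \<open>If \<open>x + y\<close> and \<open>x - y\<close> lie in the given ball about
  \<open>x\<close>, then \<open>y\<close> is the midpoint of \<open>x + y\<close> and
  \<open>- (x - y)\<close>, which moves the ball to the origin; a cube inside it is kept.\<close>

lemma sym_body_convex_body:
  assumes "convex_body n L" "origin_symmetric n L" "n > 0" shows "sym_body n L"
proof -
  obtain x r where x: "x \<in> L" "r > 0" "{y \<in> Rn n. enorm n (vadd n y (vneg n x)) < r} \<subseteq> L"
    using assms(1) by (auto simp: convex_body_def)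
  have conv: "vadd n (vscale n (1 - t) a) (vscale n t b) \<in> L" if "a \<in> L" "b \<in> L" "0 \<le> t" "t \<le> 1" for a b t
    using assms(1) that unfolding convex_body_def convex_n_def by blast
  define \<rho> where "\<rho> = r / (2 * sqrt (real n))"
  have "y \<in> L" if y: "y \<in> Rn n" "\<forall>i<n. \<bar>y i\<bar> \<le> \<rho>" for y
  proof -
    have "ipn n y y \<le> real n * \<rho>\<^sup>2" using y by (intro ipn_le_coord) auto
    also have "\<dots> = (r / 2)\<^sup>2" using assms(3) by (simp add: \<rho>_def power_divide power_mult_distrib)
    finally have "sqrt (ipn n y y) \<le> r / 2" using x(2) by (intro real_le_lsqrt) auto
    then have yr: "sqrt (ipn n y y) < r" using x(2) by linarith
    let ?a = "vadd n x y" and ?b = "vadd n x (vneg n y)"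
    have "ipn n (vadd n ?a (vneg n x)) (vadd n ?a (vneg n x)) = ipn n y y" by (rule ipn_cong) auto
    then have a: "?a \<in> L" using yr x(3) by (auto simp: enorm_def)
    have "ipn n (vadd n ?b (vneg n x)) (vadd n ?b (vneg n x)) = ipn n (\<lambda>i. - y i) (\<lambda>i. - y i)" by (rule ipn_cong) auto
    also have "\<dots> = ipn n y y" by (simp add: ipn_def)
    finally have "?b \<in> L" using yr x(3) by (auto simp: enorm_def)
    then have "vneg n ?b \<in> L" using assms(2) by (auto simp: origin_symmetric_def)
    then have "vadd n (vscale n (1 - 1/2) ?a) (vscale n (1/2) (vneg n ?b)) \<in> L"
      by (rule conv[OF a]) simp_all
    moreover have "vadd n (vscale n (1 - 1/2) ?a) (vscale n (1/2) (vneg n ?b)) = y"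
      using y(1) by (intro Rn_eqI[of _ n]) (auto simp: field_simps)
    ultimately show ?thesis by simp
  qed
  moreover have "\<rho> > 0" using x(2) assms(3) by (simp add: \<rho>_def)
  ultimately show ?thesis using assms unfolding sym_body_def convex_body_def by blast
qed

lemma voln_polar_scale:
  assumes L: "sym_body n L" and k: "k > 0" and n: "n > 0"
  shows "voln n (polar n L (real k)) = (real k / real n) ^ n * voln n (polar n L (real n))"
proof -
  let ?c = "real n / real k"
  have c: "?c > 0" using k n by simp
  have P: "sym_body n (polar n L (real n))" using n by (intro sym_body_polar[OF L]) simp
  have "polar n L (real k) = {\<xi> \<in> Rn n. vscale n ?c \<xi> \<in> polar n L (real n)}"
    unfolding polar_def using k n by (auto simp: ipn_vec field_simps)
  then have "emeasure (lebn n) (polar n L (real k)) = ennreal (1 / ?c ^ n) * emeasure (lebn n) (polar n L (real n))"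
    using vol_scaling_emeasure[OF vol_scaling_vscale[OF c] sym_body_sets[OF P]] by simp
  also have "\<dots> = ennreal (1 / ?c ^ n * voln n (polar n L (real n)))"
    unfolding sym_body_emeasure(1)[OF P] using c sym_body_emeasure(2)[OF P] by (intro ennreal_mult[symmetric]) auto
  finally have "voln n (polar n L (real k)) = 1 / ?c ^ n * voln n (polar n L (real n))"
    using c sym_body_emeasure(2)[OF P] unfolding voln_def measure_def by (simp add: less_imp_le)
  then show ?thesis by (simp add: power_divide)
qed

text \<open>\<open>2 * sqrt n\<close> is the radius of the ellipsoid in the application. After
  squaring, the falling factorial cancels \<open>n ^ k\<close> up to \<open>e ^ k\<close>;
  numerically \<open>54^2 = 2916\<close> and \<open>2916 * 4 = 108^2\<close>.\<close>

lemma slicing_constant_le: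
  assumes "k < n" shows "(\<Prod>j<k. 27 * (2 * sqrt (real n)) / sqrt (real (n - j))) \<le> 108 ^ k"
proof (rule power2_le_imp_le)
  have "(\<Prod>j<k. 27 * (2 * sqrt (real n)) / sqrt (real (n - j)))\<^sup>2 = (\<Prod>j<k. (2916 * real n) / real (n - j))"
    unfolding prod_power_distrib by (intro prod.cong refl) (simp add: power_divide power_mult_distrib)
  also have "\<dots> = (2916 * real n) ^ k / (\<Prod>j<k. real (n - j))" by (simp add: prod_dividef)
  also have "\<dots> \<le> (2916 * real n) ^ k / (real n / exp 1) ^ k"
    using assms falling_factorial_ge[of k n] by (intro divide_left_mono) (auto intro!: mult_pos_pos prod_pos)
  also have "\<dots> = (2916 * exp 1) ^ k" unfolding power_divide[symmetric] using assms by simp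
  also have "\<dots> \<le> 11664 ^ k" using exp_le by (intro power_mono) auto
  also have "\<dots> = (108 ^ k)\<^sup>2" by (simp add: power_mult[symmetric] mult.commute[of k]) (simp add: power_mult)
  finally show "(\<Prod>j<k. 27 * (2 * sqrt (real n)) / sqrt (real (n - j)))\<^sup>2 \<le> (108 ^ k)\<^sup>2" .
qed simp

text \<open>The last hypothesis is a lower bound for \<open>D\<close>, combining the volume
  inequality of the ellipsoid with reverse Santalo at level \<open>k\<close>. Solving for
  \<open>D\<close> and raising to the power \<open>- k / n\<close> produces
  \<open>sqrt (n / k) ^ k\<close>. Enlarging 12 to 16 makes the constant a square,
  \<open>16 * 10^14 = (4 * 10^7)^2\<close>.\<close>

lemma slicing_determinant_le:
  assumes "1 \<le> k" "k < n" "D > 0" "l > 0" "(real k / real n) ^ n * (1 / 10 ^ 14) ^ n \<le> 12 ^ n * (l * D)\<^sup>2"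
  shows "D powr (- (real k / real n)) \<le> (4 * 10 ^ 7 * sqrt (real n / real k)) ^ k * l powr (real k / real n)"
proof -
  define y where "y = 16 * 10 ^ 14 * (real n / real k)"
  have y: "y > 0" using assms by (simp add: y_def)
  have "1 \<le> (12 * (real n / real k) * 10 ^ 14) ^ n * (l * D)\<^sup>2"
  proof -
    define Z where "Z = 12 * (real n / real k) * 10 ^ 14"
    have "((real k / real n) * (1 / 10 ^ 14)) ^ n * Z ^ n = 12 ^ n"
      unfolding power_mult_distrib[symmetric] Z_def using assms by simp
    then have "12 ^ n * 1 = (real k / real n) ^ n * (1 / 10 ^ 14) ^ n * Z ^ n"
      by (simp only: power_mult_distrib[of "real k / real n"] mult_1_right)
    also have "\<dots> \<le> 12 ^ n * (l * D)\<^sup>2 * Z ^ n" by (rule mult_right_mono[OF assms(5)]) (simp add: Z_def)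
    finally have "12 ^ n * 1 \<le> 12 ^ n * (l * D)\<^sup>2 * (12 * (real n / real k) * 10 ^ 14) ^ n" unfolding Z_def .
    then have "12 ^ n * 1 \<le> 12 ^ n * ((12 * (real n / real k) * 10 ^ 14) ^ n * (l * D)\<^sup>2)" by (simp only: mult_ac)
    then show ?thesis by (simp only: mult_le_cancel_left_pos zero_less_power zero_less_numeral)
  qed
  also have "\<dots> \<le> y ^ n * (l * D)\<^sup>2" unfolding y_def by (intro mult_right_mono power_mono) (auto intro!: divide_right_mono mult_right_mono)
  finally have "ln 1 \<le> ln (y ^ n * (l * D)\<^sup>2)" using y assms by (subst ln_le_cancel_iff) auto
  also have "\<dots> = real n * ln y + 2 * (ln l + ln D)" using y assms by (simp add: ln_mult ln_realpow)
  finally have "0 \<le> real n * ln y + 2 * (ln l + ln D)" by simp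
  then have "0 \<le> (real k / real n) / 2 * (real n * ln y + 2 * (ln l + ln D))" using assms by (intro mult_nonneg_nonneg) auto
  also have "\<dots> = real k * (ln y / 2) + (real k / real n) * ln l + (real k / real n) * ln D"
    using assms by (simp add: field_simps)
  finally have "- (real k / real n) * ln D \<le> real k * (ln y / 2) + (real k / real n) * ln l" by simp
  then have "exp (- (real k / real n) * ln D) \<le> exp (real k * (ln y / 2) + (real k / real n) * ln l)" by simp
  also have "\<dots> = exp (ln y / 2) ^ k * exp ((real k / real n) * ln l)" by (simp only: exp_add exp_of_nat_mult)
  also have "exp (ln y / 2) = sqrt y" using y by (simp add: ln_sqrt[symmetric])
  also have "sqrt y = 4 * 10 ^ 7 * sqrt (real n / real k)"
  proof -
    have "y = (4 * 10 ^ 7)\<^sup>2 * (real n / real k)" by (simp add: y_def)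
    then show ?thesis by (simp only: real_sqrt_mult real_sqrt_abs) simp
  qed
  finally show ?thesis using assms by (simp add: powr_def)
qed

text \<open>The tilt at level \<open>s = k\<close>, with Markov constant 2, leaves at least
  \<open>exp (- k) / 2\<close> of the mass in an ellipsoid with squared radius
  \<open>2 * (n + k) <= 4 * n\<close>. Slicing that part costs \<open>108 ^ k\<close> and a power of
  its determinant; \<open>2 * exp k <= 6 ^ k\<close> accounts for the lost mass.\<close>

lemma density_slicing:
  assumes L: "sym_body n L" and k: "1 \<le> k" "k < n"
    and g0: "\<forall>x\<in>L. 0 \<le> g x" and cont: "continuous_on L g" and even: "\<forall>x\<in>L. g (vneg n x) = g x"
  shows "0 \<le> max_section n (n - k) g L"
    and "dens_measure n g L \<le> (6 * (108 * (4 * 10 ^ 7))) ^ k * sqrt (real n / real k) ^ k * max_section n (n - k) g L * voln n L powr (real k / real n)"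
proof -
  let ?m = "n - k"
  define h where "h = (\<lambda>x. indicator L x * g x)"
  define Q where "Q = max_section n ?m g L"
  have Lc: "compact L" using L by (simp add: sym_body_def)
  have Lm: "L \<in> sets (lebn n)" by (rule sym_body_sets[OF L])
  have h0: "0 \<le> h x" for x using g0 by (auto simp: h_def indicator_def)
  have hm[measurable]: "h \<in> borel_measurable (lebn n)"
  proof -
    have "(\<lambda>x. indicator L x *\<^sub>R g x) \<in> borel_measurable borel"
      by (rule borel_measurable_continuous_on_indicator[OF _ cont]) (use compact_imp_closed[OF Lc] in auto)
    from measurable_compose[OF measurable_id_lebn_borel this] show ?thesis by (simp add: h_def)
  qed
  have "bounded (g ` L)" by (rule compact_imp_bounded[OF compact_continuous_image[OF cont Lc]])
  then obtain G where G: "\<And>x. x \<in> L \<Longrightarrow> \<bar>g x\<bar> \<le> G" by (auto simp: bounded_iff)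
  obtain x0 where "x0 \<in> L" using sym_body_nonempty[OF L] by blast
  then have G0: "G \<ge> 0" using G[of x0] by linarith
  have hi: "integrable (lebn n) h"
  proof (rule Bochner_Integration.integrable_bound)
    show "integrable (lebn n) (\<lambda>x. G * indicator L x :: real)"
      using Lm sym_body_emeasure(1)[OF L] by simp
    show "AE x in lebn n. norm (h x) \<le> norm (G * indicator L x :: real)"
      using G G0 by (intro AE_I2) (auto simp: h_def indicator_def)
  qed simp
  obtain R where R: "R > 0" "\<And>x i. x \<in> L \<Longrightarrow> i < n \<Longrightarrow> \<bar>x i\<bar> \<le> R" using sym_body_bounded[OF L] by blast
  define B where "B = {t \<in> Rn ?m. ipn ?m t t \<le> (sqrt (real n) * R)\<^sup>2}"
  have Bm: "B \<in> sets (lebn ?m)" unfolding B_def by (rule ball_sets)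
  have Be: "emeasure (lebn ?m) B < \<infinity>"
    unfolding B_def using R k by (subst emeasure_ball_scaled) auto
  have sec: "integrable (lebn ?m) (\<lambda>t. h (lincomb n ?m u t))" "0 \<le> section_measure n ?m g L u"
    "section_measure n ?m g L u \<le> G * measure (lebn ?m) B"
    "(\<integral>\<^sup>+t. ennreal (h (lincomb n ?m u t)) \<partial>lebn ?m) = ennreal (section_measure n ?m g L u)"
    if u: "orthonormal_n n ?m u" for u
  proof -
    have le: "h (lincomb n ?m u t) \<le> G * indicator B t" if t: "t \<in> Rn ?m" for t
    proof (cases "lincomb n ?m u t \<in> L")
      case True
      have "ipn ?m t t = ipn n (lincomb n ?m u t) (lincomb n ?m u t)" by (rule ipn_lincomb2[OF u, symmetric])
      also have "\<dots> \<le> real n * R\<^sup>2" using R(2)[OF True] by (intro ipn_le_coord) auto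
      finally have "t \<in> B" using t by (simp add: B_def power_mult_distrib)
      then show ?thesis using G[OF True] True by (simp add: h_def)
    qed (use G0 in \<open>simp add: h_def\<close>)
    have bi: "integrable (lebn ?m) (\<lambda>t. G * indicator B t :: real)" using Bm Be by simp
    show i: "integrable (lebn ?m) (\<lambda>t. h (lincomb n ?m u t))"
    proof (rule Bochner_Integration.integrable_bound[OF bi])
      show "AE t in lebn ?m. norm (h (lincomb n ?m u t)) \<le> norm (G * indicator B t :: real)"
        using le h0 G0 by (intro AE_I2) auto
    qed measurable
    have s: "section_measure n ?m g L u = (\<integral>t. h (lincomb n ?m u t) \<partial>lebn ?m)" by (simp add: section_measure_def h_def)
    show "0 \<le> section_measure n ?m g L u" unfolding s using h0 by (intro integral_nonneg_AE AE_I2)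
    have "section_measure n ?m g L u \<le> (\<integral>t. G * indicator B t \<partial>lebn ?m)"
      unfolding s using le by (intro integral_mono[OF i bi]) auto
    also have "\<dots> = G * measure (lebn ?m) B" using sets.sets_into_space[OF Bm] by (simp add: Int_absorb2)
    finally show "section_measure n ?m g L u \<le> G * measure (lebn ?m) B" .
    show "(\<integral>\<^sup>+t. ennreal (h (lincomb n ?m u t)) \<partial>lebn ?m) = ennreal (section_measure n ?m g L u)"
      unfolding s using h0 by (intro nn_integral_eq_integral[OF i] AE_I2)
  qed
  \<comment> \<open>A real-valued \<open>SUP\<close> dominates its members only over a bounded set.
    The bound is uniform since the orthonormal coordinates of all sections of \<open>L\<close> stay
    in the single ball \<open>B\<close>.\<close>
  have up: "section_measure n ?m g L u \<le> Q" if "orthonormal_n n ?m u" for u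
    unfolding Q_def max_section_def
    by (rule cSUP_upper) (use that sec(3) in \<open>auto intro!: bdd_aboveI2[where M = "G * measure (lebn ?m) B"]\<close>)
  have ex: "orthonormal_n n ?m (\<lambda>j. \<lambda>i\<in>{..<n}. if i = j then 1 else 0)" by (rule orthonormal_std) simp
  have Q0: "Q \<ge> 0" using sec(2)[OF ex] up[OF ex] by linarith
  then show "0 \<le> max_section n ?m g L" unfolding Q_def .
  define I where "I = (\<integral>x. indicator L x * g x \<partial>lebn n)"
  have l0: "voln n L > 0" by (rule sym_body_emeasure(2)[OF L])
  have "I \<le> (6 * (108 * (4 * 10 ^ 7))) ^ k * sqrt (real n / real k) ^ k * Q * voln n L powr (real k / real n)"
  proof (cases "I > 0")
    case False
    moreover have "0 \<le> (6 * (108 * (4 * 10 ^ 7))) ^ k * sqrt (real n / real k) ^ k * Q * voln n L powr (real k / real n)"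
      using Q0 by (intro mult_nonneg_nonneg) auto
    ultimately show ?thesis by linarith
  next
    case True
    let ?\<mu> = "density (lebn n) (\<lambda>x. ennreal (indicator L x * g x / I))"
    interpret \<mu>: body_measure ?\<mu> n L "real k"
      using L k hi g0 even True by (intro body_measure_density[OF _ _ _ _ _ I_def]) (auto simp: h_def)
    obtain A where A: "lower_tri n A" "voln n (polar n L (real k)) \<le> 12 ^ n * voln n L * (diag_prod n A)\<^sup>2"
      "(1 - 1 / 2) * exp (- real k) \<le> measure ?\<mu> {x \<in> L. ipn n (mv n A x) (mv n A x) \<le> 2 * (real n + real k)}"
      using \<mu>.mass_in_ellipsoid[of 2] k by auto
    define E where "E = {x \<in> L. ipn n (mv n A x) (mv n A x) \<le> 2 * (real n + real k)}"
    have Em[measurable]: "E \<in> sets (lebn n)"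
      unfolding E_def using k by (intro sym_body_sets[OF sym_body_inter_ellipsoid[OF L]]) auto
    define f where "f = (\<lambda>x. ennreal (h x) * indicator E x)"
    have fm[measurable]: "f \<in> borel_measurable (lebn n)" unfolding f_def by measurable
    define D where "D = diag_prod n A"
    have D: "D > 0" unfolding D_def by (rule diag_prod_pos[OF A(1)])
    define c where "c = (\<Prod>j<k. 27 * (2 * sqrt (real n)) / sqrt (real (n - j)))"
    have c: "0 \<le> c" "c \<le> 108 ^ k" unfolding c_def using slicing_constant_le[OF k(2)] by (auto intro!: prod_nonneg)
    have "(\<integral>\<^sup>+x. f x \<partial>lebn n) \<le> ennreal (c * D powr (- (real k / real n))) * ennreal Q"
      unfolding c_def D_def
    proof (rule ellipsoid_slicing[OF A(1) k(2) _ fm])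
      show "0 < 2 * sqrt (real n)" using k by simp
      show "\<forall>x\<in>Rn n. f x \<noteq> 0 \<longrightarrow> ipn n (mv n A x) (mv n A x) \<le> (2 * sqrt (real n))\<^sup>2"
      proof (intro ballI impI)
        fix x assume "f x \<noteq> 0"
        then have "x \<in> E" by (auto simp: f_def indicator_def split: if_splits)
        then show "ipn n (mv n A x) (mv n A x) \<le> (2 * sqrt (real n))\<^sup>2" using k by (simp add: E_def power_mult_distrib)
      qed
      show "\<forall>u. orthonormal_n n ?m u \<longrightarrow> (\<integral>\<^sup>+t. f (lincomb n ?m u t) \<partial>lebn ?m) \<le> ennreal Q"
      proof (intro allI impI)
        fix u assume u: "orthonormal_n n ?m u"
        have "(\<integral>\<^sup>+t. f (lincomb n ?m u t) \<partial>lebn ?m) \<le> (\<integral>\<^sup>+t. ennreal (h (lincomb n ?m u t)) \<partial>lebn ?m)"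
          by (intro nn_integral_mono) (auto simp: f_def indicator_def)
        also have "\<dots> \<le> ennreal Q" unfolding sec(4)[OF u] by (intro ennreal_leI up u)
        finally show "(\<integral>\<^sup>+t. f (lincomb n ?m u t) \<partial>lebn ?m) \<le> ennreal Q" .
      qed
    qed
    then have J: "(\<integral>\<^sup>+x. f x \<partial>lebn n) \<le> ennreal (c * D powr (- (real k / real n)) * Q)"
      using c Q0 by (subst ennreal_mult) auto
    have "ennreal ((1 - 1 / 2) * exp (- real k)) \<le> emeasure ?\<mu> E"
      using A(3) unfolding E_def[symmetric] \<mu>.emeasure_eq_measure by (rule ennreal_leI)
    also have "\<dots> = (\<integral>\<^sup>+x. ennreal (1 / I) * f x \<partial>lebn n)"
    proof (subst emeasure_density)
      have e: "ennreal (indicator L x * g x / I) * indicator E x = ennreal (1 / I) * f x" for x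
      proof -
        have "ennreal (h x / I) = ennreal (1 / I) * ennreal (h x)" using h0[of x] True by (subst ennreal_mult[symmetric]) auto
        then show ?thesis by (simp add: f_def h_def mult.assoc)
      qed
      show "(\<integral>\<^sup>+x. ennreal (indicator L x * g x / I) * indicator E x \<partial>lebn n) = (\<integral>\<^sup>+x. ennreal (1 / I) * f x \<partial>lebn n)" unfolding e ..
      show "(\<lambda>x. ennreal (indicator L x * g x / I)) \<in> borel_measurable (lebn n)" using hm unfolding h_def by measurable
    qed (rule Em)
    also have "\<dots> = ennreal (1 / I) * (\<integral>\<^sup>+x. f x \<partial>lebn n)" by (rule nn_integral_cmult[OF fm])
    also have "\<dots> \<le> ennreal (1 / I) * ennreal (c * D powr (- (real k / real n)) * Q)" by (rule mult_left_mono[OF J]) simp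
    also have "\<dots> = ennreal (1 / I * (c * D powr (- (real k / real n)) * Q))" using True c Q0 by (intro ennreal_mult[symmetric]) auto
    finally have "(1 - 1 / 2) * exp (- real k) \<le> 1 / I * (c * D powr (- (real k / real n)) * Q)"
      using True c Q0 by (subst (asm) ennreal_le_iff) auto
    then have "I \<le> 2 * exp (real k) * (c * D powr (- (real k / real n)) * Q)" using True by (simp add: exp_minus field_simps)
    also have "\<dots> \<le> 6 ^ k * (108 ^ k * ((4 * 10 ^ 7 * sqrt (real n / real k)) ^ k * voln n L powr (real k / real n)) * Q)"
    proof (intro mult_mono)
      have "2 * exp (real k) \<le> 2 ^ k * exp 1 ^ k"
        using k power_increasing[of 1 k "2::real"] exp_of_nat_mult[of k "1::real"] by (simp add: mult_right_mono)
      also have "\<dots> = (2 * exp 1) ^ k" by (simp add: power_mult_distrib)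
      also have "\<dots> \<le> 6 ^ k" using exp_le by (intro power_mono) auto
      finally show "2 * exp (real k) \<le> 6 ^ k" .
      show "c \<le> 108 ^ k" by fact
      show "D powr (- (real k / real n)) \<le> (4 * 10 ^ 7 * sqrt (real n / real k)) ^ k * voln n L powr (real k / real n)"
      proof (rule slicing_determinant_le[OF k D l0])
        have n: "n > 0" using k by simp
        have "(real k / real n) ^ n * (1 / 10 ^ 14) ^ n \<le> (real k / real n) ^ n * (voln n L * voln n (polar n L (real n)))"
          by (intro mult_left_mono reverse_santalo[OF L n]) simp
        also have "\<dots> = voln n L * voln n (polar n L (real k))" using voln_polar_scale[OF L _ n, of k] k by simp
        also have "\<dots> \<le> voln n L * (12 ^ n * voln n L * D\<^sup>2)" using A(2) l0 unfolding D_def by (intro mult_left_mono) auto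
        finally show "(real k / real n) ^ n * (1 / 10 ^ 14) ^ n \<le> 12 ^ n * (voln n L * D)\<^sup>2" by (simp add: power2_eq_square mult_ac)
      qed
    qed (use Q0 c in auto)
    also have "\<dots> = (6 * (108 * (4 * 10 ^ 7))) ^ k * sqrt (real n / real k) ^ k * Q * voln n L powr (real k / real n)"
      by (simp only: power_mult_distrib mult_ac)
    finally show ?thesis .
  qed
  then show "dens_measure n g L \<le> (6 * (108 * (4 * 10 ^ 7))) ^ k * sqrt (real n / real k) ^ k * max_section n ?m g L * voln n L powr (real k / real n)"
    unfolding dens_measure_def I_def Q_def .
qed

theorem theorem5:
  shows "\<exists>C0::real. \<forall>(n::nat) (k::nat) L g.
    2 \<le> n \<longrightarrow> 1 \<le> k \<longrightarrow> k < n \<longrightarrow>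
    convex_body n L \<longrightarrow> origin_symmetric n L \<longrightarrow>
    (\<forall>x\<in>L. 0 \<le> g x) \<longrightarrow> continuous_on L g \<longrightarrow> (\<forall>x\<in>L. g (vneg n x) = g x) \<longrightarrow>
    dens_measure n g L \<le>
      C0 ^ k * (sqrt (real n / real k) * (ln (exp 1 * real n / real k)) powr (3/2)) ^ k
      * (real n / (real n - real k)) * c_const n k
      * max_section n (n - k) g L * voln n L powr (real k / real n)"
proof (intro exI allI impI)
  fix n k :: nat and L and g :: "(nat \<Rightarrow> real) \<Rightarrow> real"
  assume n: "2 \<le> n" and k: "1 \<le> k" "k < n" and body: "convex_body n L" "origin_symmetric n L"
    and g: "\<forall>x\<in>L. 0 \<le> g x" "continuous_on L g" "\<forall>x\<in>L. g (vneg n x) = g x"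
  define C where "C = 6 * (108 * (4 * 10 ^ 7 :: real))"
  define s where "s = sqrt (real n / real k)"
  define l where "l = ln (exp 1 * real n / real k) powr (3/2)"
  define Q where "Q = max_section n (n - k) g L"
  define V where "V = voln n L powr (real k / real n)"
  have L: "sym_body n L" using sym_body_convex_body[OF body] n by simp
  note ds = density_slicing[OF L k g]
  have nn: "0 \<le> C ^ k * s ^ k * Q * V" using ds(1) by (simp add: C_def s_def Q_def V_def)
  have l1: "1 \<le> l"
  proof -
    have "ln (exp 1) \<le> ln (exp 1 * real n / real k)" using k by (subst ln_le_cancel_iff) (auto simp: field_simps)
    then show ?thesis unfolding l_def by (intro ge_one_powr_ge_zero) auto
  qed
  \<comment> \<open>The factors of the statement that \<open>density_slicing\<close> does not
    produce are each at least 1, once \<open>c_const\<close> is accompanied by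
    \<open>12 ^ k\<close>; nonnegativity of the bound allows multiplying them in.\<close>
  have "1 * 1 * 1 \<le> l ^ k * (real n / (real n - real k)) * (12 ^ k * c_const n k)"
  proof (intro mult_mono)
    show "1 \<le> l ^ k" using l1 by (rule one_le_power)
    show "1 \<le> real n / (real n - real k)" using k by simp
    have "12 ^ k * (1 / 12) ^ k \<le> 12 ^ k * c_const n k" using c_const_ge[OF k] by (intro mult_left_mono) auto
    moreover have "12 ^ k * (1 / 12 :: real) ^ k = 1" unfolding power_mult_distrib[symmetric] by simp
    ultimately show "1 \<le> 12 ^ k * c_const n k" by simp
  qed (use l1 k in auto)
  from mult_left_mono[OF this nn]
  have "C ^ k * s ^ k * Q * V \<le> C ^ k * s ^ k * Q * V * (l ^ k * (real n / (real n - real k)) * (12 ^ k * c_const n k))" by simp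
  also have "\<dots> = (12 * C) ^ k * (s * l) ^ k * (real n / (real n - real k)) * c_const n k * Q * V"
    by (simp only: power_mult_distrib mult_ac)
  finally show "dens_measure n g L \<le>
      (12 * (6 * (108 * (4 * 10 ^ 7)))) ^ k * (sqrt (real n / real k) * (ln (exp 1 * real n / real k)) powr (3/2)) ^ k
      * (real n / (real n - real k)) * c_const n k
      * max_section n (n - k) g L * voln n L powr (real k / real n)"
    using ds(2) unfolding C_def s_def l_def Q_def V_def by linarith
qed

end
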